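(* Let $F=\alpha^{1+m}\beta^{-m}$, $m\neq0$, be an $m$-Kropina metric of Berwald type on a smooth manifold $M$ with $n=\dim M>2$, built from a (pseudo-)Riemannian metric $a$ and a 1-form $b$, and suppose that $|b|^2=0$ everywhere on $M$. Then $F$ is locally metrizable if and only if around each point of $M$ there exist coordinates $(u,v,x^3,\dots,x^n)$ such that $$a=e^{2m\psi}\left(-2\,du\,dv+H\,du^2+2W_a\,du\,dx^a+h_{ab}\,dx^a dx^b\right),\qquad b=e^{(1+m)\psi}\,du,$$ where $\psi$ is some locally defined smooth function on $M$, the indices $a,b$ (on $W_a$, $h_{ab}$, $x^a$) run over $3,\dots,n$, and $H,W_a,h_{ab}$ are local smooth functions depending only on $u$ and $x^3,\dots,x^n$. In this case, $F$ can be written in these coordinates as $$F=\left|-2\,du\,dv+H\,du^2+2W_a\,du\,dx^a+h_{ab}\,dx^a dx^b\right|^{(1+m)/2}(du)^{-m},$$ and the metric $-2\,du\,dv+H\,du^2+2W_a\,du\,dx^a+h_{ab}\,dx^a dx^b$ provides a local metrization of $F$.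
   Context: Finsler metrics. Let $M$ be a smooth manifold of dimension $n$, with local coordinates $x^i$ and induced coordinates $(x,y)$ on $TM$ (a tangent vector is $y^i\partial_i$); write $\partial_i=\partial/\partial x^i$, $\bar\partial_i=\partial/\partial y^i$. A conic subbundle of $TM$ is an open subset $\mathcal A\subset TM$ such that $(x,\lambda y)\in\mathcal A$ for all $(x,y)\in\mathcal A$, $\lambda>0$, and whose projection to $M$ is all of $M$. A Finsler metric on $\mathcal A$ is a smooth map $F:\mathcal A\to[0,\infty)$ with $F(x,\lambda y)=\lambda F(x,y)$ for $\lambda>0$ and with nondegenerate fundamental tensor $g_{ij}=\bar\partial_i\bar\partial_j(\tfrac12F^2)$. Berwald metrics. The canonical nonlinear connection has coefficients $N^j_i=\tfrac14\bar\partial_i\big[g^{jk}(y^l\partial_l\bar\partial_kF^2-\partial_kF^2)\big]$. $F$ is of Berwald type if $N^k_i=\Gamma^k_{ij}(x)y^j$ for functions $\Gamma^k_{ij}$ on the base; these are then the Christoffel symbols of a torsion-free affine connection on $M$, called the affine connection of $F$. Metrizability. A Berwald metric $F$ is locally metrizable if each point of $M$ has a neighborhood admitting a pseudo-Riemannian metric whose Levi-Civita connection is the restriction of the affine connection of $F$ (such a metric is a local metrization). $m$-Kropina metrics. An $m$-Kropina metric is a Finsler metric of the form $F=\alpha^{1+m}\beta^{-m}$ with $\alpha=\sqrt{|a_{ij}y^iy^j|}$, $\beta=b_iy^i$, where $a=a_{ij}dx^idx^j$ is a (pseudo-)Riemannian metric of arbitrary signature and $b=b_idx^i$ a 1-form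 on $M$, and $m\in\mathbb R$; $b$ is then nowhere vanishing. The trivial case $m=0$ is excluded. $|b|^2=a^{ij}b_ib_j$. Indices are raised and lowered with $a_{ij}$, and $\mathring\nabla$, $\mathring\Gamma$ denote the Levi-Civita connection of $a$ and its Christoffel symbols. Known fact: for $n>2$, $F$ is of Berwald type iff there is a smooth vector field $f^i$ on $M$ with $\mathring\nabla_j b_i = m (f_k b^k)a_{ij} + b_i f_j - m f_i b_j$. In that case $f$ is unique and the affine connection of $F$ is $\Gamma^\ell_{ij}=\mathring\Gamma^\ell_{ij}+m a^{\ell k}(a_{ij}f_k-a_{jk}f_i-a_{ki}f_j)$. Notation: products such as $du\,dv$ are symmetrized tensor products of 1-forms. In a formula for $F$, quadratic forms and 1-forms are evaluated on the tangent vector $y$. *)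

theory Defs
  imports "HOL-Analysis.Analysis"
begin

text \<open>The following two predicates are meant for open sets \<open>S\<close>.\<close>

primrec Ck_on :: "nat \<Rightarrow> 'e::real_normed_vector set \<Rightarrow> ('e \<Rightarrow> 'f::real_normed_vector) \<Rightarrow> bool" where
  "Ck_on 0 S f \<longleftrightarrow> continuous_on S f"
| "Ck_on (Suc k) S f \<longleftrightarrow>
     (\<forall>x\<in>S. f differentiable (at x)) \<and> (\<forall>v. Ck_on k S (\<lambda>x. frechet_derivative f (at x) v))"

definition smooth_on :: "'e::real_normed_vector set \<Rightarrow> ('e \<Rightarrow> 'f::real_normed_vector) \<Rightarrow> bool" where
  "smooth_on S f \<longleftrightarrow> (\<forall>k. Ck_on k S f)"

definition pd :: "'n::finite \<Rightarrow> (real^'n \<Rightarrow> real) \<Rightarrow> real^'n \<Rightarrow> real" where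
  "pd i f x = frechet_derivative f (at x) (axis i 1)"

text \<open>A chart is a pair of its domain and its coordinate map; the values of the coordinate map
  outside the domain are irrelevant.\<close>

type_synonym ('p, 'n) chart = "'p set \<times> ('p \<Rightarrow> real^'n)"

abbreviation cdom :: "('p, 'n::finite) chart \<Rightarrow> 'p set" where "cdom c \<equiv> fst c"
abbreviation cmap :: "('p, 'n::finite) chart \<Rightarrow> 'p \<Rightarrow> real^'n" where "cmap c \<equiv> snd c"
abbreviation cinv :: "('p, 'n::finite) chart \<Rightarrow> real^'n \<Rightarrow> 'p" where "cinv c \<equiv> inv_into (cdom c) (cmap c)"
abbreviation cimg :: "('p, 'n::finite) chart \<Rightarrow> (real^'n) set" where "cimg c \<equiv> cmap c ` cdom c"

definition is_chart :: "('p::topological_space, 'n::finite) chart \<Rightarrow> bool" where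
  "is_chart c \<longleftrightarrow> open (cdom c) \<and> open (cimg c) \<and> homeomorphism (cdom c) (cimg c) (cmap c) (cinv c)"

definition transition :: "('p, 'n::finite) chart \<Rightarrow> ('p, 'n) chart \<Rightarrow> real^'n \<Rightarrow> real^'n" where
  "transition c c' = cmap c' \<circ> cinv c"

definition compatible :: "('p, 'n::finite) chart \<Rightarrow> ('p, 'n) chart \<Rightarrow> bool" where
  "compatible c c' \<longleftrightarrow>
     smooth_on (cmap c ` (cdom c \<inter> cdom c')) (transition c c') \<and>
     smooth_on (cmap c' ` (cdom c \<inter> cdom c')) (transition c' c)"

text \<open>\<open>At\<close> is the maximal atlas, i.e. the set of all local coordinate systems on \<open>M\<close>.\<close>

definition smooth_manifold ::
  "'p::{t2_space, second_countable_topology} set \<Rightarrow> ('p, 'n::finite) chart set \<Rightarrow> bool" where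
  "smooth_manifold M At \<longleftrightarrow>
     (\<forall>c\<in>At. is_chart c) \<and>
     (\<Union>c\<in>At. cdom c) = M \<and>
     (\<forall>c\<in>At. \<forall>c'\<in>At. compatible c c') \<and>
     (\<forall>c. is_chart c \<and> cdom c \<subseteq> M \<and> (\<forall>c'\<in>At. compatible c c') \<longrightarrow> c \<in> At)"

text \<open>A tangent vector at a point assigns to each coordinate system around that point its
  components \<open>y\<^sup>i\<close>, subject to the usual transformation law (and, to have a unique representation,
  the value 0 elsewhere).\<close>

type_synonym ('p, 'n) tangent = "('p, 'n) chart \<Rightarrow> real^'n"

definition charts_at :: "('p, 'n::finite) chart set \<Rightarrow> 'p \<Rightarrow> ('p, 'n) chart set" where
  "charts_at At p = {c \<in> At. p \<in> cdom c}"

definition tangent_space :: "('p, 'n::finite) chart set \<Rightarrow> 'p \<Rightarrow> ('p, 'n) tangent set" where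
  "tangent_space At p = {v.
     (\<forall>c\<in>charts_at At p. \<forall>c'\<in>charts_at At p.
        v c' = frechet_derivative (transition c c') (at (cmap c p)) (v c)) \<and>
     (\<forall>c. c \<notin> charts_at At p \<longrightarrow> v c = 0)}"

definition TM :: "'p set \<Rightarrow> ('p, 'n::finite) chart set \<Rightarrow> ('p \<times> ('p, 'n) tangent) set" where
  "TM M At = {(p, v). p \<in> M \<and> v \<in> tangent_space At p}"

text \<open>The tangent vector \<open>y\<^sup>i \<partial>\<^sub>i\<close> at \<open>p\<close>, with respect to the coordinates \<open>c\<close>.\<close>

definition tvec :: "('p, 'n::finite) chart set \<Rightarrow> ('p, 'n) chart \<Rightarrow> 'p \<Rightarrow> real^'n \<Rightarrow> ('p, 'n) tangent" where
  "tvec At c p y =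
     (\<lambda>c'. if c' \<in> charts_at At p then frechet_derivative (transition c c') (at (cmap c p)) y else 0)"

definition coord_image ::
  "('p, 'n::finite) chart \<Rightarrow> ('p \<times> ('p, 'n) tangent) set \<Rightarrow> ((real^'n) \<times> (real^'n)) set" where
  "coord_image c A = {(cmap c p, v c) | p v. (p, v) \<in> A \<and> p \<in> cdom c}"

definition comp1 ::
  "('p, 'n::finite) chart set \<Rightarrow> ('p \<Rightarrow> ('p, 'n) tangent \<Rightarrow> real) \<Rightarrow> ('p, 'n) chart \<Rightarrow> real^'n \<Rightarrow> real^'n" where
  "comp1 At b c x = (\<chi> i. b (cinv c x) (tvec At c (cinv c x) (axis i 1)))"

definition comp2 ::
  "('p, 'n::finite) chart set \<Rightarrow> ('p \<Rightarrow> ('p, 'n) tangent \<Rightarrow> ('p, 'n) tangent \<Rightarrow> real) \<Rightarrow>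
   ('p, 'n) chart \<Rightarrow> real^'n \<Rightarrow> real^'n^'n" where
  "comp2 At q c x =
     (\<chi> i j. q (cinv c x) (tvec At c (cinv c x) (axis i 1)) (tvec At c (cinv c x) (axis j 1)))"

definition one_form ::
  "('p::topological_space, 'n::finite) chart set \<Rightarrow> 'p set \<Rightarrow> ('p \<Rightarrow> ('p, 'n) tangent \<Rightarrow> real) \<Rightarrow> bool" where
  "one_form At V b \<longleftrightarrow>
     (\<forall>c\<in>At. \<forall>p\<in>V \<inter> cdom c. linear (\<lambda>y. b p (tvec At c p y))) \<and>
     (\<forall>c\<in>At. smooth_on (cmap c ` (V \<inter> cdom c)) (comp1 At b c))"

definition pseudo_riemannian ::
  "('p::topological_space, 'n::finite) chart set \<Rightarrow> 'p set \<Rightarrow>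
   ('p \<Rightarrow> ('p, 'n) tangent \<Rightarrow> ('p, 'n) tangent \<Rightarrow> real) \<Rightarrow> bool" where
  "pseudo_riemannian At V q \<longleftrightarrow>
     (\<forall>c\<in>At. \<forall>p\<in>V \<inter> cdom c. bilinear (\<lambda>y z. q p (tvec At c p y) (tvec At c p z))) \<and>
     (\<forall>p\<in>V. \<forall>v\<in>tangent_space At p. \<forall>w\<in>tangent_space At p. q p v w = q p w v) \<and>
     (\<forall>c\<in>At. \<forall>p\<in>V \<inter> cdom c. invertible (comp2 At q c (cmap c p))) \<and>
     (\<forall>c\<in>At. smooth_on (cmap c ` (V \<inter> cdom c)) (comp2 At q c))"

definition norm2 ::
  "('p, 'n::finite) chart set \<Rightarrow> ('p \<Rightarrow> ('p, 'n) tangent \<Rightarrow> ('p, 'n) tangent \<Rightarrow> real) \<Rightarrow>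
   ('p \<Rightarrow> ('p, 'n) tangent \<Rightarrow> real) \<Rightarrow> ('p, 'n) chart \<Rightarrow> real^'n \<Rightarrow> real" where
  "norm2 At a b c x =
     (\<Sum>i\<in>UNIV. \<Sum>j\<in>UNIV. matrix_inv (comp2 At a c x) $ i $ j * comp1 At b c x $ i * comp1 At b c x $ j)"

text \<open>\<open>levi_civita At q c x k i j\<close> is the Christoffel symbol \<open>\<Gamma>\<^sup>k\<^sub>i\<^sub>j\<close> of \<open>q\<close>.\<close>

definition levi_civita ::
  "('p, 'n::finite) chart set \<Rightarrow> ('p \<Rightarrow> ('p, 'n) tangent \<Rightarrow> ('p, 'n) tangent \<Rightarrow> real) \<Rightarrow>
   ('p, 'n) chart \<Rightarrow> real^'n \<Rightarrow> 'n \<Rightarrow> 'n \<Rightarrow> 'n \<Rightarrow> real" where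
  "levi_civita At q c x k i j =
     1/2 * (\<Sum>l\<in>UNIV. matrix_inv (comp2 At q c x) $ k $ l *
       (pd i (\<lambda>x. comp2 At q c x $ l $ j) x + pd j (\<lambda>x. comp2 At q c x $ i $ l) x
        - pd l (\<lambda>x. comp2 At q c x $ i $ j) x))"

definition conic_subbundle ::
  "'p set \<Rightarrow> ('p, 'n::finite) chart set \<Rightarrow> ('p \<times> ('p, 'n) tangent) set \<Rightarrow> bool" where
  "conic_subbundle M At A \<longleftrightarrow>
     A \<subseteq> TM M At \<and>
     (\<forall>c\<in>At. open (coord_image c A)) \<and>
     (\<forall>p v. \<forall>t>0. (p, v) \<in> A \<longrightarrow> (p, \<lambda>c. t *\<^sub>R v c) \<in> A) \<and>
     fst ` A = M"

definition Frep ::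
  "('p, 'n::finite) chart set \<Rightarrow> ('p \<Rightarrow> ('p, 'n) tangent \<Rightarrow> real) \<Rightarrow> ('p, 'n) chart \<Rightarrow>
   real^'n \<Rightarrow> real^'n \<Rightarrow> real" where
  "Frep At F c x y = F (cinv c x) (tvec At c (cinv c x) y)"

definition pdx :: "'n::finite \<Rightarrow> (real^'n \<Rightarrow> real^'n \<Rightarrow> real) \<Rightarrow> real^'n \<Rightarrow> real^'n \<Rightarrow> real" where
  "pdx i f x y = pd i (\<lambda>x'. f x' y) x"

definition pdy :: "'n::finite \<Rightarrow> (real^'n \<Rightarrow> real^'n \<Rightarrow> real) \<Rightarrow> real^'n \<Rightarrow> real^'n \<Rightarrow> real" where
  "pdy i f x y = pd i (f x) y"

definition fundamental_tensor :: "(real^'n \<Rightarrow> real^'n \<Rightarrow> real) \<Rightarrow> real^'n \<Rightarrow> real^'n \<Rightarrow> real^'n^'n::finite" where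
  "fundamental_tensor f x y = (\<chi> i j. pdy i (pdy j (\<lambda>x y. 1/2 * (f x y)\<^sup>2)) x y)"

definition finsler_metric ::
  "'p set \<Rightarrow> ('p, 'n::finite) chart set \<Rightarrow> ('p \<times> ('p, 'n) tangent) set \<Rightarrow>
   ('p \<Rightarrow> ('p, 'n) tangent \<Rightarrow> real) \<Rightarrow> bool" where
  "finsler_metric M At A F \<longleftrightarrow>
     conic_subbundle M At A \<and>
     (\<forall>(p, v)\<in>A. F p v \<ge> 0) \<and>
     (\<forall>c\<in>At. smooth_on (coord_image c A) (\<lambda>(x, y). Frep At F c x y)) \<and>
     (\<forall>(p, v)\<in>A. \<forall>t>0. F p (\<lambda>c. t *\<^sub>R v c) = t * F p v) \<and>
     (\<forall>c\<in>At. \<forall>(x, y)\<in>coord_image c A. invertible (fundamental_tensor (Frep At F c) x y))"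

text \<open>\<open>nonlinear_connection f j i\<close> is \<open>N\<^sup>j\<^sub>i\<close>: the first index argument is the upper one. All derivatives are taken
  at interior points of the domain of \<open>f\<close>, so they do not depend on its values elsewhere.\<close>

definition nonlinear_connection ::
  "(real^'n \<Rightarrow> real^'n \<Rightarrow> real) \<Rightarrow> 'n::finite \<Rightarrow> 'n \<Rightarrow> real^'n \<Rightarrow> real^'n \<Rightarrow> real" where
  "nonlinear_connection f j i =
     (\<lambda>x y. 1/4 * pdy i (\<lambda>x y. \<Sum>k\<in>UNIV. matrix_inv (fundamental_tensor f x y) $ j $ k *
        ((\<Sum>l\<in>UNIV. y $ l * pdx l (pdy k (\<lambda>x y. (f x y)\<^sup>2)) x y) - pdx k (\<lambda>x y. (f x y)\<^sup>2) x y)) x y)"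

definition berwald ::
  "('p, 'n::finite) chart set \<Rightarrow> ('p \<times> ('p, 'n) tangent) set \<Rightarrow> ('p \<Rightarrow> ('p, 'n) tangent \<Rightarrow> real) \<Rightarrow> bool" where
  "berwald At A F \<longleftrightarrow>
     (\<forall>c\<in>At. \<exists>\<Gamma>. \<forall>(x, y)\<in>coord_image c A. \<forall>k i.
        nonlinear_connection (Frep At F c) k i x y = (\<Sum>j\<in>UNIV. \<Gamma> x k i j * y $ j))"

text \<open>For \<open>F\<close> of Berwald type and \<open>x\<close> in the image of \<open>c\<close>, the symbols \<open>\<Gamma>\<^sup>k\<^sub>i\<^sub>j(x)\<close> are unique because
  the fibre of \<open>A\<close> over \<open>x\<close> is open and nonempty.\<close>

definition affine_connection ::
  "('p, 'n::finite) chart set \<Rightarrow> ('p \<times> ('p, 'n) tangent) set \<Rightarrow> ('p \<Rightarrow> ('p, 'n) tangent \<Rightarrow> real) \<Rightarrow>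
   ('p, 'n) chart \<Rightarrow> real^'n \<Rightarrow> 'n \<Rightarrow> 'n \<Rightarrow> 'n \<Rightarrow> real" where
  "affine_connection At A F c x =
     (THE \<Gamma>. \<forall>y. (x, y) \<in> coord_image c A \<longrightarrow> (\<forall>k i.
        nonlinear_connection (Frep At F c) k i x y = (\<Sum>j\<in>UNIV. \<Gamma> k i j * y $ j)))"

definition local_metrization ::
  "'p::topological_space set \<Rightarrow> ('p, 'n::finite) chart set \<Rightarrow> ('p \<times> ('p, 'n) tangent) set \<Rightarrow>
   ('p \<Rightarrow> ('p, 'n) tangent \<Rightarrow> real) \<Rightarrow> 'p set \<Rightarrow>
   ('p \<Rightarrow> ('p, 'n) tangent \<Rightarrow> ('p, 'n) tangent \<Rightarrow> real) \<Rightarrow> bool" where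
  "local_metrization M At A F V q \<longleftrightarrow>
     open V \<and> V \<subseteq> M \<and> pseudo_riemannian At V q \<and>
     (\<forall>c\<in>At. \<forall>p\<in>V \<inter> cdom c. levi_civita At q c (cmap c p) = affine_connection At A F c (cmap c p))"

definition locally_metrizable ::
  "'p::topological_space set \<Rightarrow> ('p, 'n::finite) chart set \<Rightarrow> ('p \<times> ('p, 'n) tangent) set \<Rightarrow>
   ('p \<Rightarrow> ('p, 'n) tangent \<Rightarrow> real) \<Rightarrow> bool" where
  "locally_metrizable M At A F \<longleftrightarrow> (\<forall>p\<in>M. \<exists>V q. p \<in> V \<and> local_metrization M At A F V q)"

text \<open>Real powers \<open>t\<^sup>p\<close>, for negative \<open>t\<close> only in the case of an integer exponent. (The library's
  \<open>powr\<close> gives unintended values at negative bases, and \<open>0 powr 0 = 0\<close>.)\<close>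

definition rpow_defined :: "real \<Rightarrow> real \<Rightarrow> bool" where
  "rpow_defined t p \<longleftrightarrow> t > 0 \<or> (t = 0 \<and> p \<ge> 0) \<or> (t < 0 \<and> p \<in> \<int>)"

definition rpow :: "real \<Rightarrow> real \<Rightarrow> real" where
  "rpow t p = (if p \<in> \<int> then t powi \<lfloor>p\<rfloor> else t powr p)"

definition kropina_metric ::
  "'p::topological_space set \<Rightarrow> ('p, 'n::finite) chart set \<Rightarrow> ('p \<times> ('p, 'n) tangent) set \<Rightarrow> real \<Rightarrow>
   ('p \<Rightarrow> ('p, 'n) tangent \<Rightarrow> ('p, 'n) tangent \<Rightarrow> real) \<Rightarrow> ('p \<Rightarrow> ('p, 'n) tangent \<Rightarrow> real) \<Rightarrow>
   ('p \<Rightarrow> ('p, 'n) tangent \<Rightarrow> real) \<Rightarrow> bool" where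
  "kropina_metric M At A m a b F \<longleftrightarrow>
     finsler_metric M At A F \<and> pseudo_riemannian At M a \<and> one_form At M b \<and>
     (\<forall>(p, v)\<in>A. let \<alpha> = sqrt \<bar>a p v v\<bar>; \<beta> = b p v in
        rpow_defined \<alpha> (1 + m) \<and> rpow_defined \<beta> (- m) \<and>
        F p v = rpow \<alpha> (1 + m) * rpow \<beta> (- m))"

definition dx :: "'n::finite \<Rightarrow> real^'n \<Rightarrow> real" where
  "dx i y = y $ i"

definition sym_prod :: "('v \<Rightarrow> real) \<Rightarrow> ('v \<Rightarrow> real) \<Rightarrow> 'v \<Rightarrow> 'v \<Rightarrow> real"  (infixl "\<odot>" 75) where
  "(\<omega> \<odot> \<eta>) y z = (\<omega> y * \<eta> z + \<omega> z * \<eta> y) / 2"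

text \<open>The bilinear form \<open>-2 du dv + H du\<^sup>2 + 2 W\<^sub>a du dx\<^sup>a + h\<^sub>a\<^sub>b dx\<^sup>a dx\<^sup>b\<close> at the coordinate point \<open>x\<close>, where
  \<open>iu\<close> and \<open>iv\<close> are the indices of the coordinates \<open>u\<close> and \<open>v\<close>, and the remaining ones play the role of
  \<open>3, \<dots>, n\<close>.\<close>

definition uv_form ::
  "'n::finite \<Rightarrow> 'n \<Rightarrow> (real^'n \<Rightarrow> real) \<Rightarrow> ('n \<Rightarrow> real^'n \<Rightarrow> real) \<Rightarrow> ('n \<Rightarrow> 'n \<Rightarrow> real^'n \<Rightarrow> real) \<Rightarrow>
   real^'n \<Rightarrow> real^'n \<Rightarrow> real^'n \<Rightarrow> real" where
  "uv_form iu iv H W h x y z =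
     - 2 * (dx iu \<odot> dx iv) y z
     + H x * (dx iu \<odot> dx iu) y z
     + 2 * (\<Sum>i\<in>UNIV - {iu, iv}. W i x * (dx iu \<odot> dx i) y z)
     + (\<Sum>i\<in>UNIV - {iu, iv}. \<Sum>j\<in>UNIV - {iu, iv}. h i j x * (dx i \<odot> dx j) y z)"

definition indep_of :: "'n::finite \<Rightarrow> (real^'n) set \<Rightarrow> (real^'n \<Rightarrow> real) \<Rightarrow> bool" where
  "indep_of k S f \<longleftrightarrow> (\<forall>x\<in>S. \<forall>x'\<in>S. (\<forall>i. i \<noteq> k \<longrightarrow> x $ i = x' $ i) \<longrightarrow> f x = f x')"

definition adapted_coordinates ::
  "('p::topological_space, 'n::finite) chart set \<Rightarrow> real \<Rightarrow>
   ('p \<Rightarrow> ('p, 'n) tangent \<Rightarrow> ('p, 'n) tangent \<Rightarrow> real) \<Rightarrow> ('p \<Rightarrow> ('p, 'n) tangent \<Rightarrow> real) \<Rightarrow>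
   'n \<Rightarrow> 'n \<Rightarrow> ('p, 'n) chart \<Rightarrow> (real^'n \<Rightarrow> real) \<Rightarrow>
   (real^'n \<Rightarrow> real) \<Rightarrow> ('n \<Rightarrow> real^'n \<Rightarrow> real) \<Rightarrow> ('n \<Rightarrow> 'n \<Rightarrow> real^'n \<Rightarrow> real) \<Rightarrow> bool" where
  "adapted_coordinates At m a b iu iv c \<psi> H W h \<longleftrightarrow>
     c \<in> At \<and>
     smooth_on (cimg c) \<psi> \<and>
     smooth_on (cimg c) H \<and> indep_of iv (cimg c) H \<and>
     (\<forall>i\<in>UNIV - {iu, iv}. smooth_on (cimg c) (W i) \<and> indep_of iv (cimg c) (W i)) \<and>
     (\<forall>i\<in>UNIV - {iu, iv}. \<forall>j\<in>UNIV - {iu, iv}. smooth_on (cimg c) (h i j) \<and> indep_of iv (cimg c) (h i j)) \<and>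
     (\<forall>p\<in>cdom c. \<forall>v\<in>tangent_space At p. \<forall>w\<in>tangent_space At p.
        a p v w = exp (2 * m * \<psi> (cmap c p)) * uv_form iu iv H W h (cmap c p) (v c) (w c)) \<and>
     (\<forall>p\<in>cdom c. \<forall>v\<in>tangent_space At p.
        b p v = exp ((1 + m) * \<psi> (cmap c p)) * dx iu (v c))"

end

theory Submission
  imports Defs
begin

text \<open>If \<open>F\<close> is of Berwald type, \<open>F\<^sup>2\<close> is constant along the horizontal lifts of a symmetric connection
  \<open>\<Gamma>\<close>. Comparing \<open>F\<^sup>2 = |a(y,y)|\<^sup>1\<^sup>+\<^sup>m \<beta>\<^sup>-\<^sup>2\<^sup>m\<close> with its horizontal derivative, and using that the linear form \<open>\<beta>\<close>
  cannot divide \<open>a(y,y)\<close> when \<open>n > 2\<close>, one gets \<open>\<nabla>a = 2m \<theta> \<otimes> a\<close> and \<open>\<nabla>b = (1 + m) \<theta> \<otimes> b\<close> for a 1-form \<open>\<theta>\<close>.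

  If \<open>\<Gamma>\<close> is the Levi-Civita connection of \<open>q\<close>, then \<open>det a / det q\<close> yields a potential, \<open>\<theta> = d\<psi>\<close>, so
  \<open>e\<^sup>-\<^sup>2\<^sup>m\<^sup>\<psi> a\<close> and \<open>e\<^sup>-\<^sup>(\<^sup>1\<^sup>+\<^sup>m\<^sup>)\<^sup>\<psi> b\<close> are parallel. The latter is closed, hence equal to \<open>du\<close>, and straightening
  the dual vector field, which is parallel, null and Killing, provides the remaining coordinates.

  Conversely, in adapted coordinates the null vector field \<open>\<partial>\<^sub>v\<close> is Killing for the rescaled metric. Together
  with \<open>m \<noteq> \<plusminus>1\<close>, which follows from the nondegeneracy of the fundamental tensor, this forces \<open>\<theta> = d\<psi>\<close>, so that
  the rescaled metric is parallel for \<open>\<Gamma>\<close>.\<close>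

subsection \<open>Calculus of smooth maps\<close>

text \<open>F is unchanged when a is multiplied by exp(2 m s) and b by exp((1 + m) s), which is
  where the exponents 2m and 1 + m come from. Such a rescaling adds ds to \<theta>, so local
  metrizability amounts to a local rescaling that makes a parallel for \<Gamma>.

  Two obstacles shape the development. Moreover v is a flow parameter, so the new coordinates are
  smooth only if solutions of differential equations depend smoothly on initial values. This
  dependence is obtained from a contraction in a space of functions of time and parameter, followed
  by an induction through the linearised equation.

  The geometry itself is done with matrix fields and covector fields on open sets of R^n; the
  manifold enters where charts are compared.\<close>

abbreviation dirD :: "('e::real_normed_vector \<Rightarrow> 'f::real_normed_vector) \<Rightarrow> 'e \<Rightarrow> 'e \<Rightarrow> 'f" where
  "dirD f x \<equiv> frechet_derivative f (at x)"

lemma dirD_eqI: "(f has_derivative f') (at x) \<Longrightarrow> dirD f x = f'"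
  by (metis frechet_derivative_at)

lemma Ck_on_cong:
  assumes "open S" "\<And>x. x \<in> S \<Longrightarrow> f x = g x" "Ck_on k S f"
  shows "Ck_on k S g"
  using assms
proof (induction k arbitrary: f g)
  case 0
  then show ?case by (simp cong: continuous_on_cong)
next
  case (Suc k)
  have d: "(g has_derivative dirD f x) (at x)" if "x \<in> S" for x
  proof (rule has_derivative_transform_within_open[OF _ \<open>open S\<close> that Suc.prems(2)])
    show "(f has_derivative dirD f x) (at x)"
      using Suc.prems(3) that by (metis Ck_on.simps(2) frechet_derivative_works)
  qed
  then have eq: "dirD g x = dirD f x" if "x \<in> S" for x
    using that by (simp add: dirD_eqI)
  have "Ck_on k S (\<lambda>x. dirD g x v)" for v
    by (rule Suc.IH[OF \<open>open S\<close>, of "\<lambda>x. dirD f x v"]) (use Suc.prems(3) in \<open>simp_all add: eq\<close>)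
  with d show ?case by (auto simp: differentiable_def)
qed

text \<open>The derivative may be supplied as any formula \<open>f'\<close>, so each closure
  property reduces to its classical differentiation rule plus the induction hypothesis.\<close>

lemma Ck_on_SucI:
  assumes "open S" "\<And>x. x \<in> S \<Longrightarrow> (f has_derivative f' x) (at x)" "\<And>v. Ck_on k S (\<lambda>x. f' x v)"
  shows "Ck_on (Suc k) S f"
proof -
  have "Ck_on k S (\<lambda>x. dirD f x v)" for v
    by (rule Ck_on_cong[OF \<open>open S\<close> _ assms(3)]) (simp add: dirD_eqI[OF assms(2)])
  with assms(2) show ?thesis by (auto simp: differentiable_def)
qed

lemma Ck_on_Suc_has_derivative:
  "Ck_on (Suc k) S f \<Longrightarrow> x \<in> S \<Longrightarrow> (f has_derivative dirD f x) (at x)"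
  by (metis Ck_on.simps(2) frechet_derivative_works)

lemma Ck_on_SucD: "Ck_on (Suc k) S f \<Longrightarrow> Ck_on k S f"
proof (induction k arbitrary: f)
  case 0
  then show ?case
    by (meson Ck_on.simps continuous_at_imp_continuous_on differentiable_imp_continuous_within)
next
  case (Suc k)
  then show ?case by (auto simp del: Ck_on.simps(1))
qed

lemma Ck_on_le: "k \<le> l \<Longrightarrow> Ck_on l S f \<Longrightarrow> Ck_on k S f"
  by (induction rule: inc_induct) (auto intro: Ck_on_SucD)

lemma Ck_on_subset: "T \<subseteq> S \<Longrightarrow> Ck_on k S f \<Longrightarrow> Ck_on k T f"
  by (induction k arbitrary: f) (auto intro: continuous_on_subset)

text \<open>Serves where a derivative is constructed only near each given point, as for solutions of
  differential equations.\<close>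

lemma Ck_on_local:
  assumes "\<And>x. x \<in> S \<Longrightarrow> \<exists>T. open T \<and> x \<in> T \<and> T \<subseteq> S \<and> Ck_on k T f"
  shows "Ck_on k S f"
  using assms
proof (induction k arbitrary: f)
  case 0
  then show ?case
    by (metis Ck_on.simps(1) at_within_open continuous_at_imp_continuous_on
        continuous_on_eq_continuous_within)
next
  case (Suc k)
  show ?case
    unfolding Ck_on.simps
    by (intro conjI ballI allI Suc.IH) (use Suc.prems in fastforce)+
qed

section \<open>Closure properties of C^k maps\<close>

lemma Ck_on_const: "open S \<Longrightarrow> Ck_on k S (\<lambda>x. c)"
  by (induction k arbitrary: c) auto

lemma Ck_on_bounded_linear:
  assumes "open S" "bounded_linear g" "Ck_on k S f"
  shows "Ck_on k S (\<lambda>x. g (f x))"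
  using assms(3)
proof (induction k arbitrary: f)
  case 0
  then show ?case using assms by (auto intro: bounded_linear.continuous_on)
next
  case (Suc k)
  show ?case
    by (rule Ck_on_SucI[OF \<open>open S\<close> bounded_linear.has_derivative[OF assms(2) Ck_on_Suc_has_derivative[OF Suc.prems]]])
       (use Suc in auto)
qed

lemma Ck_on_ident: "open S \<Longrightarrow> Ck_on k S (\<lambda>x. x)"
  by (cases k) (auto intro: Ck_on_const)

lemma Ck_on_linear: "open S \<Longrightarrow> bounded_linear g \<Longrightarrow> Ck_on k S g"
  using Ck_on_bounded_linear[of S g k "\<lambda>x. x"] Ck_on_ident by auto

lemma Ck_on_add:
  assumes "open S" "Ck_on k S f" "Ck_on k S g"
  shows "Ck_on k S (\<lambda>x. f x + g x)"
  using assms(2,3)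
proof (induction k arbitrary: f g)
  case 0
  then show ?case by (auto intro: continuous_intros)
next
  case (Suc k)
  show ?case
    by (rule Ck_on_SucI[OF \<open>open S\<close> has_derivative_add[OF Ck_on_Suc_has_derivative[OF Suc.prems(1)]
            Ck_on_Suc_has_derivative[OF Suc.prems(2)]]])
       (use Suc in auto)
qed

lemma Ck_on_sum:
  assumes "open S" "\<And>i. i \<in> I \<Longrightarrow> Ck_on k S (f i)"
  shows "Ck_on k S (\<lambda>x. \<Sum>i\<in>I. f i x)"
  using assms(2)
  by (induction I rule: infinite_finite_induct) (auto intro: Ck_on_const Ck_on_add assms(1))

lemma (in bounded_bilinear) Ck_on:
  assumes "open S" "Ck_on k S f" "Ck_on k S g"
  shows "Ck_on k S (\<lambda>x. prod (f x) (g x))"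
  using assms(2,3)
proof (induction k arbitrary: f g)
  case 0
  then show ?case by (auto intro: continuous_on)
next
  case (Suc k)
  show ?case
    by (rule Ck_on_SucI[OF \<open>open S\<close> FDERIV[OF Ck_on_Suc_has_derivative[OF Suc.prems(1)]
            Ck_on_Suc_has_derivative[OF Suc.prems(2)]]])
       (use Suc Ck_on_SucD[OF Suc.prems(1)] Ck_on_SucD[OF Suc.prems(2)] in
         \<open>auto intro!: Ck_on_add[OF \<open>open S\<close>] simp del: Ck_on.simps(1)\<close>)
qed

lemmas Ck_on_mult = bounded_bilinear.Ck_on[OF bounded_bilinear_mult]
lemmas Ck_on_scaleR = bounded_bilinear.Ck_on[OF bounded_bilinear_scaleR]
lemmas Ck_on_inner = bounded_bilinear.Ck_on[OF bounded_bilinear_inner]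

lemma Ck_on_uminus: "open S \<Longrightarrow> Ck_on k S f \<Longrightarrow> Ck_on k S (\<lambda>x. - f x)"
  by (rule Ck_on_bounded_linear[of S uminus]) (auto intro: bounded_linear_minus[OF bounded_linear_ident])

lemma Ck_on_diff: "open S \<Longrightarrow> Ck_on k S f \<Longrightarrow> Ck_on k S g \<Longrightarrow> Ck_on k S (\<lambda>x. f x - g x)"
  using Ck_on_add[of S k f "\<lambda>x. - g x"] Ck_on_uminus[of S k g] by auto

lemma Ck_on_prod:
  fixes f :: "'i \<Rightarrow> 'e::real_normed_vector \<Rightarrow> real"
  assumes "open S" "\<And>i. i \<in> I \<Longrightarrow> Ck_on k S (f i)"
  shows "Ck_on k S (\<lambda>x. \<Prod>i\<in>I. f i x)"
  using assms(2)
  by (induction I rule: infinite_finite_induct) (auto intro: Ck_on_const Ck_on_mult assms(1))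

lemma Ck_on_compose:
  fixes g :: "'e::real_normed_vector \<Rightarrow> 'f::euclidean_space" and f :: "'f \<Rightarrow> 'g::real_normed_vector"
  assumes "open S" "open T" "Ck_on k S g" "Ck_on k T f" "g ` S \<subseteq> T"
  shows "Ck_on k S (\<lambda>x. f (g x))"
  using assms(3,4)
proof (induction k arbitrary: f)
  case 0
  then show ?case using assms(5) by (auto intro: continuous_on_compose2)
next
  case (Suc k)
  note df = Ck_on_Suc_has_derivative[OF Suc.prems(2)]
  note dg = Ck_on_Suc_has_derivative[OF Suc.prems(1)]
  have lin: "linear (dirD f y)" if "y \<in> T" for y
    using df[OF that] by (rule has_derivative_linear)
  \<comment> \<open>\<open>Ck_on\<close> controls derivatives in fixed directions only, while the
    chain rule differentiates \<open>f\<close> in the moving direction \<open>dirD g x v\<close>.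
    Expanding that direction in the basis leaves fixed directions and scalar coefficients.\<close>
  have "((\<lambda>x. f (g x)) has_derivative (\<lambda>v. \<Sum>b\<in>Basis. (dirD g x v \<bullet> b) *\<^sub>R dirD f (g x) b)) (at x)"
    if "x \<in> S" for x
  proof -
    have "((\<lambda>x. f (g x)) has_derivative (\<lambda>v. dirD f (g x) (dirD g x v))) (at x)"
      using diff_chain_at[OF dg[OF that] df[of "g x"]] that assms(5) by (auto simp: o_def)
    also have "(\<lambda>v. dirD f (g x) (dirD g x v)) = (\<lambda>v. \<Sum>b\<in>Basis. (dirD g x v \<bullet> b) *\<^sub>R dirD f (g x) b)"
    proof
      fix v
      have "dirD f (g x) (dirD g x v) = dirD f (g x) (\<Sum>b\<in>Basis. (dirD g x v \<bullet> b) *\<^sub>R b)"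
        by (simp add: euclidean_representation)
      also have "\<dots> = (\<Sum>b\<in>Basis. (dirD g x v \<bullet> b) *\<^sub>R dirD f (g x) b)"
        using lin[of "g x"] that assms(5) by (subst linear_sum) (auto simp: linear_scale image_subset_iff)
      finally show "dirD f (g x) (dirD g x v) = (\<Sum>b\<in>Basis. (dirD g x v \<bullet> b) *\<^sub>R dirD f (g x) b)" .
    qed
    finally show ?thesis .
  qed
  then show ?case
  proof (rule Ck_on_SucI[OF \<open>open S\<close>])
    show "Ck_on k S (\<lambda>x. \<Sum>b\<in>Basis. (dirD g x v \<bullet> b) *\<^sub>R dirD f (g x) b)" for v
      using Suc Ck_on_SucD[OF Suc.prems(1)] \<open>open S\<close>
      by (intro Ck_on_sum Ck_on_scaleR Ck_on_inner Ck_on_const Suc.IH) auto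
  qed
qed

lemma Ck_on_real_inverse: "Ck_on k (- {0}) (inverse :: real \<Rightarrow> real)"
proof (induction k)
  case (Suc k)
  have "((inverse :: real \<Rightarrow> real) has_derivative (\<lambda>v. - (v * (inverse x * inverse x)))) (at x)" if "x \<noteq> 0" for x
    using that by (auto intro!: derivative_eq_intros simp: mult_ac)
  then show ?case
    by (intro Ck_on_SucI[where f' = "\<lambda>x v. - (v * (inverse x * inverse x))"])
       (auto intro!: Ck_on_uminus Ck_on_mult Ck_on_const Suc)
qed (auto intro: continuous_intros)

lemma Ck_on_real_exp: "Ck_on k UNIV (exp :: real \<Rightarrow> real)"
proof (induction k)
  case (Suc k)
  have "((exp :: real \<Rightarrow> real) has_derivative (\<lambda>v. v * exp x)) (at x)" for x
    by (auto intro!: derivative_eq_intros simp: mult_ac)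
  then show ?case
    by (intro Ck_on_SucI[where f' = "\<lambda>x v. v * exp x"]) (auto intro!: Ck_on_mult Ck_on_const Suc)
qed (auto intro: continuous_intros)

lemma Ck_on_real_ln: "Ck_on k {0<..} (ln :: real \<Rightarrow> real)"
proof (cases k)
  case (Suc k)
  have "((ln :: real \<Rightarrow> real) has_derivative (\<lambda>v. v * inverse x)) (at x)" if "x > 0" for x
    using that by (auto intro!: derivative_eq_intros simp: mult_ac field_simps)
  moreover have "Ck_on k {0<..} (inverse :: real \<Rightarrow> real)"
    by (rule Ck_on_subset[OF _ Ck_on_real_inverse]) auto
  ultimately show ?thesis
    unfolding Suc by (intro Ck_on_SucI[where f' = "\<lambda>x v. v * inverse x"]) (auto intro!: Ck_on_mult Ck_on_const)
qed (auto intro!: continuous_intros)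

lemma Ck_on_divide:
  fixes f g :: "'e::real_normed_vector \<Rightarrow> real"
  assumes "open S" "Ck_on k S f" "Ck_on k S g" "\<And>x. x \<in> S \<Longrightarrow> g x \<noteq> 0"
  shows "Ck_on k S (\<lambda>x. f x / g x)"
  unfolding divide_inverse
  by (intro Ck_on_mult Ck_on_compose[OF _ _ _ Ck_on_real_inverse] assms) (use assms in auto)

lemma Ck_on_exp:
  fixes f :: "'e::real_normed_vector \<Rightarrow> real"
  shows "open S \<Longrightarrow> Ck_on k S f \<Longrightarrow> Ck_on k S (\<lambda>x. exp (f x))"
  by (rule Ck_on_compose[OF _ _ _ Ck_on_real_exp]) auto

lemma Ck_on_euclidean_iff:
  fixes f :: "'e::real_normed_vector \<Rightarrow> 'f::euclidean_space"
  assumes "open S"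
  shows "Ck_on k S f \<longleftrightarrow> (\<forall>b\<in>Basis. Ck_on k S (\<lambda>x. f x \<bullet> b))"
proof
  assume *: "\<forall>b\<in>Basis. Ck_on k S (\<lambda>x. f x \<bullet> b)"
  have "Ck_on k S (\<lambda>x. \<Sum>b\<in>Basis. (f x \<bullet> b) *\<^sub>R b)"
    using * by (intro Ck_on_sum Ck_on_scaleR Ck_on_const assms) auto
  then show "Ck_on k S f" by (simp add: euclidean_representation)
qed (auto intro: Ck_on_bounded_linear[OF assms bounded_linear_inner_left])

lemma Ck_on_vec_iff:
  fixes f :: "'e::real_normed_vector \<Rightarrow> 'f::euclidean_space^'n"
  assumes "open S"
  shows "Ck_on k S f \<longleftrightarrow> (\<forall>i. Ck_on k S (\<lambda>x. f x $ i))"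
proof
  assume *: "\<forall>i. Ck_on k S (\<lambda>x. f x $ i)"
  show "Ck_on k S f"
    unfolding Ck_on_euclidean_iff[OF assms, of k f]
  proof
    fix b :: "'f^'n" assume "b \<in> Basis"
    then obtain i u where b: "b = axis i u" "u \<in> Basis" by (auto simp: Basis_vec_def)
    then show "Ck_on k S (\<lambda>x. f x \<bullet> b)"
      using * by (auto simp: inner_axis intro: Ck_on_bounded_linear[OF assms bounded_linear_inner_left])
  qed
qed (auto intro: Ck_on_bounded_linear[OF assms bounded_linear_vec_nth])

lemma Ck_on_Pair:
  fixes f :: "'e::real_normed_vector \<Rightarrow> 'f::euclidean_space" and g :: "'e \<Rightarrow> 'g::euclidean_space"
  assumes "open S" "Ck_on k S f" "Ck_on k S g"
  shows "Ck_on k S (\<lambda>x. (f x, g x))"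
proof -
  have "Ck_on k S (\<lambda>x. (f x, 0) + (0, g x))"
    by (intro Ck_on_add Ck_on_bounded_linear[where g = "\<lambda>x. (x, 0)"]
        Ck_on_bounded_linear[where g = "\<lambda>x. (0, x)"] assms bounded_linear_intros) 
  then show ?thesis by simp
qed

lemma Ck_on_det:
  fixes A :: "'e::real_normed_vector \<Rightarrow> real^'n^'n"
  assumes "open S" "Ck_on k S A"
  shows "Ck_on k S (\<lambda>x. det (A x))"
  unfolding det_def
  using assms
  by (intro Ck_on_sum Ck_on_mult Ck_on_const Ck_on_prod) (auto simp: Ck_on_vec_iff)

text \<open>Cramer's rule makes the entries of the inverse quotients of determinants, so regularity
  of the inverse reduces to sums, products and quotients.\<close>

lemma matrix_inv_cramer:
  fixes A :: "real^'n^'n"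
  assumes "invertible A"
  shows "matrix_inv A $ k $ l = det (\<chi> i j. if j = k then axis l 1 $ i else A $ i $ j) / det A"
proof -
  have "A ** matrix_inv A = mat 1"
    using someI_ex[OF assms[unfolded invertible_def]] by (simp add: matrix_inv_def)
  then have "A *v (matrix_inv A *v axis l 1) = axis l 1"
    by (simp add: matrix_vector_mul_assoc)
  moreover have "det A \<noteq> 0" using assms by (simp add: invertible_det_nz)
  ultimately have "matrix_inv A *v axis l 1 = (\<chi> k. det (\<chi> i j. if j = k then axis l 1 $ i else A $ i $ j) / det A)"
    by (simp add: cramer)
  then show ?thesis
    by (auto simp: matrix_vector_mul_component vec_eq_iff matrix_vector_mult_basis column_def)
qed

lemma Ck_on_matrix_inv:
  fixes A :: "'e::real_normed_vector \<Rightarrow> real^'n^'n"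
  assumes "open S" "Ck_on k S A" "\<And>x. x \<in> S \<Longrightarrow> invertible (A x)"
  shows "Ck_on k S (\<lambda>x. matrix_inv (A x))"
proof -
  have A: "Ck_on k S (\<lambda>x. A x $ i $ j)" for i j
    using assms by (simp add: Ck_on_vec_iff)
  have B: "Ck_on k S (\<lambda>x. if j = p then c else A x $ i $ j)" for i j p c
    by (cases "j = p") (simp_all add: A Ck_on_const[OF \<open>open S\<close>])
  have "Ck_on k S (\<lambda>x. matrix_inv (A x) $ p $ l)" for p l
  proof (rule Ck_on_cong[OF \<open>open S\<close>])
    show "Ck_on k S (\<lambda>x. det (\<chi> i j. if j = p then axis l 1 $ i else A x $ i $ j) / det (A x))"
      using assms A B
      by (intro Ck_on_divide Ck_on_det) (auto simp: Ck_on_vec_iff invertible_det_nz intro: Ck_on_const)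
  qed (simp add: matrix_inv_cramer assms)
  then show ?thesis by (simp add: Ck_on_vec_iff assms(1))
qed

section \<open>Closure properties of smooth maps\<close>

lemma smooth_on_Ck: "smooth_on S f \<Longrightarrow> Ck_on k S f"
  by (simp add: smooth_on_def)

lemma smooth_on_cong: "open S \<Longrightarrow> (\<And>x. x \<in> S \<Longrightarrow> f x = g x) \<Longrightarrow> smooth_on S f \<Longrightarrow> smooth_on S g"
  unfolding smooth_on_def by (blast intro: Ck_on_cong)

lemma smooth_on_subset: "T \<subseteq> S \<Longrightarrow> smooth_on S f \<Longrightarrow> smooth_on T f"
  unfolding smooth_on_def by (blast intro: Ck_on_subset)

lemma smooth_on_const: "open S \<Longrightarrow> smooth_on S (\<lambda>x. c)"
  by (simp add: smooth_on_def Ck_on_const)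

lemma smooth_on_ident: "open S \<Longrightarrow> smooth_on S (\<lambda>x. x)"
  by (simp add: smooth_on_def Ck_on_ident)

lemma smooth_on_linear: "open S \<Longrightarrow> bounded_linear g \<Longrightarrow> smooth_on S g"
  by (simp add: smooth_on_def Ck_on_linear)

lemma smooth_on_bounded_linear: "open S \<Longrightarrow> bounded_linear g \<Longrightarrow> smooth_on S f \<Longrightarrow> smooth_on S (\<lambda>x. g (f x))"
  by (simp add: smooth_on_def Ck_on_bounded_linear)

lemma smooth_on_add: "open S \<Longrightarrow> smooth_on S f \<Longrightarrow> smooth_on S g \<Longrightarrow> smooth_on S (\<lambda>x. f x + g x)"
  by (simp add: smooth_on_def Ck_on_add)

lemma smooth_on_diff: "open S \<Longrightarrow> smooth_on S f \<Longrightarrow> smooth_on S g \<Longrightarrow> smooth_on S (\<lambda>x. f x - g x)"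
  by (simp add: smooth_on_def Ck_on_diff)

lemma smooth_on_uminus: "open S \<Longrightarrow> smooth_on S f \<Longrightarrow> smooth_on S (\<lambda>x. - f x)"
  by (simp add: smooth_on_def Ck_on_uminus)

lemma smooth_on_sum: "open S \<Longrightarrow> (\<And>i. i \<in> I \<Longrightarrow> smooth_on S (f i)) \<Longrightarrow> smooth_on S (\<lambda>x. \<Sum>i\<in>I. f i x)"
  by (simp add: smooth_on_def Ck_on_sum)

lemma smooth_on_mult:
  fixes f g :: "'e::real_normed_vector \<Rightarrow> real"
  shows "open S \<Longrightarrow> smooth_on S f \<Longrightarrow> smooth_on S g \<Longrightarrow> smooth_on S (\<lambda>x. f x * g x)"
  by (simp add: smooth_on_def Ck_on_mult)

lemma smooth_on_scaleR: "open S \<Longrightarrow> smooth_on S f \<Longrightarrow> smooth_on S g \<Longrightarrow> smooth_on S (\<lambda>x. f x *\<^sub>R g x)"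
  by (simp add: smooth_on_def Ck_on_scaleR)

lemma smooth_on_inner: "open S \<Longrightarrow> smooth_on S f \<Longrightarrow> smooth_on S g \<Longrightarrow> smooth_on S (\<lambda>x. f x \<bullet> g x)"
  by (simp add: smooth_on_def Ck_on_inner)

lemma smooth_on_exp:
  fixes f :: "'e::real_normed_vector \<Rightarrow> real"
  shows "open S \<Longrightarrow> smooth_on S f \<Longrightarrow> smooth_on S (\<lambda>x. exp (f x))"
  by (simp add: smooth_on_def Ck_on_exp)

lemma smooth_on_divide:
  fixes f g :: "'e::real_normed_vector \<Rightarrow> real"
  shows "open S \<Longrightarrow> smooth_on S f \<Longrightarrow> smooth_on S g \<Longrightarrow> (\<And>x. x \<in> S \<Longrightarrow> g x \<noteq> 0) \<Longrightarrow> smooth_on S (\<lambda>x. f x / g x)"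
  by (simp add: smooth_on_def Ck_on_divide)

lemma smooth_on_compose:
  fixes g :: "'e::real_normed_vector \<Rightarrow> 'f::euclidean_space" and f :: "'f \<Rightarrow> 'g::real_normed_vector"
  assumes "open S" "open T" "smooth_on S g" "smooth_on T f" "g ` S \<subseteq> T"
  shows "smooth_on S (\<lambda>x. f (g x))"
  using assms unfolding smooth_on_def by (blast intro: Ck_on_compose)

lemma smooth_on_vec_iff:
  fixes f :: "'e::real_normed_vector \<Rightarrow> 'f::euclidean_space^'n"
  shows "open S \<Longrightarrow> smooth_on S f \<longleftrightarrow> (\<forall>i. smooth_on S (\<lambda>x. f x $ i))"
  by (auto simp: smooth_on_def Ck_on_vec_iff)

lemma smooth_on_Pair:
  fixes f :: "'e::real_normed_vector \<Rightarrow> 'f::euclidean_space" and g :: "'e \<Rightarrow> 'g::euclidean_space"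
  shows "open S \<Longrightarrow> smooth_on S f \<Longrightarrow> smooth_on S g \<Longrightarrow> smooth_on S (\<lambda>x. (f x, g x))"
  by (simp add: smooth_on_def Ck_on_Pair)

lemma smooth_on_det:
  fixes A :: "'e::real_normed_vector \<Rightarrow> real^'n^'n"
  shows "open S \<Longrightarrow> smooth_on S A \<Longrightarrow> smooth_on S (\<lambda>x. det (A x))"
  by (simp add: smooth_on_def Ck_on_det)

lemma smooth_on_matrix_inv:
  fixes A :: "'e::real_normed_vector \<Rightarrow> real^'n^'n"
  shows "open S \<Longrightarrow> smooth_on S A \<Longrightarrow> (\<And>x. x \<in> S \<Longrightarrow> invertible (A x)) \<Longrightarrow> smooth_on S (\<lambda>x. matrix_inv (A x))"
  by (simp add: smooth_on_def Ck_on_matrix_inv)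

lemma smooth_on_has_derivative: "smooth_on S f \<Longrightarrow> x \<in> S \<Longrightarrow> (f has_derivative dirD f x) (at x)"
  using Ck_on_Suc_has_derivative[of 0] smooth_on_Ck by blast

lemma smooth_on_dirD: "smooth_on S f \<Longrightarrow> smooth_on S (\<lambda>x. dirD f x v)"
  unfolding smooth_on_def using Ck_on.simps(2) by metis

lemma smooth_on_linear_dirD: "smooth_on S f \<Longrightarrow> x \<in> S \<Longrightarrow> linear (dirD f x)"
  using smooth_on_has_derivative has_derivative_linear by blast

lemma smooth_on_continuous: "smooth_on S f \<Longrightarrow> continuous_on S f"
  by (metis Ck_on.simps(1) smooth_on_def)

lemma smooth_onI_dirD:
  assumes "open S" "\<And>x. x \<in> S \<Longrightarrow> (f has_derivative f' x) (at x)" "\<And>v. smooth_on S (\<lambda>x. f' x v)"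
  shows "smooth_on S f"
  unfolding smooth_on_def
proof
  fix k show "Ck_on k S f"
    by (rule Ck_on_SucD, rule Ck_on_SucI[OF assms(1,2)]) (use assms(3) smooth_on_Ck in auto)
qed

section \<open>Symmetry of second derivatives\<close>

lemma has_derivative_along_line:
  assumes "(f has_derivative f') (at (x + t *\<^sub>R v))"
  shows "((\<lambda>t. f (x + t *\<^sub>R v)) has_vector_derivative f' v) (at t)"
proof -
  have "((\<lambda>t. x + t *\<^sub>R v) has_derivative (\<lambda>s. s *\<^sub>R v)) (at t)"
    by (auto intro!: derivative_eq_intros)
  from diff_chain_at[OF this assms] show ?thesis
    using has_derivative_linear[OF assms]
    by (simp add: has_vector_derivative_def o_def linear_scale)
qed

text \<open>The second difference is symmetric in \<open>v\<close> and \<open>w\<close>, whereas the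
  right-hand side differentiates first along \<open>v\<close> and then along \<open>w\<close>;
  swapping them leads to the symmetry of second derivatives. The mean value theorem is applied once
  in each direction.\<close>

lemma second_difference_eq:
  fixes f :: "'e::euclidean_space \<Rightarrow> real"
  assumes "smooth_on (ball x r) f" "s > 0" "s * (norm v + norm w) < r"
  shows "\<exists>y. norm (y - x) \<le> s * (norm v + norm w) \<and>
    f (x + s *\<^sub>R v + s *\<^sub>R w) - f (x + s *\<^sub>R v) - f (x + s *\<^sub>R w) + f x
      = s\<^sup>2 * dirD (\<lambda>y. dirD f y v) y w"
proof -
  have inb: "x + a *\<^sub>R v + b *\<^sub>R w \<in> ball x r" if "0 \<le> a" "a \<le> s" "0 \<le> b" "b \<le> s" for a b
  proof -
    have "norm (a *\<^sub>R v + b *\<^sub>R w) \<le> a * norm v + b * norm w"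
      using that by (metis abs_of_nonneg norm_scaleR norm_triangle_ineq)
    also have "\<dots> \<le> s * norm v + s * norm w"
      using that by (intro add_mono mult_right_mono) auto
    finally have "norm (a *\<^sub>R v + b *\<^sub>R w) < r"
      using assms(3) by (simp add: algebra_simps)
    moreover have "dist x (x + a *\<^sub>R v + b *\<^sub>R w) = norm (a *\<^sub>R v + b *\<^sub>R w)"
      by (metis add.assoc add_diff_cancel_left' dist_commute dist_norm)
    ultimately show ?thesis by simp
  qed
  have l1: "((\<lambda>t. f (x + t *\<^sub>R v + b *\<^sub>R w)) has_real_derivative dirD f (x + t *\<^sub>R v + b *\<^sub>R w) v) (at t)"
    if "0 \<le> t" "t \<le> s" "0 \<le> b" "b \<le> s" for t b
    using has_derivative_along_line[of f _ "x + b *\<^sub>R w" t v] smooth_on_has_derivative[OF assms(1) inb[OF that]]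
    by (auto simp: has_real_derivative_iff_has_vector_derivative algebra_simps)
  \<comment> \<open>Mean value theorem for
    \<open>t \<mapsto> f (x + t v + s w) - f (x + t v)\<close>.\<close>
  have "\<exists>z>0. z < s \<and> (f (x + s *\<^sub>R v + s *\<^sub>R w) - f (x + s *\<^sub>R v + 0 *\<^sub>R w)) - (f (x + 0 *\<^sub>R v + s *\<^sub>R w) - f (x
      + 0 *\<^sub>R v + 0 *\<^sub>R w))
    = (s - 0) * (dirD f (x + z *\<^sub>R v + s *\<^sub>R w) v - dirD f (x + z *\<^sub>R v + 0 *\<^sub>R w) v)"
    using \<open>s > 0\<close> by (intro MVT2 DERIV_diff l1) auto
  then obtain z where z: "0 < z" "z < s" and e1: "f (x + s *\<^sub>R v + s *\<^sub>R w) - f (x + s *\<^sub>R v) - f (x + s *\<^sub>R w) + f x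
    = s * (dirD f (x + z *\<^sub>R v + s *\<^sub>R w) v - dirD f (x + z *\<^sub>R v) v)"
    by (auto simp: algebra_simps)
  have l2: "((\<lambda>t. dirD f (x + z *\<^sub>R v + t *\<^sub>R w) v) has_real_derivative
      dirD (\<lambda>y. dirD f y v) (x + z *\<^sub>R v + t *\<^sub>R w) w) (at t)"
    if "0 \<le> t" "t \<le> s" for t
    using has_derivative_along_line[of "\<lambda>y. dirD f y v" _ "x + z *\<^sub>R v" t w] z
      smooth_on_has_derivative[OF smooth_on_dirD[OF assms(1)] inb[of z t]] that
    by (auto simp: has_real_derivative_iff_has_vector_derivative)
  have "\<exists>q>0. q < s \<and> dirD f (x + z *\<^sub>R v + s *\<^sub>R w) v - dirD f (x + z *\<^sub>R v + 0 *\<^sub>R w) v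
    = (s - 0) * dirD (\<lambda>y. dirD f y v) (x + z *\<^sub>R v + q *\<^sub>R w) w"
    using \<open>s > 0\<close> by (intro MVT2 l2) auto
  then obtain q where q: "0 < q" "q < s" and e2: "dirD f (x + z *\<^sub>R v + s *\<^sub>R w) v - dirD f (x + z *\<^sub>R v) v
    = s * dirD (\<lambda>y. dirD f y v) (x + z *\<^sub>R v + q *\<^sub>R w) w"
    by auto
  have "norm (z *\<^sub>R v + q *\<^sub>R w) \<le> z * norm v + q * norm w"
    using z q by (metis abs_of_nonneg norm_scaleR norm_triangle_ineq less_imp_le)
  also have "\<dots> \<le> s * norm v + s * norm w"
    using z q by (intro add_mono mult_right_mono) auto
  finally show ?thesis
    using e1 e2 by (intro exI[of _ "x + z *\<^sub>R v + q *\<^sub>R w"]) (auto simp: algebra_simps power2_eq_square)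
qed

lemma dirD_commute_real:
  fixes f :: "'e::euclidean_space \<Rightarrow> real"
  assumes "open S" "smooth_on S f" "x \<in> S"
  shows "dirD (\<lambda>y. dirD f y v) x w = dirD (\<lambda>y. dirD f y w) x v"
proof (rule ccontr)
  let ?A = "\<lambda>y. dirD (\<lambda>y. dirD f y v) y w" and ?B = "\<lambda>y. dirD (\<lambda>y. dirD f y w) y v"
  assume neq: "?A x \<noteq> ?B x"
  define e where "e = \<bar>?A x - ?B x\<bar> / 2"
  have "e > 0" using neq by (simp add: e_def)
  have cA: "isCont ?A x" and cB: "isCont ?B x"
    using continuous_on_eq_continuous_at[OF assms(1)] assms(3)
      smooth_on_continuous[OF smooth_on_dirD[OF smooth_on_dirD[OF assms(2)]]] by blast+
  obtain d1 where d1: "d1 > 0" "\<And>y. dist y x < d1 \<Longrightarrow> dist (?A y) (?A x) < e"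
    using cA[unfolded continuous_at_eps_delta, rule_format, OF \<open>e > 0\<close>] by blast
  obtain d2 where d2: "d2 > 0" "\<And>y. dist y x < d2 \<Longrightarrow> dist (?B y) (?B x) < e"
    using cB[unfolded continuous_at_eps_delta, rule_format, OF \<open>e > 0\<close>] by blast
  obtain r where r: "r > 0" "ball x r \<subseteq> S" using assms by (meson openE)
  define R where "R = min r (min d1 d2)"
  \<comment> \<open>The parallelogram spanned by \<open>s v\<close> and \<open>s w\<close> then lies
    within \<open>R / 2\<close> of \<open>x\<close>; the summand 1 avoids a division by zero when
    \<open>v\<close> and \<open>w\<close> vanish.\<close>
  define s where "s = R / 2 / (norm v + norm w + 1)"
  have "R > 0" using r d1 d2 by (auto simp: R_def)
  have pos: "norm v + norm w + 1 > 0" by (simp add: add_nonneg_pos)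
  then have "s > 0" using \<open>R > 0\<close> by (simp add: s_def)
  have "s * (norm v + norm w) \<le> s * (norm v + norm w + 1)"
    using \<open>s > 0\<close> by simp
  also have "\<dots> = R / 2"
    unfolding s_def using pos by (metis less_numeral_extra(3) nonzero_divide_eq_eq)
  also have "\<dots> < R" using \<open>R > 0\<close> by simp
  finally have sR: "s * (norm v + norm w) < R" .
  have sm: "smooth_on (ball x R) f"
    by (rule smooth_on_subset[OF _ assms(2)]) (use r in \<open>auto simp: R_def\<close>)
  from second_difference_eq[OF sm \<open>s > 0\<close> sR]
  obtain y1 where y1: "norm (y1 - x) \<le> s * (norm v + norm w)" and e1: "f (x + s *\<^sub>R v + s *\<^sub>R w) - f (x
      + s *\<^sub>R v) - f (x + s *\<^sub>R w) + f x
      = s\<^sup>2 * ?A y1" by blast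
  from second_difference_eq[OF sm \<open>s > 0\<close>, of w v] sR
  obtain y2 where y2: "norm (y2 - x) \<le> s * (norm v + norm w)" and e2: "f (x + s *\<^sub>R v + s *\<^sub>R w) - f (x
      + s *\<^sub>R v) - f (x + s *\<^sub>R w) + f x
      = s\<^sup>2 * ?B y2" by (auto simp: add_ac)
  have "?A y1 = ?B y2" using e1 e2 \<open>s > 0\<close> by simp
  moreover have "dist (?A y1) (?A x) < e"
    by (rule d1(2)) (use y1 sR in \<open>simp add: R_def dist_norm\<close>)
  moreover have "dist (?B y2) (?B x) < e"
    by (rule d2(2)) (use y2 sR in \<open>simp add: R_def dist_norm\<close>)
  ultimately have "\<bar>?A x - ?B x\<bar> < e + e"
    by (auto simp: dist_real_def)
  then show False by (simp add: e_def)
qed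

lemma dirD_inner:
  assumes "smooth_on S f" "x \<in> S"
  shows "dirD (\<lambda>x. f x \<bullet> b) x = (\<lambda>v. dirD f x v \<bullet> b)"
  by (intro dirD_eqI has_derivative_inner_left smooth_on_has_derivative[OF assms])

lemma dirD_commute:
  fixes f :: "'e::euclidean_space \<Rightarrow> 'f::euclidean_space"
  assumes "open S" "smooth_on S f" "x \<in> S"
  shows "dirD (\<lambda>y. dirD f y v) x w = dirD (\<lambda>y. dirD f y w) x v"
proof (rule euclidean_eqI)
  fix b :: 'f
  have sm: "smooth_on S (\<lambda>y. f y \<bullet> b)"
    by (intro smooth_on_inner smooth_on_const assms)
  have *: "dirD (\<lambda>y. dirD f y v) x w \<bullet> b = dirD (\<lambda>y. dirD (\<lambda>y. f y \<bullet> b) y v) x w" for v w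
  proof -
    have "dirD (\<lambda>y. dirD f y v) x w \<bullet> b = dirD (\<lambda>y. dirD f y v \<bullet> b) x w"
      using dirD_inner[OF smooth_on_dirD[OF assms(2)] assms(3)] by metis
    also have "\<dots> = dirD (\<lambda>y. dirD (\<lambda>y. f y \<bullet> b) y v) x w"
    proof -
      have "((\<lambda>y. dirD (\<lambda>y. f y \<bullet> b) y v) has_derivative dirD (\<lambda>y. dirD f y v \<bullet> b) x) (at x)"
        by (rule has_derivative_transform_within_open[OF _ assms(1,3)])
           (use assms in \<open>auto simp: dirD_inner intro!: smooth_on_has_derivative[of S] smooth_on_inner
               smooth_on_const smooth_on_dirD\<close>)
      then show ?thesis by (simp add: dirD_eqI)
    qed
    finally show ?thesis .
  qed
  show "dirD (\<lambda>y. dirD f y v) x w \<bullet> b = dirD (\<lambda>y. dirD f y w) x v \<bullet> b"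
    unfolding * by (rule dirD_commute_real[OF assms(1) sm assms(3)])
qed

text \<open>The inverse function theorem used below wants the derivative to be continuous as a map
  into bounded operators. In finite dimension continuity in each basis direction suffices.\<close>

lemma smooth_on_blinfun_continuous:
  fixes f :: "'e::euclidean_space \<Rightarrow> 'f::real_normed_vector"
  assumes "smooth_on S f"
  shows "continuous_on S (\<lambda>x. Blinfun (dirD f x))"
proof (rule continuous_on_blinfun_componentwise)
  fix i :: 'e
  have "blinfun_apply (Blinfun (dirD f x)) i = dirD f x i" if "x \<in> S" for x
    using smooth_on_has_derivative[OF assms that]
    by (simp add: bounded_linear_Blinfun_apply has_derivative_bounded_linear)
  then show "continuous_on S (\<lambda>x. blinfun_apply (Blinfun (dirD f x)) i)"
    using smooth_on_continuous[OF smooth_on_dirD[OF assms]] by (simp cong: continuous_on_cong)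
qed

section \<open>Smooth local inverses and primitives of closed 1-forms\<close>

lemma matrix_inv_inverse:
  fixes A :: "real^'n^'n"
  assumes "invertible A"
  shows "A ** matrix_inv A = mat 1" "matrix_inv A ** A = mat 1"
  using someI_ex[OF assms[unfolded invertible_def]] by (simp_all add: matrix_inv_def)

text \<open>Bootstrapping from a differentiable inverse: the derivative of \<open>g\<close> at
  \<open>y\<close> is the inverse of the derivative of \<open>f\<close> at \<open>g y\<close>, so if
  \<open>g\<close> is of class C^k then so is its derivative, which makes \<open>g\<close> of class
  C^(k+1). Writing derivatives as matrices lets \<open>Ck_on_matrix_inv\<close> perform this
  step.\<close>

lemma smooth_local_inverse:
  fixes f :: "real^'n \<Rightarrow> real^'n"
  assumes "open U" "smooth_on U f" "x0 \<in> U" "inj (dirD f x0)"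
  obtains U' V g where "open U'" "U' \<subseteq> U" "x0 \<in> U'" "open V" "f x0 \<in> V" "homeomorphism U' V f g"
    "smooth_on V g" "\<And>x. x \<in> U' \<Longrightarrow> inj (dirD f x)"
proof -
  have bl: "blinfun_apply (Blinfun (dirD f x)) = dirD f x" if "x \<in> U" for x
    using smooth_on_has_derivative[OF assms(2) that]
    by (simp add: bounded_linear_Blinfun_apply has_derivative_bounded_linear)
  obtain h where h: "linear h" "h \<circ> dirD f x0 = id"
    using linear_injective_left_inverse[OF smooth_on_linear_dirD[OF assms(2,3)] assms(4)] by blast
  then have "Blinfun h o\<^sub>L Blinfun (dirD f x0) = id_blinfun"
    using bl[OF assms(3)] by (intro blinfun_eqI)
      (auto simp: bounded_linear_Blinfun_apply linear_conv_bounded_linear o_def id_def fun_eq_iff)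
  from inverse_function_theorem[OF assms(1) _ smooth_on_blinfun_continuous[OF assms(2)] assms(3) this]
  obtain U' V g g' where U': "open U'" "U' \<subseteq> U" "x0 \<in> U'" "open V" "f x0 \<in> V" and hom: "homeomorphism U' V f g"
    and g: "\<And>y. y \<in> V \<Longrightarrow> (g has_derivative (g' y)) (at y)"
    "\<And>y. y \<in> V \<Longrightarrow> g' y = inv (blinfun_apply (Blinfun (dirD f (g y))))"
    "\<And>y. y \<in> V \<Longrightarrow> bij (blinfun_apply (Blinfun (dirD f (g y))))"
    using bl smooth_on_has_derivative[OF assms(2)] by metis
  have gV: "g y \<in> U'" if "y \<in> V" for y using hom that by (auto simp: homeomorphism_def)
  have bij: "bij (dirD f x)" if "x \<in> U'" for x
    using g(3)[of "f x"] hom that U' bl[of x] by (auto simp: homeomorphism_def)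
  define A where "A x = matrix (dirD f x)" for x
  have lin: "linear (dirD f x)" if "x \<in> U'" for x
    using U' that smooth_on_linear_dirD[OF assms(2)] by auto
  have A: "A x *v v = dirD f x v" if "x \<in> U'" for x v
    using lin[OF that] by (simp add: A_def matrix_works)
  have invA: "invertible (A x)" if "x \<in> U'" for x
    using bij[OF that] lin[OF that] A[OF that] unfolding invertible_left_inverse matrix_left_invertible_injective
    by (simp add: bij_def inj_on_def)
  have Dg: "(g has_derivative (\<lambda>v. matrix_inv (A (g y)) *v v)) (at y)" if "y \<in> V" for y
  proof -
    have "g' y = (\<lambda>v. matrix_inv (A (g y)) *v v)"
    proof
      fix v
      have "dirD f (g y) (matrix_inv (A (g y)) *v v) = v"
        using gV[OF that] by (simp add: A[symmetric] matrix_vector_mul_assoc matrix_inv_inverse invA)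
      then have "inv (dirD f (g y)) v = matrix_inv (A (g y)) *v v"
        using bij[OF gV[OF that]] by (metis bij_inv_eq_iff)
      then show "g' y v = matrix_inv (A (g y)) *v v"
        using g(2)[OF that] bl[of "g y"] gV[OF that] U' by auto
    qed
    with g(1)[OF that] show ?thesis by simp
  qed
  have smA: "smooth_on U' A"
    unfolding A_def matrix_def
    using U' smooth_on_subset[OF U'(2) smooth_on_dirD[OF assms(2)]]
    by (simp add: smooth_on_vec_iff)
  have "Ck_on k V g" for k
  proof (induction k)
    case 0
    then show ?case using hom by (simp add: homeomorphism_def)
  next
    case (Suc k)
    have cA: "Ck_on k V (\<lambda>y. A (g y))"
      by (rule Ck_on_compose[OF \<open>open V\<close> \<open>open U'\<close> Suc smooth_on_Ck[OF smA]]) (use gV in auto)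
    have "Ck_on k V (\<lambda>y. matrix_inv (A (g y)))"
      by (rule Ck_on_matrix_inv[OF \<open>open V\<close> cA]) (use gV invA in auto)
    then have "Ck_on k V (\<lambda>y. matrix_inv (A (g y)) $ i $ j)" for i j
      using \<open>open V\<close> by (simp add: Ck_on_vec_iff)
    then have "Ck_on k V (\<lambda>y. matrix_inv (A (g y)) *v v)" for v
      using \<open>open V\<close> unfolding matrix_vector_mult_def
      by (subst Ck_on_vec_iff) (auto intro!: Ck_on_sum Ck_on_mult Ck_on_const)
    with Dg show ?case by (rule Ck_on_SucI[OF \<open>open V\<close>])
  qed
  then have "smooth_on V g" by (simp add: smooth_on_def)
  with that U' hom bij show thesis by (simp add: bij_def)
qed

text \<open>The primitive is the integral of the 1-form along the radial segment from the centre.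
  Covectors are represented by vectors through the inner product, so \<open>closed\<close> states
  that the derivative is symmetric.\<close>

lemma poincare_lemma:
  fixes \<beta> :: "'e::euclidean_space \<Rightarrow> 'e"
  assumes sm: "smooth_on (ball x0 r) \<beta>"
    and closed: "\<And>x v w. x \<in> ball x0 r \<Longrightarrow> dirD \<beta> x v \<bullet> w = dirD \<beta> x w \<bullet> v"
  obtains u where "u x0 = 0" "\<And>x. x \<in> ball x0 r \<Longrightarrow> (u has_derivative (\<lambda>v. \<beta> x \<bullet> v)) (at x)"
    "smooth_on (ball x0 r) u"
proof -
  define p where "p x t = x0 + t *\<^sub>R (x - x0)" for x :: 'e and t :: real
  define f where "f x t = \<beta> (p x t) \<bullet> (x - x0)" for x t
  define u where "u x = integral (cbox 0 1) (f x)" for x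
  let ?U = "ball x0 r"
  have pin: "p x t \<in> ?U" if "x \<in> ?U" "t \<in> cbox 0 1" for x t
  proof -
    have "norm (t *\<^sub>R (x - x0)) \<le> 1 * norm (x - x0)"
      using that(2) by (simp add: mult_left_le_one_le)
    then show ?thesis using that(1) by (auto simp: p_def dist_norm norm_minus_commute)
  qed
  have cp: "continuous_on (?U \<times> cbox 0 1) (\<lambda>z. p (fst z) (snd z))"
    unfolding p_def by (intro continuous_intros)
  define fx where "fx x t = (\<lambda>v. dirD \<beta> (p x t) (t *\<^sub>R v) \<bullet> (x - x0) + \<beta> (p x t) \<bullet> v)" for x t
  have der: "((\<lambda>x. f x t) has_derivative fx x t) (at x)" if "x \<in> ?U" "t \<in> cbox 0 1" for x t
  proof -
    have "((\<lambda>x. p x t) has_derivative (\<lambda>v. t *\<^sub>R v)) (at x)"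
      unfolding p_def by (auto intro!: derivative_eq_intros)
    from diff_chain_at[OF this smooth_on_has_derivative[OF sm pin[OF that]]]
    have "((\<lambda>x. \<beta> (p x t)) has_derivative (\<lambda>v. dirD \<beta> (p x t) (t *\<^sub>R v))) (at x)"
      by (simp add: o_def)
    then show ?thesis
      unfolding f_def fx_def by (auto intro!: derivative_eq_intros)
  qed
  have bl: "blinfun_apply (Blinfun (fx x t)) = fx x t" if "x \<in> ?U" "t \<in> cbox 0 1" for x t
    using der[OF that] by (simp add: bounded_linear_Blinfun_apply has_derivative_bounded_linear)
  have c\<beta>: "continuous_on (?U \<times> cbox 0 1) (\<lambda>z. \<beta> (p (fst z) (snd z)))"
    by (rule continuous_on_compose2[OF smooth_on_continuous[OF sm] cp]) (use pin in auto)
  have cD: "continuous_on (?U \<times> cbox 0 1) (\<lambda>z. dirD \<beta> (p (fst z) (snd z)) v)" for v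
    by (rule continuous_on_compose2[OF smooth_on_continuous[OF smooth_on_dirD[OF sm]] cp]) (use pin in auto)
  have cfx: "continuous_on (?U \<times> cbox 0 1) (\<lambda>(x, t). Blinfun (fx x t))"
  proof (rule continuous_on_blinfun_componentwise)
    fix v :: 'e
    have "continuous_on (?U \<times> cbox 0 1)
      (\<lambda>z. snd z * (dirD \<beta> (p (fst z) (snd z)) v \<bullet> (fst z - x0)) + \<beta> (p (fst z) (snd z)) \<bullet> v)"
      by (intro continuous_intros cD c\<beta>)
    then show "continuous_on (?U \<times> cbox 0 1) (\<lambda>z. blinfun_apply (case z of (x, t) \<Rightarrow> Blinfun (fx x t)) v)"
    proof (rule continuous_on_eq)
      fix z assume z: "z \<in> ?U \<times> (cbox 0 1 :: real set)"
      obtain x t where [simp]: "z = (x, t)" by force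
      have lin: "linear (dirD \<beta> (p x t))"
        using z smooth_on_linear_dirD[OF sm pin] by auto
      have eq: "blinfun_apply (Blinfun (fx x t)) v = fx x t v"
        using z bl by simp
      then show "snd z * (dirD \<beta> (p (fst z) (snd z)) v \<bullet> (fst z - x0)) + \<beta> (p (fst z) (snd z)) \<bullet> v =
        blinfun_apply (case z of (x, t) \<Rightarrow> Blinfun (fx x t)) v"
        by (simp add: eq) (simp add: fx_def linear_scale lin)
    qed
  qed
  have ft: "continuous_on (cbox 0 1) (f x)" if "x \<in> ?U" for x
  proof -
    have "continuous_on (cbox 0 1) (\<lambda>t. \<beta> (p (fst (x, t)) (snd (x, t))))"
      by (rule continuous_on_compose2[OF c\<beta>]) (use that in \<open>auto intro!: continuous_intros\<close>)
    then show ?thesis unfolding f_def by (auto intro!: continuous_intros)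
  qed
  have du: "(u has_derivative (\<lambda>v. \<beta> x \<bullet> v)) (at x)" if x: "x \<in> ?U" for x
  proof -
    have "(u has_derivative integral (cbox 0 1) (\<lambda>t. Blinfun (fx x t))) (at x within ?U)"
      unfolding u_def[abs_def]
    proof (rule leibniz_rule[OF _ _ cfx x])
      fix x t assume xt: "x \<in> ?U" "t \<in> cbox (0::real) 1"
      show "((\<lambda>x. f x t) has_derivative blinfun_apply (Blinfun (fx x t))) (at x within ?U)"
        unfolding bl[OF xt] by (rule has_derivative_at_withinI[OF der[OF xt]])
    next
      fix x assume "x \<in> ?U"
      then show "f x integrable_on cbox 0 1" by (intro integrable_continuous ft)
    qed simp
    then have D: "(u has_derivative integral (cbox 0 1) (\<lambda>t. Blinfun (fx x t))) (at x)"
      by (simp only: at_within_open[OF x open_ball])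
    have eq: "blinfun_apply (integral (cbox 0 1) (\<lambda>t. Blinfun (fx x t))) = (\<lambda>v. \<beta> x \<bullet> v)"
    proof (rule ext)
      fix v
      have "continuous_on (cbox 0 1) (\<lambda>t. case (x, t) of (x, t) \<Rightarrow> Blinfun (fx x t))"
        by (rule continuous_on_compose2[OF cfx]) (use x in \<open>auto intro!: continuous_intros\<close>)
      then have int: "(\<lambda>t. Blinfun (fx x t)) integrable_on cbox 0 1"
        by (auto intro: integrable_continuous_real)
      have "blinfun_apply (integral (cbox 0 1) (\<lambda>t. Blinfun (fx x t))) v
          = integral (cbox 0 1) (\<lambda>t. blinfun_apply (Blinfun (fx x t)) v)"
        using integral_linear[OF int blinfun.bounded_linear_left[of v]] by (simp add: o_def)
      also have "\<dots> = integral {0..1} (\<lambda>t. fx x t v)"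
        using x by (auto intro!: integral_cong simp: bl[unfolded cbox_interval])
      \<comment> \<open>By \<open>closed\<close>, the differentiated integrand
        \<open>fx x t v\<close> is the derivative in \<open>t\<close> of
        \<open>t * (\<beta> (p x t) \<bullet> v)\<close>, which is
        \<open>\<beta> x \<bullet> v\<close> at \<open>t = 1\<close> and 0 at
        \<open>t = 0\<close>.\<close>
      also have "\<dots> = 1 * (\<beta> (p x 1) \<bullet> v) - 0 * (\<beta> (p x 0) \<bullet> v)"
      proof (rule integral_unique, rule fundamental_theorem_of_calculus)
        fix t :: real assume t: "t \<in> {0..1}"
        note D = smooth_on_has_derivative[OF sm pin[OF x, of t]]
        have "((\<lambda>t. \<beta> (p x t)) has_vector_derivative dirD \<beta> (p x t) (x - x0)) (at t)"
          using has_derivative_along_line[of \<beta> _ x0 t "x - x0"] D t by (auto simp: p_def)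
        then have "((\<lambda>t. \<beta> (p x t) \<bullet> v) has_vector_derivative dirD \<beta> (p x t) (x - x0) \<bullet> v) (at t)"
          by (rule bounded_linear.has_vector_derivative[OF bounded_linear_inner_left])
        then have "((\<lambda>t. t * (\<beta> (p x t) \<bullet> v)) has_vector_derivative t * (dirD \<beta> (p x t) (x - x0) \<bullet> v)
            + 1 * (\<beta> (p x t) \<bullet> v)) (at t)"
          unfolding has_real_derivative_iff_has_vector_derivative[symmetric]
          by (auto intro!: derivative_eq_intros)
        moreover have "t * (dirD \<beta> (p x t) (x - x0) \<bullet> v) + 1 * (\<beta> (p x t) \<bullet> v) = fx x t v"
          using closed[OF pin[OF x], of t v "x - x0"] t smooth_on_linear_dirD[OF sm pin[OF x], of t]
          by (simp add: fx_def linear_scale)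
        ultimately show "((\<lambda>t. t * (\<beta> (p x t) \<bullet> v)) has_vector_derivative fx x t v) (at t within {0..1})"
          by (metis has_vector_derivative_at_within)
      qed simp
      finally show "blinfun_apply (integral (cbox 0 1) (\<lambda>t. Blinfun (fx x t))) v = \<beta> x \<bullet> v"
        by (simp add: p_def)
    qed
    show ?thesis using D unfolding eq .
  qed
  moreover have "smooth_on ?U u"
    by (rule smooth_onI_dirD[OF _ du]) (auto intro!: smooth_on_inner smooth_on_const sm)
  moreover have "f x0 = (\<lambda>t. 0)" by (simp add: f_def fun_eq_iff)
  then have "u x0 = 0" by (simp add: u_def)
  ultimately show thesis using that by blast
qed

subsection \<open>Smooth flows\<close>

text \<open>Picard's argument carried out in the space of bounded continuous functions of time and
  parameter together, so that joint continuity of the solution is part of the fixed point. The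
  condition \<open>\<tau> * L \<le> 1 / 2\<close> gives the contraction factor 1/2.\<close>

lemma ode_exists_param:
  fixes G :: "real \<Rightarrow> 'p::metric_space \<Rightarrow> 'e::euclidean_space \<Rightarrow> 'e"
  assumes cG: "continuous_on UNIV (\<lambda>q. G (fst q) (fst (snd q)) (snd (snd q)))"
    and lip: "\<And>t p y z. norm (G t p y - G t p z) \<le> L * norm (y - z)"
    and bd: "\<And>t p. norm (G t p 0) \<le> B" and "0 \<le> L" "0 < \<tau>" "\<tau> * L \<le> 1 / 2"
    and c0: "continuous_on UNIV y0" and b0: "\<And>p. norm (y0 p) \<le> C"
  obtains y where "continuous_on UNIV (\<lambda>q. y (fst q) (snd q))" "\<And>p. y 0 p = y0 p"
    "\<And>t p. \<bar>t\<bar> < \<tau> \<Longrightarrow> ((\<lambda>t. y t p) has_vector_derivative G t p (y t p)) (at t)"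
proof -
  \<comment> \<open>Clamping time to \<open>[-\<tau>, \<tau>]\<close> yields bounded functions on
    the whole line; inside the interval nothing changes.\<close>
  define c where "c t = max (-\<tau>) (min \<tau> t)" for t :: real
  have c: "\<bar>c t\<bar> \<le> \<tau>" for t using \<open>0 < \<tau>\<close> by (auto simp: c_def)
  have cc: "continuous_on UNIV c" unfolding c_def by (intro continuous_intros)
  \<comment> \<open>The integrand of the Picard operator after substituting
    \<open>s = \<theta> * t\<close>: integrating over the fixed interval [0, 1] treats positive and
    negative times alike.\<close>
  define f where "f \<gamma> q \<theta> = c (fst q) *\<^sub>R G (\<theta> * c (fst q)) (snd q) (apply_bcontfun \<gamma> (\<theta> * c (fst q), snd q))"
    for \<gamma> :: "(real \<times> 'p) \<Rightarrow>\<^sub>C 'e" and q :: "real \<times> 'p" and \<theta> :: real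
  define Op where "Op \<gamma> q = y0 (snd q) + integral (cbox 0 1) (f \<gamma> q)" for \<gamma> q
  have cf2: "continuous_on (UNIV \<times> cbox 0 1) (\<lambda>(q, \<theta>). f \<gamma> q \<theta>)" for \<gamma>
  proof -
    have 1: "continuous_on (UNIV \<times> cbox 0 1) (\<lambda>z::(real\<times>'p)\<times>real. (snd z * c (fst (fst z)), snd (fst z)))"
      by (intro continuous_intros continuous_on_compose2[OF cc]) auto
    have 2: "continuous_on (UNIV \<times> cbox 0 1) (\<lambda>z. apply_bcontfun \<gamma> (snd z * c (fst (fst z)), snd (fst z)))"
      by (rule continuous_on_compose2[OF continuous_on_apply_bcontfun[of UNIV] 1]) auto
    have 3: "continuous_on (UNIV \<times> cbox 0 1) (\<lambda>z::(real\<times>'p)\<times>real. (snd z * c (fst (fst z)), snd (fst z),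
      apply_bcontfun \<gamma> (snd z * c (fst (fst z)), snd (fst z))))"
      by (intro continuous_on_Pair 2 continuous_intros continuous_on_compose2[OF cc]) auto
    have "continuous_on (UNIV \<times> cbox 0 1) (\<lambda>z. G (snd z * c (fst (fst z))) (snd (fst z))
      (apply_bcontfun \<gamma> (snd z * c (fst (fst z)), snd (fst z))))"
      using continuous_on_compose2[OF cG 3] by auto
    then show ?thesis
      unfolding f_def split_beta by (intro continuous_intros continuous_on_compose2[OF cc]) auto
  qed
  have cf: "continuous_on (cbox 0 1) (f \<gamma> q)" for \<gamma> q
  proof -
    have "continuous_on (cbox 0 1) (\<lambda>\<theta>. case (q, \<theta>) of (q, \<theta>) \<Rightarrow> f \<gamma> q \<theta>)"
      by (rule continuous_on_compose2[OF cf2]) (auto intro!: continuous_intros)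
    then show ?thesis by simp
  qed
  have bG: "norm (G t p y) \<le> B + L * norm y" for t p y
    using lip[of t p y 0] bd[of t p] norm_triangle_ineq[of "G t p y - G t p 0" "G t p 0"] by simp
  have Op: "Op \<gamma> \<in> bcontfun" for \<gamma>
  proof (rule bcontfun_normI)
    show "continuous_on UNIV (Op \<gamma>)"
      unfolding Op_def[abs_def]
      by (intro continuous_intros integral_continuous_on_param cf2 continuous_on_compose2[OF c0]) auto
    fix q
    have "norm (integral {0..1} (f \<gamma> q)) \<le> \<tau> * (B + L * norm \<gamma>) * (1 - 0)"
    proof (rule integral_bound)
      fix \<theta> :: real
      have "norm (G (\<theta> * c (fst q)) (snd q) (apply_bcontfun \<gamma> (\<theta> * c (fst q), snd q))) \<le> B + L * norm \<gamma>"
        using bG order_trans add_left_mono[OF mult_left_mono[OF norm_bounded \<open>0 \<le> L\<close>]] by meson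
      then show "norm (f \<gamma> q \<theta>) \<le> \<tau> * (B + L * norm \<gamma>)"
        unfolding f_def norm_scaleR real_norm_def using c[of "fst q"] \<open>0 < \<tau>\<close> by (intro mult_mono) auto
    qed (use cf in auto)
    then show "norm (Op \<gamma> q) \<le> C + \<tau> * (B + L * norm \<gamma>)"
      unfolding Op_def using b0[of "snd q"] norm_triangle_ineq[of "y0 (snd q)" "integral (cbox 0 1) (f \<gamma> q)"] by simp
  qed
  define T where "T \<gamma> = Bcontfun (Op \<gamma>)" for \<gamma>
  have T: "apply_bcontfun (T \<gamma>) = Op \<gamma>" for \<gamma>
    unfolding T_def using Op by (rule Bcontfun_inverse)
  have "dist (T \<gamma>1) (T \<gamma>2) \<le> 1 / 2 * dist \<gamma>1 \<gamma>2" for \<gamma>1 \<gamma>2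
  proof (rule dist_bound)
    fix q
    have "norm (integral {0..1} (\<lambda>\<theta>. f \<gamma>1 q \<theta> - f \<gamma>2 q \<theta>)) \<le> 1 / 2 * dist \<gamma>1 \<gamma>2 * (1 - 0)"
    proof (rule integral_bound)
      show "continuous_on {0..1} (\<lambda>\<theta>. f \<gamma>1 q \<theta> - f \<gamma>2 q \<theta>)"
        using cf by (intro continuous_intros) auto
      fix \<theta> :: real
      let ?z = "(\<theta> * c (fst q), snd q)"
      have "norm (f \<gamma>1 q \<theta> - f \<gamma>2 q \<theta>) = \<bar>c (fst q)\<bar> * norm (G (\<theta> * c (fst q)) (snd q) (apply_bcontfun \<gamma>1 ?z) - G (\<theta>
          * c (fst q)) (snd q) (apply_bcontfun \<gamma>2 ?z))"
        unfolding f_def scaleR_diff_right[symmetric] by simp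
      also have "\<dots> \<le> \<tau> * (L * dist \<gamma>1 \<gamma>2)"
      proof (intro mult_mono c)
        have "norm (apply_bcontfun \<gamma>1 ?z - apply_bcontfun \<gamma>2 ?z) \<le> dist \<gamma>1 \<gamma>2"
          using dist_bounded[of \<gamma>1 ?z \<gamma>2] by (simp add: dist_norm)
        then show "norm (G (\<theta> * c (fst q)) (snd q) (apply_bcontfun \<gamma>1 ?z) - G (\<theta> * c (fst q)) (snd q) (apply_bcontfun
            \<gamma>2 ?z)) \<le> L * dist \<gamma>1 \<gamma>2"
          by (rule order_trans[OF lip mult_left_mono[OF _ \<open>0 \<le> L\<close>]])
      qed (use \<open>0 < \<tau>\<close> in auto)
      also have "\<dots> \<le> 1 / 2 * dist \<gamma>1 \<gamma>2"
        using mult_right_mono[OF \<open>\<tau> * L \<le> 1 / 2\<close>, of "dist \<gamma>1 \<gamma>2"] by (simp add: mult.assoc)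
      finally show "norm (f \<gamma>1 q \<theta> - f \<gamma>2 q \<theta>) \<le> 1 / 2 * dist \<gamma>1 \<gamma>2" .
    qed simp
    moreover have "integral {0..1} (\<lambda>\<theta>. f \<gamma>1 q \<theta> - f \<gamma>2 q \<theta>) = integral {0..1} (f \<gamma>1 q) - integral {0..1} (f \<gamma>2 q)"
      using cf by (intro integral_diff integrable_continuous_real) auto
    ultimately show "dist (apply_bcontfun (T \<gamma>1) q) (apply_bcontfun (T \<gamma>2) q) \<le> 1 / 2 * dist \<gamma>1 \<gamma>2"
      by (simp add: T Op_def dist_norm)
  qed
  then have "\<exists>!\<gamma>. T \<gamma> = \<gamma>"
    by (intro banach_fix_type[of "1/2"]) auto
  then obtain \<gamma> where \<gamma>: "T \<gamma> = \<gamma>" by blast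
  define y where "y t p = apply_bcontfun \<gamma> (t, p)" for t p
  have y: "y t p = y0 p + integral {0..1} (f \<gamma> (t, p))" for t p
    using fun_cong[OF T[of \<gamma>], of "(t, p)"] by (simp add: \<gamma> y_def Op_def)
  have cy: "continuous_on UNIV (\<lambda>q. y (fst q) (snd q))"
    by (simp add: y_def continuous_on_apply_bcontfun)
  show thesis
  proof (rule that[OF cy])
    have "f \<gamma> (0, p) = (\<lambda>\<theta>. 0)" for p using \<open>0 < \<tau>\<close> by (auto simp: f_def c_def fun_eq_iff)
    then show "y 0 p = y0 p" for p by (simp add: y)
    fix t p assume t: "\<bar>t\<bar> < \<tau>"
    define g where "g s = G s p (y s p)" for s
    have "continuous_on UNIV (\<lambda>s. y s p)"
      using continuous_on_compose2[OF cy, of UNIV "\<lambda>s. (s, p)"]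
      by (simp add: continuous_on_Pair continuous_on_id)
    then have "continuous_on UNIV g"
      unfolding g_def using continuous_on_compose2[OF cG, of UNIV "\<lambda>s. (s, p, y s p)"]
      by (simp add: continuous_on_Pair continuous_on_id)
    \<comment> \<open>The integral over [0, 1] is turned back into an antiderivative
      \<open>h\<close> of the right-hand side, from which the differential equation can be read
      off.\<close>
    then obtain h where h: "\<And>s. s \<in> {-\<tau>..\<tau>} \<Longrightarrow> (h has_vector_derivative g s) (at s within {-\<tau>..\<tau>})"
      using antiderivative_continuous[of "-\<tau>" \<tau> g] continuous_on_subset by blast
    have yh: "y s p = y0 p + (h s - h 0)" if s: "s \<in> {-\<tau>..\<tau>}" for s
    proof -
      have cs: "c s = s" using s by (auto simp: c_def)
      have "((\<lambda>\<theta>. s *\<^sub>R g (\<theta> * s)) has_integral (h (1 * s) - h (0 * s))) {0..1}"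
      proof (rule fundamental_theorem_of_calculus)
        fix \<theta> :: real assume \<theta>: "\<theta> \<in> {0..1}"
        have in\<tau>: "r * s \<in> {-\<tau>..\<tau>}" if "r \<in> {0..1}" for r
        proof -
          have "\<bar>r * s\<bar> \<le> 1 * \<bar>s\<bar>" unfolding abs_mult using that by (intro mult_right_mono) auto
          then show ?thesis using s by auto
        qed
        have "((\<lambda>\<theta>. \<theta> * s) has_vector_derivative s) (at \<theta> within {0..1})"
          by (auto intro!: derivative_eq_intros simp: has_real_derivative_iff_has_vector_derivative[symmetric])
        moreover have "(h has_vector_derivative g (\<theta> * s)) (at (\<theta> * s) within (\<lambda>\<theta>. \<theta> * s) ` {0..1})"
          by (rule has_vector_derivative_within_subset[OF h[OF in\<tau>[OF \<theta>]]]) (use in\<tau> in auto)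
        ultimately have "(h \<circ> (\<lambda>\<theta>. \<theta> * s) has_vector_derivative s *\<^sub>R g (\<theta> * s)) (at \<theta> within {0..1})"
          by (rule vector_diff_chain_within)
        then show "((\<lambda>\<theta>. h (\<theta> * s)) has_vector_derivative s *\<^sub>R g (\<theta> * s)) (at \<theta> within {0..1})"
          by (simp add: o_def)
      qed simp
      moreover have "(\<lambda>\<theta>. s *\<^sub>R g (\<theta> * s)) = f \<gamma> (s, p)"
        by (auto simp: f_def g_def cs y_def)
      ultimately show ?thesis by (simp add: y integral_unique)
    qed
    have "(h has_vector_derivative g t) (at t)"
    proof -
      have "t \<in> {-\<tau>..\<tau>}" "- \<tau> < t" "t < \<tau>" using t by auto
      then show ?thesis using h[of t] by (simp only: at_within_Icc_at)
    qed
    then have "((\<lambda>s. y0 p + (h s - h 0)) has_vector_derivative g t) (at t)"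
      by (auto intro!: derivative_eq_intros)
    then have "((\<lambda>s. y s p) has_vector_derivative g t) (at t)"
      by (rule has_vector_derivative_transform_within_open[of _ _ _ "{-\<tau><..<\<tau>}"]) (use t yh in auto)
    then show "((\<lambda>t. y t p) has_vector_derivative G t p (y t p)) (at t)"
      by (simp add: g_def)
  qed
qed

text \<open>On a short interval Gronwall's exponential is replaced by absorption: at the point where
  \<open>norm (e s)\<close> is maximal, the mean value inequality gives
  \<open>max \<le> norm (e 0) + \<tau> * \<delta> + 3/4 * max\<close>, whence the factor 4.\<close>

lemma gronwall_short:
  fixes e :: "real \<Rightarrow> 'e::real_normed_vector"
  assumes der: "\<And>t. \<bar>t\<bar> < \<tau> \<Longrightarrow> (e has_vector_derivative e' t) (at t)"
    and bd: "\<And>t. \<bar>t\<bar> < \<tau> \<Longrightarrow> norm (e' t) \<le> \<delta> + L * norm (e t)"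
    and "0 \<le> L" "0 \<le> \<delta>" "\<tau> * L \<le> 3 / 4" "\<bar>t\<bar> < \<tau>"
  shows "norm (e t) \<le> 4 * (norm (e 0) + \<tau> * \<delta>)"
proof -
  let ?I = "{- \<bar>t\<bar>..\<bar>t\<bar>}"
  have "continuous_on ?I (\<lambda>s. norm (e s))"
    using assms(6) by (intro continuous_on_norm continuous_at_imp_continuous_on ballI
        has_vector_derivative_continuous[OF der]) auto
  then obtain s where s: "s \<in> ?I" and max: "\<And>r. r \<in> ?I \<Longrightarrow> norm (e r) \<le> norm (e s)"
    using continuous_attains_sup[of ?I "\<lambda>s. norm (e s)"] by auto
  have "norm (e s - e 0) \<le> (\<delta> + L * norm (e s)) * norm (s - 0)"
  proof (rule differentiable_bound[where S = ?I and f' = "\<lambda>r h. h *\<^sub>R e' r"])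
    fix r assume r: "r \<in> ?I"
    show "(e has_derivative (\<lambda>h. h *\<^sub>R e' r)) (at r within ?I)"
      using der[of r] r assms(6) by (auto simp: has_vector_derivative_def intro: has_derivative_at_withinI)
    have "norm (e' r) \<le> \<delta> + L * norm (e s)"
      using bd[of r] mult_left_mono[OF max[OF r] \<open>0 \<le> L\<close>] r assms(6) by force
    then show "onorm (\<lambda>h. h *\<^sub>R e' r) \<le> \<delta> + L * norm (e s)"
      by (simp add: onorm_scaleR_left onorm_id)
  qed (use s in auto)
  also have "\<dots> \<le> (\<delta> + L * norm (e s)) * \<tau>"
    using s assms by (intro mult_left_mono) auto
  finally have "norm (e s) \<le> norm (e 0) + \<tau> * \<delta> + (\<tau> * L) * norm (e s)"
    using norm_triangle_ineq2[of "e s" "e 0"] by (simp add: algebra_simps)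
  also have "(\<tau> * L) * norm (e s) \<le> 3 / 4 * norm (e s)"
    by (rule mult_right_mono[OF assms(5)]) simp
  finally show ?thesis
    using max[of t] by (simp add: algebra_simps) (use abs_ge_self[of t] abs_ge_minus_self[of t] in linarith)
qed

text \<open>One \<delta> serves for all base points in a compact set, because the derivative is
  uniformly continuous on a compact thickening of it. This is applied to the right-hand side of a
  differential equation along a whole solution curve.\<close>

lemma uniform_linearization:
  fixes f :: "'a::euclidean_space \<Rightarrow> 'b::real_normed_vector"
  assumes "open S" "Ck_on 1 S f" "compact C" "C \<subseteq> S" "0 < \<epsilon>"
  obtains \<delta> where "0 < \<delta>" "\<And>z k. z \<in> C \<Longrightarrow> norm k < \<delta> \<Longrightarrow> norm (f (z + k) - f z - dirD f z k) \<le> \<epsilon> * norm k"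
proof -
  have der: "(f has_derivative dirD f z) (at z)" if "z \<in> S" for z
    using Ck_on_Suc_has_derivative[of 0 S f z] assms(2) that by simp
  obtain r where r: "0 < r" "(\<Union>z\<in>C. ball z r) \<subseteq> S"
    using compact_subset_open_imp_ball_epsilon_subset[OF assms(3,1,4)] by blast
  \<comment> \<open>The closed thickening of \<open>C\<close> by \<open>r / 2\<close> contains the
    segments along which the mean value estimate runs.\<close>
  define K where "K = {z + k | z k. z \<in> C \<and> k \<in> cball 0 (r / 2)}"
  have K: "compact K" unfolding K_def by (intro compact_sums assms(3) compact_cball)
  have KS: "K \<subseteq> S" using r by (fastforce simp: K_def dist_norm)
  have bl: "blinfun_apply (Blinfun (dirD f z)) = dirD f z" if "z \<in> S" for z
    using der[OF that] by (simp add: bounded_linear_Blinfun_apply has_derivative_bounded_linear)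
  have "continuous_on S (\<lambda>x. Blinfun (dirD f x))"
  proof (rule continuous_on_blinfun_componentwise)
    fix i
    show "continuous_on S (\<lambda>x. blinfun_apply (Blinfun (dirD f x)) i)"
      using assms(2) by (simp add: bl cong: continuous_on_cong)
  qed
  then have "uniformly_continuous_on K (\<lambda>x. Blinfun (dirD f x))"
    using K KS by (meson compact_uniformly_continuous continuous_on_subset)
  then obtain d where d: "d > 0" "\<And>x y. x \<in> K \<Longrightarrow> y \<in> K \<Longrightarrow> dist y x < d \<Longrightarrow>
      dist (Blinfun (dirD f y)) (Blinfun (dirD f x)) < \<epsilon>"
    unfolding uniformly_continuous_on_def using \<open>0 < \<epsilon>\<close> by meson
  show thesis
  proof (rule that[of "min d (r / 2)"])
    show "0 < min d (r / 2)" using d r by simp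
    fix z k :: 'a assume z: "z \<in> C" and k: "norm k < min d (r / 2)"
    have inK: "z + t *\<^sub>R k \<in> K" "norm (t *\<^sub>R k) < d" if "t \<in> {0..1}" for t
    proof -
      have "norm (t *\<^sub>R k) \<le> norm k" using that by (simp add: mult_left_le_one_le)
      then have "t *\<^sub>R k \<in> cball 0 (r / 2)" using k by simp
      then show "z + t *\<^sub>R k \<in> K" using z unfolding K_def by blast
      show "norm (t *\<^sub>R k) < d" using \<open>norm (t *\<^sub>R k) \<le> norm k\<close> k by simp
    qed
    define K' where "K' = {x \<in> K. dist x z < d}"
    have zK: "z \<in> K" using inK(1)[of 0] by simp
    have "norm (f (z + k) - f z - dirD f z k) \<le> norm k * \<epsilon>"
    proof -
      have "norm (f (z + k) - f z - dirD f z (z + k - z)) \<le> norm (z + k - z) * \<epsilon>"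
      proof (rule differentiable_bound_linearization[where S = K'])
        show "z + t *\<^sub>R (z + k - z) \<in> K'" if "t \<in> {0..1}" for t using inK[OF that] by (simp add: K'_def dist_norm)
        show "(f has_derivative dirD f x) (at x within K')" if "x \<in> K'" for x
          using KS der[of x] that by (auto simp: K'_def intro: has_derivative_at_withinI)
        show "z \<in> K'" using zK d by (simp add: K'_def)
        fix x assume x: "x \<in> K'"
        have "dirD f x - dirD f z = blinfun_apply (Blinfun (dirD f x) - Blinfun (dirD f z))"
        proof -
          have "x \<in> S" "z \<in> S" using x zK KS by (auto simp: K'_def)
          then show ?thesis by (simp add: fun_eq_iff blinfun.diff_left bl)
        qed
        moreover have "dist (Blinfun (dirD f x)) (Blinfun (dirD f z)) < \<epsilon>"
          by (rule d(2)) (use x zK in \<open>auto simp: K'_def\<close>)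
        ultimately show "onorm (dirD f x - dirD f z) \<le> \<epsilon>"
          by (simp add: dist_norm norm_blinfun.rep_eq)
      qed
      then show ?thesis by simp
    qed
    then show "norm (f (z + k) - f z - dirD f z k) \<le> \<epsilon> * norm k" by (simp add: mult.commute)
  qed
qed

text \<open>Hands the Lipschitz constant of the right-hand side on to the linearised equation, so
  that the same time bound \<open>\<tau>\<close> works for both.\<close>

lemma lipschitz_derivative_bound:
  fixes f :: "'a::real_normed_vector \<Rightarrow> 'b::real_normed_vector"
  assumes "(f has_derivative f') (at y)" "open V" "y \<in> V"
    and lip: "\<And>z. z \<in> V \<Longrightarrow> norm (f z - f y) \<le> L * norm (z - y)"
  shows "norm (f' \<eta>) \<le> L * norm \<eta>"
proof (rule field_le_epsilon)
  fix e :: real assume "0 < e"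
  define \<epsilon> where "\<epsilon> = e / (norm \<eta> + 1)"
  have pos: "0 < norm \<eta> + 1" by (simp add: add_nonneg_pos)
  then have "0 < \<epsilon>" using \<open>0 < e\<close> by (simp add: \<epsilon>_def)
  then obtain d where d: "0 < d" "\<And>z. norm (z - y) < d \<Longrightarrow> norm (f z - f y - f' (z - y)) \<le> \<epsilon> * norm (z - y)"
    using assms(1) unfolding has_derivative_at_alt by meson
  obtain r where r: "0 < r" "ball y r \<subseteq> V" using assms(2,3) openE by blast
  define s where "s = min d r / 2 / (norm \<eta> + 1)"
  have "0 < s" using d r pos by (simp add: s_def)
  have "s * norm \<eta> \<le> s * (norm \<eta> + 1)" using \<open>0 < s\<close> by simp
  also have "\<dots> = min d r / 2" unfolding s_def using pos by (metis less_numeral_extra(3) nonzero_divide_eq_eq)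
  also have "\<dots> < min d r" using d r by (simp add: min_def)
  finally have s: "s * norm \<eta> < min d r" .
  define z where "z = y + s *\<^sub>R \<eta>"
  have zy: "norm (z - y) = s * norm \<eta>" using \<open>0 < s\<close> by (simp add: z_def)
  have "z \<in> V" using r s zy by (auto simp: dist_norm norm_minus_commute)
  then have "norm (f z - f y) \<le> L * (s * norm \<eta>)" using lip zy by metis
  moreover have "norm (f z - f y - f' (z - y)) \<le> \<epsilon> * (s * norm \<eta>)" using d(2)[of z] zy s by simp
  moreover have "f' (z - y) = s *\<^sub>R f' \<eta>"
    using has_derivative_linear[OF assms(1)] by (simp add: z_def linear_scale)
  ultimately have "norm (s *\<^sub>R f' \<eta>) \<le> L * (s * norm \<eta>) + \<epsilon> * (s * norm \<eta>)"
    using norm_triangle_ineq4[of "f z - f y" "f z - f y - s *\<^sub>R f' \<eta>"] by simp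
  then have "s * norm (f' \<eta>) \<le> s * (L * norm \<eta> + \<epsilon> * norm \<eta>)"
    using \<open>0 < s\<close> by (simp add: algebra_simps)
  then have "norm (f' \<eta>) \<le> L * norm \<eta> + \<epsilon> * norm \<eta>" using \<open>0 < s\<close> by simp
  also have "\<epsilon> * norm \<eta> \<le> \<epsilon> * (norm \<eta> + 1)" using \<open>0 < \<epsilon>\<close> by simp
  also have "\<dots> = e" unfolding \<epsilon>_def using pos by simp
  finally show "norm (f' \<eta>) \<le> L * norm \<eta> + e" by simp
qed

section \<open>Differentiable dependence of solutions on parameters\<close>

lemma Ck1_has_derivative: "Ck_on 1 S f \<Longrightarrow> x \<in> S \<Longrightarrow> (f has_derivative dirD f x) (at x)"
  using Ck_on_Suc_has_derivative[of 0] by simp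

lemma Ck1_continuous_dirD: "Ck_on 1 S f \<Longrightarrow> continuous_on S (\<lambda>x. dirD f x v)"
  by simp

text \<open>The candidate derivative \<open>D\<close> solves the equation linearised along
  \<open>w\<close>. The error \<open>w s y - w s p - D s p h\<close> satisfies a differential
  inequality whose inhomogeneity is a small multiple of \<open>norm h\<close>, and the short-time
  Gronwall bound makes it o(h). The result is local because the linearised equation is first
  extended to all times and parameters by clamping.\<close>

lemma ode_differentiable_local:
  fixes G :: "real \<times> 'p::euclidean_space \<times> 'e::euclidean_space \<Rightarrow> 'e" and w :: "real \<Rightarrow> 'p \<Rightarrow> 'e" and \<tau> L :: real
  defines "T \<equiv> {t. \<bar>t\<bar> < \<tau>}"
  assumes "0 \<le> L" "0 < \<tau>" "\<tau> * L \<le> 1 / 2" "open U" "open V"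
    and G: "Ck_on 1 (T \<times> U \<times> V) G"
    and lip: "\<And>t p y z. t \<in> T \<Longrightarrow> p \<in> U \<Longrightarrow> y \<in> V \<Longrightarrow> z \<in> V \<Longrightarrow> norm (G (t, p, y) - G (t, p, z)) \<le> L * norm (y - z)"
    and w0: "Ck_on 1 U (w 0)"
    and wc: "continuous_on (T \<times> U) (\<lambda>z. w (fst z) (snd z))"
    and wV: "\<And>t p. t \<in> T \<Longrightarrow> p \<in> U \<Longrightarrow> w t p \<in> V"
    and ode: "\<And>t p. t \<in> T \<Longrightarrow> p \<in> U \<Longrightarrow> ((\<lambda>t. w t p) has_vector_derivative G (t, p, w t p)) (at t)"
    and x: "x \<in> U" and t0: "t0 \<in> T"
  obtains N D where "open N" "(t0, x) \<in> N" "N \<subseteq> T \<times> U"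
    "\<And>t p. (t, p) \<in> N \<Longrightarrow> (w t has_derivative D t p) (at p)"
    "\<And>v. continuous_on N (\<lambda>z. D (fst z) (snd z) v)"
    "\<And>t p v. (t, p) \<in> N \<Longrightarrow> ((\<lambda>t. D t p v) has_vector_derivative dirD G (t, p, w t p) (0, v, D t p v)) (at t)"
proof -
  let ?\<Omega> = "T \<times> U \<times> V"
  have "open T" unfolding T_def by (intro open_Collect_less continuous_intros)
  then have op: "open ?\<Omega>" using \<open>open U\<close> \<open>open V\<close> by (intro open_Times)
  \<comment> \<open>A time strictly between \<open>\<bar>t0\<bar>\<close> and \<open>\<tau>\<close>:
    it keeps \<open>t0\<close> in the interior while the closed interval stays inside
    \<open>T\<close>, so that compactness is available.\<close>
  define \<tau>' where "\<tau>' = (\<bar>t0\<bar> + \<tau>) / 2"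
  have \<tau>': "\<bar>t0\<bar> < \<tau>'" "\<tau>' < \<tau>" "0 < \<tau>'" using t0 \<open>0 < \<tau>\<close> by (auto simp: \<tau>'_def T_def)
  obtain \<rho> where \<rho>: "0 < \<rho>" "cball x \<rho> \<subseteq> U" using x \<open>open U\<close> open_contains_cball by blast
  define c where "c t = max (-\<tau>') (min \<tau>' t)" for t :: real
  define cp where "cp p = closest_point (cball x \<rho>) p" for p
  have c: "c t \<in> {-\<tau>'..\<tau>'}" for t using \<tau>' by (auto simp: c_def)
  have cT: "c t \<in> T" for t using c[of t] \<tau>' by (auto simp: T_def)
  have cp: "cp p \<in> cball x \<rho>" for p
    unfolding cp_def using \<rho> by (intro closest_point_in_set) auto
  have cpU: "cp p \<in> U" for p using cp \<rho> by blast
  have cid: "c t = t" if "\<bar>t\<bar> \<le> \<tau>'" for t using that by (auto simp: c_def)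
  have cpid: "cp p = p" if "p \<in> cball x \<rho>" for p using that by (simp add: cp_def closest_point_self)
  have cc: "continuous_on UNIV c" unfolding c_def by (intro continuous_intros)
  have ccp: "continuous_on UNIV cp" unfolding cp_def
    using \<rho> by (intro continuous_on_closest_point) auto
  define K where "K = {-\<tau>'..\<tau>'} \<times> cball x \<rho>"
  have "compact K" unfolding K_def by (intro compact_Times) auto
  have KTU: "K \<subseteq> T \<times> U" using \<tau>' \<rho> by (auto simp: K_def T_def)
  define C where "C = (\<lambda>q. (fst q, snd q, w (fst q) (snd q))) ` K"
  have "compact C" unfolding C_def
    by (intro compact_continuous_image continuous_on_Pair continuous_intros continuous_on_subset[OF wc KTU] \<open>compact K\<close>)
  have C\<Omega>: "C \<subseteq> ?\<Omega>" using KTU wV by (auto simp: C_def)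
  \<comment> \<open>The point of the graph of \<open>w\<close> over the clamped time and parameter.
    It always lies in the compact set \<open>C\<close>, so the linearised equation has globally
    defined, bounded coefficients.\<close>
  define Z where "Z q = (c (fst q), cp (snd q), w (c (fst q)) (cp (snd q)))" for q
  have ZC: "Z q \<in> C" for q
    using c cp unfolding Z_def C_def K_def by (intro image_eqI[of _ _ "(c (fst q), cp (snd q))"]) auto
  have Z\<Omega>: "Z q \<in> ?\<Omega>" for q using ZC C\<Omega> by blast
  have cZ0: "continuous_on UNIV (\<lambda>q. (c (fst q), cp (snd q)))"
    by (intro continuous_on_Pair continuous_on_compose2[OF cc] continuous_on_compose2[OF ccp] continuous_intros) auto
  have cZ: "continuous_on UNIV Z"
    unfolding Z_def
    by (intro continuous_on_Pair continuous_on_compose2[OF cc] continuous_on_compose2[OF ccp]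
        continuous_on_compose2[OF wc cZ0, simplified] continuous_intros) (use cT cpU in auto)
  have dG: "(G has_derivative dirD G z) (at z)" if "z \<in> ?\<Omega>" for z
    using Ck1_has_derivative[OF G that] .
  have linG: "linear (dirD G z)" if "z \<in> ?\<Omega>" for z
    using dG[OF that] by (rule has_derivative_linear)
  have cdG: "continuous_on ?\<Omega> (\<lambda>z. dirD G z v)" for v using Ck1_continuous_dirD[OF G] .
  have cA: "continuous_on UNIV (\<lambda>q. dirD G (Z q) v)" for v
    by (rule continuous_on_compose2[OF cdG cZ]) (use Z\<Omega> in blast)
  have dGL: "norm (dirD G z (0, 0, \<eta>)) \<le> L * norm \<eta>" if z\<Omega>: "z \<in> ?\<Omega>" for z \<eta>
  proof -
    obtain t p y where z: "z = (t, p, y)" "t \<in> T" "p \<in> U" "y \<in> V"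
      using z\<Omega> by auto
    have "((\<lambda>y. (t, p, y)) has_derivative (\<lambda>\<eta>. (0, 0, \<eta>))) (at y)"
      by (intro has_derivative_Pair has_derivative_const has_derivative_ident)
    from diff_chain_at[OF this] dG[OF that] have "((\<lambda>y. G (t, p, y)) has_derivative (\<lambda>\<eta>. dirD G z (0, 0, \<eta>))) (at y)"
      by (simp add: z(1) o_def)
    then show ?thesis
      by (rule lipschitz_derivative_bound[OF _ \<open>open V\<close> z(4)]) (use lip z in auto)
  qed
  have split: "dirD G z (0, v, \<eta>) = dirD G z (0, v, 0) + dirD G z (0, 0, \<eta>)" if "z \<in> ?\<Omega>" for z v \<eta>
    using linear_add[OF linG[OF that], of "(0, v, 0)" "(0, 0, \<eta>)"] by simp
  have diffG: "dirD G z (0, v, \<eta>) - dirD G z (0, v, \<zeta>) = dirD G z (0, 0, \<eta> - \<zeta>)" if "z \<in> ?\<Omega>" for z v \<eta> \<zeta>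
    using linear_diff[OF linG[OF that], of "(0, v, \<eta>)" "(0, v, \<zeta>)"] by simp
  have expand: "dirD G z (0, 0, \<eta>) = (\<Sum>b\<in>Basis. (\<eta> \<bullet> b) *\<^sub>R dirD G z (0, 0, b))" if "z \<in> ?\<Omega>" for z \<eta>
  proof -
    have "(0::real, 0::'p, \<eta>) = (\<Sum>b\<in>Basis. (\<eta> \<bullet> b) *\<^sub>R (0, 0, b))"
      by (simp add: prod_eq_iff fst_sum snd_sum euclidean_representation)
    then show ?thesis
      by (simp only: linear_sum[OF linG[OF that]] linear_scale[OF linG[OF that]])
  qed
  define is_sol where "is_sol v y \<longleftrightarrow> continuous_on UNIV (\<lambda>q. y (fst q) (snd q)) \<and> (\<forall>p. y 0 p = dirD (w 0) (cp p) v) \<and>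
    (\<forall>t p. \<bar>t\<bar> < \<tau>' \<longrightarrow> ((\<lambda>t. y t p) has_vector_derivative dirD G (Z (t, p)) (0, v, y t p)) (at t))" for v y
  have ex_sol: "\<exists>y. is_sol v y" for v
  proof -
    have c1: "continuous_on UNIV (\<lambda>q. dirD G (Z (fst q, fst (snd q))) u)" for u
      by (rule continuous_on_compose2[OF cA, of UNIV "\<lambda>q. (fst q, fst (snd q))"]) (auto intro!: continuous_intros)
    have "continuous_on UNIV (\<lambda>q. dirD G (Z (fst q, fst (snd q))) (0, v, 0)
        + (\<Sum>b\<in>Basis. (snd (snd q) \<bullet> b) *\<^sub>R dirD G (Z (fst q, fst (snd q))) (0, 0, b)))"
      by (intro continuous_intros c1)
    then have c2: "continuous_on UNIV (\<lambda>q. dirD G (Z (fst q, fst (snd q))) (0, v, snd (snd q)))"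
      by (simp add: split[OF Z\<Omega>, of _ v "snd _"] expand[OF Z\<Omega>, of _ "snd _"])
    have "compact ((\<lambda>z. dirD G z (0, v, 0)) ` C)"
      by (intro compact_continuous_image continuous_on_subset[OF cdG C\<Omega>] \<open>compact C\<close>)
    then obtain B where B: "\<And>z. z \<in> C \<Longrightarrow> norm (dirD G z (0, v, 0)) \<le> B"
      by (meson bounded_iff compact_imp_bounded image_eqI)
    have cw0: "continuous_on U (\<lambda>p. dirD (w 0) p v)" using Ck1_continuous_dirD[OF w0] .
    have "compact ((\<lambda>p. dirD (w 0) p v) ` cball x \<rho>)"
      by (intro compact_continuous_image continuous_on_subset[OF cw0 \<rho>(2)]) auto
    then obtain B' where B': "\<And>p. p \<in> cball x \<rho> \<Longrightarrow> norm (dirD (w 0) p v) \<le> B'"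
      by (meson bounded_iff compact_imp_bounded image_eqI)
    have lipG: "norm (dirD G (Z (t, p)) (0, v, y) - dirD G (Z (t, p)) (0, v, z)) \<le> L * norm (y - z)" for t p y z
      unfolding diffG[OF Z\<Omega>] by (rule dGL[OF Z\<Omega>])
    have \<tau>L: "\<tau>' * L \<le> 1 / 2" using mult_right_mono[of \<tau>' \<tau> L] \<tau>' assms(2,4) by linarith
    have cw: "continuous_on UNIV (\<lambda>p. dirD (w 0) (cp p) v)"
      by (rule continuous_on_compose2[OF cw0 ccp]) (use cpU in auto)
    obtain y where "continuous_on UNIV (\<lambda>q. y (fst q) (snd q))" "\<And>p. y 0 p = dirD (w 0) (cp p) v"
      "\<And>t p. \<bar>t\<bar> < \<tau>' \<Longrightarrow> ((\<lambda>t. y t p) has_vector_derivative dirD G (Z (t, p)) (0, v, y t p)) (at t)"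
      using ode_exists_param[of "\<lambda>t p y. dirD G (Z (t, p)) (0, v, y)", OF c2 lipG B[OF ZC] assms(2) \<tau>'(3) \<tau>L cw B'[OF cp]]
      by blast
    then show ?thesis unfolding is_sol_def by blast
  qed
  define Y where "Y v = (SOME y. is_sol v y)" for v
  have "is_sol v (Y v)" for v unfolding Y_def by (rule someI_ex[OF ex_sol])
  then have Yc: "\<And>v. continuous_on UNIV (\<lambda>q. Y v (fst q) (snd q))"
    and Y0: "\<And>v p. Y v 0 p = dirD (w 0) (cp p) v"
    and Yode: "\<And>v t p. \<bar>t\<bar> < \<tau>' \<Longrightarrow> ((\<lambda>t. Y v t p) has_vector_derivative dirD G (Z (t, p)) (0, v, Y v t p)) (at t)"
    unfolding is_sol_def by blast+
  \<comment> \<open>Solving for basis directions only and combining the solutions makes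
    \<open>D t p\<close> linear by construction.\<close>
  define D where "D t p h = (\<Sum>b\<in>Basis. (h \<bullet> b) *\<^sub>R Y b t p)" for t p and h :: 'p
  define N where "N = {-\<tau>'<..<\<tau>'} \<times> ball x \<rho>"
  have Zid: "Z (t, p) = (t, p, w t p)" if "(t, p) \<in> N" for t p
    using that cid[of t] cpid[of p] by (auto simp: Z_def N_def)
  have Dode: "((\<lambda>t. D t p h) has_vector_derivative dirD G (t, p, w t p) (0, h, D t p h)) (at t)"
      if tp: "(t, p) \<in> N" for t p h
  proof -
    have "((\<lambda>t. D t p h) has_vector_derivative (\<Sum>b\<in>Basis. (h \<bullet> b) *\<^sub>R dirD G (Z (t, p)) (0, b, Y b t p))) (at t)"
      unfolding D_def using tp
      by (intro has_vector_derivative_sum bounded_linear.has_vector_derivative[OF bounded_linear_scaleR_right] Yode)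
          (auto simp: N_def)
    moreover have "(0::real, h, D t p h) = (\<Sum>b\<in>Basis. (h \<bullet> b) *\<^sub>R (0, b, Y b t p))"
      by (simp add: prod_eq_iff fst_sum snd_sum euclidean_representation D_def)
    then have "dirD G (Z (t, p)) (0, h, D t p h) = (\<Sum>b\<in>Basis. (h \<bullet> b) *\<^sub>R dirD G (Z (t, p)) (0, b, Y b t p))"
      using linG[OF Z\<Omega>, of "(t, p)"] by (simp only: linear_sum linear_scale)
    ultimately show ?thesis using Zid[OF tp] by simp
  qed
  have Dcont: "continuous_on UNIV (\<lambda>z. D (fst z) (snd z) v)" for v
    unfolding D_def by (intro continuous_intros Yc)
  have Dbl: "bounded_linear (D t p)" for t p
    unfolding D_def linear_conv_bounded_linear[symmetric]
    by (rule linearI) (simp_all add: inner_add_left scaleR_add_left sum.distrib scaleR_sum_right)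
  have Dder: "(w t has_derivative D t p) (at p)" if tp: "(t, p) \<in> N" for t p
    unfolding has_derivative_at_alt
  proof (intro conjI allI impI Dbl)
    fix e :: real assume "0 < e"
    have pN: "dist x p < \<rho>" and tN: "\<bar>t\<bar> < \<tau>'" using tp by (auto simp: N_def)
    have pU: "p \<in> U" using pN \<rho> by auto
    have "\<exists>M. \<forall>s\<in>{-\<tau>'..\<tau>'}. norm (Y b s p) \<le> M" for b
    proof -
      have "continuous_on {-\<tau>'..\<tau>'} (\<lambda>s. Y b s p)"
        using continuous_on_compose2[OF Yc[of b], of "{-\<tau>'..\<tau>'}" "\<lambda>s. (s, p)"]
        by (simp add: continuous_on_Pair continuous_on_id)
      then have "compact ((\<lambda>s. Y b s p) ` {-\<tau>'..\<tau>'})" by (intro compact_continuous_image) auto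
      then show ?thesis by (meson bounded_iff compact_imp_bounded image_eqI)
    qed
    then obtain Mb where Mb: "\<And>b s. s \<in> {-\<tau>'..\<tau>'} \<Longrightarrow> norm (Y b s p) \<le> Mb b" by metis
    define M where "M = (\<Sum>b\<in>(Basis::'p set). Mb b)"
    have Mb0: "0 \<le> Mb b" for b using Mb[of 0 b] \<tau>' order_trans[OF norm_ge_zero] by auto
    then have "0 \<le> M" unfolding M_def by (intro sum_nonneg) auto
    have DM: "norm (D s p h) \<le> M * norm h" if "s \<in> {-\<tau>'..\<tau>'}" for s h
    proof -
      have "norm (D s p h) \<le> (\<Sum>b\<in>Basis. norm ((h \<bullet> b) *\<^sub>R Y b s p))" unfolding D_def by (rule norm_sum)
      also have "\<dots> \<le> (\<Sum>b\<in>Basis. norm h * Mb b)"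
        unfolding norm_scaleR using Basis_le_norm Mb[OF that] by (intro sum_mono mult_mono) auto
      also have "\<dots> = M * norm h" unfolding M_def sum_distrib_right by (simp add: mult.commute)
      finally show ?thesis .
    qed
    \<comment> \<open>The first bound gives
      \<open>\<tau> * (\<epsilon> + L) \<le> 1/4 + 1/2\<close>, as \<open>gronwall_short\<close>
      asks. By the second, the inhomogeneity contributes at most \<open>e / 8\<close>, and so does
      the initial error; the factor 4 turns their sum into \<open>e\<close>.\<close>
    define \<epsilon> where "\<epsilon> = min (1 / (4 * \<tau>)) (e / (8 * \<tau> * (1 + M)))"
    have "0 < \<epsilon>" using \<open>0 < e\<close> \<open>0 < \<tau>\<close> \<open>0 \<le> M\<close> by (simp add: \<epsilon>_def)
    have \<epsilon>1: "\<tau> * \<epsilon> \<le> 1 / 4" and \<epsilon>2: "\<tau> * (\<epsilon> * (1 + M)) \<le> e / 8"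
    proof -
      have "\<epsilon> \<le> 1 / (4 * \<tau>)" "\<epsilon> \<le> e / (8 * \<tau> * (1 + M))" by (auto simp: \<epsilon>_def)
      moreover have "0 < 8 * \<tau> * (1 + M)" "0 < 4 * \<tau>" using \<open>0 < \<tau>\<close> \<open>0 \<le> M\<close> by simp_all
      ultimately have "\<epsilon> * (4 * \<tau>) \<le> 1" "\<epsilon> * (8 * \<tau> * (1 + M)) \<le> e"
        by (simp_all only: pos_le_divide_eq)
      then show "\<tau> * \<epsilon> \<le> 1 / 4" "\<tau> * (\<epsilon> * (1 + M)) \<le> e / 8"
        by (simp_all add: algebra_simps)
    qed
    obtain \<delta> where \<delta>: "0 < \<delta>" "\<And>z k. z \<in> C \<Longrightarrow> norm k < \<delta> \<Longrightarrow> norm (G (z + k) - G z - dirD G z k) \<le> \<epsilon> * norm k"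
      using uniform_linearization[OF op G \<open>compact C\<close> C\<Omega> \<open>0 < \<epsilon>\<close>] by blast
    have "uniformly_continuous_on K (\<lambda>z. w (fst z) (snd z))"
      using \<open>compact K\<close> continuous_on_subset[OF wc KTU] by (rule compact_uniformly_continuous[rotated])
    then obtain d1 where d1: "0 < d1" "\<And>z z'. z \<in> K \<Longrightarrow> z' \<in> K \<Longrightarrow> dist z' z < d1
        \<Longrightarrow> dist (w (fst z') (snd z')) (w (fst z) (snd z)) < \<delta> / 2"
      unfolding uniformly_continuous_on_def using half_gt_zero[OF \<open>0 < \<delta>\<close>] by blast
    have dw0: "(w 0 has_derivative dirD (w 0) p) (at p)"
      using Ck1_has_derivative[OF w0 pU] .
    have "0 < e / 8" using \<open>0 < e\<close> by simp
    from conjunct2[OF dw0[unfolded has_derivative_at_alt], rule_format, OF this]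
    obtain d0 where d0: "0 < d0" "\<And>y. norm (y - p) < d0 \<Longrightarrow> norm (w 0 y - w 0 p - dirD (w 0) p (y - p)) \<le> e / 8 * norm (y - p)"
      by blast
    define d where "d = min (min d0 d1) (min (\<delta> / 2) (\<rho> - dist x p))"
    show "\<exists>d>0. \<forall>y. norm (y - p) < d \<longrightarrow> norm (w t y - w t p - D t p (y - p)) \<le> e * norm (y - p)"
    proof (intro exI[of _ d] conjI allI impI)
      show "0 < d" using d0 d1 \<delta> pN by (simp add: d_def)
      fix y assume y: "norm (y - p) < d"
      define h where "h = y - p"
      have yball: "dist x y < \<rho>" using y dist_triangle[of x y p] by (simp add: d_def dist_norm norm_minus_commute)
      then have yU: "y \<in> U" using \<rho> by auto
      define E where "E s = w s y - w s p - D s p h" for s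
      have "norm (E t) \<le> 4 * (norm (E 0) + \<tau>' * (\<epsilon> * (1 + M) * norm h))"
      proof (rule gronwall_short[where L = "\<epsilon> + L"])
        fix s assume s: "\<bar>s\<bar> < \<tau>'"
        have sT: "s \<in> T" using s \<tau>' by (simp add: T_def)
        have sN: "(s, p) \<in> N" using s pN by (auto simp: N_def)
        have inK: "(s, p) \<in> K" "(s, y) \<in> K" using s pN yball by (auto simp: K_def)
        define z where "z = (s, p, w s p)"
        have zC: "z \<in> C" using inK(1) unfolding z_def C_def by force
        define E' where "E' = G (s, y, w s y) - G z - dirD G z (0, h, D s p h)"
        show "(E has_vector_derivative G (s, y, w s y) - G (s, p, w s p) - dirD G (s, p, w s p) (0, h, D s p h)) (at s)"
          unfolding E_def by (intro has_vector_derivative_diff ode Dode sN sT yU pU)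
        define \<Delta> where "\<Delta> = w s y - w s p"
        have "norm \<Delta> < \<delta> / 2"
          using d1(2)[OF inK] y by (simp add: \<Delta>_def dist_norm dist_Pair_Pair d_def)
        then have "norm (0::real, h, \<Delta>) < \<delta>"
          using norm_Pair_le[of "0::real" "(h, \<Delta>)"] norm_Pair_le[of h \<Delta>] y by (simp add: h_def d_def)
        from \<delta>(2)[OF zC this] have R: "norm (G (s, y, w s y) - G z - dirD G z (0, h, \<Delta>)) \<le> \<epsilon> * norm (0::real, h, \<Delta>)"
          by (simp add: z_def h_def \<Delta>_def)
        have \<Delta>: "\<Delta> = E s + D s p h" by (simp add: \<Delta>_def E_def)
        have "norm (0::real, h, \<Delta>) \<le> norm h + (norm (E s) + M * norm h)"
          using norm_Pair_le[of "0::real" "(h, \<Delta>)"] norm_Pair_le[of h \<Delta>] norm_triangle_ineq[of "E s" "D s p h"]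
            DM[of s h] s unfolding \<Delta> by force
        with R \<open>0 < \<epsilon>\<close> have R': "norm (G (s, y, w s y) - G z - dirD G z (0, h, \<Delta>)) \<le> \<epsilon> * (norm h + (norm (E s)
            + M * norm h))"
          by (meson mult_left_mono order_trans less_imp_le)
        have z\<Omega>: "z \<in> ?\<Omega>" using zC C\<Omega> by blast
        have "dirD G z (0, h, \<Delta>) - dirD G z (0, h, D s p h) = dirD G z (0, 0, E s)"
          by (simp add: diffG[OF z\<Omega>] \<Delta>)
        then have "E' = (G (s, y, w s y) - G z - dirD G z (0, h, \<Delta>)) + dirD G z (0, 0, E s)"
          by (simp add: E'_def algebra_simps)
        then have "norm E' \<le> \<epsilon> * (norm h + (norm (E s) + M * norm h)) + L * norm (E s)"
          using R' dGL[OF z\<Omega>, of "E s"] norm_triangle_mono by blast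
        then show "norm (G (s, y, w s y) - G (s, p, w s p) - dirD G (s, p, w s p) (0, h, D s p h)) \<le> \<epsilon> * (1
            + M) * norm h + (\<epsilon> + L) * norm (E s)"
          by (simp add: E'_def z_def algebra_simps)
      next
        have "\<tau>' * (\<epsilon> + L) \<le> \<tau> * (\<epsilon> + L)" using \<tau>' \<open>0 < \<epsilon>\<close> \<open>0 \<le> L\<close> by (intro mult_right_mono) auto
        then show "\<tau>' * (\<epsilon> + L) \<le> 3 / 4" using \<epsilon>1 assms(4) by (simp add: algebra_simps)
      qed (use \<open>0 < \<epsilon>\<close> \<open>0 \<le> L\<close> \<open>0 \<le> M\<close> tN in auto)
      also have "norm (E 0) \<le> e / 8 * norm h"
      proof -
        have "D 0 p h = dirD (w 0) p h"
        proof -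
          have "linear (dirD (w 0) p)" using dw0 by (rule has_derivative_linear)
          then have "dirD (w 0) p (\<Sum>b\<in>Basis. (h \<bullet> b) *\<^sub>R b) = (\<Sum>b\<in>Basis. (h \<bullet> b) *\<^sub>R dirD (w 0) p b)"
            by (simp add: linear_sum linear_scale)
          then show ?thesis using cpid[of p] pN by (simp add: D_def Y0 euclidean_representation)
        qed
        then show ?thesis using d0(2)[of y] y by (simp add: E_def h_def d_def)
      qed
      also have "\<tau>' * (\<epsilon> * (1 + M) * norm h) \<le> e / 8 * norm h"
      proof -
        have "\<tau>' * (\<epsilon> * (1 + M)) \<le> \<tau> * (\<epsilon> * (1 + M))" using \<tau>' \<open>0 < \<epsilon>\<close> \<open>0 \<le> M\<close> by (intro mult_right_mono) auto
        then have "\<tau>' * (\<epsilon> * (1 + M)) * norm h \<le> e / 8 * norm h" using \<epsilon>2 by (intro mult_right_mono) auto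
        then show ?thesis by (simp add: mult.assoc)
      qed
      finally show "norm (w t y - w t p - D t p (y - p)) \<le> e * norm (y - p)"
        by (simp add: E_def h_def)
    qed
  qed
  show thesis
  proof (rule that[of N D])
    show "open N" unfolding N_def by (intro open_Times) auto
    show "(t0, x) \<in> N" using \<tau>' \<rho> by (auto simp: N_def)
    show "N \<subseteq> T \<times> U" using \<tau>' \<rho> by (auto simp: N_def T_def)
    show "continuous_on N (\<lambda>z. D (fst z) (snd z) v)" for v
      using Dcont continuous_on_subset by blast
  qed (use Dder Dode in auto)
qed

lemma Ck_on_dirD: "Ck_on (Suc k) S f \<Longrightarrow> Ck_on k S (\<lambda>x. dirD f x v)"
  by simp

text \<open>Induction on \<open>k\<close>: the parameter derivative of \<open>w\<close> solves the
  linearised equation, which is again of the assumed form, with a right-hand side one degree less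
  smooth and the same \<open>L\<close>. The induction hypothesis makes that derivative C^k. The time
  derivative is \<open>G\<close> along \<open>w\<close>, which is C^k by the hypothesis applied to
  \<open>w\<close> itself.\<close>

lemma ode_solution_Ck:
  fixes G :: "real \<times> 'p::euclidean_space \<times> 'e::euclidean_space \<Rightarrow> 'e" and w :: "real \<Rightarrow> 'p \<Rightarrow> 'e"
    and \<tau> L :: real
  defines "T \<equiv> {t. \<bar>t\<bar> < \<tau>}"
  assumes "0 \<le> L" "0 < \<tau>" "\<tau> * L \<le> 1 / 2" "open U" "open V"
    and G: "Ck_on k (T \<times> U \<times> V) G"
    and lip: "\<And>t p y z. t \<in> T \<Longrightarrow> p \<in> U \<Longrightarrow> y \<in> V \<Longrightarrow> z \<in> V \<Longrightarrow> norm (G (t, p, y) - G (t, p, z)) \<le> L * norm (y - z)"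
    and w0: "Ck_on k U (w 0)"
    and wc: "continuous_on (T \<times> U) (\<lambda>z. w (fst z) (snd z))"
    and wV: "\<And>t p. t \<in> T \<Longrightarrow> p \<in> U \<Longrightarrow> w t p \<in> V"
    and ode: "\<And>t p. t \<in> T \<Longrightarrow> p \<in> U \<Longrightarrow> ((\<lambda>t. w t p) has_vector_derivative G (t, p, w t p)) (at t)"
  shows "Ck_on k (T \<times> U) (\<lambda>z. w (fst z) (snd z))"
proof -
  have "open T" unfolding T_def by (intro open_Collect_less continuous_intros)
  then have oTU: "open (T \<times> U)" using \<open>open U\<close> by (intro open_Times)
  show ?thesis
    using assms(6-12)
  proof (induction k arbitrary: G V w)
    case 0
    then show ?case by simp
  next
    case (Suc k)
    note oV = Suc.prems(1) and G = Suc.prems(2) and lip = Suc.prems(3) and w0 = Suc.prems(4)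
      and wc = Suc.prems(5) and wV = Suc.prems(6) and ode = Suc.prems(7)
    have C1: "Ck_on 1 (T \<times> U \<times> V) G" "Ck_on 1 U (w 0)"
      by (rule Ck_on_le[OF _ G] Ck_on_le[OF _ w0]; simp)+
    note loc = ode_differentiable_local[OF assms(2,3,4,5) oV C1(1)[unfolded T_def] lip[unfolded T_def] C1(2)
        wc[unfolded T_def] wV[unfolded T_def] ode[unfolded T_def], folded T_def]
    define D where "D t p = dirD (w t) p" for t p
    have loc': "\<exists>N. open N \<and> (t, p) \<in> N \<and> N \<subseteq> T \<times> U \<and> (\<forall>(t, p)\<in>N. (w t has_derivative D t p) (at p)) \<and>
        (\<forall>v. continuous_on N (\<lambda>z. D (fst z) (snd z) v)) \<and>
        (\<forall>v. \<forall>(t, p)\<in>N. ((\<lambda>t. D t p v) has_vector_derivative dirD G (t, p, w t p) (0, v, D t p v)) (at t))"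
      if tp: "t \<in> T" "p \<in> U" for t p
    proof (rule loc[OF _ _ _ _ _ _ _ _ tp(2,1)])
      fix N D' assume N: "open N" "(t, p) \<in> N" "N \<subseteq> T \<times> U"
        and D': "\<And>t p. (t, p) \<in> N \<Longrightarrow> (w t has_derivative D' t p) (at p)"
        "\<And>v. continuous_on N (\<lambda>z. D' (fst z) (snd z) v)"
        "\<And>t p v. (t, p) \<in> N \<Longrightarrow> ((\<lambda>t. D' t p v) has_vector_derivative dirD G (t, p, w t p) (0, v, D' t p v)) (at t)"
      have DD': "D t p = D' t p" if "(t, p) \<in> N" for t p
        unfolding D_def using D'(1)[OF that] by (rule dirD_eqI)
      have cont: "continuous_on N (\<lambda>z. D (fst z) (snd z) v)" for v
        by (rule continuous_on_eq[OF D'(2)[of v]]) (simp add: DD')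
      have "((\<lambda>t. D t p v) has_vector_derivative dirD G (t, p, w t p) (0, v, D t p v)) (at t)" if "(t, p) \<in> N" for t p v
      proof -
        have "open ((\<lambda>s. (s, p)) -` N)"
          by (rule open_vimage[OF N(1)]) (intro continuous_intros)
        then show ?thesis
          by (rule has_vector_derivative_transform_within_open[OF D'(3)[OF that, of v, folded DD'[OF that]]])
             (use that DD' in auto)
      qed
      then show ?thesis using N D'(1) DD' cont by (intro exI[of _ N]) auto
    qed auto
    have Dd: "(w t has_derivative D t p) (at p)" if "t \<in> T" "p \<in> U" for t p
      using loc'[OF that] by auto
    have Dode: "((\<lambda>t. D t p v) has_vector_derivative dirD G (t, p, w t p) (0, v, D t p v)) (at t)"
        if "t \<in> T" "p \<in> U" for t p v
      using loc'[OF that] by auto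
    have Dc: "continuous_on (T \<times> U) (\<lambda>z. D (fst z) (snd z) v)" for v
    proof -
      have "Ck_on 0 (T \<times> U) (\<lambda>z. D (fst z) (snd z) v)"
      proof (rule Ck_on_local)
        fix z assume "z \<in> T \<times> U"
        then obtain t p where "z = (t, p)" "t \<in> T" "p \<in> U" by auto
        with loc'[of t p] show "\<exists>N. open N \<and> z \<in> N \<and> N \<subseteq> T \<times> U \<and> Ck_on 0 N (\<lambda>z. D (fst z) (snd z) v)" by auto
      qed
      then show ?thesis by simp
    qed
    have wk: "Ck_on k (T \<times> U) (\<lambda>z. w (fst z) (snd z))"
      by (rule Suc.IH[OF oV Ck_on_SucD[OF G] lip Ck_on_SucD[OF w0] wc wV ode])
    have o3: "open (T \<times> U \<times> (UNIV :: 'e set))" using \<open>open T\<close> \<open>open U\<close> by (intro open_Times) auto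
    have oTUV: "open (T \<times> U \<times> V)" using \<open>open T\<close> \<open>open U\<close> oV by (intro open_Times)
    have dG: "(G has_derivative dirD G z) (at z)" if "z \<in> T \<times> U \<times> V" for z
      by (rule Ck_on_Suc_has_derivative[OF G that])
    have linG: "linear (dirD G z)" if "z \<in> T \<times> U \<times> V" for z
      using dG[OF that] by (rule has_derivative_linear)
    have zin: "(t, p, w t p) \<in> T \<times> U \<times> V" if "t \<in> T" "p \<in> U" for t p using wV that by simp
    have Gw: "Ck_on k (T \<times> U) (\<lambda>z. F (fst z, snd z, w (fst z) (snd z)))"
        if "Ck_on k (T \<times> U \<times> V) F" for F :: "real \<times> 'p \<times> 'e \<Rightarrow> 'e"
      by (rule Ck_on_compose[OF oTU oTUV Ck_on_Pair[OF oTU Ck_on_linear[OF oTU bounded_linear_fst]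
              Ck_on_Pair[OF oTU Ck_on_linear[OF oTU bounded_linear_snd] wk]] that])
        (use wV in auto)
    have DCk: "Ck_on k (T \<times> U) (\<lambda>z. D (fst z) (snd z) v)" for v
    \<comment> \<open>The linearised equation is affine in its unknown and makes sense on the whole
      space; this is why \<open>V\<close> is generalised in the induction.\<close>
    proof (rule Suc.IH[where V = UNIV
        and G = "\<lambda>z. dirD G (fst z, fst (snd z), w (fst z) (fst (snd z))) (0, v, snd (snd z))"])
      have A: "Ck_on k (T \<times> U \<times> (UNIV :: 'e set)) (\<lambda>z. dirD G (fst z, fst (snd z), w (fst z) (fst (snd z))) u)" for u
      proof -
        have F: "Ck_on k (T \<times> U) (\<lambda>z. dirD G (fst z, snd z, w (fst z) (snd z)) u)"
          by (rule Gw[OF Ck_on_dirD[OF G]])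
        have sub: "(\<lambda>x. (fst x, fst (snd x))) ` (T \<times> U \<times> (UNIV :: 'e set)) \<subseteq> T \<times> U" by auto
        from Ck_on_compose[OF o3 oTU Ck_on_Pair[OF o3 Ck_on_linear[OF o3 bounded_linear_fst]
              Ck_on_linear[OF o3 bounded_linear_compose[OF bounded_linear_fst bounded_linear_snd]]] F sub]
        show ?thesis by simp
      qed
      have "Ck_on k (T \<times> U \<times> UNIV) (\<lambda>z. dirD G (fst z, fst (snd z), w (fst z) (fst (snd z))) (0, v, 0)
        + (\<Sum>b\<in>Basis. (snd (snd z) \<bullet> b) *\<^sub>R dirD G (fst z, fst (snd z), w (fst z) (fst (snd z))) (0, 0, b)))"
        by (intro Ck_on_add Ck_on_sum Ck_on_scaleR o3 A Ck_on_inner Ck_on_const Ck_on_linear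
            bounded_linear_compose[OF bounded_linear_snd bounded_linear_snd])
      then show "Ck_on k (T \<times> U \<times> UNIV) (\<lambda>z. dirD G (fst z, fst (snd z), w (fst z) (fst (snd z))) (0, v, snd (snd z)))"
      proof (rule Ck_on_cong[OF o3, rotated])
        fix z :: "real \<times> 'p \<times> 'e" assume z: "z \<in> T \<times> U \<times> UNIV"
        define z' where "z' = (fst z, fst (snd z), w (fst z) (fst (snd z)))"
        have lin: "linear (dirD G z')" unfolding z'_def using z by (intro linG) (auto intro: wV)
        have "(0::real, v, snd (snd z)) = (0, v, 0) + (\<Sum>b\<in>Basis. (snd (snd z) \<bullet> b) *\<^sub>R (0, 0, b))"
          by (simp add: prod_eq_iff fst_sum snd_sum euclidean_representation)
        then have "dirD G z' (0, v, snd (snd z)) = dirD G z' (0, v, 0)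
            + (\<Sum>b\<in>Basis. (snd (snd z) \<bullet> b) *\<^sub>R dirD G z' (0, 0, b))"
          by (simp only: linear_add[OF lin] linear_sum[OF lin] linear_scale[OF lin])
        then show "dirD G (fst z, fst (snd z), w (fst z) (fst (snd z))) (0, v, 0)
        + (\<Sum>b\<in>Basis. (snd (snd z) \<bullet> b) *\<^sub>R dirD G (fst z, fst (snd z), w (fst z) (fst (snd z))) (0, 0, b))
          = dirD G (fst z, fst (snd z), w (fst z) (fst (snd z))) (0, v, snd (snd z))" by (simp add: z'_def)
      qed
      show "Ck_on k U (\<lambda>p. D 0 p v)" unfolding D_def using w0 by simp
      show "continuous_on (T \<times> U) (\<lambda>z. D (fst z) (snd z) v)" by (rule Dc)
      fix t p assume tp: "t \<in> T" "p \<in> U"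
      show "((\<lambda>t. D t p v) has_vector_derivative dirD G (fst (t, p, D t p v), fst (snd (t, p, D t p v)),
          w (fst (t, p, D t p v)) (fst (snd (t, p, D t p v)))) (0, v, snd (snd (t, p, D t p v)))) (at t)"
        using Dode[OF tp] by simp
      fix y z :: 'e
      have "((\<lambda>y. (t, p, y)) has_derivative (\<lambda>\<eta>. (0, 0, \<eta>))) (at (w t p))"
        by (intro has_derivative_Pair has_derivative_const has_derivative_ident)
      from diff_chain_at[OF this dG[OF zin[OF tp]]]
      have "((\<lambda>y. G (t, p, y)) has_derivative (\<lambda>\<eta>. dirD G (t, p, w t p) (0, 0, \<eta>))) (at (w t p))"
        by (simp add: o_def)
      then have "norm (dirD G (t, p, w t p) (0, 0, y - z)) \<le> L * norm (y - z)"
        by (rule lipschitz_derivative_bound[OF _ oV wV[OF tp]]) (use lip tp wV in auto)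
      then show "norm (dirD G (fst (t, p, y), fst (snd (t, p, y)), w (fst (t, p, y)) (fst (snd (t, p, y)))) (0, v,
          snd (snd (t, p, y))) -
          dirD G (fst (t, p, z), fst (snd (t, p, z)), w (fst (t, p, z)) (fst (snd (t, p, z)))) (0, v, snd (snd (t, p,
              z)))) \<le> L * norm (y - z)"
        using linear_diff[OF linG[OF zin[OF tp]], of "(0, v, y)" "(0, v, z)"] by simp
    qed auto
    have bl: "blinfun_apply (Blinfun (D t p)) = D t p" if "t \<in> T" "p \<in> U" for t p
      using Dd[OF that] by (simp add: bounded_linear_Blinfun_apply has_derivative_bounded_linear)
    show ?case
    proof (rule Ck_on_SucI[OF oTU])
      fix z assume "z \<in> T \<times> U"
      then obtain t p where z: "z = (t, p)" "t \<in> T" "p \<in> U" by auto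
      obtain r where r: "0 < r" "ball p r \<subseteq> U" using z(3) \<open>open U\<close> openE by blast
      \<comment> \<open>The joint derivative follows from the two partial ones because the parameter
        derivative is jointly continuous.\<close>
      have "((\<lambda>(t, p). w t p) has_derivative (\<lambda>(s, v). s *\<^sub>R G (t, p, w t p)
          + blinfun_apply (Blinfun (D t p)) v)) (at (t, p) within T \<times> ball p r)"
      proof (rule has_derivative_partialsI)
        show "((\<lambda>t. w t p) has_derivative (\<lambda>s. s *\<^sub>R G (t, p, w t p))) (at t within T)"
          using ode[OF z(2,3)] has_derivative_at_withinI unfolding has_vector_derivative_def by blast
        show "(w s has_derivative blinfun_apply (Blinfun (D s q))) (at q within ball p r)" if "s \<in> T" "q \<in> ball p r" for s q
        proof -
          have q: "q \<in> U" using that(2) r(2) by blast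
          show ?thesis unfolding bl[OF that(1) q] by (rule has_derivative_at_withinI[OF Dd[OF that(1) q]])
        qed
        have "continuous_on (T \<times> U) (\<lambda>(t, p). Blinfun (D t p))"
        proof (rule continuous_on_blinfun_componentwise)
          fix i
          show "continuous_on (T \<times> U) (\<lambda>z. blinfun_apply (case z of (t, p) \<Rightarrow> Blinfun (D t p)) i)"
            by (rule continuous_on_eq[OF Dc[of i]]) (auto simp: bl)
        qed
        then show "continuous (at (t, p) within T \<times> ball p r) (\<lambda>(t, p). Blinfun (D t p))"
          using z oTU by (auto simp: continuous_on_eq_continuous_at intro: continuous_at_imp_continuous_within)
      qed (use r in auto)
      then have "((\<lambda>(t, p). w t p) has_derivative (\<lambda>(s, v). s *\<^sub>R G (t, p, w t p)
          + blinfun_apply (Blinfun (D t p)) v)) (at (t, p))"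
        using z(2) r(1) \<open>open T\<close> by (subst (asm) at_within_open) (auto intro!: open_Times)
      then show "((\<lambda>z. w (fst z) (snd z)) has_derivative (\<lambda>v. fst v *\<^sub>R G (fst z, snd z, w (fst z) (snd z))
          + D (fst z) (snd z) (snd v))) (at z)"
        using z(1) by (simp add: split_beta' bl[OF z(2,3)])
    next
      fix v :: "real \<times> 'p"
      show "Ck_on k (T \<times> U) (\<lambda>z. fst v *\<^sub>R G (fst z, snd z, w (fst z) (snd z)) + D (fst z) (snd z) (snd v))"
        by (intro Ck_on_add Ck_on_scaleR Ck_on_const oTU DCk Gw Ck_on_SucD[OF G])
    qed
  qed
qed

section \<open>Local flows of vector fields\<close>

lemma vector_derivative_bound:
  fixes e :: "real \<Rightarrow> 'e::real_normed_vector"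
  assumes "\<And>s. \<bar>s\<bar> < \<tau> \<Longrightarrow> (e has_vector_derivative e' s) (at s)" "\<And>s. \<bar>s\<bar> < \<tau> \<Longrightarrow> norm (e' s) \<le> K" "\<bar>t\<bar> < \<tau>"
  shows "norm (e t - e 0) \<le> K * \<bar>t\<bar>"
proof -
  have "norm (e t - e 0) \<le> K * norm (t - 0)"
  proof (rule differentiable_bound[where S = "{- \<bar>t\<bar>..\<bar>t\<bar>}" and f' = "\<lambda>r h. h *\<^sub>R e' r"])
    fix r assume r: "r \<in> {- \<bar>t\<bar>..\<bar>t\<bar>}"
    show "(e has_derivative (\<lambda>h. h *\<^sub>R e' r)) (at r within {- \<bar>t\<bar>..\<bar>t\<bar>})"
      using assms(1)[of r] r assms(3) by (auto simp: has_vector_derivative_def intro: has_derivative_at_withinI)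
    show "onorm (\<lambda>h. h *\<^sub>R e' r) \<le> K"
      using assms(2)[of r] r assms(3) by (auto simp: onorm_scaleR_left onorm_id)
  qed auto
  then show ?thesis by simp
qed

text \<open>The field is cut off by composing it with the nearest-point projection to a closed ball,
  which is 1-Lipschitz and so keeps the field bounded and Lipschitz. Trajectories starting in the
  half-size ball do not leave the ball in the allotted time, hence are trajectories of
  \<open>X\<close> itself.\<close>

lemma smooth_local_flow:
  fixes X :: "'e::euclidean_space \<Rightarrow> 'e"
  assumes "open S" "smooth_on S X" "x0 \<in> S"
  obtains \<phi> \<tau> r where "0 < \<tau>" "0 < r" "ball x0 r \<subseteq> S" "smooth_on ({t. \<bar>t\<bar> < \<tau>} \<times> ball x0 r) (\<lambda>z. \<phi> (fst z) (snd z))"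
    "\<And>x. x \<in> ball x0 r \<Longrightarrow> \<phi> 0 x = x" "\<And>t x. \<bar>t\<bar> < \<tau> \<Longrightarrow> x \<in> ball x0 r \<Longrightarrow> \<phi> t x \<in> S"
    "\<And>t x. \<bar>t\<bar> < \<tau> \<Longrightarrow> x \<in> ball x0 r \<Longrightarrow> ((\<lambda>t. \<phi> t x) has_vector_derivative X (\<phi> t x)) (at t)"
proof -
  obtain \<rho> where \<rho>: "0 < \<rho>" "cball x0 \<rho> \<subseteq> S" using assms open_contains_cball by blast
  let ?B = "cball x0 \<rho>"
  have "compact ((\<lambda>x. Blinfun (dirD X x)) ` ?B)"
    by (intro compact_continuous_image continuous_on_subset[OF smooth_on_blinfun_continuous[OF assms(2)] \<rho>(2)]) auto
  from compact_imp_bounded[OF this] obtain L where "0 < L" "\<forall>y\<in>(\<lambda>x. Blinfun (dirD X x)) ` ?B. norm y \<le> L"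
    unfolding bounded_pos by blast
  then have L: "0 < L" "\<And>x. x \<in> ?B \<Longrightarrow> norm (Blinfun (dirD X x)) \<le> L"
    by blast+
  have "compact (X ` ?B)"
    by (intro compact_continuous_image continuous_on_subset[OF smooth_on_continuous[OF assms(2)] \<rho>(2)]) auto
  from compact_imp_bounded[OF this] obtain K where "0 < K" "\<forall>y\<in>X ` ?B. norm y \<le> K"
    unfolding bounded_pos by blast
  then have K: "0 < K" "\<And>x. x \<in> ?B \<Longrightarrow> norm (X x) \<le> K"
    by blast+
  have lip: "norm (X y - X z) \<le> L * norm (y - z)" if yz: "y \<in> ?B" "z \<in> ?B" for y z
  proof (rule differentiable_bound[where S = ?B and f' = "dirD X"])
    fix x assume x: "x \<in> ?B"
    have d: "(X has_derivative dirD X x) (at x)" using smooth_on_has_derivative[OF assms(2)] x \<rho> by blast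
    then show "(X has_derivative dirD X x) (at x within ?B)" by (rule has_derivative_at_withinI)
    show "onorm (dirD X x) \<le> L"
      using L(2)[OF x] d by (simp add: norm_blinfun.rep_eq bounded_linear_Blinfun_apply has_derivative_bounded_linear)
  qed (use yz in auto)
  define cp where "cp = closest_point ?B"
  have cpB: "cp y \<in> ?B" for y unfolding cp_def using \<rho> by (intro closest_point_in_set) auto
  have cplip: "norm (cp y - cp z) \<le> norm (y - z)" for y z
    unfolding cp_def dist_norm[symmetric] using \<rho> by (intro closest_point_lipschitz) auto
  have cpid: "cp y = y" if "y \<in> ?B" for y using that by (simp add: cp_def closest_point_self)
  have ccp: "continuous_on A cp" for A unfolding cp_def using \<rho> by (intro continuous_on_closest_point) auto
  \<comment> \<open>The first bound is the contraction condition; the second limits the distance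
    travelled at speed \<open>K\<close> to \<open>\<rho> / 2\<close>.\<close>
  define \<tau> where "\<tau> = min (1 / (2 * L)) (\<rho> / (2 * K))"
  have \<tau>: "0 < \<tau>" using L K \<rho> by (simp add: \<tau>_def)
  have \<tau>L: "\<tau> * L \<le> 1 / 2" and \<tau>K: "\<tau> * K \<le> \<rho> / 2"
  proof -
    have "\<tau> \<le> 1 / (2 * L)" "\<tau> \<le> \<rho> / (2 * K)" by (auto simp: \<tau>_def)
    then show "\<tau> * L \<le> 1 / 2" "\<tau> * K \<le> \<rho> / 2" using L(1) K(1) by (simp_all add: pos_le_divide_eq mult_ac)
  qed
  define y0 where "y0 = closest_point (cball x0 (\<rho> / 2))"
  have y0B: "y0 p \<in> cball x0 (\<rho> / 2)" for p unfolding y0_def using \<rho> by (intro closest_point_in_set) auto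
  have cy0: "continuous_on UNIV y0" unfolding y0_def using \<rho> by (intro continuous_on_closest_point) auto
  have cX: "continuous_on UNIV (\<lambda>q :: real \<times> 'e \<times> 'e. X (cp (snd (snd q))))"
    by (rule continuous_on_compose2[OF continuous_on_subset[OF smooth_on_continuous[OF assms(2)] \<rho>(2)]
        continuous_on_compose2[OF ccp[of UNIV]]])
       (use cpB in \<open>auto intro!: continuous_intros\<close>)
  have lipX: "norm (X (cp y) - X (cp z)) \<le> L * norm (y - z)" for y z
    using order_trans[OF lip[OF cpB cpB] mult_left_mono[OF cplip]] L(1) by simp
  have by0: "norm (y0 p) \<le> norm x0 + \<rho> / 2" for p
    using y0B[of p] norm_triangle_ineq2[of "y0 p" x0] by (simp add: dist_norm norm_minus_commute)
  obtain \<phi> where c\<phi>: "continuous_on UNIV (\<lambda>q. \<phi> (fst q) (snd q))" and \<phi>0: "\<And>p. \<phi> 0 p = y0 p"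
    and ode: "\<And>t p. \<bar>t\<bar> < \<tau> \<Longrightarrow> ((\<lambda>t. \<phi> t p) has_vector_derivative X (cp (\<phi> t p))) (at t)"
    using ode_exists_param[of "\<lambda>t p y. X (cp y)", OF cX lipX K(2)[OF cpB] less_imp_le[OF L(1)] \<tau> \<tau>L cy0 by0] by blast
  let ?U = "ball x0 (\<rho> / 2)" and ?V = "ball x0 \<rho>"
  have \<phi>0': "\<phi> 0 p = p" if "p \<in> ?U" for p using that by (simp add: \<phi>0 y0_def closest_point_self)
  have \<phi>V: "\<phi> t p \<in> ?V" if t: "\<bar>t\<bar> < \<tau>" and p: "p \<in> ?U" for t p
  proof -
    have "norm (\<phi> t p - \<phi> 0 p) \<le> K * \<bar>t\<bar>"
      by (rule vector_derivative_bound[where e = "\<lambda>t. \<phi> t p", OF ode K(2)[OF cpB] t])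
    also have "\<dots> \<le> \<tau> * K" using t K(1) by (simp add: mult.commute)
    finally have "dist (\<phi> t p) p \<le> \<rho> / 2" using \<tau>K \<phi>0'[OF p] by (simp add: dist_norm)
    then show ?thesis using p dist_triangle[of x0 "\<phi> t p" p] by (simp add: dist_commute)
  qed
  have ode': "((\<lambda>t. \<phi> t p) has_vector_derivative X (\<phi> t p)) (at t)" if "\<bar>t\<bar> < \<tau>" "p \<in> ?U" for t p
    using ode[OF that(1), of p] \<phi>V[OF that] cpid[of "\<phi> t p"] by simp
  have oT: "open {t. \<bar>t\<bar> < \<tau>}" by (intro open_Collect_less continuous_intros)
  have "Ck_on k ({t. \<bar>t\<bar> < \<tau>} \<times> ?U) (\<lambda>z. \<phi> (fst z) (snd z))" for k
  proof (rule ode_solution_Ck[where G = "\<lambda>z. X (snd (snd z))" and V = ?V, OF less_imp_le[OF L(1)] \<tau> \<tau>L])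
    show "Ck_on k ({t. \<bar>t\<bar> < \<tau>} \<times> ?U \<times> ?V) (\<lambda>z. X (snd (snd z)))"
      by (rule Ck_on_compose[OF _ assms(1) _ smooth_on_Ck[OF assms(2)]])
         (use \<rho> in \<open>auto intro!: open_Times oT Ck_on_linear bounded_linear_compose[OF bounded_linear_snd
             bounded_linear_snd]\<close>)
    show "Ck_on k ?U (\<phi> 0)"
      by (rule Ck_on_cong[OF _ _ Ck_on_ident]) (auto simp: \<phi>0')
  qed (use lip \<phi>V ode' continuous_on_subset[OF c\<phi>] in auto)
  then have "smooth_on ({t. \<bar>t\<bar> < \<tau>} \<times> ?U) (\<lambda>z. \<phi> (fst z) (snd z))"
    by (simp add: smooth_on_def)
  then show thesis
  proof (rule that[of \<tau> "\<rho> / 2" \<phi>, OF \<tau>, rotated 2])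
    show "0 < \<rho> / 2" "ball x0 (\<rho> / 2) \<subseteq> S" using \<rho> by auto
    show "\<phi> t x \<in> S" if "\<bar>t\<bar> < \<tau>" "x \<in> ball x0 (\<rho> / 2)" for t x
      using \<phi>V[OF that] \<rho>(2) ball_subset_cball by blast
  qed (use \<phi>0' ode' in auto)
qed

section \<open>Simultaneous straightening of a closed 1-form and a vector field in its
  kernel\<close>

lemma exists_adapted_linear_map:
  fixes b X :: "real^'n"
  assumes "b \<noteq> 0" "X \<noteq> 0" "b \<bullet> X = 0" "iu \<noteq> iv"
  obtains S :: "real^'n \<Rightarrow> real^'n" where "linear S" "inj S" "S (axis iv 1) = X" "\<And>y. b \<bullet> S y = y $ iu"
proof -
  obtain k where k: "b $ k \<noteq> 0" using assms(1) by (auto simp: vec_eq_iff)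
  have "\<exists>l. l \<noteq> k \<and> X $ l \<noteq> 0"
  proof (rule ccontr)
    assume "\<not> ?thesis"
    then have X: "X $ l = 0" if "l \<noteq> k" for l using that by auto
    have "b \<bullet> X = (\<Sum>l\<in>UNIV. if l = k then b $ k * X $ k else 0)"
      unfolding inner_vec_def by (rule sum.cong) (use X in auto)
    then have "X $ k = 0" using assms(3) k by simp
    with X assms(2) show False by (metis vec_eq_iff zero_index)
  qed
  then obtain l where l: "l \<noteq> k" "X $ l \<noteq> 0" by blast
  \<comment> \<open>\<open>\<pi>\<close> matches \<open>iu\<close> with an index where
    \<open>b\<close> is nonzero and \<open>iv\<close> with a different one where \<open>X\<close> is
    nonzero. It is a product of two transpositions, the second of which fixes \<open>k\<close>
    because neither index it swaps is \<open>k\<close>.\<close>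
  obtain \<pi> where \<pi>: "bij \<pi>" "\<pi> iu = k" "\<pi> iv = l"
  proof -
    define \<sigma> where "\<sigma> = Transposition.transpose iu k"
    define \<rho> where "\<rho> = Transposition.transpose (\<sigma> iv) l"
    have "\<sigma> iu = k" "bij \<sigma>" "bij \<rho>" by (simp_all add: \<sigma>_def \<rho>_def)
    moreover have "\<sigma> iv \<noteq> k" using \<open>\<sigma> iu = k\<close> \<open>bij \<sigma>\<close> assms(4) by (metis bij_inv_eq_iff)
    ultimately show thesis using l(1)
      by (intro that[of "\<rho> \<circ> \<sigma>"]) (auto simp: \<rho>_def bij_comp Transposition.transpose_def)
  qed
  define e where "e = axis k (1 / b $ k)"
  have be: "b \<bullet> e = 1" using k by (simp add: e_def inner_axis)
  \<comment> \<open>The basis consists of \<open>e\<close> with \<open>b \<bullet> e = 1\<close>, of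
    \<open>X\<close>, and of the other unit vectors, each corrected by a multiple of
    \<open>e\<close> to lie in the kernel of \<open>b\<close>.\<close>
  define S where "S y = y $ iu *\<^sub>R e + y $ iv *\<^sub>R X + (\<Sum>i\<in>UNIV - {iu, iv}. y $ i *\<^sub>R (axis (\<pi> i) 1 - b $ \<pi> i *\<^sub>R e))" for y
  have lin: "linear S"
    unfolding S_def
        by (rule linearI) (simp_all add: scaleR_add_left sum.distrib scaleR_sum_right sum_subtractf algebra_simps)
  have bS: "b \<bullet> S y = y $ iu" for y
    unfolding S_def by (simp add: inner_add_right inner_sum_right inner_diff_right be assms(3) inner_axis)
  have "S (axis iv 1) = X"
    unfolding S_def using assms(4) by (simp add: axis_def)
  moreover have "y = 0" if "S y = 0" for y
  proof -
    have yu: "y $ iu = 0" using bS[of y] that by simp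
    have comp: "S y $ \<pi> j = y $ iv * X $ \<pi> j + (if j \<noteq> iv then y $ j else 0)" if "j \<noteq> iu" for j
    proof -
      have jk: "\<pi> j \<noteq> k" using that \<pi> by (metis bij_inv_eq_iff)
      have mult_delta: "y $ x * (if j = x then 1 else 0) = (if x = j then y $ j else 0)" for x by auto
      have ij: "\<pi> j = \<pi> i \<longleftrightarrow> j = i" for i using \<pi>(1) by (metis bij_inv_eq_iff)
      have "S y $ \<pi> j = y $ iv * X $ \<pi> j + (\<Sum>i\<in>UNIV - {iu, iv}. if i = j then y $ j else 0)"
        unfolding S_def using jk
        by (simp add: yu e_def axis_def ij mult_delta)
      also have "(\<Sum>i\<in>UNIV - {iu, iv}. if i = j then y $ j else 0) = (if j \<noteq> iv then y $ j else 0)"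
        using that by (simp add: sum.delta)
      finally show ?thesis .
    qed
    have yv: "y $ iv = 0" using comp[of iv] assms(4) that l(2) \<pi>(3) by simp
    have "y $ j = 0" for j using yu yv comp[of j] that by (cases "j = iu"; cases "j = iv") auto
    then show ?thesis by (simp add: vec_eq_iff)
  qed
  then have "inj S" using lin by (simp add: linear_injective_0)
  ultimately show thesis using that lin bS by blast
qed

lemma open_homeomorphism_image:
  assumes "homeomorphism U V f g" "open V" "open B" "B \<subseteq> U"
  shows "open (f ` B)" "homeomorphism B (f ` B) f g"
proof -
  show hom: "homeomorphism B (f ` B) f g"
    by (rule homeomorphism_of_subsets[OF assms(1,4)]) (use assms in \<open>auto simp: homeomorphism_def\<close>)
  have "openin (top_of_set U) B" using assms(3,4) by (simp add: open_subset)
  then have "openin (top_of_set V) (f ` B)" using homeomorphism_imp_open_map[OF assms(1)] by blast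
  then show "open (f ` B)" using assms(2) openin_open_trans by blast
qed

text \<open>The closed 1-form has a local primitive \<open>u\<close>, which is constant along the
  flow of \<open>X\<close> since the form annihilates \<open>X\<close>. A slice transverse to
  \<open>X\<close> is parametrised so that \<open>u\<close> is one of its coordinates, and flow time
  is the remaining coordinate; flowing does not disturb \<open>u\<close>.\<close>

theorem straightening:
  fixes X \<beta> :: "real^'n \<Rightarrow> real^'n" and iu iv :: 'n
  assumes "open S" "x0 \<in> S" "iu \<noteq> iv" and smX: "smooth_on S X" and sm\<beta>: "smooth_on S \<beta>"
    and closed: "\<And>x v w. x \<in> S \<Longrightarrow> dirD \<beta> x v \<bullet> w = dirD \<beta> x w \<bullet> v"
    and \<beta>X: "\<And>x. x \<in> S \<Longrightarrow> \<beta> x \<bullet> X x = 0" and "\<beta> x0 \<noteq> 0" "X x0 \<noteq> 0"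
  obtains \<Lambda> \<kappa> r where "0 < r" "smooth_on (ball 0 r) \<Lambda>" "open (\<Lambda> ` ball 0 r)" "\<Lambda> ` ball 0 r \<subseteq> S"
    "x0 \<in> \<Lambda> ` ball 0 r" "homeomorphism (ball 0 r) (\<Lambda> ` ball 0 r) \<Lambda> \<kappa>" "smooth_on (\<Lambda> ` ball 0 r) \<kappa>"
    "\<And>z. z \<in> ball 0 r \<Longrightarrow> dirD \<Lambda> z (axis iv 1) = X (\<Lambda> z)"
    "\<And>z v. z \<in> ball 0 r \<Longrightarrow> \<beta> (\<Lambda> z) \<bullet> dirD \<Lambda> z v = v $ iu"
proof -
  obtain r1 where r1: "0 < r1" "ball x0 r1 \<subseteq> S" using assms(1,2) openE by blast
  let ?B = "ball x0 r1"
  have x0B: "x0 \<in> ?B" using r1 by simp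
  obtain u where u0: "u x0 = 0" and du: "\<And>x. x \<in> ?B \<Longrightarrow> (u has_derivative (\<lambda>v. \<beta> x \<bullet> v)) (at x)" and smu: "smooth_on ?B u"
    using poincare_lemma[OF smooth_on_subset[OF r1(2) sm\<beta>]] closed r1(2) by blast
  obtain L where L: "linear L" "inj L" "L (axis iv 1) = X x0" "\<And>y. \<beta> x0 \<bullet> L y = y $ iu"
    using exists_adapted_linear_map[OF assms(8,9) \<beta>X[OF assms(2)] assms(3)] by blast
  obtain h where h: "linear h" "h \<circ> L = id" "L \<circ> h = id"
    using L(1,2) by (metis linear_injective_isomorphism eq_id_iff o_def comp_apply)
  have hb: "h y $ iu = \<beta> x0 \<bullet> y" for y using L(4)[of "h y"] h(3) by (metis comp_apply id_apply)
  have hX: "h (X x0) = axis iv 1" using L(3) h(2) by (metis comp_apply id_apply)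
  \<comment> \<open>The linear chart \<open>h\<close>, corrected in the component \<open>iu\<close>
    so that this component is exactly \<open>u\<close>. The correction has zero derivative at
    \<open>x0\<close>, so \<open>\<theta>\<close> is still locally invertible there.\<close>
  define \<theta> where "\<theta> x = h (x - x0) + (u x - \<beta> x0 \<bullet> (x - x0)) *\<^sub>R axis iu 1" for x
  have blh: "bounded_linear h" using h(1) by (simp add: linear_conv_bounded_linear)
  have sm\<theta>: "smooth_on ?B \<theta>"
    unfolding \<theta>_def
    by (intro smooth_on_add smooth_on_scaleR smooth_on_diff smooth_on_inner smooth_on_const smooth_on_ident smu
        smooth_on_bounded_linear[OF _ blh] open_ball)
  have "(\<theta> has_derivative (\<lambda>v. h v + (\<beta> x0 \<bullet> v - \<beta> x0 \<bullet> v) *\<^sub>R axis iu 1)) (at x0)"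
    unfolding \<theta>_def
    by (auto intro!: derivative_eq_intros bounded_linear.has_derivative[OF blh] du[OF x0B])
  then have d\<theta>: "dirD \<theta> x0 = h" by (simp add: dirD_eqI)
  have "inj (dirD \<theta> x0)" unfolding d\<theta> using h(3) by (metis inj_on_id inj_on_imageI2)
  obtain U V g where gU: "open U" "U \<subseteq> ?B" "x0 \<in> U" "open V" "\<theta> x0 \<in> V" and homg: "homeomorphism U V \<theta> g"
    and smg: "smooth_on V g"
    using smooth_local_inverse[OF open_ball sm\<theta> x0B \<open>inj (dirD \<theta> x0)\<close>] by metis
  have \<theta>0: "\<theta> x0 = 0" using h(1) by (simp add: \<theta>_def u0 linear_0)
  have gV: "g w \<in> ?B" "\<theta> (g w) = w" if "w \<in> V" for w using homg gU(2) that by (auto simp: homeomorphism_def)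
  have \<theta>u: "\<theta> x $ iu = u x" for x by (simp add: \<theta>_def hb)
  obtain \<phi> \<tau> r2 where \<tau>: "0 < \<tau>" "0 < r2" "ball x0 r2 \<subseteq> ?B"
      and sm\<phi>: "smooth_on ({t. \<bar>t\<bar> < \<tau>} \<times> ball x0 r2) (\<lambda>z. \<phi> (fst z) (snd z))"
    and \<phi>0: "\<And>x. x \<in> ball x0 r2 \<Longrightarrow> \<phi> 0 x = x" and \<phi>B: "\<And>t x. \<bar>t\<bar> < \<tau> \<Longrightarrow> x \<in> ball x0 r2 \<Longrightarrow> \<phi> t x \<in> ?B"
    and \<phi>ode: "\<And>t x. \<bar>t\<bar> < \<tau> \<Longrightarrow> x \<in> ball x0 r2 \<Longrightarrow> ((\<lambda>t. \<phi> t x) has_vector_derivative X (\<phi> t x)) (at t)"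
    by (rule smooth_local_flow[OF open_ball smooth_on_subset[OF r1(2) smX] x0B]) blast
  have u\<phi>: "u (\<phi> t x) = u x" if t: "\<bar>t\<bar> < \<tau>" and x: "x \<in> ball x0 r2" for t x
  proof -
    have "norm (u (\<phi> t x) - u (\<phi> 0 x)) \<le> 0 * \<bar>t\<bar>"
    proof (rule vector_derivative_bound[where e = "\<lambda>t. u (\<phi> t x)" and e' = "\<lambda>t. \<beta> (\<phi> t x) \<bullet> X (\<phi> t x)", OF _ _ t])
      fix s assume s: "\<bar>s\<bar> < \<tau>"
      have "((\<lambda>s. \<phi> s x) has_derivative (\<lambda>k. k *\<^sub>R X (\<phi> s x))) (at s)"
        using \<phi>ode[OF s x] by (simp add: has_vector_derivative_def)
      from diff_chain_at[OF this du[OF \<phi>B[OF s x]]]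
      show "((\<lambda>t. u (\<phi> t x)) has_vector_derivative \<beta> (\<phi> s x) \<bullet> X (\<phi> s x)) (at s)"
        by (simp add: has_vector_derivative_def o_def)
      show "norm (\<beta> (\<phi> s x) \<bullet> X (\<phi> s x)) \<le> 0"
        using \<beta>X \<phi>B[OF s x] r1(2) by auto
    qed
    then show ?thesis by (simp add: \<phi>0[OF x])
  qed
  define P where "P z = z - z $ iv *\<^sub>R axis iv 1" for z :: "real^'n"
  have blP: "bounded_linear P"
    unfolding P_def linear_conv_bounded_linear[symmetric] by (rule linearI) (simp_all add: algebra_simps)
  define V' where "V' = V \<inter> g -` ball x0 r2"
  have "open V'" unfolding V'_def using continuous_open_preimage[OF smooth_on_continuous[OF smg] gU(4) open_ball] by simp
  define Q where "Q = {z. \<bar>z $ iv\<bar> < \<tau>} \<inter> P -` V'"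
  have "open Q" unfolding Q_def
    using blP \<open>open V'\<close> by (intro open_Int open_Collect_less continuous_intros open_vimage linear_continuous_on)
  have "g 0 = x0" using homg gU(3) \<theta>0 by (metis homeomorphism_def)
  then have "0 \<in> Q" using \<tau> gU(5) \<theta>0 by (simp add: Q_def V'_def P_def)
  \<comment> \<open>\<open>P z\<close> lies in the slice where the coordinate \<open>iv\<close>
    vanishes; from its image under \<open>g\<close> the flow runs for time
    \<open>z $ iv\<close>.\<close>
  define \<Lambda> where "\<Lambda> z = \<phi> (z $ iv) (g (P z))" for z
  have Qin: "\<bar>z $ iv\<bar> < \<tau>" "g (P z) \<in> ball x0 r2" "P z \<in> V" if "z \<in> Q" for z using that by (auto simp: Q_def V'_def)
  have smgP: "smooth_on Q (\<lambda>z. g (P z))"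
    by (rule smooth_on_compose[OF \<open>open Q\<close> gU(4) smooth_on_linear[OF \<open>open Q\<close> blP] smg]) (use Qin in auto)
  have oTB: "open ({t. \<bar>t\<bar> < \<tau>} \<times> ball x0 r2)"
    by (intro open_Times open_Collect_less continuous_intros open_ball)
  have "smooth_on Q (\<lambda>z. (\<lambda>z. \<phi> (fst z) (snd z)) (z $ iv, g (P z)))"
    by (rule smooth_on_compose[OF \<open>open Q\<close> oTB smooth_on_Pair[OF \<open>open Q\<close> smooth_on_linear[OF \<open>open Q\<close>
        bounded_linear_vec_nth] smgP] sm\<phi>])
       (use Qin in auto)
  then have sm\<Lambda>: "smooth_on Q \<Lambda>" by (simp add: \<Lambda>_def[abs_def])
  have \<Lambda>B: "\<Lambda> z \<in> ?B" if "z \<in> Q" for z unfolding \<Lambda>_def by (intro \<phi>B Qin that)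
  have u\<Lambda>: "u (\<Lambda> z) = z $ iu" if "z \<in> Q" for z
    using u\<phi>[OF Qin(1,2)[OF that]] \<theta>u[of "g (P z)"] gV(2)[OF Qin(3)[OF that]] assms(3) by (simp add: \<Lambda>_def P_def axis_def)
  have D\<Lambda>: "(\<Lambda> has_derivative dirD \<Lambda> z) (at z)" if "z \<in> Q" for z by (rule smooth_on_has_derivative[OF sm\<Lambda> that])
  have 1: "dirD \<Lambda> z (axis iv 1) = X (\<Lambda> z)" if z: "z \<in> Q" for z
  proof -
    have "((\<lambda>s. \<Lambda> (z + s *\<^sub>R axis iv 1)) has_vector_derivative dirD \<Lambda> z (axis iv 1)) (at 0)"
      by (rule has_derivative_along_line) (simp add: D\<Lambda>[OF z])
    moreover have "P (z + s *\<^sub>R axis iv 1) = P z" for s by (simp add: P_def algebra_simps)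
    then have "(\<lambda>s. \<Lambda> (z + s *\<^sub>R axis iv 1)) = (\<lambda>s. \<phi> (z $ iv + s) (g (P z)))" by (simp add: \<Lambda>_def)
    moreover have "((\<lambda>s. \<phi> (z $ iv + s) (g (P z))) has_vector_derivative X (\<Lambda> z)) (at 0)"
    proof -
      have "((\<lambda>t. \<phi> t (g (P z))) has_vector_derivative X (\<Lambda> z)) (at (z $ iv + 0))"
        using \<phi>ode[OF Qin(1,2)[OF z]] by (simp add: \<Lambda>_def)
      then have "((\<lambda>t. \<phi> t (g (P z))) \<circ> (\<lambda>s. z $ iv + s) has_vector_derivative 1 *\<^sub>R X (\<Lambda> z)) (at 0)"
        by (intro vector_diff_chain_at) (auto intro!: derivative_eq_intros)
      then show ?thesis by (simp add: o_def)
    qed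
    ultimately show ?thesis by (metis vector_derivative_unique_at)
  qed
  have 2: "\<beta> (\<Lambda> z) \<bullet> dirD \<Lambda> z v = v $ iu" if z: "z \<in> Q" for z v
  proof -
    from diff_chain_at[OF D\<Lambda>[OF z] du[OF \<Lambda>B[OF z]]]
    have "((\<lambda>z. u (\<Lambda> z)) has_derivative (\<lambda>v. \<beta> (\<Lambda> z) \<bullet> dirD \<Lambda> z v)) (at z)" by (simp add: o_def)
    moreover have "((\<lambda>z. u (\<Lambda> z)) has_derivative (\<lambda>v. v $ iu)) (at z)"
      by (rule has_derivative_transform_within_open[OF bounded_linear_imp_has_derivative[OF bounded_linear_vec_nth]
          \<open>open Q\<close> z])
         (simp add: u\<Lambda>)
    ultimately have "(\<lambda>v. \<beta> (\<Lambda> z) \<bullet> dirD \<Lambda> z v) = (\<lambda>v. v $ iu)" by (rule has_derivative_unique)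
    then show ?thesis by meson
  qed
  have lin0: "linear (dirD \<Lambda> 0)" using D\<Lambda>[OF \<open>0 \<in> Q\<close>] by (rule has_derivative_linear)
  \<comment> \<open>Along the slice the flow time is zero, so \<open>\<Lambda>\<close> agrees with
    \<open>g\<close> there.\<close>
  have D0: "dirD \<Lambda> 0 (P v) = dirD g 0 (P v)" for v
  proof -
    have "((\<lambda>s. \<Lambda> (0 + s *\<^sub>R P v)) has_vector_derivative dirD \<Lambda> 0 (P v)) (at 0)"
      by (rule has_derivative_along_line) (simp add: D\<Lambda>[OF \<open>0 \<in> Q\<close>])
    moreover have "((\<lambda>s. \<Lambda> (0 + s *\<^sub>R P v)) has_vector_derivative dirD g 0 (P v)) (at 0)"
    proof (rule has_vector_derivative_transform_within_open)
      show "((\<lambda>s. g (0 + s *\<^sub>R P v)) has_vector_derivative dirD g 0 (P v)) (at 0)"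
        by (rule has_derivative_along_line) (use smooth_on_has_derivative[OF smg, of 0] gU(5) \<theta>0 in simp)
      show "open ((\<lambda>s. s *\<^sub>R P v) -` Q)"
        by (rule open_vimage[OF \<open>open Q\<close>]) (intro continuous_intros)
      show "0 \<in> (\<lambda>s. s *\<^sub>R P v) -` Q" using \<open>0 \<in> Q\<close> by simp
      fix s assume s: "s \<in> (\<lambda>s. s *\<^sub>R P v) -` Q"
      have "(s *\<^sub>R P v) $ iv = 0" by (simp add: P_def)
      then have PP: "P (s *\<^sub>R P v) = s *\<^sub>R P v" by (simp only: P_def[of "s *\<^sub>R P v"]) simp
      then have "g (s *\<^sub>R P v) \<in> ball x0 r2" using Qin(2)[of "s *\<^sub>R P v"] s by simp
      then show "g (0 + s *\<^sub>R P v) = \<Lambda> (0 + s *\<^sub>R P v)"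
        using PP \<open>(s *\<^sub>R P v) $ iv = 0\<close> by (simp only: \<Lambda>_def add_0 \<phi>0)
    qed
    ultimately show ?thesis by (rule vector_derivative_unique_at)
  qed
  have dg: "h (dirD g 0 w) = w" for w
  proof -
    have dg0: "(g has_derivative dirD g 0) (at 0)" using smooth_on_has_derivative[OF smg, of 0] gU(5) \<theta>0 by simp
    have "(\<theta> has_derivative h) (at (g 0))" using smooth_on_has_derivative[OF sm\<theta> x0B] d\<theta> \<open>g 0 = x0\<close> by simp
    from diff_chain_at[OF dg0 this] have "(\<theta> \<circ> g has_derivative h \<circ> dirD g 0) (at 0)" .
    moreover have "(\<theta> \<circ> g has_derivative (\<lambda>w. w)) (at 0)"
      by (rule has_derivative_transform_within_open[OF has_derivative_ident gU(4)]) (use gU(5) \<theta>0 gV in auto)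
    ultimately have "h \<circ> dirD g 0 = (\<lambda>w. w)" by (rule has_derivative_unique)
    then show ?thesis by (simp add: fun_eq_iff)
  qed
  \<comment> \<open>Slice directions are mapped by \<open>dirD g 0\<close> and
    \<open>axis iv 1\<close> is mapped to \<open>X x0\<close>; applying \<open>h\<close> undoes
    both.\<close>
  have "v = 0" if "dirD \<Lambda> 0 v = 0" for v
  proof -
    have "\<Lambda> 0 = x0" using \<phi>0[of x0] \<tau> \<open>g 0 = x0\<close> by (simp add: \<Lambda>_def P_def)
    have v: "v = P v + v $ iv *\<^sub>R axis iv 1" by (simp add: P_def)
    have "dirD \<Lambda> 0 v = dirD g 0 (P v) + v $ iv *\<^sub>R X x0"
      using D0[of v] 1[OF \<open>0 \<in> Q\<close>] \<open>\<Lambda> 0 = x0\<close> by (subst v) (simp add: linear_add[OF lin0] linear_scale[OF lin0])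
    then have "h (dirD g 0 (P v) + v $ iv *\<^sub>R X x0) = h 0" using that by simp
    then have "P v + v $ iv *\<^sub>R axis iv 1 = 0"
        by (simp add: linear_add[OF h(1)] linear_scale[OF h(1)] linear_0[OF h(1)] dg hX)
    then show "v = 0" using v by simp
  qed
  then have "inj (dirD \<Lambda> 0)" using lin0 by (simp add: linear_injective_0)
  then obtain U' V'' \<kappa> where U': "open U'" "U' \<subseteq> Q" "0 \<in> U'" "open V''" and hom: "homeomorphism U' V'' \<Lambda> \<kappa>"
      and sm\<kappa>: "smooth_on V'' \<kappa>"
    using smooth_local_inverse[OF \<open>open Q\<close> sm\<Lambda> \<open>0 \<in> Q\<close>] by metis
  obtain r where r: "0 < r" "ball 0 r \<subseteq> U'" using U' openE by blast
  have rQ: "ball 0 r \<subseteq> Q" using r U' by blast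
  have img: "\<Lambda> ` ball 0 r \<subseteq> V''" using hom r(2) by (auto simp: homeomorphism_def)
  show thesis
  proof (rule that[of r \<Lambda> \<kappa>])
    show "0 < r" by (rule r)
    show "smooth_on (ball 0 r) \<Lambda>" by (rule smooth_on_subset[OF rQ sm\<Lambda>])
    show "open (\<Lambda> ` ball 0 r)" "homeomorphism (ball 0 r) (\<Lambda> ` ball 0 r) \<Lambda> \<kappa>"
      using open_homeomorphism_image[OF hom U'(4) open_ball r(2)] by auto
    show "\<Lambda> ` ball 0 r \<subseteq> S" using \<Lambda>B rQ r1(2) by blast
    have "\<Lambda> 0 = x0" using \<phi>0[of x0] \<tau> \<open>g 0 = x0\<close> by (simp add: \<Lambda>_def P_def)
    then show "x0 \<in> \<Lambda> ` ball 0 r" using r(1) by (metis centre_in_ball imageI)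
    show "smooth_on (\<Lambda> ` ball 0 r) \<kappa>" by (rule smooth_on_subset[OF img sm\<kappa>])
  qed (use 1 2 rQ in auto)
qed

subsection \<open>Berwald metrics\<close>

lemma inner_vanishes_on_open:
  fixes c :: "'a::real_inner"
  assumes "open Y" "y0 \<in> Y" "\<And>y. y \<in> Y \<Longrightarrow> c \<bullet> y = 0"
  shows "c = 0"
proof (rule ccontr)
  assume "c \<noteq> 0"
  obtain r where r: "0 < r" "ball y0 r \<subseteq> Y" using assms openE by blast
  have "norm ((r / 2 / norm c) *\<^sub>R c) < r" using \<open>c \<noteq> 0\<close> r by simp
  then have "y0 + (r / 2 / norm c) *\<^sub>R c \<in> Y" using r by (auto simp: dist_norm subset_iff)
  from assms(3)[OF this] assms(3)[OF assms(2)] have "(r / 2 / norm c) * (c \<bullet> c) = 0"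
    by (simp add: inner_add_right)
  then show False using \<open>c \<noteq> 0\<close> r by simp
qed

text \<open>Together with the next lemma, replaces the iterated coordinate derivatives of the
  Finsler definitions by directional derivatives of one function of the pair \<open>(x, y)\<close>,
  for which symmetry of second derivatives is available.\<close>

lemma pdy_eq:
  fixes h :: "real^'n \<Rightarrow> real^'n \<Rightarrow> real" and H :: "(real^'n) \<times> (real^'n) \<Rightarrow> real"
  assumes "open D" "smooth_on D H" "\<And>x y. (x, y) \<in> D \<Longrightarrow> h x y = H (x, y)" "(x, y) \<in> D"
  shows "pdy k h x y = dirD H (x, y) (0, axis k 1)"
proof -
  have op: "open ((\<lambda>y. (x, y)) -` D)" by (rule open_vimage[OF assms(1)]) (intro continuous_intros)
  have "((\<lambda>y. (x, y)) has_derivative (\<lambda>v. (0, v))) (at y)"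
    by (intro has_derivative_Pair has_derivative_const has_derivative_ident)
  from diff_chain_at[OF this smooth_on_has_derivative[OF assms(2,4)]]
  have "((\<lambda>y. H (x, y)) has_derivative (\<lambda>v. dirD H (x, y) (0, v))) (at y)" by (simp add: o_def)
  then have "(h x has_derivative (\<lambda>v. dirD H (x, y) (0, v))) (at y)"
    by (rule has_derivative_transform_within_open[OF _ op]) (use assms in auto)
  then show ?thesis by (simp add: pdy_def pd_def dirD_eqI)
qed

lemma pdx_eq:
  fixes h :: "real^'n \<Rightarrow> real^'n \<Rightarrow> real" and H :: "(real^'n) \<times> (real^'n) \<Rightarrow> real"
  assumes "open D" "smooth_on D H" "\<And>x y. (x, y) \<in> D \<Longrightarrow> h x y = H (x, y)" "(x, y) \<in> D"
  shows "pdx k h x y = dirD H (x, y) (axis k 1, 0)"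
proof -
  have op: "open ((\<lambda>x. (x, y)) -` D)" by (rule open_vimage[OF assms(1)]) (intro continuous_intros)
  have "((\<lambda>x. (x, y)) has_derivative (\<lambda>v. (v, 0))) (at x)"
    by (intro has_derivative_Pair has_derivative_const has_derivative_ident)
  from diff_chain_at[OF this smooth_on_has_derivative[OF assms(2,4)]]
  have "((\<lambda>x. H (x, y)) has_derivative (\<lambda>v. dirD H (x, y) (v, 0))) (at x)" by (simp add: o_def)
  then have "((\<lambda>x. h x y) has_derivative (\<lambda>v. dirD H (x, y) (v, 0))) (at x)"
    by (rule has_derivative_transform_within_open[OF _ op]) (use assms in auto)
  then show ?thesis by (simp add: pdx_def pd_def dirD_eqI)
qed

lemma euler_homogeneous:
  fixes H :: "'a::real_normed_vector \<times> 'b::real_normed_vector \<Rightarrow> real"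
  assumes "(H has_derivative H') (at (x, y))" "\<And>t. 0 < t \<Longrightarrow> H (x, t *\<^sub>R y) = t ^ n * H (x, y)"
  shows "H' (0, y) = real n * H (x, y)"
proof -
  have "((\<lambda>s. H ((x, y) + s *\<^sub>R (0, y))) has_vector_derivative H' (0, y)) (at 0)"
    by (rule has_derivative_along_line) (use assms(1) in simp)
  moreover have "((\<lambda>s. H ((x, y) + s *\<^sub>R (0, y))) has_vector_derivative real n * H (x, y)) (at 0)"
  proof (rule has_vector_derivative_transform_within_open)
    show "((\<lambda>s. (1 + s) ^ n * H (x, y)) has_vector_derivative real n * H (x, y)) (at 0)"
      unfolding has_real_derivative_iff_has_vector_derivative[symmetric]
      by (auto intro!: derivative_eq_intros)
    show "open {-1<..<1::real}" "0 \<in> {-1<..<1::real}" by auto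
    fix s :: real assume "s \<in> {-1<..<1}"
    then have "0 < 1 + s" by simp
    from assms(2)[OF this] show "(1 + s) ^ n * H (x, y) = H ((x, y) + s *\<^sub>R (0, y))"
      by (simp add: scaleR_add_left)
  qed
  ultimately show ?thesis by (rule vector_derivative_unique_at)
qed

lemma vec_eq_sum_axis: "(y :: real^'n) = (\<Sum>i\<in>UNIV. y $ i *\<^sub>R axis i 1)"
  by (simp add: vec_eq_iff axis_def if_distrib cong: if_cong)

lemma linear_Pair_expand:
  fixes T :: "(real^'n) \<times> (real^'m) \<Rightarrow> real"
  assumes "linear T"
  shows "T (y, 0) = (\<Sum>i\<in>UNIV. y $ i * T (axis i 1, 0))" "T (0, w) = (\<Sum>i\<in>UNIV. w $ i * T (0, axis i 1))"
    "T (y, w) = T (y, 0) + T (0, w)"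
proof -
  have "(y, 0::real^'m) = (\<Sum>i\<in>UNIV. y $ i *\<^sub>R (axis i 1, 0))"
    by (simp add: prod_eq_iff fst_sum snd_sum vec_eq_sum_axis[symmetric])
  then show "T (y, 0) = (\<Sum>i\<in>UNIV. y $ i * T (axis i 1, 0))"
    by (simp only: linear_sum[OF assms] linear_scale[OF assms] real_scaleR_def)
  have "(0::real^'n, w) = (\<Sum>i\<in>UNIV. w $ i *\<^sub>R (0, axis i 1))"
    by (simp add: prod_eq_iff fst_sum snd_sum vec_eq_sum_axis[symmetric])
  then show "T (0, w) = (\<Sum>i\<in>UNIV. w $ i * T (0, axis i 1))"
    by (simp only: linear_sum[OF assms] linear_scale[OF assms] real_scaleR_def)
  show "T (y, w) = T (y, 0) + T (0, w)" using linear_add[OF assms, of "(y, 0)" "(0, w)"] by simp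
qed

text \<open>The connection as a bilinear map: the horizontal lift of \<open>v\<close> at
  \<open>y\<close> is \<open>(v, - bil \<Gamma> v y)\<close>, and a vector field \<open>Y\<close> is
  parallel when \<open>dirD Y x v + bil \<Gamma> v (Y x) = 0\<close> for all
  \<open>v\<close>.\<close>

definition bil :: "('n \<Rightarrow> 'n \<Rightarrow> 'n \<Rightarrow> real) \<Rightarrow> real^'n \<Rightarrow> real^'n \<Rightarrow> real^'n::finite" where
  "bil \<Gamma> v y = (\<chi> k. \<Sum>i\<in>UNIV. \<Sum>j\<in>UNIV. \<Gamma> k i j * v $ i * y $ j)"

lemma bilinear_bil: "bilinear (bil \<Gamma>)"
  unfolding bilinear_def bil_def
  by (auto intro!: linearI simp: vec_eq_iff algebra_simps sum.distrib sum_distrib_left)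

text \<open>The vector \<open>G\<close> whose vertical derivative is 4N is homogeneous of degree 2,
  so Euler's relation gives \<open>G = 2 bil \<Gamma> y y\<close>; differentiating this again forces
  \<Gamma> to be symmetric. Multiplied by the fundamental tensor, the definition of \<open>G\<close>
  becomes the equation \<open>spray\<close>. Contracting it with \<open>y\<close> gives invariance
  of F^2 in the horizontal direction over \<open>y\<close>, and differentiating that relation in
  \<open>y\<close> extends it to every \<open>v\<close>.\<close>

theorem berwald_horizontal:
  fixes f :: "real^'n \<Rightarrow> real^'n \<Rightarrow> real" and D :: "((real^'n) \<times> (real^'n)) set"
  assumes op: "open D" and sm: "smooth_on D (\<lambda>(x, y). f x y)"
    and cone: "\<And>x y t. (x, y) \<in> D \<Longrightarrow> 0 < t \<Longrightarrow> (x, t *\<^sub>R y) \<in> D"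
    and hom: "\<And>x y t. (x, y) \<in> D \<Longrightarrow> 0 < t \<Longrightarrow> f x (t *\<^sub>R y) = t * f x y"
    and nondeg: "\<And>x y. (x, y) \<in> D \<Longrightarrow> invertible (fundamental_tensor f x y)"
    and ber: "\<And>y k i. (x, y) \<in> D \<Longrightarrow> nonlinear_connection f k i x y = (\<Sum>j\<in>UNIV. \<Gamma> k i j * y $ j)"
    and ne: "(x, y0) \<in> D"
  defines "\<Lambda> \<equiv> \<lambda>z. (f (fst z) (snd z))\<^sup>2"
  shows "\<Gamma> k i j = \<Gamma> k j i"
    and "(x, y) \<in> D \<Longrightarrow> dirD \<Lambda> (x, y) (v, 0) = dirD \<Lambda> (x, y) (0, bil \<Gamma> v y)"
proof -
  have sm\<Lambda>: "smooth_on D \<Lambda>"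
    using smooth_on_mult[OF op sm sm] by (simp add: \<Lambda>_def power2_eq_square split_beta')
  define \<Lambda>2 where "\<Lambda>2 z a b = dirD (\<lambda>z. dirD \<Lambda> z a) z b" for z a b
  have comm: "\<Lambda>2 z a b = \<Lambda>2 z b a" if "z \<in> D" for z a b
    unfolding \<Lambda>2_def by (rule dirD_commute[OF op sm\<Lambda> that])
  have sm1: "smooth_on D (\<lambda>z. dirD \<Lambda> z a)" for a by (rule smooth_on_dirD[OF sm\<Lambda>])
  have sm2: "smooth_on D (\<lambda>z. \<Lambda>2 z a b)" for a b unfolding \<Lambda>2_def by (rule smooth_on_dirD[OF sm1])
  have d1: "(\<Lambda> has_derivative dirD \<Lambda> z) (at z)" if "z \<in> D" for z by (rule smooth_on_has_derivative[OF sm\<Lambda> that])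
  have d2: "((\<lambda>z. dirD \<Lambda> z a) has_derivative \<Lambda>2 z a) (at z)" if "z \<in> D" for z a
    using smooth_on_has_derivative[OF sm1 that, of a] by (simp add: \<Lambda>2_def[abs_def])
  have lin1: "linear (dirD \<Lambda> z)" if "z \<in> D" for z using d1[OF that] by (rule has_derivative_linear)
  have lin2: "linear (\<Lambda>2 z a)" if "z \<in> D" for z a using d2[OF that] by (rule has_derivative_linear)
  \<comment> \<open>Scaling in the fibre. \<open>h0\<close>, \<open>h1\<close> and \<open>h2\<close>
    transport the homogeneity of F^2 to its first and second derivatives, whose vertical directions
    are scaled as well.\<close>
  define \<delta> where "\<delta> t z = (fst z, t *\<^sub>R snd z)" for t :: real and z :: "(real^'n) \<times> (real^'n)"
  have \<delta>D: "\<delta> t z \<in> D" if "z \<in> D" "0 < t" for t z using cone that by (auto simp: \<delta>_def)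
  have d\<delta>: "(\<delta> t has_derivative \<delta> t) (at z)" for t z
    unfolding \<delta>_def by (auto intro!: derivative_eq_intros)
  have h0: "\<Lambda> (\<delta> t z) = t\<^sup>2 * \<Lambda> z" if "z \<in> D" "0 < t" for t z
    using hom[of "fst z" "snd z" t] that by (simp add: \<Lambda>_def \<delta>_def power_mult_distrib)
  have h1: "dirD \<Lambda> (\<delta> t z) (\<delta> t a) = t\<^sup>2 * dirD \<Lambda> z a" if z: "z \<in> D" and t: "0 < t" for t z a
  proof -
    from diff_chain_at[OF d\<delta> d1[OF \<delta>D[OF z t]]]
    have "((\<lambda>z. \<Lambda> (\<delta> t z)) has_derivative (\<lambda>a. dirD \<Lambda> (\<delta> t z) (\<delta> t a))) (at z)" by (simp add: o_def)
    moreover have "((\<lambda>z. \<Lambda> (\<delta> t z)) has_derivative (\<lambda>a. t\<^sup>2 * dirD \<Lambda> z a)) (at z)"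
      by (rule has_derivative_transform_within_open[OF has_derivative_mult_right[OF d1[OF z]] op z]) (simp add: h0 t)
    ultimately have "(\<lambda>a. dirD \<Lambda> (\<delta> t z) (\<delta> t a)) = (\<lambda>a. t\<^sup>2 * dirD \<Lambda> z a)" by (rule has_derivative_unique)
    then show ?thesis by meson
  qed
  have h2: "\<Lambda>2 (\<delta> t z) (\<delta> t a) (\<delta> t b) = t\<^sup>2 * \<Lambda>2 z a b" if z: "z \<in> D" and t: "0 < t" for t z a b
  proof -
    from diff_chain_at[OF d\<delta> d2[OF \<delta>D[OF z t]]]
    have "((\<lambda>z. dirD \<Lambda> (\<delta> t z) (\<delta> t a)) has_derivative (\<lambda>b. \<Lambda>2 (\<delta> t z) (\<delta> t a) (\<delta> t b))) (at z)" by (simp add: o_def)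
    moreover have "((\<lambda>z. dirD \<Lambda> (\<delta> t z) (\<delta> t a)) has_derivative (\<lambda>b. t\<^sup>2 * \<Lambda>2 z a b)) (at z)"
      by (rule has_derivative_transform_within_open[OF has_derivative_mult_right[OF d2[OF z]] op z]) (simp add: h1 t)
    ultimately have "(\<lambda>b. \<Lambda>2 (\<delta> t z) (\<delta> t a) (\<delta> t b)) = (\<lambda>b. t\<^sup>2 * \<Lambda>2 z a b)" by (rule has_derivative_unique)
    then show ?thesis by meson
  qed
  have \<delta>0: "\<delta> t (v, 0) = (v, 0)" "\<delta> t (0, v) = t *\<^sub>R (0, v)" for t v by (simp_all add: \<delta>_def)
  have L1: "pdy k (\<lambda>x y. (f x y)\<^sup>2) x y = dirD \<Lambda> (x, y) (0, axis k 1)" if "(x, y) \<in> D" for x y k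
    by (rule pdy_eq[OF op sm\<Lambda> _ that]) (simp add: \<Lambda>_def)
  have L2: "pdx k (\<lambda>x y. (f x y)\<^sup>2) x y = dirD \<Lambda> (x, y) (axis k 1, 0)" if "(x, y) \<in> D" for x y k
    by (rule pdx_eq[OF op sm\<Lambda> _ that]) (simp add: \<Lambda>_def)
  have L3: "pdx l (pdy k (\<lambda>x y. (f x y)\<^sup>2)) x y = \<Lambda>2 (x, y) (0, axis k 1) (axis l 1, 0)" if "(x, y) \<in> D" for x y k l
    unfolding \<Lambda>2_def by (rule pdx_eq[OF op sm1 _ that]) (simp add: L1)
  have FT: "fundamental_tensor f x y $ i $ j = 1 / 2 * \<Lambda>2 (x, y) (0, axis i 1) (0, axis j 1)" if xy: "(x, y) \<in> D" for x y i j
  proof -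
    have smh: "smooth_on D (\<lambda>z. 1 / 2 * \<Lambda> z)" by (intro smooth_on_mult smooth_on_const op sm\<Lambda>)
    have dh: "dirD (\<lambda>z. 1 / 2 * \<Lambda> z) z = (\<lambda>a. 1 / 2 * dirD \<Lambda> z a)" if "z \<in> D" for z
      by (rule dirD_eqI[OF has_derivative_mult_right[OF d1[OF that]]])
    have "pdy j (\<lambda>x y. 1 / 2 * (f x y)\<^sup>2) x y = 1 / 2 * dirD \<Lambda> (x, y) (0, axis j 1)" if "(x, y) \<in> D" for x y
      using pdy_eq[OF op smh _ that, of "\<lambda>x y. 1 / 2 * (f x y)\<^sup>2" j] dh[OF that] by (simp add: \<Lambda>_def)
    then have "pdy i (pdy j (\<lambda>x y. 1 / 2 * (f x y)\<^sup>2)) x y = dirD (\<lambda>z. 1 / 2 * dirD \<Lambda> z (0, axis j 1)) (x, y) (0, axis i 1)"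
      by (intro pdy_eq[OF op _ _ xy] smooth_on_mult smooth_on_const op sm1)
    also have "\<dots> = 1 / 2 * \<Lambda>2 (x, y) (0, axis j 1) (0, axis i 1)"
      by (subst dirD_eqI[OF has_derivative_mult_right[OF d2[OF xy]]]) simp
    finally show ?thesis by (simp add: fundamental_tensor_def comm[OF xy, of "(0, axis j 1)"])
  qed
  define g where "g z = fundamental_tensor f (fst z) (snd z)" for z
  define S where "S k z = \<Lambda>2 z (0, axis k 1) (snd z, 0) - dirD \<Lambda> z (axis k 1, 0)" for k z
  define G where "G j z = (\<Sum>k\<in>UNIV. matrix_inv (g z) $ j $ k * S k z)" for j z
  have S: "S k z = (\<Sum>l\<in>UNIV. snd z $ l * \<Lambda>2 z (0, axis k 1) (axis l 1, 0)) - dirD \<Lambda> z (axis k 1, 0)" if "z \<in> D" for k z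
    unfolding S_def by (subst linear_Pair_expand(1)[OF lin2[OF that]]) (rule refl)
  have smg: "smooth_on D g"
    unfolding smooth_on_vec_iff[OF op]
  proof (intro allI)
    fix i j
    show "smooth_on D (\<lambda>z. g z $ i $ j)"
      by (rule smooth_on_cong[OF op _ smooth_on_mult[OF op smooth_on_const[OF op, of "1 / 2"] sm2]]) (auto simp: g_def FT)
  qed
  have inv: "invertible (g z)" if "z \<in> D" for z using nondeg[of "fst z" "snd z"] that by (simp add: g_def)
  have "smooth_on D (\<lambda>z. matrix_inv (g z) $ j $ k)" for j k
    using smooth_on_matrix_inv[OF op smg inv] by (simp add: smooth_on_vec_iff[OF op])
  moreover have "smooth_on D (S k)" for k
  proof (rule smooth_on_cong[OF op S[symmetric]])
    show "smooth_on D (\<lambda>z. (\<Sum>l\<in>UNIV. snd z $ l * \<Lambda>2 z (0, axis k 1) (axis l 1, 0)) - dirD \<Lambda> z (axis k 1, 0))"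
      by (intro smooth_on_diff smooth_on_sum smooth_on_mult op sm2 sm1 smooth_on_linear
          bounded_linear_compose[OF bounded_linear_vec_nth bounded_linear_snd])
  qed
  ultimately have smG: "smooth_on D (G j)" for j
    unfolding G_def[abs_def] by (intro smooth_on_sum smooth_on_mult op)
  have N: "nonlinear_connection f k i x y = 1 / 4 * dirD (G k) (x, y) (0, axis i 1)" if "(x, y) \<in> D" for k i x y
    unfolding nonlinear_connection_def
    by (subst pdy_eq[OF op smG _ that, of _ k]) (auto simp: G_def g_def S L1 L2 L3)
  have hg: "g (\<delta> t z) = g z" if "z \<in> D" "0 < t" for t z
  proof -
    have "g (\<delta> t z) $ i $ j = g z $ i $ j" for i j
    proof -
      have "t * (t * \<Lambda>2 (\<delta> t z) (0, axis i 1) (0, axis j 1)) = t\<^sup>2 * \<Lambda>2 z (0, axis i 1) (0, axis j 1)"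
        using h2[OF that, of "(0, axis i 1)" "(0, axis j 1)"] linear_scale[OF lin2[OF \<delta>D[OF that]]]
          comm[OF \<delta>D[OF that], of "t *\<^sub>R (0, axis i 1)"] comm[OF \<delta>D[OF that], of "(0, axis j 1)"]
        unfolding \<delta>0 by (metis real_scaleR_def)
      then have "\<Lambda>2 (\<delta> t z) (0, axis i 1) (0, axis j 1) = \<Lambda>2 z (0, axis i 1) (0, axis j 1)"
        using that(2) by (simp add: power2_eq_square)
      then show ?thesis using FT[of "fst z" "snd z" i j] FT[of "fst (\<delta> t z)" "snd (\<delta> t z)" i j] \<delta>D[OF that] that(1)
        by (simp add: g_def)
    qed
    then show ?thesis by (simp add: vec_eq_iff)
  qed
  have hS: "S k (\<delta> t z) = t\<^sup>2 * S k z" if "z \<in> D" "0 < t" for t z k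
  proof -
    have "\<Lambda>2 (\<delta> t z) (0, axis k 1) (snd (\<delta> t z), 0) = t * \<Lambda>2 (\<delta> t z) (0, axis k 1) (snd z, 0)"
      using linear_scale[OF lin2[OF \<delta>D[OF that]], of _ t "(snd z, 0)"] by (simp add: \<delta>_def)
    also have "\<dots> = \<Lambda>2 (\<delta> t z) (\<delta> t (0, axis k 1)) (\<delta> t (snd z, 0))"
      using linear_scale[OF lin2[OF \<delta>D[OF that]], of "(snd z, 0)" t "(0, axis k 1)"]
        comm[OF \<delta>D[OF that], of "(snd z, 0)"] unfolding \<delta>0 by (metis real_scaleR_def)
    also have "\<dots> = t\<^sup>2 * \<Lambda>2 z (0, axis k 1) (snd z, 0)" by (rule h2[OF that])
    finally show ?thesis using h1[OF that, of "(axis k 1, 0)"] by (simp add: S_def \<delta>0 algebra_simps)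
  qed
  have hG: "G j (\<delta> t z) = t\<^sup>2 * G j z" if "z \<in> D" "0 < t" for t z j
    unfolding G_def hg[OF that] hS[OF that] by (simp add: sum_distrib_left mult_ac)
  have dG: "(G j has_derivative dirD (G j) z) (at z)" if "z \<in> D" for j z by (rule smooth_on_has_derivative[OF smG that])
  have G\<Gamma>: "G k (x, y) = 2 * (bil \<Gamma> y y $ k)" if xy: "(x, y) \<in> D" for k y
  proof -
    have "dirD (G k) (x, y) (0, y) = real 2 * G k (x, y)"
      by (rule euler_homogeneous[OF dG[OF xy]]) (use hG[OF xy] in \<open>simp add: \<delta>_def\<close>)
    moreover have "dirD (G k) (x, y) (0, y) = (\<Sum>i\<in>UNIV. y $ i * dirD (G k) (x, y) (0, axis i 1))"
      by (rule linear_Pair_expand(2)[OF has_derivative_linear[OF dG[OF xy]]])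
    moreover have "dirD (G k) (x, y) (0, axis i 1) = 4 * (\<Sum>j\<in>UNIV. \<Gamma> k i j * y $ j)" for i
      using N[OF xy, of k i] ber[OF xy, of k i] by linarith
    ultimately have "2 * G k (x, y) = (\<Sum>i\<in>UNIV. y $ i * (4 * (\<Sum>j\<in>UNIV. \<Gamma> k i j * y $ j)))" by simp
    also have "\<dots> = 4 * (bil \<Gamma> y y $ k)" by (simp add: bil_def sum_distrib_left mult_ac)
    finally show ?thesis by simp
  qed
  have opx: "open ((\<lambda>y. (x, y)) -` D)" by (rule open_vimage[OF op]) (intro continuous_intros)
  have dbil: "((\<lambda>y. bil \<Gamma> y y $ k) has_derivative (\<lambda>\<eta>. bil \<Gamma> y \<eta> $ k + bil \<Gamma> \<eta> y $ k)) (at y)" for y k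
    using bounded_linear.has_derivative[OF bounded_linear_vec_nth[of k] bounded_bilinear.FDERIV[OF
          bilinear_conv_bounded_bilinear[THEN iffD1, OF bilinear_bil] has_derivative_ident has_derivative_ident]]
    by simp
  have axb: "bil \<Gamma> y (axis i 1) $ k = (\<Sum>j\<in>UNIV. \<Gamma> k j i * y $ j)"
      "bil \<Gamma> (axis i 1) y $ k = (\<Sum>j\<in>UNIV. \<Gamma> k i j * y $ j)" for y i k
  proof -
    have a: "axis i (1::real) $ j = (if j = i then 1 else 0)" for j by (simp add: axis_def)
    have "(\<Sum>i'\<in>UNIV. \<Sum>j\<in>UNIV. \<Gamma> k i' j * y $ i' * axis i 1 $ j) = (\<Sum>i'\<in>UNIV. \<Sum>j\<in>UNIV. if j
        = i then \<Gamma> k i' i * y $ i' else 0)"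
      by (intro sum.cong refl) (simp add: a)
    then show "bil \<Gamma> y (axis i 1) $ k = (\<Sum>j\<in>UNIV. \<Gamma> k j i * y $ j)" by (simp add: bil_def)
    have "(\<Sum>i'\<in>UNIV. \<Sum>j\<in>UNIV. \<Gamma> k i' j * axis i 1 $ i' * y $ j) = (\<Sum>i'\<in>UNIV. if i' = i then \<Sum>j\<in>UNIV. \<Gamma> k i j * y $ j else 0)"
      by (intro sum.cong refl) (simp add: a)
    then show "bil \<Gamma> (axis i 1) y $ k = (\<Sum>j\<in>UNIV. \<Gamma> k i j * y $ j)" by (simp add: bil_def)
  qed
  have sym: "\<Gamma> k i j = \<Gamma> k j i" for k i j
  proof -
    have "(\<chi> j. \<Gamma> k j i - \<Gamma> k i j) = 0"
    proof (rule inner_vanishes_on_open[OF opx])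
      show "y0 \<in> (\<lambda>y. (x, y)) -` D" using ne by simp
      fix y assume "y \<in> (\<lambda>y. (x, y)) -` D"
      then have xy: "(x, y) \<in> D" by simp
      have "((\<lambda>y. (x, y)) has_derivative (\<lambda>v. (0, v))) (at y)"
        by (intro has_derivative_Pair has_derivative_const has_derivative_ident)
      from diff_chain_at[OF this dG[OF xy]]
      have "((\<lambda>y. G k (x, y)) has_derivative (\<lambda>\<eta>. dirD (G k) (x, y) (0, \<eta>))) (at y)" by (simp add: o_def)
      moreover have "((\<lambda>y. G k (x, y)) has_derivative (\<lambda>\<eta>. 2 * (bil \<Gamma> y \<eta> $ k + bil \<Gamma> \<eta> y $ k))) (at y)"
        by (rule has_derivative_transform_within_open[OF has_derivative_mult_right[OF dbil] opx]) (use xy G\<Gamma> in auto)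
      ultimately have "(\<lambda>\<eta>. dirD (G k) (x, y) (0, \<eta>)) = (\<lambda>\<eta>. 2 * (bil \<Gamma> y \<eta> $ k + bil \<Gamma> \<eta> y $ k))"
          by (rule has_derivative_unique)
      then have "dirD (G k) (x, y) (0, axis i 1) = 2 * ((\<Sum>j\<in>UNIV. \<Gamma> k j i * y $ j) + (\<Sum>j\<in>UNIV. \<Gamma> k i j * y $ j))"
        by (metis axb)
      then have "(\<Sum>j\<in>UNIV. \<Gamma> k j i * y $ j) = (\<Sum>j\<in>UNIV. \<Gamma> k i j * y $ j)" using N[OF xy, of k i] ber[OF xy, of k i] by simp
      then show "(\<chi> j. \<Gamma> k j i - \<Gamma> k i j) \<bullet> y = 0" by (simp add: inner_vec_def left_diff_distrib sum_subtractf)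
    qed
    then show ?thesis by (simp add: vec_eq_iff)
  qed
  then show "\<Gamma> k i j = \<Gamma> k j i" .
  have bsym: "bil \<Gamma> v w = bil \<Gamma> w v" for v w
  proof -
    have "(\<Sum>i\<in>UNIV. \<Sum>j\<in>UNIV. \<Gamma> k i j * v $ i * w $ j) = (\<Sum>i\<in>UNIV. \<Sum>j\<in>UNIV. \<Gamma> k i j * w $ i * v $ j)" for k
      by (subst sum.swap, intro sum.cong refl, subst sym) (simp add: mult_ac)
    then show ?thesis by (simp add: bil_def)
  qed
  \<comment> \<open>The equation \<open>g G = S\<close>, with \<open>G = 2 bil \<Gamma> y y\<close>
    and \<open>g\<close> half the vertical Hessian of F^2, contracted with a vertical direction
    \<open>\<eta>\<close>.\<close>
  have spray: "\<Lambda>2 (x, y) (0, \<eta>) (0, bil \<Gamma> y y) = \<Lambda>2 (x, y) (0, \<eta>) (y, 0) - dirD \<Lambda> (x, y) (\<eta>, 0)" if xy: "(x, y) \<in> D" for y \<eta>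
  proof -
    define z where "z = (x, y)"
    have zD: "z \<in> D" and sz: "snd z = y" using xy by (simp_all add: z_def)
    have ax: "\<Lambda>2 z (0, axis k 1) (0, bil \<Gamma> y y) = S k z" for k
    proof -
      have "(\<chi> j. G j z) = matrix_inv (g z) *v (\<chi> k. S k z)" by (simp add: G_def matrix_vector_mult_def)
      then have "g z *v (\<chi> j. G j z) = (\<chi> k. S k z)"
        by (simp add: matrix_vector_mul_assoc matrix_inv_inverse inv[OF zD])
      then have "(\<Sum>j\<in>UNIV. g z $ k $ j * G j z) = S k z" by (simp add: matrix_vector_mult_def vec_eq_iff)
      moreover have "g z $ k $ j * G j z = bil \<Gamma> y y $ j * \<Lambda>2 z (0, axis k 1) (0, axis j 1)" for j
        using FT[OF xy, of k j] G\<Gamma>[OF xy, of j] by (simp add: g_def z_def)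
      ultimately show ?thesis using linear_Pair_expand(2)[OF lin2[OF zD], of "(0, axis k 1)" "bil \<Gamma> y y"] by simp
    qed
    have e: "\<Lambda>2 z (0, \<eta>) b = (\<Sum>k\<in>UNIV. \<eta> $ k * \<Lambda>2 z (0, axis k 1) b)" for b
      using linear_Pair_expand(2)[OF lin2[OF zD], of b \<eta>] by (simp add: comm[OF zD, of b])
    have "\<Lambda>2 z (0, \<eta>) (0, bil \<Gamma> y y) = (\<Sum>k\<in>UNIV. \<eta> $ k * \<Lambda>2 z (0, axis k 1) (y, 0)) - (\<Sum>k\<in>UNIV. \<eta> $ k * dirD \<Lambda> z
        (axis k 1, 0))"
      by (subst e) (simp add: ax S_def sz right_diff_distrib sum_subtractf)
    then show ?thesis using linear_Pair_expand(1)[OF lin1[OF zD], of \<eta>] e by (simp add: z_def)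
  qed
  have eu1: "\<Lambda>2 (x, y) (0, \<eta>) (0, y) = dirD \<Lambda> (x, y) (0, \<eta>)" if xy: "(x, y) \<in> D" for y \<eta>
  proof -
    have "\<Lambda>2 (x, y) (0, \<eta>) (0, y) = real 1 * dirD \<Lambda> (x, y) (0, \<eta>)"
    proof (rule euler_homogeneous[OF d2[OF xy]])
      fix t :: real assume t: "0 < t"
      have "t * dirD \<Lambda> (\<delta> t (x, y)) (0, \<eta>) = t\<^sup>2 * dirD \<Lambda> (x, y) (0, \<eta>)"
        using h1[OF xy t, of "(0, \<eta>)"] linear_scale[OF lin1[OF \<delta>D[OF xy t]]] unfolding \<delta>0 by (metis real_scaleR_def)
      then show "dirD \<Lambda> (x, t *\<^sub>R y) (0, \<eta>) = t ^ 1 * dirD \<Lambda> (x, y) (0, \<eta>)"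
        using t by (simp add: \<delta>_def power2_eq_square)
    qed
    then show ?thesis by simp
  qed
  have eu2: "\<Lambda>2 (x, y) (v, 0) (0, y) = 2 * dirD \<Lambda> (x, y) (v, 0)" if xy: "(x, y) \<in> D" for y v
  proof -
    have "\<Lambda>2 (x, y) (v, 0) (0, y) = real 2 * dirD \<Lambda> (x, y) (v, 0)"
      by (rule euler_homogeneous[OF d2[OF xy]]) (use h1[OF xy, of _ "(v, 0)"] in \<open>simp add: \<delta>_def\<close>)
    then show ?thesis by simp
  qed
  \<comment> \<open>\<open>spray\<close> at \<open>\<eta> = y\<close>: Euler's relations
    \<open>eu1\<close> and \<open>eu2\<close> reduce the second derivatives to first ones.\<close>
  have E0: "dirD \<Lambda> (x, y) (0, bil \<Gamma> y y) = dirD \<Lambda> (x, y) (y, 0)" if xy: "(x, y) \<in> D" for y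
    using spray[OF xy, of y] comm[OF xy, of "(0, y)"] eu1[OF xy] eu2[OF xy] by simp
  show "dirD \<Lambda> (x, y) (v, 0) = dirD \<Lambda> (x, y) (0, bil \<Gamma> v y)" if xy: "(x, y) \<in> D" for y v
  proof -
    \<comment> \<open>\<open>Z\<close> vanishes on the open fibre by \<open>E0\<close>, so its
      derivative \<open>Z'\<close> vanishes. The second derivatives in \<open>Z' v\<close> are those
      of \<open>spray\<close> at \<open>v\<close>; eliminating them leaves twice the claimed
      identity.\<close>
    define Z where "Z y = dirD \<Lambda> (x, y) (y, 0) - dirD \<Lambda> (x, y) (0, bil \<Gamma> y y)" for y
    define Z' where "Z' \<eta> = (\<Sum>i\<in>UNIV. y $ i * \<Lambda>2 (x, y) (axis i 1, 0) (0, \<eta>) + \<eta> $ i * dirD \<Lambda> (x, y) (axis i 1, 0))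
      - (\<Sum>i\<in>UNIV. bil \<Gamma> y y $ i * \<Lambda>2 (x, y) (0, axis i 1) (0, \<eta>) + (bil \<Gamma> y \<eta> $ i + bil \<Gamma> \<eta> y $ i) * dirD \<Lambda> (x, y)
          (0, axis i 1))" for \<eta>
    have dy: "((\<lambda>y. dirD \<Lambda> (x, y) a) has_derivative (\<lambda>\<eta>. \<Lambda>2 (x, y) a (0, \<eta>))) (at y)" for a
    proof -
      have "((\<lambda>y. (x, y)) has_derivative (\<lambda>v. (0, v))) (at y)"
        by (intro has_derivative_Pair has_derivative_const has_derivative_ident)
      from diff_chain_at[OF this d2[OF xy, of a]] show ?thesis by (simp add: o_def)
    qed
    have "((\<lambda>y. (\<Sum>i\<in>UNIV. y $ i * dirD \<Lambda> (x, y) (axis i 1, 0)) - (\<Sum>i\<in>UNIV. bil \<Gamma> y y $ i * dirD \<Lambda> (x, y) (0, axis i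
        1))) has_derivative Z') (at y)"
      unfolding Z'_def
      by (intro has_derivative_diff has_derivative_sum has_derivative_mult dy dbil
          bounded_linear_imp_has_derivative bounded_linear_vec_nth)
    then have "(Z has_derivative Z') (at y)"
      by (rule has_derivative_transform_within_open[OF _ opx])
        (use xy linear_Pair_expand(1,2)[OF lin1] in \<open>auto simp: Z_def\<close>)
    moreover have "(Z has_derivative (\<lambda>\<eta>. 0)) (at y)"
      by (rule has_derivative_transform_within_open[OF has_derivative_const opx]) (use xy E0 in \<open>auto simp: Z_def\<close>)
    ultimately have "Z' = (\<lambda>\<eta>. 0)" by (rule has_derivative_unique)
    then have "Z' v = 0" by simp
    moreover have "Z' v = \<Lambda>2 (x, y) (0, v) (y, 0) + dirD \<Lambda> (x, y) (v, 0) - (\<Lambda>2 (x, y) (0, v) (0, bil \<Gamma> y y)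
        + dirD \<Lambda> (x, y) (0, bil \<Gamma> y v + bil \<Gamma> v y))"
      unfolding Z'_def sum.distrib
      using linear_Pair_expand(1)[OF lin2[OF xy], of "(0, v)" y] linear_Pair_expand(2)[OF lin2[OF xy], of "(0, v)"
          "bil \<Gamma> y y"]
        linear_Pair_expand(1)[OF lin1[OF xy], of v] linear_Pair_expand(2)[OF lin1[OF xy], of "bil \<Gamma> y v + bil \<Gamma> v y"]
      by (simp add: comm[OF xy, of "(axis _ 1, 0)"] comm[OF xy, of "(0, axis _ 1)"])
    moreover have "dirD \<Lambda> (x, y) (0, bil \<Gamma> y v + bil \<Gamma> v y) = 2 * dirD \<Lambda> (x, y) (0, bil \<Gamma> v y)"
      using linear_add[OF lin1[OF xy], of "(0, bil \<Gamma> v y)" "(0, bil \<Gamma> v y)"] by (simp add: bsym[of y v])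
    ultimately show ?thesis using spray[OF xy, of v] by simp
  qed
qed

lemma bounded_bilinear_matrix_vector_mult: "bounded_bilinear (\<lambda>(A :: real^'n^'m) v. A *v v)"
  unfolding bilinear_conv_bounded_bilinear[symmetric] bilinear_def
  by (auto intro!: linearI simp: matrix_vector_right_distrib matrix_vector_mult_scaleR
      matrix_vector_mult_add_rdistrib scaleR_matrix_vector_assoc)

lemma derivative_symmetric:
  fixes M :: "real^'n \<Rightarrow> real^'n^'n"
  assumes d: "(M has_derivative M') (at x)" and "open U" "x \<in> U" and sym: "\<And>x v w. x \<in> U \<Longrightarrow> v \<bullet> (M x *v w) = w \<bullet> (M x *v v)"
  shows "v \<bullet> (M' k *v w) = w \<bullet> (M' k *v v)"
proof -
  have d: "((\<lambda>x. y \<bullet> (M x *v z)) has_derivative (\<lambda>v. y \<bullet> (M' v *v z))) (at x)" for y z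
    by (intro has_derivative_inner_right bounded_linear.has_derivative[OF
          bounded_bilinear.bounded_linear_left[OF bounded_bilinear_matrix_vector_mult] d])
  have "((\<lambda>x. v \<bullet> (M x *v w)) has_derivative (\<lambda>k. w \<bullet> (M' k *v v))) (at x)"
    by (rule has_derivative_transform_within_open[OF d assms(2,3)]) (rule sym)
  from has_derivative_unique[OF d this] show ?thesis by meson
qed

subsection \<open>Kropina metrics in a chart\<close>

text \<open>For the cubic \<open>f\<close>, the combination
  \<open>f(2d) - f(-2d) - 2 (f(d) - f(-d))\<close> removes all but the top term and equals
  \<open>12 c3 d^3\<close>.\<close>

lemma cubic_leading_coefficient:
  fixes c0 c1 c2 c3 d :: real
  assumes "d \<noteq> 0" "\<And>t. t \<in> {d, -d, 2 * d, -2 * d} \<Longrightarrow> c0 + c1 * t + c2 * t\<^sup>2 + c3 * t ^ 3 = 0"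
  shows "c3 = 0"
proof -
  have e: "c0 + c1 * d + c2 * d\<^sup>2 + c3 * d ^ 3 = 0" "c0 + c1 * (-d) + c2 * (-d)\<^sup>2 + c3 * (-d) ^ 3 = 0"
    "c0 + c1 * (2*d) + c2 * (2*d)\<^sup>2 + c3 * (2*d) ^ 3 = 0" "c0 + c1 * (-2*d) + c2 * (-2*d)\<^sup>2 + c3 * (-2*d) ^ 3 = 0"
    using assms(2) by (blast intro: insertI1 insertI2)+
  have "c3 * d ^ 3 * 12 = 0" using e by (simp add: power2_eq_square power3_eq_cube) algebra
  then show ?thesis using assms(1) by simp
qed

lemma open_line_segment:
  fixes y w :: "'a::real_normed_vector"
  assumes "open Y" "y \<in> Y"
  obtains d where "0 < d" "\<And>t. \<bar>t\<bar> \<le> d \<Longrightarrow> y + t *\<^sub>R w \<in> Y"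
proof -
  have "open ((\<lambda>t. y + t *\<^sub>R w) -` Y)" by (rule open_vimage[OF assms(1)]) (intro continuous_intros)
  moreover have "0 \<in> (\<lambda>t. y + t *\<^sub>R w) -` Y" using assms(2) by simp
  ultimately obtain e where "0 < e" "cball 0 e \<subseteq> (\<lambda>t. y + t *\<^sub>R w) -` Y" using open_contains_cball by blast
  then show thesis by (intro that[of e]) (auto simp: subset_iff dist_norm)
qed

lemma polarization:
  fixes p :: "'a::real_vector \<Rightarrow> 'a \<Rightarrow> real"
  assumes "bilinear p" "\<And>v w. p v w = p w v" "p (v + w) (v + w) = 0" "p v v = 0" "p w w = 0"
  shows "p v w = 0"
  using assms(3-5) assms(2)[of v w] by (simp add: bilinear_ladd[OF assms(1)] bilinear_radd[OF assms(1)])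

lemma bilinear_quadratic_expand:
  fixes p :: "'a::real_vector \<Rightarrow> 'a \<Rightarrow> real"
  assumes "bilinear p" "\<And>v w. p v w = p w v"
  shows "p (y + t *\<^sub>R w) (y + t *\<^sub>R w) = p y y + 2 * t * p y w + t\<^sup>2 * p w w"
  using assms(2)[of w y]
  by (simp add: bilinear_ladd[OF assms(1)] bilinear_radd[OF assms(1)] bilinear_lmul[OF assms(1)] bilinear_rmul[OF assms(1)]
      power2_eq_square algebra_simps)

text \<open>The second difference of the quadratic form along a line in direction \<open>w\<close>
  is a multiple of \<open>p w w\<close>.\<close>

lemma quadratic_vanishes_on_open:
  fixes p :: "'a::real_normed_vector \<Rightarrow> 'a \<Rightarrow> real"
  assumes "bilinear p" "\<And>v w. p v w = p w v" "open Y" "y \<in> Y" "\<And>y. y \<in> Y \<Longrightarrow> p y y = 0"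
  shows "p v w = 0"
proof -
  have "p w w = 0" for w
  proof -
    obtain d where d: "0 < d" "\<And>t. \<bar>t\<bar> \<le> d \<Longrightarrow> y + t *\<^sub>R w \<in> Y" using open_line_segment[OF assms(3,4)] by blast
    have "p y y = 0" "p (y + d *\<^sub>R w) (y + d *\<^sub>R w) = 0" "p (y + (-d) *\<^sub>R w) (y + (-d) *\<^sub>R w) = 0"
      using assms(5)[OF assms(4)] assms(5)[OF d(2)[of d]] assms(5)[OF d(2)[of "-d"]] d(1) by simp_all
    then show ?thesis using d(1) unfolding bilinear_quadratic_expand[OF assms(1,2)] by simp
  qed
  then show ?thesis using polarization[OF assms(1,2)] by blast
qed

text \<open>Since the quadratic form \<open>p\<close> has rank at least 3, it does not vanish on a hyperplane, so the
  linear form \<open>B\<close> does not divide it and must divide \<open>l\<close>.\<close>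

lemma linear_form_divides:
  fixes p q :: "real^'n \<Rightarrow> real^'n \<Rightarrow> real" and B l :: "real^'n"
  assumes card: "CARD('n) > 2" and p: "bilinear p" "\<And>v w. p v w = p w v" and nd: "\<And>y. (\<And>z. p y z = 0) \<Longrightarrow> y = 0"
    and q: "bilinear q" "\<And>v w. q v w = q w v" and B: "B \<noteq> 0" and Y: "open Y" "y0 \<in> Y"
    and eq: "\<And>y. y \<in> Y \<Longrightarrow> p y y \<noteq> 0 \<Longrightarrow> B \<bullet> y \<noteq> 0 \<Longrightarrow> (B \<bullet> y) * q y y = p y y * (l \<bullet> y)"
  obtains \<omega> where "l = \<omega> *\<^sub>R B" "\<And>v w. q v w = \<omega> * p v w"
proof -
  have cB: "continuous_on UNIV (\<lambda>y. B \<bullet> y)" by (intro continuous_intros)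
  have cp: "continuous_on UNIV (\<lambda>y. p y y)"
    using bounded_bilinear.continuous_on[OF bilinear_conv_bounded_bilinear[THEN iffD1, OF p(1)] continuous_on_id
        continuous_on_id] by simp
  define Y1 where "Y1 = Y \<inter> {y. B \<bullet> y \<noteq> 0}"
  have o1: "open Y1" unfolding Y1_def using Y(1) cB by (intro open_Int open_Collect_neq continuous_intros) auto
  have "\<exists>y\<in>Y. B \<bullet> y \<noteq> 0" using inner_vanishes_on_open[OF Y] B by blast
  then obtain y1 where y1: "y1 \<in> Y1" by (auto simp: Y1_def)
  have "\<exists>y\<in>Y1. p y y \<noteq> 0"
    using quadratic_vanishes_on_open[OF p o1 y1] nd[of B] B by blast
  then obtain y2 where y2: "y2 \<in> Y1" "p y2 y2 \<noteq> 0" by blast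
  \<comment> \<open>The region where \<open>eq\<close> is available; it is nonempty because neither
    the linear form \<open>B\<close> nor the quadratic form \<open>p\<close> vanishes on an open
    set.\<close>
  define Y2 where "Y2 = Y1 \<inter> {y. p y y \<noteq> 0}"
  have o2: "open Y2" unfolding Y2_def using o1 cp by (intro open_Int open_Collect_neq continuous_intros) auto
  have y2': "y2 \<in> Y2" using y2 by (simp add: Y2_def)
  \<comment> \<open>Along the line \<open>y2 + t w\<close> the identity is a cubic polynomial in
    \<open>t\<close> that vanishes near 0; its leading coefficient is the identity at
    \<open>w\<close> itself.\<close>
  have cubic: "(B \<bullet> w) * q w w = p w w * (l \<bullet> w)" for w
  proof -
    obtain d where d: "0 < d" "\<And>t. \<bar>t\<bar> \<le> d \<Longrightarrow> y2 + t *\<^sub>R w \<in> Y2" using open_line_segment[OF o2 y2'] by blast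
    have "(B \<bullet> w) * q w w - p w w * (l \<bullet> w) = 0"
    proof (rule cubic_leading_coefficient)
      show "d / 2 \<noteq> 0" using d by simp
      fix t assume "t \<in> {d / 2, - (d / 2), 2 * (d / 2), - 2 * (d / 2)}"
      then have "y2 + t *\<^sub>R w \<in> Y2" using d by (intro d(2)) auto
      then have "(B \<bullet> (y2 + t *\<^sub>R w)) * q (y2 + t *\<^sub>R w) (y2 + t *\<^sub>R w) = p (y2 + t *\<^sub>R w) (y2 + t *\<^sub>R w) * (l \<bullet> (y2
          + t *\<^sub>R w))"
        by (intro eq) (auto simp: Y2_def Y1_def)
      then show "((B \<bullet> y2) * q y2 y2 - p y2 y2 * (l \<bullet> y2))
        + ((B \<bullet> w) * q y2 y2 + 2 * (B \<bullet> y2) * q y2 w - p y2 y2 * (l \<bullet> w) - 2 * p y2 w * (l \<bullet> y2)) * t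
        + ((B \<bullet> y2) * q w w + 2 * (B \<bullet> w) * q y2 w - p w w * (l \<bullet> y2) - 2 * p y2 w * (l \<bullet> w)) * t\<^sup>2
        + ((B \<bullet> w) * q w w - p w w * (l \<bullet> w)) * t ^ 3 = 0"
        unfolding bilinear_quadratic_expand[OF p] bilinear_quadratic_expand[OF q] inner_add_right inner_scaleR_right
        by (simp add: power2_eq_square power3_eq_cube algebra_simps)
    qed
    then show ?thesis by simp
  qed
  define e where "e = B /\<^sub>R (B \<bullet> B)"
  have Be: "B \<bullet> e = 1" using B by (simp add: e_def)
  \<comment> \<open>If \<open>l\<close> is nonzero at a point of the kernel of \<open>B\<close>,
    then \<open>cubic\<close> makes \<open>p\<close> vanish near that point within the kernel, hence
    on the whole kernel.\<close>
  have lker: "l \<bullet> z = 0" if z: "B \<bullet> z = 0" for z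
  proof (rule ccontr)
    assume lz: "l \<bullet> z \<noteq> 0"
    have pz: "p w w = 0" if w: "B \<bullet> w = 0" for w
    proof -
      define d where "d = \<bar>l \<bullet> z\<bar> / (2 * (\<bar>l \<bullet> w\<bar> + 1))"
      have d: "0 < d" using lz by (simp add: d_def)
      have dw: "d * \<bar>l \<bullet> w\<bar> < \<bar>l \<bullet> z\<bar>"
      proof -
        have "d * (2 * (\<bar>l \<bullet> w\<bar> + 1)) = \<bar>l \<bullet> z\<bar>" by (simp add: d_def)
        then show ?thesis using d lz by (simp add: algebra_simps)
      qed
      have "p (z + t *\<^sub>R w) (z + t *\<^sub>R w) = 0" if t: "\<bar>t\<bar> \<le> d" for t
      proof -
        have "\<bar>t * (l \<bullet> w)\<bar> \<le> d * \<bar>l \<bullet> w\<bar>" unfolding abs_mult using t by (intro mult_right_mono) auto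
        then have "l \<bullet> (z + t *\<^sub>R w) \<noteq> 0" using dw by (simp add: inner_add_right)
        moreover have "B \<bullet> (z + t *\<^sub>R w) = 0" using z w by (simp add: inner_add_right)
        ultimately show ?thesis using cubic[of "z + t *\<^sub>R w"] by simp
      qed
      from this[of 0] this[of d] this[of "-d"] have "p z z = 0" "p (z + d *\<^sub>R w) (z + d *\<^sub>R w) = 0"
          "p (z + (-d) *\<^sub>R w) (z + (-d) *\<^sub>R w) = 0"
        using d by simp_all
      then show ?thesis using d(1) unfolding bilinear_quadratic_expand[OF p] by simp
    qed
    have pker: "p v w = 0" if "B \<bullet> v = 0" "B \<bullet> w = 0" for v w
      by (rule polarization[OF p]) (use that pz in \<open>simp_all add: inner_add_right\<close>)
    have pe: "v = 0" if "B \<bullet> v = 0" "p v e = 0" for v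
    proof (rule nd)
      fix w
      have "p v ((w - (B \<bullet> w) *\<^sub>R e) + (B \<bullet> w) *\<^sub>R e) = 0"
        unfolding bilinear_radd[OF p(1)] bilinear_rmul[OF p(1)] using that by (simp add: pker inner_diff_right Be)
      then show "p v w = 0" by simp
    qed
    obtain i where i: "B $ i \<noteq> 0" using B by (auto simp: vec_eq_iff)
    have "card (UNIV - {i}) > 1" using card by (simp add: card_Diff_subset)
    then have "\<not> (\<forall>j\<in>UNIV - {i}. \<forall>k\<in>UNIV - {i}. j = k)"
      using card_le_Suc0_iff_eq[of "UNIV - {i}"] by simp
    then obtain j k where jk: "j \<noteq> i" "k \<noteq> i" "j \<noteq> k" by blast
    \<comment> \<open>Two independent vectors in the kernel of \<open>B\<close>, which exist because
      n > 2. The combination of them that is \<open>p\<close>-orthogonal to \<open>e\<close> lies in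
      the radical of \<open>p\<close>, so it is zero and its coefficients vanish; then
      \<open>z2\<close> itself lies in the radical, a contradiction.\<close>
    define z1 :: "real^'n" where "z1 = B $ i *\<^sub>R axis j 1 - B $ j *\<^sub>R axis i 1"
    define z2 :: "real^'n" where "z2 = B $ i *\<^sub>R axis k 1 - B $ k *\<^sub>R axis i 1"
    have z12: "B \<bullet> z1 = 0" "B \<bullet> z2 = 0" by (simp_all add: z1_def z2_def inner_diff_right inner_axis)
    have "p z2 e *\<^sub>R z1 - p z1 e *\<^sub>R z2 = 0"
      by (rule pe) (simp_all add: inner_diff_right z12 bilinear_lsub[OF p(1)] bilinear_lmul[OF p(1)])
    then have "(p z2 e *\<^sub>R z1 - p z1 e *\<^sub>R z2) $ j = 0" by simp
    then have "p z2 e = 0" using jk i by (simp add: z1_def z2_def axis_def)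
    then have "z2 $ k = 0" using pe[OF z12(2)] by simp
    then show False using jk i by (simp add: z2_def axis_def)
  qed
  define \<omega> where "\<omega> = (l \<bullet> B) / (B \<bullet> B)"
  have lB: "l = \<omega> *\<^sub>R B"
  proof -
    have "B \<bullet> (l - \<omega> *\<^sub>R B) = 0" using B by (simp add: \<omega>_def inner_diff_right inner_commute)
    then have "l \<bullet> (l - \<omega> *\<^sub>R B) = 0" by (rule lker)
    then have "(l - \<omega> *\<^sub>R B) \<bullet> (l - \<omega> *\<^sub>R B) = 0"
      using \<open>B \<bullet> (l - \<omega> *\<^sub>R B) = 0\<close> by (simp add: inner_diff_left)
    then show ?thesis by simp
  qed
  define r where "r v w = q v w - \<omega> * p v w" for v w
  have r: "bilinear r" "r v w = r w v" for v w
    unfolding r_def using p q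
        by (auto simp: bilinear_def intro!: linear_compose_sub linear_compose_scale_right[where 'b = real, simplified])
  have r0: "r w w = 0" if "B \<bullet> w \<noteq> 0" for w
    using cubic[of w] that by (simp add: r_def lB algebra_simps)
  \<comment> \<open>Off the kernel of \<open>B\<close> one divides \<open>cubic\<close> by
    \<open>B \<bullet> w\<close>; a vector of the kernel is reached through the points
    \<open>e\<close>, \<open>e + w\<close> and \<open>e - w\<close> outside it.\<close>
  have rw: "r w w = 0" for w
  proof (cases "B \<bullet> w = 0")
    case True
    have "r e e = 0" "r (e + 1 *\<^sub>R w) (e + 1 *\<^sub>R w) = 0" "r (e + (-1) *\<^sub>R w) (e + (-1) *\<^sub>R w) = 0"
      by (rule r0; simp add: Be True inner_add_right inner_diff_right)+
    then show ?thesis unfolding bilinear_quadratic_expand[OF r] by simp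
  qed (rule r0)
  have "r v w = 0" for v w using polarization[OF r] rw by blast
  then show thesis by (intro that[OF lB]) (simp add: r_def)
qed

text \<open>Squaring removes the sign, since a negative base occurs only with an integer exponent.
  Thus one logarithmic formula describes F^2 on all regions where a(y,y) and b(y) are
  nonzero.\<close>

lemma rpow_square:
  assumes "t \<noteq> 0" "rpow_defined t p"
  shows "(rpow t p)\<^sup>2 = exp (p * ln (t\<^sup>2))"
proof (cases "p \<in> \<int>")
  case True
  then obtain n where n: "p = of_int n" by (auto elim: Ints_cases)
  have "(rpow t p)\<^sup>2 = (t\<^sup>2) powi n"
    by (simp add: rpow_def n power_int_power power_int_power' mult.commute)
  also have "\<dots> = exp (ln (t\<^sup>2)) powi n" using assms(1) by simp
  also have "\<dots> = exp (p * ln (t\<^sup>2))" by (simp add: n exp_power_int)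
  finally show ?thesis .
next
  case False
  then have "t > 0" using assms by (auto simp: rpow_defined_def)
  then show ?thesis using False
    by (simp add: rpow_def powr_def exp_double[symmetric] ln_realpow mult.left_commute)
qed

lemma rpow_simps:
  "rpow t 0 = 1" "rpow t 1 = t" "rpow t 2 = t\<^sup>2" "rpow t (-1) = inverse t" "0 < p \<Longrightarrow> rpow 0 p = 0"
proof -
  show "rpow t 0 = 1" "rpow t 1 = t" by (simp_all add: rpow_def)
  have "(2::real) \<in> \<int>" "(-1::real) \<in> \<int>" by simp_all
  then show "rpow t 2 = t\<^sup>2" "rpow t (-1) = inverse t"
    using floor_of_int[of "-1", where 'a = real] by (simp_all add: rpow_def power_int_minus)
  assume "0 < p"
  then show "rpow 0 p = 0" by (auto simp: rpow_def power_int_0_left_if elim!: Ints_cases)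
qed

text \<open>The square makes the logarithmic derivative available for either sign of
  \<open>P\<close>.\<close>

lemma has_derivative_ln_square:
  fixes P :: "'a::real_normed_vector \<Rightarrow> real"
  assumes "(P has_derivative P') (at z)" "P z \<noteq> 0"
  shows "((\<lambda>z. ln ((P z)\<^sup>2)) has_derivative (\<lambda>a. 2 * P' a / P z)) (at z)"
proof -
  have "((\<lambda>z. (P z)\<^sup>2) has_derivative (\<lambda>a. 2 * P z * P' a)) (at z)"
    using assms(1) by (auto intro!: derivative_eq_intros)
  moreover have "0 < (P z)\<^sup>2" using assms(2) by simp
  ultimately have "((\<lambda>z. ln ((P z)\<^sup>2)) has_derivative (\<lambda>a. 2 * P z * P' a * inverse ((P z)\<^sup>2))) (at z)"
    by (intro DERIV_compose_FDERIV[OF DERIV_ln])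
  moreover have "(\<lambda>a. 2 * P z * P' a * inverse ((P z)\<^sup>2)) = (\<lambda>a. 2 * P' a / P z)"
    using assms(2) by (simp add: field_simps power2_eq_square)
  ultimately show ?thesis by simp
qed

text \<open>The situation read in one chart: \<open>M\<close> is the matrix of a, \<open>B\<close>
  the component vector of b, \<open>f\<close> the function F and \<open>D\<close> the image of the
  cone A. The Berwald condition and |b|^2 = 0 appear as hypotheses of the individual lemmas.\<close>

locale kropina_chart =
  fixes M :: "real^'n \<Rightarrow> real^'n^'n" and B :: "real^'n \<Rightarrow> real^'n" and f :: "real^'n \<Rightarrow> real^'n \<Rightarrow> real"
    and D :: "((real^'n) \<times> (real^'n)) set" and U :: "(real^'n) set" and m :: real
  assumes card: "CARD('n) > 2" and m0: "m \<noteq> 0" and opU: "open U" and opD: "open D"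
    and DU: "\<And>x y. (x, y) \<in> D \<Longrightarrow> x \<in> U"
    and smM: "smooth_on U M" and smB: "smooth_on U B"
    and symM: "\<And>x v w. x \<in> U \<Longrightarrow> v \<bullet> (M x *v w) = w \<bullet> (M x *v v)"
    and invM: "\<And>x. x \<in> U \<Longrightarrow> invertible (M x)"
    and smf: "smooth_on D (\<lambda>(x, y). f x y)"
    and cone: "\<And>x y t. (x, y) \<in> D \<Longrightarrow> 0 < t \<Longrightarrow> (x, t *\<^sub>R y) \<in> D"
    and hom: "\<And>x y t. (x, y) \<in> D \<Longrightarrow> 0 < t \<Longrightarrow> f x (t *\<^sub>R y) = t * f x y"
    and nondeg: "\<And>x y. (x, y) \<in> D \<Longrightarrow> invertible (fundamental_tensor f x y)"
    and rdef: "\<And>x y. (x, y) \<in> D \<Longrightarrow> rpow_defined (sqrt \<bar>y \<bullet> (M x *v y)\<bar>) (1 + m) \<and> rpow_defined (B x \<bullet> y) (- m)"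
    and f_eq: "\<And>x y. (x, y) \<in> D \<Longrightarrow> f x y = rpow (sqrt \<bar>y \<bullet> (M x *v y)\<bar>) (1 + m) * rpow (B x \<bullet> y) (- m)"
begin

definition p where "p x v w = v \<bullet> (M x *v w)"

lemma bilinear_p: "bilinear (p x)"
  unfolding p_def bilinear_def
  by (auto intro!: linearI simp: inner_add_left inner_add_right matrix_vector_right_distrib matrix_vector_mult_scaleR)

lemma p_sym: "x \<in> U \<Longrightarrow> p x v w = p x w v"
  unfolding p_def by (rule symM)

lemma p_nondeg:
  assumes "x \<in> U" "\<And>z. p x y z = 0"
  shows "y = 0"
proof -
  have "p x y (matrix_inv (M x) *v y) = 0" by (rule assms(2))
  then show ?thesis by (simp add: p_def matrix_vector_mul_assoc matrix_inv_inverse invM assms(1))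
qed

lemma open_fibre: "open {y. (x, y) \<in> D}"
proof -
  have "open ((\<lambda>y. (x, y)) -` D)" by (rule open_vimage[OF opD]) (intro continuous_intros)
  then show ?thesis by (simp add: vimage_def)
qed

text \<open>The form in which nondegeneracy is used: if F^2 has a known expression \<phi> on part of
  a fibre, a vector in the kernel of the Hessian of \<phi> must be zero. Exhibiting a nonzero one
  refutes the assumption that led to \<phi>.\<close>

lemma fibre_nondegenerate:
  assumes xy: "(x, y) \<in> D" and Y: "open Y" "y \<in> Y" and \<phi>: "\<And>y. y \<in> Y \<Longrightarrow> (f x y)\<^sup>2 = \<phi> y" "smooth_on Y \<phi>"
    and null: "\<And>v. dirD (\<lambda>y. dirD \<phi> y w) y v = 0"
  shows "w = 0"
proof -
  note dd = smooth_on_has_derivative[OF smooth_on_dirD[OF \<phi>(2)]]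
  have "pdy j (\<lambda>x y. 1 / 2 * (f x y)\<^sup>2) x y = 1 / 2 * dirD \<phi> y (axis j 1)" if "y \<in> Y" for j y
  proof -
    have "((\<lambda>y. 1 / 2 * (f x y)\<^sup>2) has_derivative (\<lambda>v. 1 / 2 * dirD \<phi> y v)) (at y)"
      by (rule has_derivative_transform_within_open[OF has_derivative_mult_right[OF smooth_on_has_derivative[OF \<phi>(2)
          that]] Y(1) that])
         (simp add: \<phi>(1))
    then show ?thesis by (simp add: pdy_def pd_def dirD_eqI)
  qed
  then have "((\<lambda>y. pdy j (\<lambda>x y. 1 / 2 * (f x y)\<^sup>2) x y) has_derivative (\<lambda>v. 1 / 2 * dirD (\<lambda>y. dirD \<phi> y (axis j 1)) y
      v)) (at y)" for j
    by (intro has_derivative_transform_within_open[OF has_derivative_mult_right[OF dd[OF Y(2)]] Y]) simp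
  then have e: "dirD (pdy j (\<lambda>x y. 1 / 2 * (f x y)\<^sup>2) x) y = (\<lambda>v. 1 / 2 * dirD (\<lambda>y. dirD \<phi> y (axis j 1)) y v)" for j
    by (rule dirD_eqI)
  have FT: "fundamental_tensor f x y $ i $ j = 1 / 2 * dirD (\<lambda>y. dirD \<phi> y (axis j 1)) y (axis i 1)" for i j
    unfolding fundamental_tensor_def by (simp only: vec_lambda_beta pdy_def[of i] pd_def e)
  have "(fundamental_tensor f x y *v w) $ i = 0" for i
  proof -
    have lin: "linear (dirD (\<lambda>y. dirD \<phi> y (axis i 1)) y)" using dd[OF Y(2)] by (rule has_derivative_linear)
    have "(fundamental_tensor f x y *v w) $ i = 1 / 2 * (\<Sum>j\<in>UNIV. w $ j * dirD (\<lambda>y. dirD \<phi> y (axis i 1)) y (axis j 1))"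
      by (simp add: matrix_vector_mult_def FT dirD_commute[OF Y(1) \<phi>(2) Y(2), of _ "axis i 1"] sum_distrib_left mult_ac)
    also have "(\<Sum>j\<in>UNIV. w $ j * dirD (\<lambda>y. dirD \<phi> y (axis i 1)) y (axis j 1))
        = dirD (\<lambda>y. dirD \<phi> y (axis i 1)) y (\<Sum>j\<in>UNIV. w $ j *\<^sub>R axis j 1)"
      by (simp add: linear_sum[OF lin] linear_scale[OF lin])
    also have "\<dots> = dirD (\<lambda>y. dirD \<phi> y w) y (axis i 1)"
      by (simp add: vec_eq_sum_axis[symmetric] dirD_commute[OF Y(1) \<phi>(2) Y(2), of "axis i 1"])
    finally show ?thesis by (simp add: null)
  qed
  then have "matrix_inv (fundamental_tensor f x y) *v (fundamental_tensor f x y *v w) = 0"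
    by (simp add: vec_eq_iff[of _ 0] matrix_vector_mult_def)
  then show ?thesis
    by (simp add: matrix_vector_mul_assoc matrix_inv_inverse nondeg[OF xy])
qed

text \<open>If b vanished at \<open>x\<close>, the power of 0 with exponent -m would be defined only
  for m < 0, where it is 0. Then F vanishes on the fibre and every vector lies in the kernel of the
  Hessian.\<close>

lemma B_nonzero:
  assumes xy: "(x, y) \<in> D"
  shows "B x \<noteq> 0"
proof
  assume B: "B x = 0"
  have "0 < - m" using rdef[OF xy] m0 B by (simp add: rpow_defined_def)
  have "axis undefined 1 = (0 :: real^'n)"
    by (rule fibre_nondegenerate[OF xy open_fibre, where \<phi> = "\<lambda>y. 0"])
       (use xy f_eq B rpow_simps(5)[OF \<open>0 < - m\<close>] smooth_on_const[OF open_fibre] in auto)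
  then show False by simp
qed

text \<open>For m = -1 the metric is the 1-form \<beta> alone, and the Hessian of its square has
  rank at most 1.\<close>

lemma m_neq_minus_1:
  assumes xy: "(x, y) \<in> D"
  shows "m \<noteq> - 1"
proof
  assume m: "m = - 1"
  have "2 \<le> DIM(real^'n)" using card by simp
  then obtain w where w: "w \<noteq> 0" "B x \<bullet> w = 0"
    using orthogonal_to_vector_exists[of "B x"] by (auto simp: orthogonal_def)
  have d: "dirD (\<lambda>y. (B x \<bullet> y)\<^sup>2) y v = 2 * (B x \<bullet> y) * (B x \<bullet> v)" for y v
    by (subst dirD_eqI) (auto intro!: derivative_eq_intros)
  have "w = 0"
  proof (rule fibre_nondegenerate[OF xy open_fibre, where \<phi> = "\<lambda>y. (B x \<bullet> y)\<^sup>2"])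
    show "smooth_on {y. (x, y) \<in> D} (\<lambda>y. (B x \<bullet> y)\<^sup>2)"
      unfolding power2_eq_square
      by (intro smooth_on_mult smooth_on_inner smooth_on_const smooth_on_ident open_fibre)
  qed (use xy f_eq m w in \<open>auto simp: d rpow_simps\<close>)
  with w show False by simp
qed

text \<open>Neither a nonzero linear form nor a nondegenerate quadratic form vanishes on a nonempty
  open set, so every nonempty fibre contains vectors at which the logarithmic formula
  applies.\<close>

lemma exists_regular_vector:
  assumes xy: "(x, y) \<in> D"
  obtains y' where "(x, y') \<in> D" "p x y' y' \<noteq> 0" "B x \<bullet> y' \<noteq> 0"
proof -
  have "\<exists>y\<in>{y. (x, y) \<in> D}. B x \<bullet> y \<noteq> 0"
    using inner_vanishes_on_open[OF open_fibre] B_nonzero[OF xy] xy by blast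
  then obtain y1 where y1: "y1 \<in> {y. (x, y) \<in> D} \<inter> {y. B x \<bullet> y \<noteq> 0}" by blast
  have o: "open ({y. (x, y) \<in> D} \<inter> {y. B x \<bullet> y \<noteq> 0})"
    by (intro open_Int open_fibre open_Collect_neq continuous_intros)
  have "\<exists>y\<in>{y. (x, y) \<in> D} \<inter> {y. B x \<bullet> y \<noteq> 0}. p x y y \<noteq> 0"
    using quadratic_vanishes_on_open[OF bilinear_p p_sym[OF DU[OF xy]] o y1] p_nondeg[OF DU[OF xy]] B_nonzero[OF xy] by blast
  then show thesis using that by blast
qed

text \<open>For \<open>m = 1\<close> and \<open>b\<close> null, \<open>a\<^sup>i\<^sup>jb\<^sub>j - (2\<beta>/\<alpha>\<^sup>2) y\<^sup>i\<close> is in the kernel of the fundamental tensor.\<close>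

lemma m_neq_1:
  assumes xy: "(x, y) \<in> D" and null: "B x \<bullet> (matrix_inv (M x) *v B x) = 0"
  shows "m \<noteq> 1"
proof
  assume m: "m = 1"
  obtain y0 where y0: "(x, y0) \<in> D" "p x y0 y0 \<noteq> 0" "B x \<bullet> y0 \<noteq> 0" using exists_regular_vector[OF xy] by blast
  have xU: "x \<in> U" by (rule DU[OF xy])
  define n where "n = matrix_inv (M x) *v B x"
  have pn: "p x y n = B x \<bullet> y" for y
    by (simp add: p_def n_def matrix_vector_mul_assoc matrix_inv_inverse invM[OF xU] inner_commute)
  have Bn: "B x \<bullet> n = 0" using null by (simp add: n_def)
  define P where "P y = p x y y" for y
  define \<beta> where "\<beta> y = B x \<bullet> y" for y
  define Y where "Y = {y. (x, y) \<in> D} \<inter> {y. P y \<noteq> 0} \<inter> {y. \<beta> y \<noteq> 0}"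
  have cP: "continuous_on UNIV P"
    unfolding P_def
        using bounded_bilinear.continuous_on[OF bilinear_conv_bounded_bilinear[THEN iffD1, OF bilinear_p]
        continuous_on_id continuous_on_id] by simp
  have c\<beta>: "continuous_on UNIV \<beta>" unfolding \<beta>_def by (intro continuous_intros)
  have Y: "open Y" unfolding Y_def using cP c\<beta> by (intro open_Int open_fibre open_Collect_neq continuous_on_const)
  have y0Y: "y0 \<in> Y" using y0 by (simp add: Y_def P_def \<beta>_def)
  have dP: "(P has_derivative (\<lambda>v. 2 * p x v y)) (at y)" for y
  proof -
    have "(P has_derivative (\<lambda>v. p x y v + p x v y)) (at y)"
      unfolding P_def
      by (rule bounded_bilinear.FDERIV[OF bilinear_conv_bounded_bilinear[THEN iffD1, OF bilinear_p]
          has_derivative_ident has_derivative_ident])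
    then show ?thesis by (simp add: p_sym[OF xU, of y])
  qed
  have d\<beta>: "(\<beta> has_derivative \<beta>) (at y)" for y unfolding \<beta>_def by (auto intro!: derivative_eq_intros)
  define \<phi> where "\<phi> y = (P y / \<beta> y)\<^sup>2" for y
  have "smooth_on Y P"
    unfolding P_def p_def
    by (intro smooth_on_inner smooth_on_ident smooth_on_bounded_linear[OF _ matrix_vector_mul_bounded_linear] Y)
  moreover have "smooth_on Y \<beta>" unfolding \<beta>_def by (intro smooth_on_inner smooth_on_const smooth_on_ident Y)
  ultimately have sm\<phi>: "smooth_on Y \<phi>"
    unfolding \<phi>_def power2_eq_square by (intro smooth_on_mult smooth_on_divide Y) (auto simp: Y_def)
  have d\<phi>: "dirD \<phi> y v = 2 * (P y / \<beta> y) * (2 * p x v y / \<beta> y - P y * \<beta> v / (\<beta> y)\<^sup>2)" if "y \<in> Y" for y v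
  proof -
    have b: "\<beta> y \<noteq> 0" using that by (simp add: Y_def)
    have "(\<phi> has_derivative (\<lambda>v. 2 * (P y / \<beta> y) * (2 * p x v y / \<beta> y - P y * \<beta> v / (\<beta> y)\<^sup>2))) (at y)"
      unfolding \<phi>_def using b
      by (auto intro!: derivative_eq_intros dP d\<beta> simp: field_simps power2_eq_square)
    then show ?thesis by (simp add: dirD_eqI)
  qed
  \<comment> \<open>\<beta> vanishes on the null vector \<open>n\<close>, and subtracting
    \<open>c y0\<close> with this \<open>c\<close> makes the derivative of
    \<open>dirD \<phi> y w\<close> vanish at \<open>y0\<close>. The vector \<open>w\<close> is
    nonzero because \<open>\<beta> w = - c * \<beta> y0\<close>.\<close>
  define c where "c = 2 * \<beta> y0 / P y0"
  define w where "w = n - c *\<^sub>R y0"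
  have nz: "P y0 \<noteq> 0" "\<beta> y0 \<noteq> 0" using y0Y by (auto simp: Y_def)
  define \<psi> where "\<psi> y = 2 * (P y / \<beta> y) * (2 - c * (2 * p x y y0 / \<beta> y - P y * \<beta> y0 / (\<beta> y)\<^sup>2))" for y
  have dw: "dirD \<phi> y w = \<psi> y" if "y \<in> Y" for y
  proof -
    have b: "\<beta> y \<noteq> 0" using that by (simp add: Y_def)
    have e1: "p x w y = \<beta> y - c * p x y y0"
      unfolding w_def bilinear_lsub[OF bilinear_p] bilinear_lmul[OF bilinear_p]
      using pn[of y] by (simp add: p_sym[OF xU, of n] p_sym[OF xU, of y0] \<beta>_def)
    have e2: "\<beta> w = - c * \<beta> y0" using Bn by (simp add: w_def \<beta>_def inner_diff_right)
    show ?thesis unfolding d\<phi>[OF that] \<psi>_def e1 e2 using b by (simp add: field_simps power2_eq_square)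
  qed
  have dpy: "((\<lambda>y. p x y y0) has_derivative (\<lambda>v. p x v y0)) (at y)" for y
    using bounded_bilinear.bounded_linear_left[OF bilinear_conv_bounded_bilinear[THEN iffD1, OF bilinear_p]]
        by (rule bounded_linear_imp_has_derivative)
  have "(\<psi> has_derivative (\<lambda>v. 0)) (at y0)"
    unfolding \<psi>_def using nz
    by (auto intro!: derivative_eq_intros dP d\<beta> dpy simp: c_def P_def[symmetric] field_simps power2_eq_square)
  then have d0: "((\<lambda>y. dirD \<phi> y w) has_derivative (\<lambda>v. 0)) (at y0)"
    by (rule has_derivative_transform_within_open[OF _ Y y0Y]) (simp add: dw)
  have "w = 0"
  proof (rule fibre_nondegenerate[OF y0(1) Y y0Y _ sm\<phi>])
    fix y assume "y \<in> Y"
    then have "(x, y) \<in> D" by (simp add: Y_def)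
    from f_eq[OF this] show "(f x y)\<^sup>2 = \<phi> y"
      by (simp add: m rpow_simps \<phi>_def P_def p_def \<beta>_def divide_inverse power_mult_distrib)
  qed (simp add: dirD_eqI[OF d0])
  then have "B x \<bullet> w = 0" by simp
  then show False using Bn nz by (simp add: w_def inner_diff_right c_def \<beta>_def)
qed

text \<open>The coefficient (1 + m)/2 arises because \<alpha>^2 is the absolute value of P = a(y,y),
  whose logarithm is half that of P^2.\<close>

lemma square_f:
  assumes "(x, y) \<in> D" "p x y y \<noteq> 0" "B x \<bullet> y \<noteq> 0"
  shows "(f x y)\<^sup>2 = exp ((1 + m) / 2 * ln ((p x y y)\<^sup>2) - m * ln ((B x \<bullet> y)\<^sup>2))"
proof -
  have "(rpow (sqrt \<bar>p x y y\<bar>) (1 + m))\<^sup>2 = exp ((1 + m) * ln ((sqrt \<bar>p x y y\<bar>)\<^sup>2))"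
    by (rule rpow_square) (use assms rdef[OF assms(1)] in \<open>auto simp: p_def\<close>)
  also have "(sqrt \<bar>p x y y\<bar>)\<^sup>2 = \<bar>p x y y\<bar>" by simp
  also have "ln \<bar>p x y y\<bar> = ln ((p x y y)\<^sup>2) / 2"
    by (metis ln_realpow power2_abs of_nat_numeral nonzero_mult_div_cancel_left zero_neq_numeral)
  finally have "(rpow (sqrt \<bar>p x y y\<bar>) (1 + m))\<^sup>2 = exp ((1 + m) / 2 * ln ((p x y y)\<^sup>2))" by simp
  moreover have "(rpow (B x \<bullet> y) (- m))\<^sup>2 = exp (- m * ln ((B x \<bullet> y)\<^sup>2))"
    by (rule rpow_square) (use assms rdef[OF assms(1)] in auto)
  ultimately show ?thesis
    unfolding f_eq[OF assms(1)] power_mult_distrib p_def[symmetric]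
        by (simp add: exp_add[symmetric] diff_conv_add_uminus del: add_uminus_conv_diff)
qed

text \<open>With P = a(y,y), horizontal invariance of F^2 says that (1 + m) \<nabla>P / P = 2m
  \<nabla>\<beta> / \<beta> at regular vectors. Clearing denominators, \<beta> times a quadratic
  form equals P times a linear form for each direction \<open>v\<close>, and divisibility produces
  the common factor.\<close>

theorem weyl_structure:
  assumes xy: "(x, y0) \<in> D"
    and ber: "\<And>y k i. (x, y) \<in> D \<Longrightarrow> nonlinear_connection f k i x y = (\<Sum>j\<in>UNIV. \<Gamma> k i j * y $ j)"
  obtains \<theta> :: "real^'n \<Rightarrow> real" where "linear \<theta>"
    "\<And>v y z. y \<bullet> (dirD M x v *v z) = p x (bil \<Gamma> v y) z + p x y (bil \<Gamma> v z) + 2 * m * \<theta> v * p x y z"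
    "\<And>v y. dirD B x v \<bullet> y = B x \<bullet> bil \<Gamma> v y + (1 + m) * \<theta> v * (B x \<bullet> y)"
proof -
  have xU: "x \<in> U" by (rule DU[OF xy])
  have hor: "dirD (\<lambda>z. (f (fst z) (snd z))\<^sup>2) (x, y) (v, 0) = dirD (\<lambda>z. (f (fst z) (snd z))\<^sup>2) (x, y) (0, bil \<Gamma> v y)"
    if "(x, y) \<in> D" for y v
    by (rule berwald_horizontal(2)[OF opD smf _ _ _ _ xy that]) (use cone hom nondeg ber in auto)
  have B0: "B x \<noteq> 0" by (rule B_nonzero[OF xy])
  have m1: "1 + m \<noteq> 0" using m_neq_minus_1[OF xy] by linarith
  note dM = smooth_on_has_derivative[OF smM xU] and dB = smooth_on_has_derivative[OF smB xU]
  note bM = bilinear_conv_bounded_bilinear[THEN iffD1, OF bilinear_p]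
  \<comment> \<open>\<open>q\<close> and \<open>l\<close> are 1 + m times the covariant derivative
    of a and 2m times that of b in the direction \<open>v\<close>; the adjoint represents
    \<open>y \<mapsto> B x \<bullet> bil \<Gamma> v y\<close> as a vector.\<close>
  define q where "q v y z = (1 + m) * (y \<bullet> (dirD M x v *v z) - p x (bil \<Gamma> v y) z - p x y (bil \<Gamma> v z))" for v y z
  define l where "l v = (2 * m) *\<^sub>R (dirD B x v - adjoint (bil \<Gamma> v) (B x))" for v
  have linb: "linear (bil \<Gamma> v)" "linear (\<lambda>v. bil \<Gamma> v y)" for v y using bilinear_bil[of \<Gamma>] by (auto simp: bilinear_def)
  have adj: "adjoint (bil \<Gamma> v) (B x) \<bullet> y = B x \<bullet> bil \<Gamma> v y" for v y
  proof -
    have "adjoint (bil \<Gamma> v) (B x) \<bullet> y = y \<bullet> adjoint (bil \<Gamma> v) (B x)" by (rule inner_commute)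
    also have "\<dots> = bil \<Gamma> v y \<bullet> B x" by (rule adjoint_works[OF linb(1)])
    finally show ?thesis by (simp only: inner_commute)
  qed
  have dMsym: "y \<bullet> (dirD M x v *v z) = z \<bullet> (dirD M x v *v y)" for v y z
    by (rule derivative_symmetric[OF dM opU xU symM])
  have q: "bilinear (q v)" "q v y z = q v z y" for v y z
  proof -
    show "bilinear (q v)"
      unfolding q_def bilinear_def
      by (auto intro!: linearI simp: inner_add_left inner_add_right matrix_vector_right_distrib matrix_vector_mult_scaleR
          linear_add[OF linb(1)] linear_scale[OF linb(1)] bilinear_ladd[OF bilinear_p] bilinear_radd[OF bilinear_p]
          bilinear_lmul[OF bilinear_p] bilinear_rmul[OF bilinear_p] algebra_simps)
    show "q v y z = q v z y" unfolding q_def using dMsym[of y v z] p_sym[OF xU] by simp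
  qed
  have eq: "(B x \<bullet> y) * q v y y = p x y y * (l v \<bullet> y)" if y: "(x, y) \<in> D" "p x y y \<noteq> 0" "B x \<bullet> y \<noteq> 0" for v y
  proof -
    define P where "P z = snd z \<bullet> (M (fst z) *v snd z)" for z
    define \<beta> where "\<beta> z = B (fst z) \<bullet> snd z" for z :: "(real^'n) \<times> (real^'n)"
    define P' where "P' a = y \<bullet> (dirD M x (fst a) *v y) + 2 * p x (snd a) y" for a
    define \<beta>' where "\<beta>' a = dirD B x (fst a) \<bullet> y + B x \<bullet> snd a" for a
    have dfst: "(fst has_derivative fst) (at (x, y))" and dsnd: "(snd has_derivative snd) (at (x, y))"
      by (auto intro!: derivative_eq_intros)
    have dMz: "((\<lambda>z. M (fst z)) has_derivative (\<lambda>a. dirD M x (fst a))) (at (x, y))"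
      using diff_chain_at[OF dfst, of M "dirD M x"] dM by (simp add: o_def)
    have dBz: "((\<lambda>z. B (fst z)) has_derivative (\<lambda>a. dirD B x (fst a))) (at (x, y))"
      using diff_chain_at[OF dfst, of B "dirD B x"] dB by (simp add: o_def)
    have dP: "(P has_derivative P') (at (x, y))"
    proof -
      have "(P has_derivative (\<lambda>a. y \<bullet> (M x *v snd a + dirD M x (fst a) *v y) + snd a \<bullet> (M x *v y))) (at (x, y))"
        unfolding P_def
        using has_derivative_inner[OF dsnd bounded_bilinear.FDERIV[OF bounded_bilinear_matrix_vector_mult dMz dsnd]] by simp
      then show ?thesis
        unfolding P'_def using symM[OF xU] by (simp add: inner_add_right p_def fun_eq_iff algebra_simps)
    qed
    have d\<beta>: "(\<beta> has_derivative \<beta>') (at (x, y))"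
      unfolding \<beta>_def \<beta>'_def using has_derivative_inner[OF dBz dsnd] by (simp add: add.commute)
    have Pxy: "P (x, y) = p x y y" "\<beta> (x, y) = B x \<bullet> y" by (simp_all add: P_def \<beta>_def p_def)
    define \<Lambda> where "\<Lambda> z = (f (fst z) (snd z))\<^sup>2" for z
    define E where "E z = exp ((1 + m) / 2 * ln ((P z)\<^sup>2) - m * ln ((\<beta> z)\<^sup>2))" for z
    have dE: "(E has_derivative (\<lambda>a. E (x, y) * ((1 + m) * P' a / P (x, y) - 2 * m * \<beta>' a / \<beta> (x, y)))) (at (x, y))"
      unfolding E_def
    proof (rule has_derivative_eq_rhs[OF DERIV_compose_FDERIV[OF DERIV_exp has_derivative_diff[OF
              has_derivative_mult_right[OF has_derivative_ln_square[OF dP]] has_derivative_mult_right[OF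
                  has_derivative_ln_square[OF d\<beta>]]]]])
    qed (use y Pxy in \<open>simp_all add: fun_eq_iff mult.commute\<close>)
    have "open (D \<inter> (\<lambda>z. P z * \<beta> z) -` (- {0}))"
    proof (rule continuous_open_preimage[OF _ opD])
      have cM: "continuous_on D (\<lambda>z. M (fst z))" "continuous_on D (\<lambda>z. B (fst z))"
        by (rule continuous_on_compose2[OF smooth_on_continuous[OF smM] continuous_on_fst[OF continuous_on_id]]
             continuous_on_compose2[OF smooth_on_continuous[OF smB] continuous_on_fst[OF continuous_on_id]]; use DU in auto)+
      show "continuous_on D (\<lambda>z. P z * \<beta> z)"
        unfolding P_def \<beta>_def by (intro continuous_intros bounded_bilinear.continuous_on[OF bounded_bilinear_matrix_vector_mult] cM)
    qed auto
    moreover have "D \<inter> (\<lambda>z. P z * \<beta> z) -` (- {0}) = {z \<in> D. P z \<noteq> 0 \<and> \<beta> z \<noteq> 0}" by auto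
    ultimately have "open {z \<in> D. P z \<noteq> 0 \<and> \<beta> z \<noteq> 0}" by simp
    have d\<Lambda>: "dirD \<Lambda> (x, y) = (\<lambda>a. E (x, y) * ((1 + m) * P' a / P (x, y) - 2 * m * \<beta>' a / \<beta> (x, y)))"
    proof (rule dirD_eqI, rule has_derivative_transform_within_open[OF dE])
      show "open {z \<in> D. P z \<noteq> 0 \<and> \<beta> z \<noteq> 0}" by fact
      show "(x, y) \<in> {z \<in> D. P z \<noteq> 0 \<and> \<beta> z \<noteq> 0}" using y Pxy by simp
      fix z assume "z \<in> {z \<in> D. P z \<noteq> 0 \<and> \<beta> z \<noteq> 0}"
      then show "E z = \<Lambda> z" using square_f[of "fst z" "snd z"] by (simp add: E_def \<Lambda>_def P_def \<beta>_def p_def)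
    qed
    have "dirD \<Lambda> (x, y) (v, 0) = dirD \<Lambda> (x, y) (0, bil \<Gamma> v y)"
      using hor[OF y(1)] unfolding \<Lambda>_def by simp
    then have "(1 + m) * P' (v, 0) / P (x, y) - 2 * m * \<beta>' (v, 0) / \<beta> (x, y) = (1
        + m) * P' (0, bil \<Gamma> v y) / P (x, y) - 2 * m * \<beta>' (0, bil \<Gamma> v y) / \<beta> (x, y)"
      unfolding d\<Lambda> by (simp add: E_def)
    moreover have "dirD M x 0 = 0" "dirD B x 0 = 0"
      using dM dB by (simp_all add: has_derivative_linear linear_0)
    ultimately have "(1 + m) * (y \<bullet> (dirD M x v *v y)) / p x y y - 2 * m * (dirD B x v \<bullet> y) / (B x \<bullet> y)
        = (1 + m) * (2 * p x (bil \<Gamma> v y) y) / p x y y - 2 * m * (B x \<bullet> bil \<Gamma> v y) / (B x \<bullet> y)"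
      by (simp add: P'_def \<beta>'_def Pxy p_def[of x 0])
    then have "(B x \<bullet> y) * ((1 + m) * (y \<bullet> (dirD M x v *v y) - 2 * p x (bil \<Gamma> v y) y))
        = p x y y * (2 * m * (dirD B x v \<bullet> y - B x \<bullet> bil \<Gamma> v y))"
      using y(2,3) by (simp add: field_simps)
    then show ?thesis
      using p_sym[OF xU, of y "bil \<Gamma> v y"] by (simp add: q_def l_def adj inner_diff_left algebra_simps)
  qed
  \<comment> \<open>The common factor is obtained for each \<open>v\<close> separately, which says
    nothing about linearity in \<open>v\<close>. Evaluating at a vector \<open>e\<close> with
    \<open>B x \<bullet> e = 1\<close> gives an explicit linear formula for
    \<open>\<theta>\<close>.\<close>
  define e where "e = B x /\<^sub>R (B x \<bullet> B x)"
  have Be: "B x \<bullet> e = 1" using B0 by (simp add: e_def)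
  define \<theta> where "\<theta> v = (dirD B x v \<bullet> e - B x \<bullet> bil \<Gamma> v e) / (1 + m)" for v
  have lin\<theta>: "linear \<theta>"
    unfolding \<theta>_def
    by (rule linearI) (simp_all add: linear_add[OF has_derivative_linear[OF dB]] linear_scale[OF
        has_derivative_linear[OF dB]]
        linear_add[OF linb(2)] linear_scale[OF linb(2)] inner_add_left inner_add_right add_divide_distrib
            diff_divide_distrib algebra_simps)
  have key: "l v \<bullet> y = 2 * m * (1 + m) * \<theta> v * (B x \<bullet> y) \<and> q v y z = 2 * m * (1 + m) * \<theta> v * p x y z" for v y z
  proof -
    have y0in: "y0 \<in> {y. (x, y) \<in> D}" using xy by simp
    show ?thesis
    proof (rule linear_form_divides[OF card bilinear_p p_sym[OF xU] _ q B0 open_fibre y0in])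
      show "y = 0" if "\<And>z. p x y z = 0" for y by (rule p_nondeg[OF xU that])
      show "(B x \<bullet> y) * q v y y = p x y y * (l v \<bullet> y)" if "y \<in> {y. (x, y) \<in> D}" "p x y y \<noteq> 0" "B x \<bullet> y \<noteq> 0" for y
        using eq that by simp
      fix \<omega> assume \<omega>: "l v = \<omega> *\<^sub>R B x" "\<And>y z. q v y z = \<omega> * p x y z"
      have "\<omega> = l v \<bullet> e" by (simp add: \<omega>(1) Be)
      also have "\<dots> = 2 * m * (1 + m) * \<theta> v" using m1 by (simp add: l_def adj inner_diff_left \<theta>_def)
      finally show ?thesis by (simp add: \<omega>)
    qed
  qed
  show thesis
  proof (rule that[OF lin\<theta>])
    fix v y z
    have "(1 + m) * (y \<bullet> (dirD M x v *v z) - p x (bil \<Gamma> v y) z - p x y (bil \<Gamma> v z)) = (1 + m) * (2 * m * \<theta> v * p x y z)"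
      using key[of v y z] by (simp add: q_def mult.assoc mult.left_commute)
    then show "y \<bullet> (dirD M x v *v z) = p x (bil \<Gamma> v y) z + p x y (bil \<Gamma> v z) + 2 * m * \<theta> v * p x y z"
      using m1 by simp
    have "2 * m * (dirD B x v \<bullet> y - B x \<bullet> bil \<Gamma> v y) = 2 * m * ((1 + m) * \<theta> v * (B x \<bullet> y))"
      using key[of v y z] by (simp add: l_def adj inner_diff_left mult.assoc)
    then show "dirD B x v \<bullet> y = B x \<bullet> bil \<Gamma> v y + (1 + m) * \<theta> v * (B x \<bullet> y)"
      using m0 by simp
  qed
qed

end

subsection \<open>Parallel metrics and adapted coordinates\<close>

lemma linear_eq_axis:
  fixes f g :: "real^'n \<Rightarrow> 'a::real_vector"
  assumes "linear f" "linear g" "\<And>i. f (axis i 1) = g (axis i 1)"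
  shows "f y = g y"
proof -
  have "f (\<Sum>i\<in>UNIV. y $ i *\<^sub>R axis i 1) = g (\<Sum>i\<in>UNIV. y $ i *\<^sub>R axis i 1)"
    unfolding linear_sum[OF assms(1)] linear_sum[OF assms(2)] linear_scale[OF assms(1)] linear_scale[OF assms(2)] assms(3) ..
  then show ?thesis by (simp add: vec_eq_sum_axis[symmetric])
qed

lemma inner_axis_matrix: "axis i 1 \<bullet> ((A :: real^'n^'m) *v axis j 1) = A $ i $ j"
  by (simp add: inner_axis' matrix_vector_mult_basis column_def)

text \<open>Depends on a matrix field alone, so that the coordinate results can be stated without
  charts; applied to the component matrix of a metric it is \<open>levi_civita\<close>.\<close>

definition christoffel :: "(real^'n \<Rightarrow> real^'n^'n) \<Rightarrow> real^'n \<Rightarrow> 'n \<Rightarrow> 'n \<Rightarrow> 'n::finite \<Rightarrow> real" where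
  "christoffel M x k i j = 1/2 * (\<Sum>l\<in>UNIV. matrix_inv (M x) $ k $ l *
       (pd i (\<lambda>x. M x $ l $ j) x + pd j (\<lambda>x. M x $ i $ l) x - pd l (\<lambda>x. M x $ i $ j) x))"

lemma pd_entry:
  fixes M :: "real^'n \<Rightarrow> real^'n^'n"
  assumes "(M has_derivative M') (at x)"
  shows "pd k (\<lambda>x. M x $ i $ j) x = M' (axis k 1) $ i $ j"
proof -
  have "((\<lambda>x. M x $ i $ j) has_derivative (\<lambda>v. M' v $ i $ j)) (at x)"
    by (intro bounded_linear.has_derivative[OF bounded_linear_vec_nth] assms)
  then show ?thesis by (simp add: pd_def dirD_eqI)
qed

lemma bil_axis: "bil \<Gamma> (axis i 1) (axis j 1) $ k = \<Gamma> k i j"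
proof -
  have a: "axis i (1::real) $ l = (if l = i then 1 else 0)" for i l :: 'a by (simp add: axis_def)
  have md: "x * (if b then 1 else 0) = (if b then x else 0)" for x :: real and b by simp
  have "(\<Sum>i'\<in>UNIV. \<Sum>j'\<in>UNIV. \<Gamma> k i' j' * axis i 1 $ i' * axis j 1 $ j')
      = (\<Sum>i'\<in>UNIV. if i' = i then (\<Sum>j'\<in>UNIV. if j' = j then \<Gamma> k i j else 0) else 0)"
    by (intro sum.cong refl) (simp add: a md)
  then show ?thesis by (simp add: bil_def)
qed

lemma bil_commute:
  assumes "\<And>k i j. \<Gamma> k i j = \<Gamma> k j i"
  shows "bil \<Gamma> v w = bil \<Gamma> w v"
proof -
  have "(\<Sum>i\<in>UNIV. \<Sum>j\<in>UNIV. \<Gamma> k i j * v $ i * w $ j) = (\<Sum>i\<in>UNIV. \<Sum>j\<in>UNIV. \<Gamma> k i j * w $ i * v $ j)" for k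
    by (subst sum.swap, intro sum.cong refl, subst assms) (simp add: mult_ac)
  then show ?thesis by (simp add: bil_def)
qed

text \<open>Koszul's argument: with the upper index lowered, \<open>par\<close> writes each
  derivative of the metric as a sum of two terms \<open>L\<close>, and by symmetry the alternating
  sum of three derivatives leaves \<open>2 L\<close>.\<close>

lemma christoffel_unique:
  fixes M :: "real^'n \<Rightarrow> real^'n^'n"
  assumes d: "(M has_derivative M') (at x)" and sym: "\<And>v w. v \<bullet> (M x *v w) = w \<bullet> (M x *v v)" and inv: "invertible (M x)"
    and \<Gamma>: "\<And>k i j. \<Gamma> k i j = \<Gamma> k j i"
    and par: "\<And>v y z. y \<bullet> (M' v *v z) = bil \<Gamma> v y \<bullet> (M x *v z) + y \<bullet> (M x *v bil \<Gamma> v z)"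
  shows "christoffel M x k i j = \<Gamma> k i j"
proof -
  define L where "L p i j = axis p 1 \<bullet> (M x *v bil \<Gamma> (axis i 1) (axis j 1))" for p i j
  have e: "M' (axis k 1) $ i $ j = L j k i + L i k j" for i j k
    using par[of "axis i 1" "axis k 1" "axis j 1"] sym[of "bil \<Gamma> (axis k 1) (axis i 1)" "axis j 1"]
    by (simp add: inner_axis_matrix L_def)
  have Ls: "L p i j = L p j i" for p i j unfolding L_def by (subst bil_commute[OF \<Gamma>]) (rule refl)
  have L: "L p i j = (\<Sum>k\<in>UNIV. M x $ p $ k * \<Gamma> k i j)" for p i j
    by (simp add: L_def inner_axis' matrix_vector_mult_def bil_axis)
  have "christoffel M x k i j = (\<Sum>l\<in>UNIV. matrix_inv (M x) $ k $ l * L l i j)"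
  proof -
    have "pd i (\<lambda>x. M x $ l $ j) x + pd j (\<lambda>x. M x $ i $ l) x - pd l (\<lambda>x. M x $ i $ j) x = 2 * L l i j" for l
      unfolding pd_entry[OF d] e using Ls[of j i l] Ls[of l j i] Ls[of i j l] by simp
    then show ?thesis by (simp add: christoffel_def sum_distrib_left)
  qed
  also have "\<dots> = (matrix_inv (M x) *v (M x *v (\<chi> k. \<Gamma> k i j))) $ k"
    by (simp add: matrix_vector_mult_def L)
  also have "\<dots> = \<Gamma> k i j"
    by (simp add: matrix_vector_mul_assoc matrix_inv_inverse inv)
  finally show ?thesis .
qed

text \<open>The existence half: lowering the index of the Christoffel symbols gives the identity on
  unit vectors, and linearity in each of the three arguments extends it.\<close>

lemma christoffel_parallel:
  fixes M :: "real^'n \<Rightarrow> real^'n^'n"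
  assumes d: "(M has_derivative M') (at x)" and "open U" "x \<in> U" and sym: "\<And>x v w. x \<in> U \<Longrightarrow> v \<bullet> (M x *v w)
      = w \<bullet> (M x *v v)" and inv: "invertible (M x)"
  shows "y \<bullet> (M' v *v z) = bil (christoffel M x) v y \<bullet> (M x *v z) + y \<bullet> (M x *v bil (christoffel M x) v z)"
proof -
  let ?b = "bil (christoffel M x)"
  have ms: "M' k $ i $ j = M' k $ j $ i" for k i j
    using derivative_symmetric[OF assms(1-4), of "axis i 1" k "axis j 1"] by (simp add: inner_axis_matrix)
  have low: "axis p 1 \<bullet> (M x *v ?b (axis i 1) (axis j 1)) = 1 / 2 * (M' (axis i 1) $ p $ j
      + M' (axis j 1) $ i $ p - M' (axis p 1) $ i $ j)" for p i j
  proof -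
    define t where "t = (\<chi> l. 1 / 2 * (M' (axis i 1) $ l $ j + M' (axis j 1) $ i $ l - M' (axis l 1) $ i $ j))"
    have "?b (axis i 1) (axis j 1) = matrix_inv (M x) *v t"
      by (simp add: vec_eq_iff bil_axis christoffel_def pd_entry[OF d] matrix_vector_mult_def t_def sum_distrib_left mult_ac)
    then have "M x *v ?b (axis i 1) (axis j 1) = t" by (simp add: matrix_vector_mul_assoc matrix_inv_inverse inv)
    then show ?thesis by (simp add: inner_axis' t_def)
  qed
  have linb: "linear (?b v)" "linear (\<lambda>v. ?b v y)" for v y using bilinear_bil by (auto simp: bilinear_def)
  have linM': "linear M'" using d by (rule has_derivative_linear)
  note lins = linear_add[OF linb(1)] linear_scale[OF linb(1)] linear_add[OF linb(2)] linear_scale[OF linb(2)]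
      linear_add[OF linM'] linear_scale[OF linM']
      matrix_vector_right_distrib matrix_vector_mult_scaleR matrix_vector_mult_add_rdistrib
          scaleR_matrix_vector_assoc[symmetric]
      inner_add_left inner_add_right algebra_simps
  define R where "R v y z = ?b v y \<bullet> (M x *v z) + y \<bullet> (M x *v ?b v z)" for v y z
  have "axis i 1 \<bullet> (M' (axis k 1) *v axis j 1) = R (axis k 1) (axis i 1) (axis j 1)" for i j k
    unfolding R_def inner_axis_matrix low sym[OF assms(3), of "?b _ _" "axis j 1"] using ms by (simp add: algebra_simps)
  then have "axis i 1 \<bullet> (M' (axis k 1) *v z) = R (axis k 1) (axis i 1) z" for i k z
    by (rule linear_eq_axis[where f = "\<lambda>z. axis i 1 \<bullet> (M' (axis k 1) *v z)", rotated 2]) (auto intro!: linearI simp: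
        R_def lins)
  then have "y \<bullet> (M' (axis k 1) *v z) = R (axis k 1) y z" for k y z
    by (rule linear_eq_axis[where f = "\<lambda>y. y \<bullet> (M' (axis k 1) *v z)", rotated 2]) (auto intro!: linearI simp: R_def lins)
  then have "y \<bullet> (M' v *v z) = R v y z" for v y z
    by (rule linear_eq_axis[where f = "\<lambda>v. y \<bullet> (M' v *v z)", rotated 2]) (auto intro!: linearI simp: R_def lins)
  then show ?thesis by (simp add: R_def)
qed

section \<open>Derivatives of determinants and the potential of the Weyl 1-form\<close>

lemma has_derivative_det_ex: "(det has_derivative dirD det A) (at (A :: real^'n^'n))"
  using smooth_on_has_derivative[OF smooth_on_det[OF open_UNIV smooth_on_ident[OF open_UNIV]]] by simp

text \<open>Here \<open>dirD det (mat 1)\<close> is the trace. Jacobi's formula comes from factoring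
  \<open>A + s (T A)\<close> as \<open>(1 + s T) A\<close> and using multiplicativity of the
  determinant.\<close>

lemma dirD_det_mult:
  fixes A T :: "real^'n^'n"
  shows "dirD det A (T ** A) = det A * dirD det (mat 1) T" "dirD det A (A ** T) = det A * dirD det (mat 1) T"
    "dirD det (mat 1) (transpose T) = dirD det (mat 1) T" "dirD det (mat 1) (mat 1 :: real^'n^'n) = real CARD('n)"
proof -
  have d: "((\<lambda>s. det (A + s *\<^sub>R T)) has_vector_derivative dirD det A T) (at 0)" for A T :: "real^'n^'n"
    by (rule has_derivative_along_line) (simp add: has_derivative_det_ex)
  have l: "A + s *\<^sub>R (T ** A) = (mat 1 + s *\<^sub>R T) ** A" for s
    by (simp add: matrix_eq matrix_vector_mult_add_rdistrib matrix_vector_mul_assoc[symmetric]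
        scaleR_matrix_vector_assoc[symmetric])
  have r: "A + s *\<^sub>R (A ** T) = A ** (mat 1 + s *\<^sub>R T)" for s
    by (simp add: matrix_add_ldistrib matrix_scalar_ac scalar_matrix_assoc)
  have c: "((\<lambda>s. det A * det (mat 1 + s *\<^sub>R T)) has_vector_derivative det A * dirD det (mat 1) T) (at 0)"
    by (rule bounded_linear.has_vector_derivative[OF bounded_linear_mult_right d])
  show "dirD det A (T ** A) = det A * dirD det (mat 1) T"
    using d[of A "T ** A"] c unfolding l det_mul by (simp add: mult.commute vector_derivative_unique_at)
  show "dirD det A (A ** T) = det A * dirD det (mat 1) T"
    using d[of A "A ** T"] c unfolding r det_mul by (simp add: vector_derivative_unique_at)
  have t: "det (mat 1 + s *\<^sub>R transpose T) = det (mat 1 + s *\<^sub>R T)" for s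
  proof -
    have "mat 1 + s *\<^sub>R transpose T = transpose (mat 1 + s *\<^sub>R T)" by (simp add: transpose_def vec_eq_iff mat_def)
    then show ?thesis by (simp add: det_transpose)
  qed
  show "dirD det (mat 1) (transpose T) = dirD det (mat 1) T"
    using d[of "mat 1" "transpose T"] d[of "mat 1" T] unfolding t by (rule vector_derivative_unique_at)
  have m: "det (mat 1 + s *\<^sub>R mat 1 :: real^'n^'n) = (1 + s) ^ CARD('n)" for s
  proof -
    have "mat 1 + s *\<^sub>R mat 1 = ((\<chi> i j. if i = j then 1 + s else 0) :: real^'n^'n)" by (simp add: vec_eq_iff mat_def)
    then show ?thesis by (simp add: det_diagonal)
  qed
  have "((\<lambda>s. (1 + s) ^ CARD('n)) has_vector_derivative real CARD('n)) (at (0::real))"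
    unfolding has_real_derivative_iff_has_vector_derivative[symmetric] by (auto intro!: derivative_eq_intros)
  then show "dirD det (mat 1) (mat 1 :: real^'n^'n) = real CARD('n)"
    using d[of "mat 1" "mat 1"] unfolding m by (rule vector_derivative_unique_at[rotated])
qed

text \<open>In matrix form \<open>par\<close> reads \<open>M' v = T^t M + M T + c M\<close> with
  \<open>T\<close> the matrix of \<open>bil \<Gamma> v\<close>, so the logarithmic derivative of the
  determinant is twice the trace of \<open>T\<close> plus \<open>n c\<close>. The trace depends on
  the connection alone and cancels in a quotient of two such determinants.\<close>

lemma has_derivative_det_weyl:
  fixes M :: "real^'n \<Rightarrow> real^'n^'n" and c :: "real^'n \<Rightarrow> real"
  assumes d: "(M has_derivative M') (at x)"
    and par: "\<And>v y z. y \<bullet> (M' v *v z) = bil \<Gamma> v y \<bullet> (M x *v z) + y \<bullet> (M x *v bil \<Gamma> v z) + c v * (y \<bullet> (M x *v z))"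
  shows "((\<lambda>x. det (M x)) has_derivative (\<lambda>v. det (M x) * (2 * dirD det (mat 1) (matrix (bil \<Gamma> v))
      + real CARD('n) * c v))) (at x)"
proof -
  have "M' v = transpose (matrix (bil \<Gamma> v)) ** M x + M x ** matrix (bil \<Gamma> v) + c v *\<^sub>R (mat 1 ** M x)" for v
  proof -
    let ?A = "matrix (bil \<Gamma> v)"
    have A: "?A *v y = bil \<Gamma> v y" for y using bilinear_bil[of \<Gamma>] by (simp add: bilinear_def matrix_works)
    have "axis i 1 \<bullet> (M' v *v axis j 1) = axis i 1 \<bullet> ((transpose ?A ** M x + M x ** ?A
        + c v *\<^sub>R (mat 1 ** M x)) *v axis j 1)" for i j
    proof -
      have "axis i 1 \<bullet> (transpose ?A *v (M x *v axis j 1)) = (?A *v axis i 1) \<bullet> (M x *v axis j 1)"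
        by (metis dot_lmul_matrix vector_transpose_matrix inner_commute transpose_transpose)
      then show ?thesis
        unfolding par
            by (simp add: A matrix_vector_mult_add_rdistrib matrix_vector_mul_assoc[symmetric] inner_add_right
            scaleR_matrix_vector_assoc[symmetric])
    qed
    then show ?thesis unfolding inner_axis_matrix by (simp add: vec_eq_iff)
  qed
  then have e: "dirD det (M x) (M' v) = det (M x) * (2 * dirD det (mat 1) (matrix (bil \<Gamma> v)) + real CARD('n) * c v)" for v
    using has_derivative_linear[OF has_derivative_det_ex[of "M x"]]
    by (simp add: linear_add linear_scale dirD_det_mult(1)[of "M x" "transpose _"] dirD_det_mult(1)[of "M x" "mat 1"]
        dirD_det_mult(2,3,4) algebra_simps del: matrix_mul_lid)
  from diff_chain_at[OF d has_derivative_det_ex] show ?thesis by (simp add: o_def e)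
qed

lemma matrix_vector_mult_minus_right: "(A :: real^'n^'m) *v (- x) = - (A *v x)"
  by (simp add: vec_eq_iff matrix_vector_mult_def sum_negf)

lemma smooth_on_ln_square:
  fixes f :: "'e::real_normed_vector \<Rightarrow> real"
  assumes "open S" "smooth_on S f" "\<And>x. x \<in> S \<Longrightarrow> f x \<noteq> 0"
  shows "smooth_on S (\<lambda>x. ln ((f x)\<^sup>2))"
proof -
  have "smooth_on {0<..} (ln :: real \<Rightarrow> real)" by (simp add: smooth_on_def Ck_on_real_ln)
  then show ?thesis
    unfolding power2_eq_square
    by (rule smooth_on_compose[OF assms(1) _ smooth_on_mult[OF assms(1,2,2)], rotated]) (use assms(3)
        in \<open>auto simp flip: power2_eq_square\<close>)
qed

text \<open>The ratio of the volume densities of \<open>a\<close> and of a parallel metric \<open>q\<close> is a primitive of the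
  1-form by which \<open>a\<close> fails to be parallel; this is what makes the latter exact.\<close>

lemma weyl_potential:
  fixes M Q :: "real^'n \<Rightarrow> real^'n^'n"
  assumes "open U" and sm: "smooth_on U M" "smooth_on U Q" and inv: "\<And>x. x \<in> U \<Longrightarrow> invertible (M x)"
      "\<And>x. x \<in> U \<Longrightarrow> invertible (Q x)"
    and m: "m \<noteq> 0"
    and parM: "\<And>x v y z. x \<in> U \<Longrightarrow> y \<bullet> (dirD M x v *v z) = bil (\<Gamma> x) v y \<bullet> (M x *v z) + y \<bullet> (M x *v bil (\<Gamma> x) v z)
        + 2 * m * \<theta> x v * (y \<bullet> (M x *v z))"
    and parQ: "\<And>x v y z. x \<in> U \<Longrightarrow> y \<bullet> (dirD Q x v *v z) = bil (\<Gamma> x) v y \<bullet> (Q x *v z) + y \<bullet> (Q x *v bil (\<Gamma> x) v z)"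
  obtains \<psi> :: "real^'n \<Rightarrow> real" where "smooth_on U \<psi>" "\<And>x. x \<in> U \<Longrightarrow> (\<psi> has_derivative \<theta> x) (at x)"
proof -
  let ?N = "real CARD('n)"
  \<comment> \<open>The logarithmic derivative of the quotient is 2mn times \<theta>, and squaring
    inside the logarithm doubles it. The square also takes care of the unknown sign of the
    quotient.\<close>
  define \<psi> where "\<psi> x = 1 / (4 * m * ?N) * ln ((det (M x) / det (Q x))\<^sup>2)" for x
  have nz: "det (M x) \<noteq> 0" "det (Q x) \<noteq> 0" if "x \<in> U" for x using inv that by (auto simp: invertible_det_nz)
  have "smooth_on U (\<lambda>x. ln ((det (M x) / det (Q x))\<^sup>2))"
    using nz sm by (intro smooth_on_ln_square smooth_on_divide smooth_on_det assms(1)) auto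
  then have "smooth_on U \<psi>"
    unfolding \<psi>_def by (intro smooth_on_mult smooth_on_const assms(1))
  moreover have "(\<psi> has_derivative \<theta> x) (at x)" if x: "x \<in> U" for x
  proof -
    define t where "t v = dirD det (mat 1) (matrix (bil (\<Gamma> x) v))" for v
    have dM: "((\<lambda>x. det (M x)) has_derivative (\<lambda>v. det (M x) * (2 * t v + ?N * (2 * m * \<theta> x v)))) (at x)"
      unfolding t_def by (rule has_derivative_det_weyl[OF smooth_on_has_derivative[OF sm(1) x] parM[OF x]])
    have dQ: "((\<lambda>x. det (Q x)) has_derivative (\<lambda>v. det (Q x) * (2 * t v + ?N * 0))) (at x)"
      unfolding t_def by (rule has_derivative_det_weyl[OF smooth_on_has_derivative[OF sm(2) x]]) (simp add: parQ[OF x])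
    have "((\<lambda>x. det (M x) / det (Q x)) has_derivative (\<lambda>v. det (M x) / det (Q x) * (?N * (2 * m * \<theta> x v)))) (at x)"
      by (rule has_derivative_eq_rhs[OF has_derivative_divide'[OF dM dQ nz(2)[OF x]]])
         (use nz[OF x] in \<open>simp add: fun_eq_iff field_simps\<close>)
    from has_derivative_mult_right[OF has_derivative_ln_square[OF this], of "1 / (4 * m * ?N)"] show ?thesis
      using nz[OF x] m unfolding \<psi>_def by (simp add: field_simps)
  qed
  ultimately show thesis using that by blast
qed

text \<open>The metric given by the matrices \<open>M\<close> and the covector field \<open>B\<close> are parallel for \<open>\<Gamma>\<close>, so the null field
  \<open>N = M\<^sup>-\<^sup>1 B\<close> is parallel too; \<open>v\<close> is the flow parameter of \<open>-N\<close>, which is a Killing field.\<close>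

theorem brinkmann_coordinates:
  fixes M :: "real^'n \<Rightarrow> real^'n^'n" and B :: "real^'n \<Rightarrow> real^'n" and iu iv :: 'n
  assumes "open U" "x0 \<in> U" "iu \<noteq> iv" and sm: "smooth_on U M" "smooth_on U B"
    and sym: "\<And>x v w. x \<in> U \<Longrightarrow> v \<bullet> (M x *v w) = w \<bullet> (M x *v v)" and inv: "\<And>x. x \<in> U \<Longrightarrow> invertible (M x)"
    and \<Gamma>: "\<And>x k i j. x \<in> U \<Longrightarrow> \<Gamma> x k i j = \<Gamma> x k j i"
    and parM: "\<And>x v y z. x \<in> U \<Longrightarrow> y \<bullet> (dirD M x v *v z) = bil (\<Gamma> x) v y \<bullet> (M x *v z) + y \<bullet> (M x *v bil (\<Gamma> x) v z)"
    and parB: "\<And>x v y. x \<in> U \<Longrightarrow> dirD B x v \<bullet> y = B x \<bullet> bil (\<Gamma> x) v y"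
    and null: "\<And>x. x \<in> U \<Longrightarrow> B x \<bullet> (matrix_inv (M x) *v B x) = 0" and B0: "B x0 \<noteq> 0"
  obtains \<Lambda> \<kappa> r H W h where "0 < r" "smooth_on (ball 0 r) \<Lambda>" "open (\<Lambda> ` ball 0 r)" "\<Lambda> ` ball 0 r \<subseteq> U"
    "x0 \<in> \<Lambda> ` ball 0 r" "homeomorphism (ball 0 r) (\<Lambda> ` ball 0 r) \<Lambda> \<kappa>" "smooth_on (\<Lambda> ` ball 0 r) \<kappa>"
    "smooth_on (ball 0 r) H" "indep_of iv (ball 0 r) H"
    "\<And>i. smooth_on (ball 0 r) (W i)" "\<And>i. indep_of iv (ball 0 r) (W i)"
    "\<And>i j. smooth_on (ball 0 r) (h i j)" "\<And>i j. indep_of iv (ball 0 r) (h i j)"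
    "\<And>z v w. z \<in> ball 0 r \<Longrightarrow> dirD \<Lambda> z v \<bullet> (M (\<Lambda> z) *v dirD \<Lambda> z w) = uv_form iu iv H W h z v w"
    "\<And>z v. z \<in> ball 0 r \<Longrightarrow> B (\<Lambda> z) \<bullet> dirD \<Lambda> z v = v $ iu"
proof -
  define N where "N x = matrix_inv (M x) *v B x" for x
  have MN: "M x *v N x = B x" if "x \<in> U" for x
    by (simp add: N_def matrix_vector_mul_assoc matrix_inv_inverse inv that)
  have smN: "smooth_on U N"
  proof -
    have "smooth_on U (\<lambda>x. matrix_inv (M x) $ i $ j)" for i j
      using smooth_on_matrix_inv[OF assms(1) sm(1) inv] by (simp add: smooth_on_vec_iff[OF assms(1)])
    moreover have "smooth_on U (\<lambda>x. B x $ j)" for j using sm(2) by (simp add: smooth_on_vec_iff[OF assms(1)])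
    ultimately show ?thesis
      unfolding N_def matrix_vector_mult_def
      by (subst smooth_on_vec_iff[OF assms(1)]) (auto intro!: smooth_on_sum smooth_on_mult assms(1))
  qed
  \<comment> \<open>Differentiating \<open>M N = B\<close> and using that \<open>M\<close> and
    \<open>B\<close> are parallel leaves \<open>M\<close> applied to the covariant derivative of
    \<open>N\<close>.\<close>
  have dN: "dirD N x v = - bil (\<Gamma> x) v (N x)" if x: "x \<in> U" for x v
  proof -
    note dM = smooth_on_has_derivative[OF sm(1) x] and dN = smooth_on_has_derivative[OF smN x]
        and dB = smooth_on_has_derivative[OF sm(2) x]
    have "((\<lambda>x. M x *v N x) has_derivative (\<lambda>v. M x *v dirD N x v + dirD M x v *v N x)) (at x)"
      by (rule bounded_bilinear.FDERIV[OF bounded_bilinear_matrix_vector_mult dM dN])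
    moreover have "((\<lambda>x. M x *v N x) has_derivative dirD B x) (at x)"
      by (rule has_derivative_transform_within_open[OF dB assms(1) x]) (simp add: MN)
    ultimately have "(\<lambda>v. M x *v dirD N x v + dirD M x v *v N x) = dirD B x" by (rule has_derivative_unique)
    from fun_cong[OF this, of v] have e: "M x *v dirD N x v + dirD M x v *v N x = dirD B x v" .
    have "y \<bullet> (M x *v (dirD N x v + bil (\<Gamma> x) v (N x))) = 0" for y
    proof -
      have "y \<bullet> (M x *v dirD N x v) + y \<bullet> (dirD M x v *v N x) = y \<bullet> dirD B x v"
        unfolding e[symmetric] by (simp add: inner_add_right)
      moreover have "y \<bullet> dirD B x v = B x \<bullet> bil (\<Gamma> x) v y"
        using parB[OF x, of v y] by (simp add: inner_commute)
      ultimately show ?thesis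
        by (simp add: parM[OF x] MN[OF x] matrix_vector_right_distrib inner_add_right inner_commute[of _ "B x"])
    qed
    then have "M x *v (dirD N x v + bil (\<Gamma> x) v (N x)) = 0" by (metis inner_eq_zero_iff)
    then have "matrix_inv (M x) *v (M x *v (dirD N x v + bil (\<Gamma> x) v (N x))) = 0" by simp
    then show ?thesis by (simp add: matrix_vector_mul_assoc matrix_inv_inverse inv x eq_neg_iff_add_eq_0)
  qed
  \<comment> \<open>With this sign the product of the coordinate fields of u and v is -1, as the
    term -2 du dv demands.\<close>
  define X where "X x = - N x" for x
  have smX: "smooth_on U X" unfolding X_def by (intro smooth_on_uminus smN assms(1))
  have dX: "dirD X x v = bil (\<Gamma> x) v (N x)" if "x \<in> U" for x v
    unfolding X_def[abs_def] using dN[OF that, of v]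
    by (subst dirD_eqI[OF has_derivative_minus[OF smooth_on_has_derivative[OF smN that]]]) simp
  have closed: "dirD B x v \<bullet> w = dirD B x w \<bullet> v" if "x \<in> U" for x v w
    using bil_commute[of "\<Gamma> x" v w] \<Gamma>[OF that] by (simp add: parB[OF that])
  have "N x0 \<noteq> 0" using MN[OF assms(2)] B0 by auto
  then have "X x0 \<noteq> 0" by (simp add: X_def)
  have BX: "B x \<bullet> X x = 0" if "x \<in> U" for x using null[OF that] by (simp add: X_def N_def)
  obtain \<Lambda> \<kappa> r where r: "0 < r" and sm\<Lambda>: "smooth_on (ball 0 r) \<Lambda>" and o\<Lambda>: "open (\<Lambda> ` ball 0 r)" and \<Lambda>U: "\<Lambda> ` ball 0 r \<subseteq> U"
    and x0: "x0 \<in> \<Lambda> ` ball 0 r" and hom: "homeomorphism (ball 0 r) (\<Lambda> ` ball 0 r) \<Lambda> \<kappa>" and sm\<kappa>: "smooth_on (\<Lambda> ` ball 0 r) \<kappa>"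
    and \<Lambda>v: "\<And>z. z \<in> ball 0 r \<Longrightarrow> dirD \<Lambda> z (axis iv 1) = X (\<Lambda> z)"
    and \<Lambda>u: "\<And>z v. z \<in> ball 0 r \<Longrightarrow> B (\<Lambda> z) \<bullet> dirD \<Lambda> z v = v $ iu"
    by (rule straightening[OF assms(1,2,3) smX sm(2) closed BX B0 \<open>X x0 \<noteq> 0\<close>]; (assumption | (rule that; assumption)))
  let ?S = "ball (0::real^'n) r"
  define g where "g z v w = dirD \<Lambda> z v \<bullet> (M (\<Lambda> z) *v dirD \<Lambda> z w)" for z v w
  have zU: "\<Lambda> z \<in> U" if "z \<in> ?S" for z using that \<Lambda>U by blast
  have lin\<Lambda>: "linear (dirD \<Lambda> z)" if "z \<in> ?S" for z using smooth_on_linear_dirD[OF sm\<Lambda> that] .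
  have gsym: "g z v w = g z w v" if "z \<in> ?S" for z v w unfolding g_def by (rule sym[OF zU[OF that]])
  have gadd: "g z (v + v') w = g z v w + g z v' w" "g z (c *\<^sub>R v) w = c * g z v w" if "z \<in> ?S" for z v v' w c
    unfolding g_def using lin\<Lambda>[OF that] by (simp_all add: linear_add linear_scale inner_add_left)
  have gadd': "g z w (v + v') = g z w v + g z w v'" "g z w (c *\<^sub>R v) = c * g z w v" if "z \<in> ?S" for z v v' w c
    using gadd[OF that] gsym[OF that] by metis+
  have gv: "g z (axis iv 1) w = - w $ iu" if "z \<in> ?S" for z w
  proof -
    have "g z (axis iv 1) w = dirD \<Lambda> z w \<bullet> (M (\<Lambda> z) *v X (\<Lambda> z))"
      unfolding gsym[OF that, of "axis iv 1"] by (simp add: g_def \<Lambda>v[OF that])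
    also have "\<dots> = - (B (\<Lambda> z) \<bullet> dirD \<Lambda> z w)"
      unfolding X_def matrix_vector_mult_minus_right inner_minus_right MN[OF zU[OF that]] by (simp add: inner_commute)
    finally show ?thesis by (simp add: \<Lambda>u[OF that])
  qed
  have d\<Lambda>: "(\<Lambda> has_derivative dirD \<Lambda> z) (at z)" if "z \<in> ?S" for z by (rule smooth_on_has_derivative[OF sm\<Lambda> that])
  have dg: "((\<lambda>z. g z v w) has_derivative (\<lambda>k. dirD \<Lambda> z v \<bullet> (M (\<Lambda> z) *v dirD (\<lambda>z. dirD \<Lambda> z w) z k
      + dirD M (\<Lambda> z) (dirD \<Lambda> z k) *v dirD \<Lambda> z w)
      + dirD (\<lambda>z. dirD \<Lambda> z v) z k \<bullet> (M (\<Lambda> z) *v dirD \<Lambda> z w))) (at z)" if z: "z \<in> ?S" for z v w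
  proof -
    have "((\<lambda>z. M (\<Lambda> z)) has_derivative (\<lambda>k. dirD M (\<Lambda> z) (dirD \<Lambda> z k))) (at z)"
      using diff_chain_at[OF d\<Lambda>[OF z] smooth_on_has_derivative[OF sm(1) zU[OF z]]] by (simp add: o_def)
    then show ?thesis
      unfolding g_def
      by (intro has_derivative_inner bounded_bilinear.FDERIV[OF bounded_bilinear_matrix_vector_mult]
          smooth_on_has_derivative[OF smooth_on_dirD[OF sm\<Lambda>] z])
  qed
  \<comment> \<open>Second derivatives commute, so differentiating \<open>dirD \<Lambda> z v\<close>
    along the coordinate \<open>iv\<close> amounts to differentiating \<open>X\<close> along
    \<open>dirD \<Lambda> z v\<close>.\<close>
  have dD: "dirD (\<lambda>z. dirD \<Lambda> z v) z (axis iv 1) = bil (\<Gamma> (\<Lambda> z)) (dirD \<Lambda> z v) (N (\<Lambda> z))" if z: "z \<in> ?S" for z v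
  proof -
    have "dirD (\<lambda>z. dirD \<Lambda> z v) z (axis iv 1) = dirD (\<lambda>z. dirD \<Lambda> z (axis iv 1)) z v"
      by (rule dirD_commute[OF open_ball sm\<Lambda> z])
    also have "((\<lambda>z. dirD \<Lambda> z (axis iv 1)) has_derivative (\<lambda>v. dirD X (\<Lambda> z) (dirD \<Lambda> z v))) (at z)"
      by (rule has_derivative_transform_within_open[OF _ open_ball z])
         (use diff_chain_at[OF d\<Lambda>[OF z] smooth_on_has_derivative[OF smX zU[OF z]]] \<Lambda>v in \<open>auto simp: o_def\<close>)
    then have "dirD (\<lambda>z. dirD \<Lambda> z (axis iv 1)) z v = dirD X (\<Lambda> z) (dirD \<Lambda> z v)" by (simp add: dirD_eqI)
    finally show ?thesis by (simp add: dX[OF zU[OF z]])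
  qed
  \<comment> \<open>Since the metric and \<open>N\<close> are parallel, the terms of the product
    rule cancel.\<close>
  have killing: "((\<lambda>t. g (z + t *\<^sub>R axis iv 1) v w) has_vector_derivative 0) (at t)"
      if z: "z + t *\<^sub>R axis iv 1 \<in> ?S" for z t v w
  proof -
    define y where "y = z + t *\<^sub>R axis iv 1"
    have yS: "y \<in> ?S" using z by (simp add: y_def)
    note yU = zU[OF yS]
    have "dirD \<Lambda> y v \<bullet> (M (\<Lambda> y) *v dirD (\<lambda>z. dirD \<Lambda> z w) y (axis iv 1) + dirD M (\<Lambda> y) (dirD \<Lambda> y (axis iv 1)) *v dirD \<Lambda> y w)
      + dirD (\<lambda>z. dirD \<Lambda> z v) y (axis iv 1) \<bullet> (M (\<Lambda> y) *v dirD \<Lambda> y w) = 0"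
    proof -
      have "bil (\<Gamma> (\<Lambda> y)) (X (\<Lambda> y)) u = - bil (\<Gamma> (\<Lambda> y)) u (N (\<Lambda> y))" for u
        unfolding X_def using bil_commute[of "\<Gamma> (\<Lambda> y)" u "N (\<Lambda> y)"] \<Gamma>[OF yU] bilinear_bil[of "\<Gamma> (\<Lambda> y)"]
        by (simp add: bilinear_lneg)
      then show ?thesis
        unfolding dD[OF yS] \<Lambda>v[OF yS] by (simp add: inner_add_right parM[OF yU] matrix_vector_mult_minus_right)
    qed
    with has_derivative_along_line[OF dg[OF z], of v w] show ?thesis by (simp add: y_def)
  qed
  \<comment> \<open>A ball is convex, so two of its points that differ only in the coordinate
    \<open>iv\<close> are joined by a segment on which \<open>killing\<close> applies.\<close>
  have gind: "g z v w = g z' v w" if z: "z \<in> ?S" "z' \<in> ?S" and zz': "\<forall>i. i \<noteq> iv \<longrightarrow> z $ i = z' $ i" for z z' v w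
  proof -
    define s where "s = z' $ iv - z $ iv"
    have z': "z' = z + s *\<^sub>R axis iv 1" using zz' by (auto simp: vec_eq_iff axis_def s_def)
    have seg: "z + t *\<^sub>R (s *\<^sub>R axis iv 1) \<in> ?S" if "t \<in> {0..1}" for t
    proof -
      have "z + t *\<^sub>R (s *\<^sub>R axis iv 1) = (1 - t) *\<^sub>R z + t *\<^sub>R z'" by (simp add: z' algebra_simps)
      then show ?thesis using convexD_alt[OF convex_ball z, of t] that by simp
    qed
    have "norm (g (z + 1 *\<^sub>R (s *\<^sub>R axis iv 1)) v w - g (z + 0 *\<^sub>R (s *\<^sub>R axis iv 1)) v w) \<le> 0 * norm (1 - 0 :: real)"
    proof (rule differentiable_bound[where S = "{0..1}" and f' = "\<lambda>t k. 0"])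
      fix t :: real assume t: "t \<in> {0..1}"
      have "((\<lambda>r. g (z + r *\<^sub>R axis iv 1) v w) has_vector_derivative 0) (at (t * s))"
        by (rule killing) (use seg[OF t] in simp)
      then have "((\<lambda>r. g (z + r *\<^sub>R axis iv 1) v w) \<circ> (\<lambda>t. t * s) has_vector_derivative s *\<^sub>R 0) (at t)"
        by (intro vector_diff_chain_at) (auto intro!: derivative_eq_intros simp:
            has_real_derivative_iff_has_vector_derivative[symmetric])
      then show "((\<lambda>t. g (z + t *\<^sub>R (s *\<^sub>R axis iv 1)) v w) has_derivative (\<lambda>k. 0)) (at t within {0..1})"
        by (auto simp: has_vector_derivative_def o_def intro: has_derivative_at_withinI)
    qed (auto simp: onorm_zero)
    then show ?thesis by (simp add: z')
  qed
  have smg: "smooth_on ?S (\<lambda>z. g z v w)" for v w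
  proof -
    have "smooth_on ?S (\<lambda>z. M (\<Lambda> z))" by (rule smooth_on_compose[OF open_ball assms(1) sm\<Lambda> sm(1) \<Lambda>U])
    then have "smooth_on ?S (\<lambda>z. M (\<Lambda> z) $ i $ j)" for i j by (simp add: smooth_on_vec_iff[OF open_ball])
    moreover have "smooth_on ?S (\<lambda>z. dirD \<Lambda> z w $ j)" for w j
      using smooth_on_dirD[OF sm\<Lambda>] by (simp add: smooth_on_vec_iff[OF open_ball])
    ultimately show ?thesis
      unfolding g_def inner_vec_def matrix_vector_mult_def
      by (auto intro!: smooth_on_sum smooth_on_mult)
  qed
  \<comment> \<open>The coefficients are entries of the pulled-back metric; the entries involving
    \<open>iv\<close> are already fixed by \<open>gv\<close>.\<close>
  define H where "H z = g z (axis iu 1) (axis iu 1)" for z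
  define W where "W i z = g z (axis iu 1) (axis i 1)" for i z
  define h where "h i j z = g z (axis i 1) (axis j 1)" for i j z
  have form: "g z v w = uv_form iu iv H W h z v w" if z: "z \<in> ?S" for z v w
  proof -
    let ?I = "UNIV - {iu, iv}"
    have dec: "v = v $ iu *\<^sub>R axis iu 1 + (v $ iv *\<^sub>R axis iv 1 + (\<Sum>i\<in>?I. v $ i *\<^sub>R axis i 1))" for v :: "real^'n"
    proof -
      have "v = (\<Sum>i\<in>insert iu (insert iv ?I). v $ i *\<^sub>R axis i 1)"
        by (subst vec_eq_sum_axis) (rule sum.cong, auto)
      then show ?thesis using assms(3) by simp
    qed
    have lg: "linear (\<lambda>v. g z v w)" "linear (g z w)" for w
      using gadd[OF z] gadd'[OF z] by (auto intro!: linearI)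
    have sv: "g z (\<Sum>i\<in>?I. v $ i *\<^sub>R axis i 1) w = (\<Sum>i\<in>?I. v $ i * g z (axis i 1) w)" for v w
      by (subst linear_sum[OF lg(1)]) (simp add: gadd(2)[OF z])
    have sw: "g z w (\<Sum>i\<in>?I. v $ i *\<^sub>R axis i 1) = (\<Sum>i\<in>?I. v $ i * g z w (axis i 1))" for v w
      by (subst linear_sum[OF lg(2)]) (simp add: gadd'(2)[OF z])
    have gvr: "g z w (axis iv 1) = - w $ iu" for w using gv[OF z] gsym[OF z] by metis
    have ax: "axis iu 1 $ iu = (1::real)" "axis iv 1 $ iu = (0::real)" "axis i (1::real) $ iu = 0" if "i \<in> ?I" for i
      using that assms(3) by (auto simp: axis_def)
    have ax1: "axis iu 1 $ iu = (1::real)" "axis iv 1 $ iu = (0::real)" using assms(3) by (auto simp: axis_def)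
    have "g z v w = v $ iu * (w $ iu * H z - w $ iv + (\<Sum>i\<in>?I. w $ i * W i z)) - v $ iv * w $ iu
      + (\<Sum>i\<in>?I. v $ i * (w $ iu * W i z + (\<Sum>j\<in>?I. w $ j * h i j z)))"
    proof -
      have 1: "g z (axis iu 1) w = w $ iu * H z - w $ iv + (\<Sum>i\<in>?I. w $ i * W i z)"
        by (subst dec[of w]) (simp add: gadd'[OF z] sw gvr ax1 H_def W_def)
      have 2: "g z (axis i 1) w = w $ iu * W i z + (\<Sum>j\<in>?I. w $ j * h i j z)" if "i \<in> ?I" for i
        by (subst dec[of w]) (simp add: gadd'[OF z] sw gvr ax(3)[OF that] W_def h_def gsym[OF z, of "axis i 1" "axis iu 1"])
      have "g z v w = v $ iu * g z (axis iu 1) w - v $ iv * w $ iu + (\<Sum>i\<in>?I. v $ i * g z (axis i 1) w)"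
        by (subst dec[of v]) (simp add: gadd[OF z] sv gv[OF z])
      also have "(\<Sum>i\<in>?I. v $ i * g z (axis i 1) w) = (\<Sum>i\<in>?I. v $ i * (w $ iu * W i z + (\<Sum>j\<in>?I. w $ j * h i j z)))"
        by (intro sum.cong refl) (simp only: 2)
      finally show ?thesis by (simp only: 1)
    qed
    moreover have "(\<Sum>i\<in>?I. \<Sum>j\<in>?I. h i j z * (v $ i * w $ j + w $ i * v $ j) / 2) = (\<Sum>i\<in>?I. \<Sum>j\<in>?I. v $ i * (w $ j * h i j z))"
    proof -
      have hs: "h i j z = h j i z" for i j unfolding h_def by (rule gsym[OF z])
      have "(\<Sum>i\<in>?I. \<Sum>j\<in>?I. h i j z * (w $ i * v $ j)) = (\<Sum>i\<in>?I. \<Sum>j\<in>?I. h i j z * (v $ i * w $ j))"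
        by (subst sum.swap) (intro sum.cong refl, subst hs, simp)
      then show ?thesis
        by (simp add: distrib_left add_divide_distrib sum.distrib sum_divide_distrib[symmetric]) (simp add: mult_ac)
    qed
    ultimately show ?thesis
      unfolding uv_form_def sym_prod_def dx_def
      by (simp add: algebra_simps sum.distrib sum_distrib_left add_divide_distrib)
  qed
  have gi: "indep_of iv ?S (\<lambda>z. g z v w)" for v w
    unfolding indep_of_def using gind by blast
  have sms: "smooth_on ?S H" "smooth_on ?S (W i)" "smooth_on ?S (h i j)" for i j
    unfolding H_def[abs_def] W_def[abs_def] h_def[abs_def] by (rule smg)+
  have inds: "indep_of iv ?S H" "indep_of iv ?S (W i)" "indep_of iv ?S (h i j)" for i j
    unfolding H_def[abs_def] W_def[abs_def] h_def[abs_def] by (rule gi)+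
  have form': "dirD \<Lambda> z v \<bullet> (M (\<Lambda> z) *v dirD \<Lambda> z w) = uv_form iu iv H W h z v w" if "z \<in> ?S" for z v w
    using form[OF that] by (simp only: g_def)
  show thesis
    by (rule that[OF r sm\<Lambda> o\<Lambda> \<Lambda>U x0 hom sm\<kappa> sms(1) inds(1) sms(2) inds(2) sms(3) inds(3) form' \<Lambda>u]; assumption)
qed

text \<open>In adapted coordinates \<open>\<kappa>\<close> the Weyl 1-form \<open>\<tau>\<close> of the rescaled pair \<open>(M, B)\<close> vanishes: the null field \<open>n\<close>
  dual to \<open>B = du\<close> is a constant multiple of \<open>\<partial>\<^sub>v\<close>, hence Killing, which forces
  \<open>(1 - m) (\<tau>\<^sub>i b\<^sub>j + \<tau>\<^sub>j b\<^sub>i) + 2 m (\<tau>\<^sub>k n\<^sup>k) a\<^sub>i\<^sub>j = 0\<close>, while \<open>dB = 0\<close> gives \<open>\<tau> \<and> b = 0\<close>.\<close>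

lemma adapted_weyl_exact:
  fixes M G :: "real^'n \<Rightarrow> real^'n^'n" and B \<kappa> :: "real^'n \<Rightarrow> real^'n" and iu iv :: 'n
  assumes "open S" "x \<in> S" "open V" and sm\<kappa>: "smooth_on S \<kappa>" and \<kappa>V: "\<kappa> ` S \<subseteq> V" and surj: "surj (dirD \<kappa> x)" and "iu \<noteq> iv"
    and smG: "smooth_on V G" and Gsym: "\<And>z v w. z \<in> V \<Longrightarrow> v \<bullet> (G z *v w) = w \<bullet> (G z *v v)"
    and Gv: "\<And>z w. z \<in> V \<Longrightarrow> axis iv 1 \<bullet> (G z *v w) = - w $ iu"
    and Gind: "\<And>z. z \<in> V \<Longrightarrow> dirD G z (axis iv 1) = 0"
    and smM: "smooth_on S M" and smB: "smooth_on S B"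
    and M: "\<And>x y z. x \<in> S \<Longrightarrow> y \<bullet> (M x *v z) = dirD \<kappa> x y \<bullet> (G (\<kappa> x) *v dirD \<kappa> x z)"
    and B: "\<And>x y. x \<in> S \<Longrightarrow> B x \<bullet> y = dirD \<kappa> x y $ iu"
    and \<Gamma>: "\<And>k i j. \<Gamma> k i j = \<Gamma> k j i"
    and parM: "\<And>v y z. y \<bullet> (dirD M x v *v z) = bil \<Gamma> v y \<bullet> (M x *v z) + y \<bullet> (M x *v bil \<Gamma> v z)
        + 2 * m * \<tau> v * (y \<bullet> (M x *v z))"
    and parB: "\<And>v y. dirD B x v \<bullet> y = B x \<bullet> bil \<Gamma> v y + (1 + m) * \<tau> v * (B x \<bullet> y)"
    and m: "m \<noteq> 1" "m \<noteq> -1" and B0: "B x \<noteq> 0"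
  shows "\<tau> v = 0"
proof -
  \<comment> \<open>\<open>n\<close> is the value at \<open>x\<close> of minus the coordinate field
    of v; by \<open>Mn\<close> it is the vector dual to \<open>B\<close> with respect to
    \<open>M\<close>.\<close>
  obtain n where n: "dirD \<kappa> x n = - axis iv 1" using surj by (metis surj_def)
  define s where "s a b = dirD (\<lambda>x. dirD \<kappa> x a) x b" for a b
  have s_sym: "s a b = s b a" for a b unfolding s_def by (rule dirD_commute[OF assms(1) sm\<kappa> assms(2)])
  have xV: "\<kappa> x \<in> V" using \<kappa>V assms(2) by blast
  note d\<kappa> = smooth_on_has_derivative[OF sm\<kappa> assms(2)]
  have ds: "((\<lambda>x. dirD \<kappa> x a) has_derivative s a) (at x)" for a
    using smooth_on_has_derivative[OF smooth_on_dirD[OF sm\<kappa>] assms(2), of a] by (simp add: s_def[abs_def])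
  note dG = smooth_on_has_derivative[OF smG xV]
  note dM = smooth_on_has_derivative[OF smM assms(2)] and dB = smooth_on_has_derivative[OF smB assms(2)]
  define K where "K = dirD \<kappa> x"
  define g where "g = G (\<kappa> x)"
  have FD: "y \<bullet> (dirD M x v *v z) = s y v \<bullet> (g *v K z) + K y \<bullet> (dirD G (\<kappa> x) (K v) *v K z) + K y \<bullet> (g *v s z v)" for v y z
  proof -
    have "((\<lambda>x. G (\<kappa> x)) has_derivative (\<lambda>v. dirD G (\<kappa> x) (K v))) (at x)"
      using diff_chain_at[OF d\<kappa> dG] by (simp add: o_def K_def)
    from has_derivative_inner[OF ds bounded_bilinear.FDERIV[OF bounded_bilinear_matrix_vector_mult this ds], of y z]
    have "((\<lambda>x. dirD \<kappa> x y \<bullet> (G (\<kappa> x) *v dirD \<kappa> x z)) has_derivative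
        (\<lambda>v. s y v \<bullet> (g *v K z) + K y \<bullet> (dirD G (\<kappa> x) (K v) *v K z) + K y \<bullet> (g *v s z v))) (at x)"
      by (simp add: K_def g_def inner_add_right algebra_simps)
    then have "((\<lambda>x. y \<bullet> (M x *v z)) has_derivative
        (\<lambda>v. s y v \<bullet> (g *v K z) + K y \<bullet> (dirD G (\<kappa> x) (K v) *v K z) + K y \<bullet> (g *v s z v))) (at x)"
      by (rule has_derivative_transform_within_open[OF _ assms(1,2)]) (simp add: M)
    moreover have "((\<lambda>x. y \<bullet> (M x *v z)) has_derivative (\<lambda>v. y \<bullet> (dirD M x v *v z))) (at x)"
      by (intro has_derivative_inner_right bounded_linear.has_derivative[OF
            bounded_bilinear.bounded_linear_left[OF bounded_bilinear_matrix_vector_mult] dM])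
    ultimately have "(\<lambda>v. y \<bullet> (dirD M x v *v z)) = (\<lambda>v. s y v \<bullet> (g *v K z) + K y \<bullet> (dirD G (\<kappa> x) (K v) *v K z)
        + K y \<bullet> (g *v s z v))"
      by (intro has_derivative_unique)
    from fun_cong[OF this, of v] show ?thesis .
  qed
  have FB: "dirD B x v \<bullet> y = s y v $ iu" for v y
  proof -
    have "((\<lambda>x. dirD \<kappa> x y $ iu) has_derivative (\<lambda>v. s y v $ iu)) (at x)"
      by (rule bounded_linear.has_derivative[OF bounded_linear_vec_nth ds])
    then have "((\<lambda>x. B x \<bullet> y) has_derivative (\<lambda>v. s y v $ iu)) (at x)"
      by (rule has_derivative_transform_within_open[OF _ assms(1,2)]) (simp add: B)
    moreover have "((\<lambda>x. B x \<bullet> y) has_derivative (\<lambda>v. dirD B x v \<bullet> y)) (at x)"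
      by (intro has_derivative_inner_left dB)
    ultimately show ?thesis using has_derivative_unique by metis
  qed
  have DGv: "axis iv 1 \<bullet> (dirD G (\<kappa> x) k *v w) = 0" for k w
  proof -
    have "((\<lambda>z. axis iv 1 \<bullet> (G z *v w)) has_derivative (\<lambda>k. axis iv 1 \<bullet> (dirD G (\<kappa> x) k *v w))) (at (\<kappa> x))"
      by (intro has_derivative_inner_right bounded_linear.has_derivative[OF
            bounded_bilinear.bounded_linear_left[OF bounded_bilinear_matrix_vector_mult] dG])
    moreover have "((\<lambda>z. axis iv 1 \<bullet> (G z *v w)) has_derivative (\<lambda>k. 0)) (at (\<kappa> x))"
      by (rule has_derivative_transform_within_open[OF has_derivative_const assms(3) xV]) (simp add: Gv)
    ultimately show ?thesis using has_derivative_unique by metis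
  qed
  have DGn: "dirD G (\<kappa> x) (K n) = 0"
    using Gind[OF xV] has_derivative_linear[OF dG] by (simp add: K_def n linear_neg)
  have gs: "v \<bullet> (g *v w) = w \<bullet> (g *v v)" for v w unfolding g_def by (rule Gsym[OF xV])
  have Kn: "K n \<bullet> (g *v w) = w $ iu" for w by (simp add: K_def n g_def Gv[OF xV])
  have Mn: "n \<bullet> (M x *v y) = B x \<bullet> y" for y
    unfolding M[OF assms(2)] B[OF assms(2)] using Kn by (simp add: K_def g_def)
  have "n \<bullet> (dirD M x y *v z) = s n y \<bullet> (g *v K z) + s z y $ iu" for y z
    unfolding FD Kn using DGv by (simp add: K_def n)
  moreover have "y \<bullet> (dirD M x n *v z) = s y n \<bullet> (g *v K z) + s z n \<bullet> (g *v K y)" for y z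
    unfolding FD DGn using gs[of "K y"] by simp
  \<comment> \<open>In this combination the second derivatives \<open>s\<close> of
    \<open>\<kappa>\<close> cancel. It is the Killing equation of the null field, written with
    \<open>B\<close> in place of the field with lowered index.\<close>
  ultimately have killing: "y \<bullet> (dirD M x n *v z) - n \<bullet> (dirD M x y *v z) - n \<bullet> (dirD M x z *v y) + dirD B x y \<bullet> z
      + dirD B x z \<bullet> y = 0" for y z
    unfolding FB using s_sym[of y n] s_sym[of z n] by simp
  have bs: "bil \<Gamma> v w = bil \<Gamma> w v" for v w by (rule bil_commute[OF \<Gamma>])
  \<comment> \<open>On substituting the Weyl relations all terms with \<Gamma> cancel; the
    coefficient 1 - m is (1 + m) - 2m.\<close>
  have W1: "2 * m * \<tau> n * (y \<bullet> (M x *v z)) + (1 - m) * (\<tau> y * (B x \<bullet> z) + \<tau> z * (B x \<bullet> y)) = 0" for y z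
    using killing[of y z] M[OF assms(2), of y "bil \<Gamma> n z"] M[OF assms(2), of "bil \<Gamma> n z" y] Gsym[OF xV]
    unfolding parM parB Mn bs[of n y] bs[of n z] bs[of z y] by (simp add: algebra_simps)
  have W2: "\<tau> y * (B x \<bullet> z) = \<tau> z * (B x \<bullet> y)" for y z
  proof -
    have "dirD B x y \<bullet> z = dirD B x z \<bullet> y" unfolding FB by (simp add: s_sym)
    then have "(1 + m) * (\<tau> y * (B x \<bullet> z)) = (1 + m) * (\<tau> z * (B x \<bullet> y))"
      unfolding parB bs[of y z] by simp
    moreover have "1 + m \<noteq> 0" using m(2) by linarith
    ultimately show ?thesis by simp
  qed
  have BB: "B x \<bullet> B x \<noteq> 0" using B0 by simp
  have Bn: "B x \<bullet> n = 0" using B[OF assms(2), of n] assms(7) by (simp add: n axis_def)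
  \<comment> \<open>\<open>B\<close> annihilates \<open>n\<close>, so by \<open>W2\<close> the form
    \<open>\<tau>\<close> does too; then \<open>W1\<close> and \<open>W2\<close> together leave (1 -
    m) times \<open>\<tau>\<close> equal to 0.\<close>
  have "\<tau> n * (B x \<bullet> B x) = 0" using W2[of n "B x"] Bn by simp
  then have \<tau>n: "\<tau> n = 0" using BB by simp
  have "(1 - m) * (2 * (\<tau> v * (B x \<bullet> B x))) = 0"
    using W1[of v "B x"] W2[of v "B x"] \<tau>n by (simp add: algebra_simps)
  then show ?thesis using m(1) BB by simp
qed

text \<open>Rescaling by \<open>exp (k * \<psi>)\<close> adds k d\<psi> to the factor by which the
  field fails to be parallel. With k = -2m here and k = -(1 + m) in the next lemma, \<theta> turns
  into \<theta> - d\<psi> in both Weyl relations at once.\<close>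

lemma has_derivative_matrix_scale:
  fixes M :: "real^'n \<Rightarrow> real^'n^'n" and \<psi> :: "real^'n \<Rightarrow> real"
  assumes "(M has_derivative M') (at x)" "(\<psi> has_derivative \<psi>') (at x)"
    and "\<And>v y z. y \<bullet> (M' v *v z) = bil \<Gamma> v y \<bullet> (M x *v z) + y \<bullet> (M x *v bil \<Gamma> v z) + c v * (y \<bullet> (M x *v z))"
  shows "y \<bullet> (dirD (\<lambda>x. exp (k * \<psi> x) *\<^sub>R M x) x v *v z)
    = bil \<Gamma> v y \<bullet> ((exp (k * \<psi> x) *\<^sub>R M x) *v z) + y \<bullet> ((exp (k * \<psi> x) *\<^sub>R M x) *v bil \<Gamma> v z) + (c v + k * \<psi>' v) * (y
        \<bullet> ((exp (k * \<psi> x) *\<^sub>R M x) *v z))"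
proof -
  have "((\<lambda>x. exp (k * \<psi> x) *\<^sub>R M x) has_derivative (\<lambda>v. exp (k * \<psi> x) *\<^sub>R M' v
      + (exp (k * \<psi> x) * (k * \<psi>' v)) *\<^sub>R M x)) (at x)"
    by (auto intro!: derivative_eq_intros assms(1,2))
  then have "dirD (\<lambda>x. exp (k * \<psi> x) *\<^sub>R M x) x v = exp (k * \<psi> x) *\<^sub>R M' v + (exp (k * \<psi> x) * (k * \<psi>' v)) *\<^sub>R M x"
      by (simp add: dirD_eqI)
  then show ?thesis
    by (simp add: matrix_vector_mult_add_rdistrib scaleR_matrix_vector_assoc[symmetric] inner_add_right assms(3)
        algebra_simps)
qed

lemma has_derivative_vector_scale:
  fixes B :: "real^'n \<Rightarrow> real^'n" and \<psi> :: "real^'n \<Rightarrow> real"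
  assumes "(B has_derivative B') (at x)" "(\<psi> has_derivative \<psi>') (at x)"
    and "\<And>v y. B' v \<bullet> y = B x \<bullet> bil \<Gamma> v y + c v * (B x \<bullet> y)"
  shows "dirD (\<lambda>x. exp (k * \<psi> x) *\<^sub>R B x) x v \<bullet> y
    = (exp (k * \<psi> x) *\<^sub>R B x) \<bullet> bil \<Gamma> v y + (c v + k * \<psi>' v) * ((exp (k * \<psi> x) *\<^sub>R B x) \<bullet> y)"
proof -
  have "((\<lambda>x. exp (k * \<psi> x) *\<^sub>R B x) has_derivative (\<lambda>v. exp (k * \<psi> x) *\<^sub>R B' v
      + (exp (k * \<psi> x) * (k * \<psi>' v)) *\<^sub>R B x)) (at x)"
    by (auto intro!: derivative_eq_intros assms(1,2))
  then have "dirD (\<lambda>x. exp (k * \<psi> x) *\<^sub>R B x) x v = exp (k * \<psi> x) *\<^sub>R B' v + (exp (k * \<psi> x) * (k * \<psi>' v)) *\<^sub>R B x"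
      by (simp add: dirD_eqI)
  then show ?thesis by (simp add: inner_add_left assms(3) algebra_simps)
qed

subsection \<open>Kropina metrics on a manifold\<close>

lemma chartD:
  assumes "is_chart c"
  shows "open (cdom c)" "open (cimg c)" "p \<in> cdom c \<Longrightarrow> cinv c (cmap c p) = p"
    "x \<in> cimg c \<Longrightarrow> cmap c (cinv c x) = x" "x \<in> cimg c \<Longrightarrow> cinv c x \<in> cdom c"
    "open W \<Longrightarrow> W \<subseteq> cdom c \<Longrightarrow> open (cmap c ` W)"
proof -
  have hom: "homeomorphism (cdom c) (cimg c) (cmap c) (cinv c)" using assms by (simp add: is_chart_def)
  show "open (cdom c)" "open (cimg c)" using assms by (simp_all add: is_chart_def)
  show "p \<in> cdom c \<Longrightarrow> cinv c (cmap c p) = p" "x \<in> cimg c \<Longrightarrow> cmap c (cinv c x) = x" "x \<in> cimg c \<Longrightarrow> cinv c x \<in> cdom c"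
    using hom by (auto simp: homeomorphism_def)
  show "open W \<Longrightarrow> W \<subseteq> cdom c \<Longrightarrow> open (cmap c ` W)"
    using open_homeomorphism_image(1)[OF hom \<open>open (cimg c)\<close>] by blast
qed

locale manifold =
  fixes M :: "'p::{t2_space, second_countable_topology} set" and At :: "('p, 'n::finite) chart set"
  assumes smooth_manifold: "smooth_manifold M At"
begin

lemma is_chart: "c \<in> At \<Longrightarrow> is_chart c"
  using smooth_manifold by (simp add: smooth_manifold_def)

lemma cdom_open: "c \<in> At \<Longrightarrow> open (cdom c)"
  using is_chart chartD(1) by blast

lemma cdom_M: "c \<in> At \<Longrightarrow> cdom c \<subseteq> M" and M_cdom: "p \<in> M \<Longrightarrow> \<exists>c\<in>At. p \<in> cdom c"
  using smooth_manifold unfolding smooth_manifold_def by blast+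

lemma overlap_open: "c \<in> At \<Longrightarrow> c' \<in> At \<Longrightarrow> open (cmap c ` (cdom c \<inter> cdom c'))"
  by (intro chartD(6) is_chart open_Int cdom_open) auto

lemma transition_smooth: "c \<in> At \<Longrightarrow> c' \<in> At \<Longrightarrow> smooth_on (cmap c ` (cdom c \<inter> cdom c')) (transition c c')"
  using smooth_manifold unfolding smooth_manifold_def compatible_def by blast

lemma transition_apply: "c \<in> At \<Longrightarrow> p \<in> cdom c \<Longrightarrow> transition c c' (cmap c p) = cmap c' p"
  by (simp add: transition_def chartD(3)[OF is_chart])

lemma transition_derivative:
  assumes "c \<in> At" "c' \<in> At" "p \<in> cdom c" "p \<in> cdom c'"
  shows "(transition c c' has_derivative dirD (transition c c') (cmap c p)) (at (cmap c p))"
  by (rule smooth_on_has_derivative[OF transition_smooth[OF assms(1,2)]]) (use assms in auto)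

text \<open>The chain rule, which makes \<open>tvec\<close> satisfy the transformation law of
  tangent vectors.\<close>

lemma transition_cocycle:
  assumes "c \<in> At" "c' \<in> At" "c'' \<in> At" "p \<in> cdom c" "p \<in> cdom c'" "p \<in> cdom c''"
  shows "dirD (transition c' c'') (cmap c' p) (dirD (transition c c') (cmap c p) y) = dirD (transition c c'') (cmap c p) y"
proof -
  let ?W = "cmap c ` (cdom c \<inter> cdom c' \<inter> cdom c'')"
  have op: "open ?W" by (intro chartD(6) is_chart open_Int cdom_open assms) auto
  have "(transition c' c'' has_derivative dirD (transition c' c'') (cmap c' p)) (at (transition c c' (cmap c p)))"
    using transition_derivative[OF assms(2,3,5,6)] by (simp add: transition_apply assms)
  from diff_chain_at[OF transition_derivative[OF assms(1,2,4,5)] this]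
  have "(transition c c'' has_derivative (dirD (transition c' c'') (cmap c' p) \<circ> dirD (transition c c') (cmap c p)))
      (at (cmap c p))"
    by (rule has_derivative_transform_within_open[OF _ op]) (use assms in \<open>auto simp: transition_apply\<close>)
  from dirD_eqI[OF this] show ?thesis by simp
qed

lemma transition_self:
  assumes "c \<in> At" "p \<in> cdom c"
  shows "dirD (transition c c) (cmap c p) y = y"
proof -
  have "(transition c c has_derivative (\<lambda>y. y)) (at (cmap c p))"
    by (rule has_derivative_transform_within_open[OF has_derivative_ident chartD(2)[OF is_chart[OF assms(1)]]])
       (use assms in \<open>auto simp: transition_apply\<close>)
  from dirD_eqI[OF this] show ?thesis by simp
qed

lemma tvec_tangent: "c \<in> At \<Longrightarrow> p \<in> cdom c \<Longrightarrow> tvec At c p y \<in> tangent_space At p"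
  unfolding tangent_space_def
      by (intro CollectI conjI ballI allI impI) (simp_all add: tvec_def charts_at_def transition_cocycle, blast)

lemma tvec_apply:
  assumes "c \<in> At" "c' \<in> At" "p \<in> cdom c" "p \<in> cdom c'"
  shows "tvec At c p y c' = dirD (transition c c') (cmap c p) y"
  using assms by (simp add: tvec_def charts_at_def)

lemma tvec_same: "c \<in> At \<Longrightarrow> p \<in> cdom c \<Longrightarrow> tvec At c p y c = y"
  by (simp add: tvec_apply transition_self)

lemma tangent_apply:
  assumes "v \<in> tangent_space At p" "c \<in> At" "c' \<in> At" "p \<in> cdom c" "p \<in> cdom c'"
  shows "v c' = dirD (transition c c') (cmap c p) (v c)"
proof -
  have "c \<in> charts_at At p" "c' \<in> charts_at At p" using assms by (simp_all add: charts_at_def)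
  then show ?thesis using assms(1) unfolding tangent_space_def by blast
qed

lemma tvec_tangent_eq:
  assumes "v \<in> tangent_space At p" "c \<in> At" "p \<in> cdom c"
  shows "tvec At c p (v c) = v"
proof
  fix c' show "tvec At c p (v c) c' = v c'"
  proof (cases "c' \<in> charts_at At p")
    case True
    then show ?thesis using assms by (simp add: tvec_def charts_at_def tangent_apply[of v p c c'])
  next
    \<comment> \<open>Away from the charts at \<open>p\<close> both families take the default value
      0.\<close>
    case False
    then have "v c' = 0" using assms(1) unfolding tangent_space_def by blast
    then show ?thesis using False by (simp add: tvec_def)
  qed
qed

text \<open>A tangent vector is recovered from its components in any one chart, so bilinearity in
  that chart reduces the form to its values on coordinate vectors.\<close>

lemma form_comp2:
  assumes q: "pseudo_riemannian At V q" and c: "c \<in> At" "p \<in> cdom c" "p \<in> V" and vw: "v \<in> tangent_space At p"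
      "w \<in> tangent_space At p"
  shows "q p v w = v c \<bullet> (comp2 At q c (cmap c p) *v w c)"
proof -
  have bil: "bilinear (\<lambda>y z. q p (tvec At c p y) (tvec At c p z))" using q c by (auto simp: pseudo_riemannian_def)
  define L where "L y z = q p (tvec At c p y) (tvec At c p z)" for y z
  have L: "linear (L y)" "linear (\<lambda>y. L y z)" for y z using bil unfolding L_def bilinear_def by blast+
  have e: "comp2 At q c (cmap c p) $ i $ j = L (axis i 1) (axis j 1)" for i j
    by (simp add: comp2_def L_def chartD(3)[OF is_chart[OF c(1)] c(2)])
  have "L (axis i 1) z = axis i 1 \<bullet> (comp2 At q c (cmap c p) *v z)" for i z
    by (rule linear_eq_axis[where f = "L (axis i 1)", OF L(1)])
       (auto intro!: linearI simp: matrix_vector_right_distrib matrix_vector_mult_scaleR inner_add_right inner_axis_matrix e)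
  then have "L y z = y \<bullet> (comp2 At q c (cmap c p) *v z)" for y z
    by (rule linear_eq_axis[where f = "\<lambda>y. L y z", OF L(2), rotated]) (auto intro!: linearI simp: inner_add_left)
  from this[of "v c" "w c"] show ?thesis by (simp add: L_def tvec_tangent_eq vw c)
qed

lemma form_comp1:
  assumes b: "one_form At V b" and c: "c \<in> At" "p \<in> cdom c" "p \<in> V" and v: "v \<in> tangent_space At p"
  shows "b p v = comp1 At b c (cmap c p) \<bullet> v c"
proof -
  have lin: "linear (\<lambda>y. b p (tvec At c p y))" using b c by (auto simp: one_form_def)
  have "b p (tvec At c p y) = comp1 At b c (cmap c p) \<bullet> y" for y
    by (rule linear_eq_axis[OF lin])
       (auto intro!: linearI simp: inner_add_right inner_axis comp1_def chartD(3)[OF is_chart[OF c(1)] c(2)])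
  from this[of "v c"] show ?thesis by (simp add: tvec_tangent_eq v c)
qed

lemma comp2_eqI:
  assumes q: "pseudo_riemannian At V q" and c: "c \<in> At" "p \<in> cdom c" "p \<in> V"
  shows "y \<bullet> (comp2 At q c (cmap c p) *v z) = q p (tvec At c p y) (tvec At c p z)"
  using form_comp2[OF q c tvec_tangent tvec_tangent, of c c y z] c by (simp add: tvec_same)

lemma comp2_sym:
  assumes q: "pseudo_riemannian At V q" and c: "c \<in> At" "x \<in> cmap c ` (V \<inter> cdom c)"
  shows "y \<bullet> (comp2 At q c x *v z) = z \<bullet> (comp2 At q c x *v y)"
proof -
  obtain p where p: "x = cmap c p" "p \<in> V" "p \<in> cdom c" using c(2) by auto
  have "q p (tvec At c p y) (tvec At c p z) = q p (tvec At c p z) (tvec At c p y)"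
    using q p(2) tvec_tangent[OF c(1) p(3)] unfolding pseudo_riemannian_def by blast
  then show ?thesis by (simp add: p(1) comp2_eqI[OF q c(1) p(3,2)])
qed

end

section \<open>The normal form of the metric as a bilinear form and as a matrix field\<close>

lemma bilinear_uv_form: "bilinear (uv_form iu iv H W h x)"
  unfolding bilinear_def uv_form_def sym_prod_def dx_def
  by (auto intro!: linearI simp: algebra_simps sum.distrib sum_distrib_left add_divide_distrib)

lemma uv_form_sym: "uv_form iu iv H W h x y z = uv_form iu iv H W h x z y"
  by (simp add: uv_form_def sym_prod_def mult.commute add.commute)

text \<open>Only the term -2 du dv involves v; hence the coordinate field of v is null and minus the
  dual of du, whatever the coefficients.\<close>

lemma uv_form_dv: "iu \<noteq> iv \<Longrightarrow> uv_form iu iv H W h x (axis iv 1) w = - w $ iu"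
  by (simp add: uv_form_def sym_prod_def dx_def axis_def)

definition uv_matrix :: "'n::finite \<Rightarrow> 'n \<Rightarrow> (real^'n \<Rightarrow> real) \<Rightarrow> ('n \<Rightarrow> real^'n \<Rightarrow> real) \<Rightarrow> ('n \<Rightarrow> 'n \<Rightarrow> real^'n \<Rightarrow> real) \<Rightarrow>
    real^'n \<Rightarrow> real^'n^'n" where
  "uv_matrix iu iv H W h x = (\<chi> i j. uv_form iu iv H W h x (axis i 1) (axis j 1))"

lemma uv_matrix_form: "y \<bullet> (uv_matrix iu iv H W h x *v z) = uv_form iu iv H W h x y z"
proof -
  define L where "L = uv_form iu iv H W h x"
  have L: "linear (L y)" "linear (\<lambda>y. L y z)" for y z
    using bilinear_uv_form unfolding L_def bilinear_def by blast+
  have "axis i 1 \<bullet> (uv_matrix iu iv H W h x *v z) = L (axis i 1) z" for i z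
    by (rule linear_eq_axis[where g = "L (axis i 1)", OF _ L(1)])
       (auto intro!: linearI simp: matrix_vector_right_distrib matrix_vector_mult_scaleR inner_add_right
           inner_axis_matrix uv_matrix_def L_def)
  then have "y \<bullet> (uv_matrix iu iv H W h x *v z) = L y z"
    by (rule linear_eq_axis[where g = "\<lambda>y. L y z", OF _ L(2), rotated]) (auto intro!: linearI simp: inner_add_left)
  then show ?thesis by (simp add: L_def)
qed

section \<open>Null Kropina metrics of Berwald type in the charts of a manifold\<close>

locale kropina_manifold = manifold M At
  for M :: "'p::{t2_space, second_countable_topology} set" and At :: "('p, 'n::finite) chart set" +
  fixes A :: "('p \<times> ('p, 'n) tangent) set" and F :: "'p \<Rightarrow> ('p, 'n) tangent \<Rightarrow> real"
    and a :: "'p \<Rightarrow> ('p, 'n) tangent \<Rightarrow> ('p, 'n) tangent \<Rightarrow> real" and b :: "'p \<Rightarrow> ('p, 'n) tangent \<Rightarrow> real"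
    and m :: real and iu iv :: 'n
  assumes card: "CARD('n) > 2" and iuv: "iu \<noteq> iv" and m0: "m \<noteq> 0" and kropina: "kropina_metric M At A m a b F"
    and berwald: "berwald At A F" and null: "\<forall>c\<in>At. \<forall>x\<in>cimg c. norm2 At a b c x = 0"
begin

lemma finsler: "finsler_metric M At A F" and riem: "pseudo_riemannian At M a" and oform: "one_form At M b"
  using kropina by (simp_all add: kropina_metric_def)

lemma F_eq:
  assumes "(p, v) \<in> A"
  shows "rpow_defined (sqrt \<bar>a p v v\<bar>) (1 + m)" "rpow_defined (b p v) (- m)"
      "F p v = rpow (sqrt \<bar>a p v v\<bar>) (1 + m) * rpow (b p v) (- m)"
  using kropina assms by (auto simp: kropina_metric_def Let_def)

lemma conic: "conic_subbundle M At A"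
  using finsler by (simp add: finsler_metric_def)

lemma A_D:
  assumes "(p, v) \<in> A"
  shows "p \<in> M" "v \<in> tangent_space At p"
  using conic assms unfolding conic_subbundle_def TM_def by blast+

lemma M_Int: "c \<in> At \<Longrightarrow> M \<inter> cdom c = cdom c"
  using cdom_M by blast

lemma coord_imageE:
  assumes "(x, y) \<in> coord_image c A"
  obtains p v where "x = cmap c p" "y = v c" "(p, v) \<in> A" "p \<in> cdom c"
  using assms unfolding coord_image_def by blast

lemma Frep_eq:
  assumes "c \<in> At" "(p, v) \<in> A" "p \<in> cdom c"
  shows "Frep At F c (cmap c p) (v c) = F p v"
  using assms A_D(2)[OF assms(2)] by (simp add: Frep_def chartD(3)[OF is_chart] tvec_tangent_eq)

lemma smooth_comp: "c \<in> At \<Longrightarrow> smooth_on (cimg c) (comp2 At a c)" "c \<in> At \<Longrightarrow> smooth_on (cimg c) (comp1 At b c)"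
  using riem oform M_Int unfolding pseudo_riemannian_def one_form_def by metis+

lemma kropina_chart:
  assumes c: "c \<in> At"
  shows "kropina_chart (comp2 At a c) (comp1 At b c) (Frep At F c) (coord_image c A) (cimg c) m"
proof
  show "2 < CARD('n)" "m \<noteq> 0" by (rule card m0)+
  show "open (cimg c)" by (rule chartD(2)[OF is_chart[OF c]])
  show "open (coord_image c A)" using conic c by (simp add: conic_subbundle_def)
  show "smooth_on (cimg c) (comp2 At a c)" "smooth_on (cimg c) (comp1 At b c)" by (rule smooth_comp[OF c])+
  show "smooth_on (coord_image c A) (\<lambda>(x, y). Frep At F c x y)" using finsler c by (simp add: finsler_metric_def)
  show "v \<bullet> (comp2 At a c x *v w) = w \<bullet> (comp2 At a c x *v v)" if "x \<in> cimg c" for x v w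
    by (rule comp2_sym[OF riem c]) (use that M_Int[OF c] in simp)
  show "invertible (comp2 At a c x)" if "x \<in> cimg c" for x
    using riem c that M_Int[OF c] unfolding pseudo_riemannian_def by blast
  fix x y assume xy: "(x, y) \<in> coord_image c A"
  then obtain p v where pv: "x = cmap c p" "y = v c" "(p, v) \<in> A" "p \<in> cdom c" by (rule coord_imageE)
  note v = A_D[OF pv(3)]
  show "x \<in> cimg c" using pv by simp
  show "invertible (fundamental_tensor (Frep At F c) x y)" using finsler c xy by (auto simp: finsler_metric_def)
  have form: "y \<bullet> (comp2 At a c x *v y) = a p v v" "comp1 At b c x \<bullet> y = b p v"
    using form_comp2[OF riem c pv(4) v(1) v(2) v(2)] form_comp1[OF oform c pv(4) v] by (simp_all add: pv)
  show "rpow_defined (sqrt \<bar>y \<bullet> (comp2 At a c x *v y)\<bar>) (1 + m) \<and> rpow_defined (comp1 At b c x \<bullet> y) (- m)"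
    using F_eq[OF pv(3)] by (simp add: form)
  show "Frep At F c x y = rpow (sqrt \<bar>y \<bullet> (comp2 At a c x *v y)\<bar>) (1 + m) * rpow (comp1 At b c x \<bullet> y) (- m)"
    using F_eq(3)[OF pv(3)] Frep_eq[OF c pv(3,4)] by (simp only: form) (simp add: pv)
  fix t :: real assume t: "0 < t"
  have tA: "(p, \<lambda>c. t *\<^sub>R v c) \<in> A" using conic pv(3) t unfolding conic_subbundle_def by blast
  show "(x, t *\<^sub>R y) \<in> coord_image c A"
    unfolding coord_image_def using tA pv by (intro CollectI exI[of _ p] exI[of _ "\<lambda>c. t *\<^sub>R v c"]) auto
  have "F p (\<lambda>c. t *\<^sub>R v c) = t * F p v" using finsler pv(3) t unfolding finsler_metric_def by blast
  then show "Frep At F c x (t *\<^sub>R y) = t * Frep At F c x y"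
    using Frep_eq[OF c pv(3,4)] Frep_eq[OF c tA pv(4)] by (simp add: pv)
qed

lemma fibre_nonempty:
  assumes c: "c \<in> At" "x \<in> cimg c"
  obtains y where "(x, y) \<in> coord_image c A"
proof -
  obtain p where p: "x = cmap c p" "p \<in> cdom c" using c by blast
  then have "p \<in> fst ` A" using conic cdom_M[OF c(1)] unfolding conic_subbundle_def by blast
  then obtain v where "(p, v) \<in> A" by force
  then show thesis using that[of "v c"] p unfolding coord_image_def by blast
qed

abbreviation \<Gamma> where "\<Gamma> c x \<equiv> affine_connection At A F c x"

text \<open>Resolves the \<open>THE\<close> in \<open>affine_connection\<close>: two candidates
  differ by linear forms vanishing on the fibre over \<open>x\<close>, which is open and
  nonempty.\<close>

lemma affine_connection_eq:
  assumes c: "c \<in> At" "x \<in> cimg c" and xy: "(x, y) \<in> coord_image c A"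
  shows "nonlinear_connection (Frep At F c) k i x y = (\<Sum>j\<in>UNIV. \<Gamma> c x k i j * y $ j)"
proof -
  interpret kropina_chart "comp2 At a c" "comp1 At b c" "Frep At F c" "coord_image c A" "cimg c" m
    by (rule kropina_chart[OF c(1)])
  obtain G0 where G0: "\<And>y k i. (x, y) \<in> coord_image c A \<Longrightarrow> nonlinear_connection (Frep At F c) k i x y
      = (\<Sum>j\<in>UNIV. G0 x k i j * y $ j)"
    using berwald c(1) unfolding berwald_def by blast
  have "\<Gamma> c x = G0 x"
    unfolding affine_connection_def
  proof (rule the_equality)
    show "\<forall>y. (x, y) \<in> coord_image c A \<longrightarrow> (\<forall>k i. nonlinear_connection (Frep At F c) k i x y = (\<Sum>j\<in>UNIV. G0 x k i j * y $ j))"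
      using G0 by blast
    fix G1 assume G1: "\<forall>y. (x, y) \<in> coord_image c A \<longrightarrow> (\<forall>k i. nonlinear_connection (Frep At F c) k i x y
        = (\<Sum>j\<in>UNIV. G1 k i j * y $ j))"
    show "G1 = G0 x"
    proof (intro ext)
      fix k i j
      have "(\<chi> j. G1 k i j - G0 x k i j) = 0"
      proof (rule inner_vanishes_on_open[OF open_fibre])
        show "y \<in> {y. (x, y) \<in> coord_image c A}" using xy by simp
        fix y assume "y \<in> {y. (x, y) \<in> coord_image c A}"
        then have "(\<Sum>j\<in>UNIV. G1 k i j * y $ j) = (\<Sum>j\<in>UNIV. G0 x k i j * y $ j)" using G0 G1 by (metis mem_Collect_eq)
        then show "(\<chi> j. G1 k i j - G0 x k i j) \<bullet> y = 0" by (simp add: inner_vec_def left_diff_distrib sum_subtractf)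
      qed
      then show "G1 k i j = G0 x k i j" by (simp add: vec_eq_iff)
    qed
  qed
  then show ?thesis using G0[OF xy] by simp
qed

text \<open>The 1-form is only asserted to exist at each point; its dependence on the point is
  settled later, by exhibiting it as a differential.\<close>

lemma weyl:
  assumes c: "c \<in> At" "x \<in> cimg c"
  shows "\<Gamma> c x k i j = \<Gamma> c x k j i" "comp1 At b c x \<noteq> 0" "m \<noteq> 1" "m \<noteq> -1"
    "comp1 At b c x \<bullet> (matrix_inv (comp2 At a c x) *v comp1 At b c x) = 0"
    "\<exists>\<theta>. linear \<theta> \<and> (\<forall>v y z. y \<bullet> (dirD (comp2 At a c) x v *v z) = bil (\<Gamma> c x) v y \<bullet> (comp2 At a c x *v z)
        + y \<bullet> (comp2 At a c x *v bil (\<Gamma> c x) v z) + 2 * m * \<theta> v * (y \<bullet> (comp2 At a c x *v z)))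
      \<and> (\<forall>v y. dirD (comp1 At b c) x v \<bullet> y = comp1 At b c x \<bullet> bil (\<Gamma> c x) v y + (1 + m) * \<theta> v * (comp1 At b c x \<bullet> y))"
proof -
  interpret K: kropina_chart "comp2 At a c" "comp1 At b c" "Frep At F c" "coord_image c A" "cimg c" m
    by (rule kropina_chart[OF c(1)])
  obtain y where xy: "(x, y) \<in> coord_image c A" using fibre_nonempty[OF c] .
  show "\<Gamma> c x k i j = \<Gamma> c x k j i"
    by (rule berwald_horizontal(1)[OF K.opD K.smf _ _ _ _ xy]) (use K.cone K.hom K.nondeg affine_connection_eq[OF c] in auto)
  show "comp1 At b c x \<noteq> 0" "m \<noteq> -1" by (rule K.B_nonzero[OF xy] K.m_neq_minus_1[OF xy])+
  show n: "comp1 At b c x \<bullet> (matrix_inv (comp2 At a c x) *v comp1 At b c x) = 0"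
  proof -
    have "norm2 At a b c x = 0" using null c by blast
    then show ?thesis by (simp add: norm2_def inner_vec_def matrix_vector_mult_def sum_distrib_left mult_ac)
  qed
  show "m \<noteq> 1" by (rule K.m_neq_1[OF xy n])
  obtain \<theta> where "linear \<theta>"
    "\<And>v y z. y \<bullet> (dirD (comp2 At a c) x v *v z) = K.p x (bil (\<Gamma> c x) v y) z + K.p x y (bil (\<Gamma> c x) v z)
        + 2 * m * \<theta> v * K.p x y z"
    "\<And>v y. dirD (comp1 At b c) x v \<bullet> y = comp1 At b c x \<bullet> bil (\<Gamma> c x) v y + (1 + m) * \<theta> v * (comp1 At b c x \<bullet> y)"
    using K.weyl_structure[OF xy affine_connection_eq[OF c]] by blast
  then show "\<exists>\<theta>. linear \<theta> \<and> (\<forall>v y z. y \<bullet> (dirD (comp2 At a c) x v *v z) = bil (\<Gamma> c x) v y \<bullet> (comp2 At a c x *v z)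
        + y \<bullet> (comp2 At a c x *v bil (\<Gamma> c x) v z) + 2 * m * \<theta> v * (y \<bullet> (comp2 At a c x *v z)))
      \<and> (\<forall>v y. dirD (comp1 At b c) x v \<bullet> y = comp1 At b c x \<bullet> bil (\<Gamma> c x) v y + (1 + m) * \<theta> v * (comp1 At b c x \<bullet> y))"
    by (intro exI[of _ \<theta>]) (simp add: K.p_def)
qed

lemma levi_civita_christoffel: "levi_civita At q c x = christoffel (comp2 At q c) x"
  by (intro ext) (simp add: levi_civita_def christoffel_def)

end

lemma rpow_mult_pos:
  assumes "0 < k"
  shows "rpow (k * t) p = k powr p * rpow t p"
proof (cases "p \<in> \<int>")
  case True
  then obtain n where n: "p = of_int n" by (auto elim: Ints_cases)
  then show ?thesis using assms by (simp add: rpow_def power_int_mult_distrib powr_real_of_int')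
next
  case False
  then show ?thesis by (simp add: rpow_def powr_mult)
qed

text \<open>One of \<open>p\<close> and \<open>p / 2\<close> may be an integer without the other,
  but at positive bases \<open>rpow\<close> agrees with \<open>powr\<close> in either case, and at 0
  both sides are 1 or 0 according to whether \<open>p\<close> is 0.\<close>

lemma rpow_sqrt:
  assumes "0 \<le> t"
  shows "rpow (sqrt t) p = rpow t (p / 2)"
proof (cases "t = 0")
  case True
  have "rpow 0 q = (if q = 0 then 1 else 0)" for q
    by (auto simp: rpow_def power_int_0_left_if elim!: Ints_cases)
  then show ?thesis using True by simp
next
  case False
  have pos: "rpow s q = s powr q" if "0 < s" for s q
    using that by (auto simp: rpow_def powr_real_of_int' elim!: Ints_cases)
  show ?thesis using False assms by (simp add: pos powr_half_sqrt[symmetric] powr_powr)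
qed

lemma smooth_on_uv_matrix:
  assumes "open V" "smooth_on V H" "\<And>i. i \<in> UNIV - {iu, iv} \<Longrightarrow> smooth_on V (W i)"
    "\<And>i j. i \<in> UNIV - {iu, iv} \<Longrightarrow> j \<in> UNIV - {iu, iv} \<Longrightarrow> smooth_on V (h i j)"
  shows "smooth_on V (uv_matrix iu iv H W h)"
proof -
  have "smooth_on V (\<lambda>z. uv_form iu iv H W h z v w)" for v w
    unfolding uv_form_def
    by (intro smooth_on_add smooth_on_sum smooth_on_mult smooth_on_const assms)
  then show ?thesis by (subst smooth_on_vec_iff[OF assms(1)]) (simp add: smooth_on_vec_iff[OF assms(1)] uv_matrix_def)
qed

text \<open>The infinitesimal form of independence of v: the coordinate field of v is Killing for
  the normal form. This is the hypothesis \<open>Gind\<close> of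
  \<open>adapted_weyl_exact\<close>.\<close>

lemma dirD_uv_matrix_dv:
  assumes "open V" "z \<in> V" "smooth_on V (uv_matrix iu iv H W h)" "indep_of iv V H"
      "\<And>i. i \<in> UNIV - {iu, iv} \<Longrightarrow> indep_of iv V (W i)"
    "\<And>i j. i \<in> UNIV - {iu, iv} \<Longrightarrow> j \<in> UNIV - {iu, iv} \<Longrightarrow> indep_of iv V (h i j)"
  shows "dirD (uv_matrix iu iv H W h) z (axis iv 1) = 0"
proof -
  have ind: "uv_matrix iu iv H W h z' = uv_matrix iu iv H W h z" if "z' \<in> V" "\<And>i. i \<noteq> iv \<Longrightarrow> z' $ i = z $ i" for z'
  proof -
    have "f z' = f z" if "indep_of iv V f" for f
      using that \<open>z' \<in> V\<close> assms(2) \<open>\<And>i. i \<noteq> iv \<Longrightarrow> z' $ i = z $ i\<close> unfolding indep_of_def by blast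
    then have fH: "H z' = H z" and fW: "\<And>i. i \<in> UNIV - {iu, iv} \<Longrightarrow> W i z' = W i z"
      and fh: "\<And>i j. i \<in> UNIV - {iu, iv} \<Longrightarrow> j \<in> UNIV - {iu, iv} \<Longrightarrow> h i j z' = h i j z"
      using assms(4-6) by blast+
    have "uv_form iu iv H W h z' v w = uv_form iu iv H W h z v w" for v w
      unfolding uv_form_def fH
      by (intro arg_cong2[where f = "(+)"] arg_cong2[where f = "(*)"] refl sum.cong) (simp_all only: fW fh)
    then show ?thesis by (simp add: uv_matrix_def)
  qed
  have "((\<lambda>s. uv_matrix iu iv H W h (z + s *\<^sub>R axis iv 1)) has_vector_derivative dirD (uv_matrix iu iv H W h) z (axis
      iv 1)) (at 0)"
    by (rule has_derivative_along_line) (use smooth_on_has_derivative[OF assms(3,2)] in simp)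
  moreover have "((\<lambda>s. uv_matrix iu iv H W h (z + s *\<^sub>R axis iv 1)) has_vector_derivative 0) (at 0)"
  proof (rule has_vector_derivative_transform_within_open[OF has_vector_derivative_const])
    show "open ((\<lambda>s. z + s *\<^sub>R axis iv 1) -` V)" by (rule open_vimage[OF assms(1)]) (intro continuous_intros)
    show "0 \<in> (\<lambda>s. z + s *\<^sub>R axis iv 1) -` V" using assms(2) by simp
    fix s assume "s \<in> (\<lambda>s. z + s *\<^sub>R axis iv (1::real)) -` V"
    then show "uv_matrix iu iv H W h z = uv_matrix iu iv H W h (z + s *\<^sub>R axis iv 1)"
      by (intro ind[symmetric]) (auto simp: axis_def)
  qed
  ultimately show ?thesis by (rule vector_derivative_unique_at)
qed

section \<open>The two implications and the formula for F\<close>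

context kropina_manifold
begin

text \<open>The exponentials coming from \<alpha> and \<beta> have the opposite exponents m (1 + m)
  \<psi> and -m (1 + m) \<psi>, so they cancel.\<close>

lemma adapted_formula:
  assumes ad: "adapted_coordinates At m a b iu iv c \<psi> H W h" and pv: "(p, v) \<in> A" "p \<in> cdom c"
  shows "F p v = rpow \<bar>uv_form iu iv H W h (cmap c p) (v c) (v c)\<bar> ((1 + m) / 2) * rpow (dx iu (v c)) (- m)"
proof -
  define Q where "Q = uv_form iu iv H W h (cmap c p) (v c) (v c)"
  define k where "k = \<psi> (cmap c p)"
  note v = A_D(2)[OF pv(1)]
  have aQ: "a p v v = exp (2 * m * k) * Q" and bu: "b p v = exp ((1 + m) * k) * dx iu (v c)"
    using ad v pv(2) unfolding adapted_coordinates_def Q_def k_def by blast+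
  have "sqrt \<bar>a p v v\<bar> = exp (m * k) * sqrt \<bar>Q\<bar>"
  proof -
    have "exp (2 * m * k) = (exp (m * k))\<^sup>2" by (simp add: exp_double[symmetric] mult.assoc)
    then show ?thesis by (simp add: aQ abs_mult real_sqrt_mult)
  qed
  then have "F p v = (exp (m * k) powr (1 + m) * exp ((1 + m) * k) powr (- m)) * (rpow (sqrt \<bar>Q\<bar>) (1
      + m) * rpow (dx iu (v c)) (- m))"
    unfolding F_eq(3)[OF pv(1)] bu by (simp add: rpow_mult_pos)
  also have "exp (m * k) powr (1 + m) * exp ((1 + m) * k) powr (- m) = 1"
    by (simp add: exp_powr_real exp_add[symmetric] algebra_simps)
  finally show ?thesis by (simp add: rpow_sqrt Q_def)
qed

text \<open>A local metrization is tested in every chart, so the argument runs in an arbitrary chart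
  \<open>c'\<close> meeting \<open>c\<close>, and \<open>c\<close> enters through the transition
  map. There the matrix of the proposed metric is the rescaled \<open>Mt\<close>, whose Weyl form
  vanishes by \<open>adapted_weyl_exact\<close>; uniqueness of the symmetric parallel connection
  identifies its Christoffel symbols.\<close>

lemma adapted_metrization:
  assumes ad: "adapted_coordinates At m a b iu iv c \<psi> H W h"
  shows "local_metrization M At A F (cdom c) (\<lambda>p v w. uv_form iu iv H W h (cmap c p) (v c) (w c))"
proof -
  have c: "c \<in> At" and sm\<psi>: "smooth_on (cimg c) \<psi>" and smH: "smooth_on (cimg c) H" "indep_of iv (cimg c) H"
    and smW: "\<And>i. i \<in> UNIV - {iu, iv} \<Longrightarrow> smooth_on (cimg c) (W i)" "\<And>i. i \<in> UNIV - {iu, iv} \<Longrightarrow> indep_of iv (cimg c) (W i)"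
    and smh: "\<And>i j. i \<in> UNIV - {iu, iv} \<Longrightarrow> j \<in> UNIV - {iu, iv} \<Longrightarrow> smooth_on (cimg c) (h i j)"
      "\<And>i j. i \<in> UNIV - {iu, iv} \<Longrightarrow> j \<in> UNIV - {iu, iv} \<Longrightarrow> indep_of iv (cimg c) (h i j)"
    and aeq: "\<And>p v w. p \<in> cdom c \<Longrightarrow> v \<in> tangent_space At p \<Longrightarrow> w \<in> tangent_space At p \<Longrightarrow>
        a p v w = exp (2 * m * \<psi> (cmap c p)) * uv_form iu iv H W h (cmap c p) (v c) (w c)"
    and beq: "\<And>p v. p \<in> cdom c \<Longrightarrow> v \<in> tangent_space At p \<Longrightarrow> b p v = exp ((1 + m) * \<psi> (cmap c p)) * dx iu (v c)"
    using ad unfolding adapted_coordinates_def by blast+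
  define q where "q p v w = uv_form iu iv H W h (cmap c p) (v c) (w c)" for p and v w :: "('p, 'n) tangent"
  define G where "G = uv_matrix iu iv H W h"
  have opV: "open (cimg c)" by (rule chartD(2)[OF is_chart[OF c]])
  have smG: "smooth_on (cimg c) G" unfolding G_def by (rule smooth_on_uv_matrix[OF opV smH(1) smW(1) smh(1)])
  have chart: "(\<forall>y z. q p (tvec At c' p y) (tvec At c' p z) = y \<bullet> (comp2 At q c' (cmap c' p) *v z)) \<and>
      invertible (comp2 At q c' (cmap c' p)) \<and> levi_civita At q c' (cmap c' p) = \<Gamma> c' (cmap c' p) \<and>
      smooth_on (cmap c' ` (cdom c \<inter> cdom c')) (comp2 At q c')"
    if c': "c' \<in> At" and p: "p \<in> cdom c" "p \<in> cdom c'" for c' p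
  proof -
    define S where "S = cmap c' ` (cdom c' \<inter> cdom c)"
    define \<kappa> where "\<kappa> = transition c' c"
    define x where "x = cmap c' p"
    \<comment> \<open>Undoes the factors of \<open>adapted_coordinates\<close>: \<open>Mt\<close> is
      the pullback of the normal form, and \<open>Bt\<close> that of du, along the transition map
      \<open>\<kappa>\<close>.\<close>
    define Mt where "Mt x = exp (- 2 * m * \<psi> (\<kappa> x)) *\<^sub>R comp2 At a c' x" for x
    define Bt where "Bt x = exp (- (1 + m) * \<psi> (\<kappa> x)) *\<^sub>R comp1 At b c' x" for x
    have oS: "open S" unfolding S_def by (rule overlap_open[OF c' c])
    have sm\<kappa>: "smooth_on S \<kappa>" unfolding S_def \<kappa>_def by (rule transition_smooth[OF c' c])
    have xS: "x \<in> S" using p by (auto simp: x_def S_def)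
    have Simg: "S \<subseteq> cimg c'" by (auto simp: S_def)
    have \<kappa>V: "\<kappa> ` S \<subseteq> cimg c" by (auto simp: S_def \<kappa>_def transition_apply c')
    have sm\<psi>\<kappa>: "smooth_on S (\<lambda>x. \<psi> (\<kappa> x))" by (rule smooth_on_compose[OF oS opV sm\<kappa> sm\<psi> \<kappa>V])
    have sma: "smooth_on S (comp2 At a c')" "smooth_on S (comp1 At b c')"
      by (rule smooth_on_subset[OF Simg smooth_comp(1)[OF c']] smooth_on_subset[OF Simg smooth_comp(2)[OF c']])+
    have smMt: "smooth_on S Mt" unfolding Mt_def
      by (intro smooth_on_scaleR smooth_on_exp smooth_on_mult smooth_on_const oS sm\<psi>\<kappa> sma)
    have smBt: "smooth_on S Bt" unfolding Bt_def
      by (intro smooth_on_scaleR smooth_on_exp smooth_on_mult smooth_on_const oS sm\<psi>\<kappa> sma)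
    have form: "y \<bullet> (Mt (cmap c' p) *v z) = uv_form iu iv H W h (cmap c p) (dirD \<kappa> (cmap c' p) y) (dirD \<kappa> (cmap c' p) z)"
      and Bform: "Bt (cmap c' p) \<bullet> y = dirD \<kappa> (cmap c' p) y $ iu"
      if p: "p \<in> cdom c" "p \<in> cdom c'" for p y z
    proof -
      have pM: "p \<in> M" using cdom_M[OF c] p by blast
      note t = tvec_tangent[OF c' p(2)]
      have "y \<bullet> (comp2 At a c' (cmap c' p) *v z) = exp (2 * m * \<psi> (cmap c p)) * uv_form iu iv H W h (cmap c p) (dirD
          \<kappa> (cmap c' p) y) (dirD \<kappa> (cmap c' p) z)"
        unfolding comp2_eqI[OF riem c' p(2) pM] aeq[OF p(1) t t] by (simp add: tvec_apply[OF c' c p(2,1)] \<kappa>_def)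
      then show "y \<bullet> (Mt (cmap c' p) *v z) = uv_form iu iv H W h (cmap c p) (dirD \<kappa> (cmap c' p) y) (dirD \<kappa> (cmap c' p) z)"
        by (simp add: Mt_def scaleR_matrix_vector_assoc[symmetric] \<kappa>_def transition_apply[OF c' p(2)] exp_minus)
      have "comp1 At b c' (cmap c' p) \<bullet> y = exp ((1 + m) * \<psi> (cmap c p)) * dirD \<kappa> (cmap c' p) y $ iu"
        using form_comp1[OF oform c' p(2) pM t, of y] beq[OF p(1) t, of y]
        by (simp add: tvec_same[OF c' p(2)] tvec_apply[OF c' c p(2,1)] \<kappa>_def dx_def)
      moreover have "\<kappa> (cmap c' p) = cmap c p" by (simp add: \<kappa>_def transition_apply[OF c' p(2)])
      ultimately have "Bt (cmap c' p) \<bullet> y = exp (- ((1 + m) * \<psi> (cmap c p))) * (exp ((1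
          + m) * \<psi> (cmap c p)) * dirD \<kappa> (cmap c' p) y $ iu)"
        by (simp only: Bt_def inner_scaleR_left mult_minus_left)
      also have "\<dots> = dirD \<kappa> (cmap c' p) y $ iu" by (simp add: exp_minus)
      finally show "Bt (cmap c' p) \<bullet> y = dirD \<kappa> (cmap c' p) y $ iu" .
    qed
    have qform: "q p (tvec At c' p y) (tvec At c' p z) = y \<bullet> (Mt (cmap c' p) *v z)" if "p \<in> cdom c" "p \<in> cdom c'" for p y z
      unfolding form[OF that] q_def by (simp add: tvec_apply[OF c' c that(2,1)] \<kappa>_def)
    have comp: "comp2 At q c' x = Mt x" if x: "x \<in> S" for x
    proof -
      obtain p where p: "x = cmap c' p" "p \<in> cdom c" "p \<in> cdom c'" using x by (auto simp: S_def)
      have "comp2 At q c' x $ i $ j = Mt x $ i $ j" for i j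
        using qform[OF p(2,3)] by (simp add: comp2_def p(1) chartD(3)[OF is_chart[OF c'] p(3)] inner_axis_matrix)
      then show ?thesis by (simp add: vec_eq_iff)
    qed
    have invMt: "invertible (Mt x)"
      unfolding Mt_def using kropina_chart.invM[OF kropina_chart[OF c']] xS Simg by (intro scalar_invertible) auto
    have xc': "x \<in> cimg c'" using xS Simg by blast
    obtain \<theta> where \<theta>: "\<And>v y z. y \<bullet> (dirD (comp2 At a c') x v *v z) = bil (\<Gamma> c' x) v y \<bullet> (comp2 At a c' x *v z)
        + y \<bullet> (comp2 At a c' x *v bil (\<Gamma> c' x) v z) + 2 * m * \<theta> v * (y \<bullet> (comp2 At a c' x *v z))"
      "\<And>v y. dirD (comp1 At b c') x v \<bullet> y = comp1 At b c' x \<bullet> bil (\<Gamma> c' x) v y + (1 + m) * \<theta> v * (comp1 At b c' x \<bullet> y)"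
      using weyl(6)[OF c' xc'] by (elim exE conjE) (rule that; blast)
    note weyl' = weyl[OF c' xc']
    define \<psi>' where "\<psi>' = dirD (\<lambda>x. \<psi> (\<kappa> x)) x"
    note d\<psi> = smooth_on_has_derivative[OF sm\<psi>\<kappa> xS, folded \<psi>'_def]
    have parM: "y \<bullet> (dirD Mt x v *v z) = bil (\<Gamma> c' x) v y \<bullet> (Mt x *v z) + y \<bullet> (Mt x *v bil (\<Gamma> c' x) v z)
        + 2 * m * (\<theta> v - \<psi>' v) * (y \<bullet> (Mt x *v z))" for v y z
      using has_derivative_matrix_scale[OF smooth_on_has_derivative[OF sma(1) xS] d\<psi> \<theta>(1), of y "- 2 * m" v z, folded Mt_def]
      by (simp add: algebra_simps)
    have parB: "dirD Bt x v \<bullet> y = Bt x \<bullet> bil (\<Gamma> c' x) v y + (1 + m) * (\<theta> v - \<psi>' v) * (Bt x \<bullet> y)" for v y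
      using has_derivative_vector_scale[OF smooth_on_has_derivative[OF sma(2) xS] d\<psi> \<theta>(2), of "- (1 + m)" v y, folded Bt_def]
      by (simp add: algebra_simps)
    have surj: "surj (dirD \<kappa> x)"
    proof (rule surjI)
      show "dirD \<kappa> x (dirD (transition c c') (cmap c p) y) = y" for y
        unfolding \<kappa>_def x_def by (simp add: transition_cocycle[OF c c' c] p transition_self[OF c p(1)])
    qed
    \<comment> \<open>The Weyl form of the rescaled pair is \<theta> - d\<psi>; its vanishing shows
      that \<theta> is exact near \<open>x\<close>.\<close>
    have \<tau>0: "\<theta> v - \<psi>' v = 0" for v
    proof (rule adapted_weyl_exact[OF oS xS opV sm\<kappa> \<kappa>V surj iuv smG, where M = Mt and B = Bt and \<Gamma> = "\<Gamma> c' x"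
        and m = m and \<tau> = "\<lambda>v. \<theta> v - \<psi>' v"])
      show "v \<bullet> (G z *v w) = w \<bullet> (G z *v v)" for z v w
        unfolding G_def uv_matrix_form by (rule uv_form_sym)
      show "axis iv 1 \<bullet> (G z *v w) = - w $ iu" for z w
        unfolding G_def uv_matrix_form by (rule uv_form_dv[OF iuv])
      show "dirD G z (axis iv 1) = 0" if "z \<in> cimg c" for z
        unfolding G_def by (rule dirD_uv_matrix_dv[OF opV that smG[unfolded G_def] smH(2) smW(2) smh(2)])
      show "y \<bullet> (Mt x *v z) = dirD \<kappa> x y \<bullet> (G (\<kappa> x) *v dirD \<kappa> x z)" if xS: "x \<in> S" for x y z
      proof -
        obtain p where p: "x = cmap c' p" "p \<in> cdom c" "p \<in> cdom c'" using xS by (auto simp: S_def)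
        show ?thesis unfolding p(1) form[OF p(2,3)] G_def uv_matrix_form by (simp add: \<kappa>_def transition_apply[OF c' p(3)])
      qed
      show "Bt x \<bullet> y = dirD \<kappa> x y $ iu" if xS: "x \<in> S" for x y
      proof -
        obtain p where p: "x = cmap c' p" "p \<in> cdom c" "p \<in> cdom c'" using xS by (auto simp: S_def)
        show ?thesis unfolding p(1) by (rule Bform[OF p(2,3)])
      qed
      show "Bt x \<noteq> 0" using weyl'(2) by (simp add: Bt_def)
    qed (use smMt smBt weyl' parM parB in auto)
    have chr: "christoffel (comp2 At q c') x k i j = \<Gamma> c' x k i j" for k i j
    proof (rule christoffel_unique)
      show "(comp2 At q c' has_derivative dirD Mt x) (at x)"
        by (rule has_derivative_transform_within_open[OF smooth_on_has_derivative[OF smMt xS] oS xS]) (simp add: comp)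
      show "v \<bullet> (comp2 At q c' x *v w) = w \<bullet> (comp2 At q c' x *v v)" for v w
        unfolding comp[OF xS] unfolding x_def form[OF p] by (rule uv_form_sym)
      show "y \<bullet> (dirD Mt x v *v z) = bil (\<Gamma> c' x) v y \<bullet> (comp2 At q c' x *v z)
          + y \<bullet> (comp2 At q c' x *v bil (\<Gamma> c' x) v z)" for v y z
        unfolding comp[OF xS] parM \<tau>0 by simp
    qed (use weyl'(1) invMt comp[OF xS] in auto)
    have "smooth_on S (comp2 At q c')" by (rule smooth_on_cong[OF oS _ smMt]) (simp add: comp)
    moreover have "christoffel (comp2 At q c') x = \<Gamma> c' x" by (intro ext chr)
    ultimately show ?thesis
      using qform[OF p] comp[OF xS] invMt
      by (auto simp: levi_civita_christoffel S_def Int_commute x_def[symmetric])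
  qed
  have "pseudo_riemannian At (cdom c) q"
    unfolding pseudo_riemannian_def
  proof (intro conjI ballI)
    fix c' p assume c': "c' \<in> At" and p: "p \<in> cdom c \<inter> cdom c'"
    have e: "q p (tvec At c' p y) (tvec At c' p z) = y \<bullet> (comp2 At q c' (cmap c' p) *v z)" for y z
      using chart[OF c', of p] p by blast
    show "bilinear (\<lambda>y z. q p (tvec At c' p y) (tvec At c' p z))"
      unfolding e bilinear_def
      by (auto intro!: linearI simp: inner_add_left inner_add_right matrix_vector_right_distrib matrix_vector_mult_scaleR)
    show "invertible (comp2 At q c' (cmap c' p))" using chart[OF c', of p] p by blast
  next
    fix p v w show "q p v w = q p w v" unfolding q_def by (rule uv_form_sym)
  next
    fix c' assume c': "c' \<in> At"
    show "smooth_on (cmap c' ` (cdom c \<inter> cdom c')) (comp2 At q c')"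
    \<comment> \<open>\<open>chart\<close> requires a point of the overlap; on an empty overlap
      smoothness is vacuous.\<close>
    proof (cases "cdom c \<inter> cdom c' = {}")
      case True
      then show ?thesis using smooth_on_const[OF open_empty] smooth_on_cong[OF open_empty] by fastforce
    next
      case False
      then show ?thesis using chart[OF c'] by blast
    qed
  qed
  then have "local_metrization M At A F (cdom c) q"
    unfolding local_metrization_def using cdom_open[OF c] cdom_M[OF c] chart by blast
  then show ?thesis by (simp add: q_def[abs_def])
qed

text \<open>Inside one chart the metrization \<open>q\<close> supplies the potential, the rescaled
  pair is parallel, and \<open>brinkmann_coordinates\<close> applies to it. Composing the resulting
  coordinates with the chart gives a chart that belongs to \<open>At\<close> because the atlas is
  maximal.\<close>

lemma metrizable_adapted:
  assumes met: "locally_metrizable M At A F" and p0: "p0 \<in> M"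
  shows "\<exists>c \<psi> H W h. p0 \<in> cdom c \<and> adapted_coordinates At m a b iu iv c \<psi> H W h"
proof -
  obtain V q where p0V: "p0 \<in> V" and lm: "local_metrization M At A F V q"
    using met p0 unfolding locally_metrizable_def by blast
  have oV: "open V" and qr: "pseudo_riemannian At V q"
    and lc: "\<And>c p. c \<in> At \<Longrightarrow> p \<in> V \<inter> cdom c \<Longrightarrow> levi_civita At q c (cmap c p) = \<Gamma> c (cmap c p)"
    using lm unfolding local_metrization_def by blast+
  obtain c where c: "c \<in> At" "p0 \<in> cdom c" using M_cdom[OF p0] by blast
  define U where "U = cmap c ` (V \<inter> cdom c)"
  define x0 where "x0 = cmap c p0"
  have oU: "open U" unfolding U_def by (intro chartD(6) is_chart c open_Int oV cdom_open) auto
  have x0U: "x0 \<in> U" using p0V c(2) by (auto simp: U_def x0_def)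
  have Uc: "U \<subseteq> cimg c" by (auto simp: U_def)
  define g where "g = comp2 At a c"
  define \<beta> where "\<beta> = comp1 At b c"
  define Q where "Q = comp2 At q c"
  interpret K: kropina_chart g \<beta> "Frep At F c" "coord_image c A" "cimg c" m
    unfolding g_def \<beta>_def by (rule kropina_chart[OF c(1)])
  have smg: "smooth_on U g" "smooth_on U \<beta>"
    by (rule smooth_on_subset[OF Uc K.smM] smooth_on_subset[OF Uc K.smB])+
  have smQ: "smooth_on U Q" using qr c(1) unfolding pseudo_riemannian_def U_def Q_def by blast
  have invQ: "invertible (Q x)" if "x \<in> U" for x using qr c(1) that unfolding pseudo_riemannian_def U_def Q_def by blast
  have symQ: "y \<bullet> (Q x *v z) = z \<bullet> (Q x *v y)" if "x \<in> U" for x y z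
    unfolding Q_def by (rule comp2_sym[OF qr c(1)]) (use that in \<open>simp add: U_def\<close>)
  have chr: "christoffel Q x = \<Gamma> c x" if "x \<in> U" for x
    using lc[OF c(1)] that by (auto simp: U_def levi_civita_christoffel Q_def)
  have parQ: "y \<bullet> (dirD Q x v *v z) = bil (\<Gamma> c x) v y \<bullet> (Q x *v z) + y \<bullet> (Q x *v bil (\<Gamma> c x) v z)" if "x \<in> U" for x v y z
    using christoffel_parallel[OF smooth_on_has_derivative[OF smQ that] oU that symQ invQ[OF that]] chr[OF that] by simp
  define weyl_form where "weyl_form x \<theta> \<longleftrightarrow> (\<forall>v y z. y \<bullet> (dirD g x v *v z) = bil (\<Gamma> c x) v y \<bullet> (g x *v z)
        + y \<bullet> (g x *v bil (\<Gamma> c x) v z) + 2 * m * \<theta> v * (y \<bullet> (g x *v z)))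
      \<and> (\<forall>v y. dirD \<beta> x v \<bullet> y = \<beta> x \<bullet> bil (\<Gamma> c x) v y + (1 + m) * \<theta> v * (\<beta> x \<bullet> y))" for x \<theta>
  \<comment> \<open>A pointwise choice without any regularity in \<open>x\<close>; smoothness comes
    afterwards, when it is recognised as the differential of \<psi>.\<close>
  define \<theta> where "\<theta> x = (SOME \<theta>. weyl_form x \<theta>)" for x
  have "weyl_form x (\<theta> x)" if "x \<in> U" for x
  proof -
    have "\<exists>\<theta>. weyl_form x \<theta>"
      using weyl(6)[OF c(1), of x] that Uc unfolding weyl_form_def g_def \<beta>_def by blast
    then show ?thesis unfolding \<theta>_def by (rule someI_ex)
  qed
  then have parg: "\<And>x v y z. x \<in> U \<Longrightarrow> y \<bullet> (dirD g x v *v z) = bil (\<Gamma> c x) v y \<bullet> (g x *v z)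
        + y \<bullet> (g x *v bil (\<Gamma> c x) v z) + 2 * m * \<theta> x v * (y \<bullet> (g x *v z))"
    and par\<beta>: "\<And>x v y. x \<in> U \<Longrightarrow> dirD \<beta> x v \<bullet> y = \<beta> x \<bullet> bil (\<Gamma> c x) v y + (1 + m) * \<theta> x v * (\<beta> x \<bullet> y)"
    unfolding weyl_form_def by blast+
  have invg: "invertible (g x)" if "x \<in> U" for x using K.invM that Uc by blast
  obtain \<psi> where sm\<psi>: "smooth_on U \<psi>" and d\<psi>: "\<And>x. x \<in> U \<Longrightarrow> (\<psi> has_derivative \<theta> x) (at x)"
    using weyl_potential[where \<Gamma> = "\<lambda>x. \<Gamma> c x" and m = m and \<theta> = \<theta>, OF oU smg(1) smQ invg invQ m0 parg parQ] by blast
  define Mt where "Mt x = exp (- 2 * m * \<psi> x) *\<^sub>R g x" for x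
  define Bt where "Bt x = exp (- (1 + m) * \<psi> x) *\<^sub>R \<beta> x" for x
  have smMt: "smooth_on U Mt" and smBt: "smooth_on U Bt" unfolding Mt_def Bt_def
    by (intro smooth_on_scaleR smooth_on_exp smooth_on_mult smooth_on_const oU sm\<psi> smg)+
  have parM: "y \<bullet> (dirD Mt x v *v z) = bil (\<Gamma> c x) v y \<bullet> (Mt x *v z) + y \<bullet> (Mt x *v bil (\<Gamma> c x) v z)"
      if x: "x \<in> U" for x v y z
    using has_derivative_matrix_scale[OF smooth_on_has_derivative[OF smg(1) x] d\<psi>[OF x] parg[OF x], of y "- 2 * m" v
        z, folded Mt_def] by simp
  have parB: "dirD Bt x v \<bullet> y = Bt x \<bullet> bil (\<Gamma> c x) v y" if x: "x \<in> U" for x v y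
    using has_derivative_vector_scale[OF smooth_on_has_derivative[OF smg(2) x] d\<psi>[OF x] par\<beta>[OF x], of "- (1
        + m)" v y, folded Bt_def]
    by (simp add: left_diff_distrib distrib_right)
  have invMt: "invertible (Mt x)" if "x \<in> U" for x unfolding Mt_def using invg[OF that] by (intro scalar_invertible) auto
  have nullt: "Bt x \<bullet> (matrix_inv (Mt x) *v Bt x) = 0" if x: "x \<in> U" for x
  proof -
    \<comment> \<open>Rescaling multiplies the vector dual to b by exp(-(1 + m) \<psi>) and divides
      it by exp(-2m \<psi>), which gives this factor; hence nullity persists.\<close>
    define k where "k = exp (- (1 + m) * \<psi> x + 2 * m * \<psi> x)"
    define n where "n = k *\<^sub>R (matrix_inv (g x) *v \<beta> x)"
    have k: "k * exp (- 2 * m * \<psi> x) = exp (- (1 + m) * \<psi> x)" by (simp add: k_def exp_add[symmetric])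
    have gn: "g x *v (matrix_inv (g x) *v \<beta> x) = \<beta> x"
      by (simp add: matrix_vector_mul_assoc matrix_inv_inverse invg[OF x])
    have "Mt x *v n = Bt x"
      unfolding Mt_def Bt_def n_def scaleR_matrix_vector_assoc[symmetric] matrix_vector_mult_scaleR gn scaleR_scaleR k ..
    then have "matrix_inv (Mt x) *v Bt x = matrix_inv (Mt x) *v (Mt x *v n)" by simp
    also have "\<dots> = n" by (simp add: matrix_vector_mul_assoc matrix_inv_inverse invMt[OF x])
    finally show ?thesis using weyl(5)[OF c(1), of x] x Uc by (auto simp: Bt_def n_def g_def \<beta>_def)
  qed
  have symMt: "v \<bullet> (Mt x *v w) = w \<bullet> (Mt x *v v)" if "x \<in> U" for x v w
    using K.symM[of x v w] that Uc by (auto simp: Mt_def scaleR_matrix_vector_assoc[symmetric])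
  have \<Gamma>s: "\<Gamma> c x k i j = \<Gamma> c x k j i" if "x \<in> U" for x k i j using weyl(1)[OF c(1)] that Uc by blast
  have B0: "Bt x0 \<noteq> 0" using weyl(2)[OF c(1)] x0U Uc by (auto simp: Bt_def \<beta>_def)
  obtain \<Lambda> \<kappa> r H W h where r: "0 < r" and sm\<Lambda>: "smooth_on (ball 0 r) \<Lambda>" and o\<Lambda>: "open (\<Lambda> ` ball 0 r)"
      and \<Lambda>U: "\<Lambda> ` ball 0 r \<subseteq> U"
    and x0\<Lambda>: "x0 \<in> \<Lambda> ` ball 0 r" and hom: "homeomorphism (ball 0 r) (\<Lambda> ` ball 0 r) \<Lambda> \<kappa>" and sm\<kappa>: "smooth_on (\<Lambda> ` ball 0 r) \<kappa>"
    and H: "smooth_on (ball 0 r) H" "indep_of iv (ball 0 r) H"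
    and W: "\<And>i. smooth_on (ball 0 r) (W i)" "\<And>i. indep_of iv (ball 0 r) (W i)"
    and h: "\<And>i j. smooth_on (ball 0 r) (h i j)" "\<And>i j. indep_of iv (ball 0 r) (h i j)"
    and form: "\<And>z v w. z \<in> ball 0 r \<Longrightarrow> dirD \<Lambda> z v \<bullet> (Mt (\<Lambda> z) *v dirD \<Lambda> z w) = uv_form iu iv H W h z v w"
    and Bform: "\<And>z v. z \<in> ball 0 r \<Longrightarrow> Bt (\<Lambda> z) \<bullet> dirD \<Lambda> z v = v $ iu"
    by (rule brinkmann_coordinates[where \<Gamma> = "\<lambda>x. \<Gamma> c x", OF oU x0U iuv smMt smBt symMt invMt \<Gamma>s parM parB nullt B0];
        (assumption | (rule that; assumption)))
  let ?S = "ball (0::real^'n) r"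
  let ?T = "\<Lambda> ` ?S"
  have Tc: "?T \<subseteq> cimg c" using \<Lambda>U Uc by blast
  \<comment> \<open>The domain is the part of \<open>c\<close> parametrised by
    \<open>\<Lambda>\<close>, so the image is the whole ball on which the coefficients are
    defined.\<close>
  define c2 where "c2 = (cinv c ` ?T, \<kappa> \<circ> cmap c)"
  have homc: "homeomorphism (cimg c) (cdom c) (cinv c) (cmap c)"
    using is_chart[OF c(1)] homeomorphism_symD unfolding is_chart_def by blast
  have dom2: "cdom c2 = {p \<in> cdom c. cmap c p \<in> ?T}"
  proof -
    have "p \<in> cinv c ` ?T" if "p \<in> cdom c" "cmap c p \<in> ?T" for p
      by (rule image_eqI[of _ _ "cmap c p"]) (simp_all add: that(1) chartD(3)[OF is_chart[OF c(1)]], rule that(2))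
    moreover have "cinv c x \<in> cdom c \<and> cmap c (cinv c x) \<in> ?T" if "x \<in> ?T" for x
    proof -
      have "x \<in> cimg c" using that Tc by blast
      then have "cinv c x \<in> cdom c" "cmap c (cinv c x) = x"
        by (rule chartD(5)[OF is_chart[OF c(1)]], rule chartD(4)[OF is_chart[OF c(1)]])
      then show ?thesis using that by metis
    qed
    ultimately show ?thesis unfolding c2_def fst_conv by blast
  qed
  have map2: "cmap c2 p = \<kappa> (cmap c p)" for p by (simp add: c2_def)
  have odom2: "open (cdom c2)" and hom1: "homeomorphism ?T (cdom c2) (cinv c) (cmap c)"
    using open_homeomorphism_image[OF homc cdom_open[OF c(1)] o\<Lambda> Tc] by (auto simp: c2_def)
  have homc2: "homeomorphism (cdom c2) ?S (cmap c2) (cinv c \<circ> \<Lambda>)"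
    using homeomorphism_compose[OF hom1[THEN homeomorphism_symD] hom[THEN homeomorphism_symD]] by (simp add: c2_def)
  have img2: "cimg c2 = ?S" using homc2 by (simp add: homeomorphism_def)
  have inv2: "cinv c2 z = cinv c (\<Lambda> z)" if "z \<in> ?S" for z
  proof -
    have "cmap c2 (cinv c (\<Lambda> z)) = z" "cinv c (\<Lambda> z) \<in> cdom c2" "inj_on (cmap c2) (cdom c2)"
      using homc2 that by (auto simp: homeomorphism_def inj_on_def) (metis comp_apply)+
    then show ?thesis by (metis inv_into_f_f)
  qed
  have chart2: "is_chart c2"
    unfolding is_chart_def
  proof (intro conjI)
    show "open (cdom c2)" "open (cimg c2)" using odom2 by (simp_all add: img2)
    show "homeomorphism (cdom c2) (cimg c2) (cmap c2) (cinv c2)"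
      unfolding img2 by (rule homeomorphism_cong[OF homc2 refl refl]) (simp_all add: inv2)
  qed
  have \<Lambda>map: "\<Lambda> (cmap c2 p) = cmap c p" "cmap c2 p \<in> ?S" if "p \<in> cdom c2" for p
    using that hom by (auto simp: dom2 map2 homeomorphism_def)
  have dom2c: "cdom c2 \<subseteq> cdom c" by (auto simp: dom2)
  have compat: "compatible c2 c'" if c': "c' \<in> At" for c'
    unfolding compatible_def
  proof
    have o2: "open (cmap c2 ` (cdom c2 \<inter> cdom c'))"
      by (rule chartD(6)[OF chart2]) (use odom2 cdom_open[OF c'] in auto)
    have sub: "cmap c2 ` (cdom c2 \<inter> cdom c') \<subseteq> ?S" using \<Lambda>map by blast
    have "smooth_on (cmap c2 ` (cdom c2 \<inter> cdom c')) (\<lambda>z. transition c c' (\<Lambda> z))"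
    proof (rule smooth_on_compose[OF o2 overlap_open[OF c(1) c'] smooth_on_subset[OF sub sm\<Lambda>] transition_smooth[OF c(1) c']])
      show "\<Lambda> ` cmap c2 ` (cdom c2 \<inter> cdom c') \<subseteq> cmap c ` (cdom c \<inter> cdom c')"
        using \<Lambda>map dom2c by fastforce
    qed
    then show "smooth_on (cmap c2 ` (cdom c2 \<inter> cdom c')) (transition c2 c')"
    proof (rule smooth_on_cong[OF o2, rotated])
      fix z assume "z \<in> cmap c2 ` (cdom c2 \<inter> cdom c')"
      then obtain p where p: "z = cmap c2 p" "p \<in> cdom c2" by blast
      then have "p \<in> cdom c" using dom2c by blast
      then show "transition c c' (\<Lambda> z) = transition c2 c' z"
        using p by (simp add: \<Lambda>map transition_def chartD(3)[OF is_chart[OF c(1)]] chartD(3)[OF chart2])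
    qed
    have o3: "open (cmap c' ` (cdom c2 \<inter> cdom c'))"
      by (rule chartD(6)[OF is_chart[OF c']]) (use odom2 cdom_open[OF c'] in auto)
    have sub3: "cmap c' ` (cdom c2 \<inter> cdom c') \<subseteq> cmap c' ` (cdom c' \<inter> cdom c)" using dom2c by blast
    have "smooth_on (cmap c' ` (cdom c2 \<inter> cdom c')) (\<lambda>x. \<kappa> (transition c' c x))"
    proof (rule smooth_on_compose[OF o3 o\<Lambda> smooth_on_subset[OF sub3 transition_smooth[OF c' c(1)]] sm\<kappa>])
      show "transition c' c ` cmap c' ` (cdom c2 \<inter> cdom c') \<subseteq> ?T"
        using c' by (auto simp: transition_apply dom2)
    qed
    then show "smooth_on (cmap c' ` (cdom c2 \<inter> cdom c')) (transition c' c2)"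
      by (rule smooth_on_cong[OF o3, rotated]) (use c' in \<open>auto simp: transition_apply map2\<close>)
  qed
  have "cdom c2 \<subseteq> M" using dom2c cdom_M[OF c(1)] by blast
  then have c2: "c2 \<in> At"
    using smooth_manifold chart2 compat unfolding smooth_manifold_def by blast
  have D2: "dirD (transition c2 c) z = dirD \<Lambda> z" if z: "z \<in> ?S" for z
  proof (rule dirD_eqI, rule has_derivative_transform_within_open[OF smooth_on_has_derivative[OF sm\<Lambda> z] open_ball z])
    fix z assume z: "z \<in> ?S"
    then have "\<Lambda> z \<in> cimg c" using Tc by blast
    then show "\<Lambda> z = transition c2 c z" by (simp add: transition_def inv2[OF z] chartD(4)[OF is_chart[OF c(1)]])
  qed
  \<comment> \<open>\<open>adapted_coordinates\<close> expects functions of the new coordinates, so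
    the potential is carried over by \<open>\<Lambda>\<close>.\<close>
  define \<psi>2 where "\<psi>2 z = \<psi> (\<Lambda> z)" for z
  have "adapted_coordinates At m a b iu iv c2 \<psi>2 H W h"
    unfolding adapted_coordinates_def img2
  proof (intro conjI ballI)
    show "smooth_on ?S \<psi>2" unfolding \<psi>2_def by (rule smooth_on_compose[OF open_ball oU sm\<Lambda> sm\<psi> \<Lambda>U])
    fix p v assume p: "p \<in> cdom c2" and v: "v \<in> tangent_space At p"
    define z where "z = cmap c2 p"
    have z: "z \<in> ?S" "\<Lambda> z = cmap c p" using \<Lambda>map[OF p] by (simp_all add: z_def)
    have pc: "p \<in> cdom c" "p \<in> M" using p dom2c cdom_M[OF c(1)] by auto
    have vc: "v c = dirD \<Lambda> z (v c2)" if "v \<in> tangent_space At p" for v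
      using tangent_apply[OF that c2 c(1) p pc(1)] D2[OF z(1)] by (simp add: z_def)
    have "b p v = \<beta> (\<Lambda> z) \<bullet> dirD \<Lambda> z (v c2)"
      using form_comp1[OF oform c(1) pc v] vc[OF v] by (simp add: \<beta>_def z(2))
    also have "\<beta> (\<Lambda> z) = exp ((1 + m) * \<psi>2 z) *\<^sub>R Bt (\<Lambda> z)"
      unfolding Bt_def \<psi>2_def scaleR_scaleR mult_exp_exp distrib_right[symmetric] by simp
    finally show "b p v = exp ((1 + m) * \<psi>2 (cmap c2 p)) * dx iu (v c2)"
      using Bform[OF z(1)] by (simp add: dx_def z_def)
    fix w assume w: "w \<in> tangent_space At p"
    have "a p v w = dirD \<Lambda> z (v c2) \<bullet> (g (\<Lambda> z) *v dirD \<Lambda> z (w c2))"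
      using form_comp2[OF riem c(1) pc v w] vc[OF v] vc[OF w] by (simp add: g_def z(2))
    also have "g (\<Lambda> z) = exp (2 * m * \<psi>2 z) *\<^sub>R Mt (\<Lambda> z)"
      unfolding Mt_def \<psi>2_def scaleR_scaleR mult_exp_exp by simp
    finally show "a p v w = exp (2 * m * \<psi>2 (cmap c2 p)) * uv_form iu iv H W h (cmap c2 p) (v c2) (w c2)"
      using form[OF z(1)] by (simp add: scaleR_matrix_vector_assoc[symmetric] z_def)
  qed (use c2 H W h in auto)
  moreover have "p0 \<in> cdom c2" using c(2) x0\<Lambda> by (simp add: dom2 x0_def)
  ultimately show ?thesis by blast
qed

end

text \<open>The labels \<open>iu\<close> and \<open>iv\<close> of the distinguished coordinates are
  arbitrary, because \<open>straightening\<close> can place the 1-form and the vector field on any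
  prescribed pair of axes.\<close>

theorem proposition12:
  fixes M :: "'p::{t2_space, second_countable_topology} set"
    and At :: "('p, 'n::finite) chart set"
    and A :: "('p \<times> ('p, 'n) tangent) set"
    and F :: "'p \<Rightarrow> ('p, 'n) tangent \<Rightarrow> real"
    and a :: "'p \<Rightarrow> ('p, 'n) tangent \<Rightarrow> ('p, 'n) tangent \<Rightarrow> real"
    and b :: "'p \<Rightarrow> ('p, 'n) tangent \<Rightarrow> real"
    and m :: real
    and iu iv :: 'n
  assumes "smooth_manifold M At"
    and "CARD('n) > 2"
    and "iu \<noteq> iv"
    and "m \<noteq> 0"
    and "kropina_metric M At A m a b F"
    and "berwald At A F"
    and "\<forall>c\<in>At. \<forall>x\<in>cimg c. norm2 At a b c x = 0"
  shows "(locally_metrizable M At A F \<longleftrightarrow>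
            (\<forall>p\<in>M. \<exists>c \<psi> H W h. p \<in> cdom c \<and> adapted_coordinates At m a b iu iv c \<psi> H W h)) \<and>
         (locally_metrizable M At A F \<longrightarrow>
            (\<forall>c \<psi> H W h. adapted_coordinates At m a b iu iv c \<psi> H W h \<longrightarrow>
               (\<forall>(p, v)\<in>A. p \<in> cdom c \<longrightarrow>
                  F p v = rpow \<bar>uv_form iu iv H W h (cmap c p) (v c) (v c)\<bar> ((1 + m) / 2)
                          * rpow (dx iu (v c)) (- m)) \<and>
               local_metrization M At A F (cdom c)
                 (\<lambda>p v w. uv_form iu iv H W h (cmap c p) (v c) (w c))))"
proof -
  interpret kropina_manifold M At A F a b m iu iv
    by unfold_locales (fact assms)+
  have "locally_metrizable M At A F"
    if "\<forall>p\<in>M. \<exists>c \<psi> H W h. p \<in> cdom c \<and> adapted_coordinates At m a b iu iv c \<psi> H W h"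
    unfolding locally_metrizable_def
  proof
    fix p assume "p \<in> M"
    then obtain c \<psi> H W h where "p \<in> cdom c" "adapted_coordinates At m a b iu iv c \<psi> H W h" using \<open>\<forall>p\<in>M. _ p\<close> by blast
    then show "\<exists>V q. p \<in> V \<and> local_metrization M At A F V q" using adapted_metrization by blast
  qed
  then show ?thesis
    using metrizable_adapted adapted_formula adapted_metrization by blast
qed

end
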